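(* Suppose $\mu$ and $\sigma$ are continuous in time and continuously differentiable in space such that their spatial derivatives are globally bounded uniformly in time. Suppose $\mu,\sigma,g$ are three times continuously differentiable in the space variable, $g$ is also continuously differentiable in the time variable, and $f$ is five times continuously differentiable. Suppose $u\in C^{1,5}([0,T]\times\mathbb{R}^d,\mathbb{R}^o)$ solves $$\partial_t u(t,x) + \nabla u(t,x)^T\mu(t,x) + \tfrac12 \mathrm{Tr}\big(\sigma(t,x)\sigma(t,x)^T\nabla^2 u(t,x)\big) + g(t,x) = 0 \ \text{ on } [0,T]\times\mathbb{R}^d,\qquad u(T,\cdot)=f \ \text{ on } \mathbb{R}^d.$$ Suppose $\nu,\tau,F,G$ are twice differentiable in the space variable, and that $\nu$ and $\tau$ are also continuous in time and continuously differentiable in space such that their spatial derivatives are globally bounded uniformly in time. Suppose, for each fixed $t\in[0,T]$, that the functions $F$, $G(t,\cdot)$, $\nu(t,\cdot)$, and $\tau(t,\cdot)$ are given by networks, whose architectures are independent of $t$ and whose depths are all the same, namely $D\in\mathbb{N}$. Let $\alpha\in(0,1]$, $\epsilon\in(0,1)$, $r\in[0,\infty)$, and denote $$c=\max\{\mathcal{G}(\hat\mu),\mathcal{G}(\hat\sigma)^2,\mathcal{G}(\hat\nu),\mathcal{G}(\hat\tau)^2\}.$$ Suppose that the quantities $$c,\ \mathcal{G}_{2,0}(\mu),\ \mathcal{G}_{2,0}(\sigma),\ \mathcal{G}_{2,0}(f),\ \mathcal{G}_{2,0}(g),$$ $$\mathcal{G}_{1,r}(F),\ \mathcal{G}_{1,r}(G),\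 \mathcal{G}_{1,r}(\partial_tg),\ \mathcal{G}_{3,r}(\mu),\ \mathcal{G}_{3,r}(\sigma),\ \mathcal{G}_{3,r}(g),\ \mathcal{G}_{5,r}(u),\ \mathcal{H}_{\alpha,r}(\hat\mu),\ \mathcal{H}_{\alpha,r}(\hat\sigma)$$ are all bounded by $\kappa_{r,\alpha}d^{\kappa_{r,\alpha}}$ for a constant $\kappa_{r,\alpha}$ depending only on $r$ and $\alpha$, and suppose $$\max\{\mathcal{G}_{1,0}(\mu-\nu),\mathcal{G}_{1,0}(\sigma-\tau),\mathcal{G}_{1,0}(f-F),\mathcal{G}_{1,0}(g-G)\}\le\lambda^{d^\lambda}\exp\big(-\mathcal{P}^{\lambda^{-1}}\big),$$ where $\lambda$ is a universal constant and $\mathcal{P}=\min\{\mathcal{P}(F),\mathcal{P}(G),\mathcal{P}(\nu),\mathcal{P}(\tau)\}$. Then, there exists a constant $\kappa>0$, depending only on $T$, $\lambda$, $r$, and $\alpha$, and a network $\psi$ such that $$\|u(0,\cdot)-\psi\|_{L^2([0,1]^d)}+\|\nabla u(0,\cdot)-\nabla\psi\|_{L^2([0,1]^d)}\le\epsilon$$ and $$\mathcal{P}(\psi)\le\kappa(do)^\kappa e^{\kappa c}\epsilon^{-\kappa}.$$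
   Context: Standing setting: $d,o\in\mathbb{N}$; $T\ge 1$ is a fixed time horizon; $\mu\colon[0,T]\times\mathbb{R}^d\to\mathbb{R}^d$ and $\sigma\colon[0,T]\times\mathbb{R}^d\to\mathbb{R}^{d\times d}$ are measurable; $g\colon[0,T]\times\mathbb{R}^d\to\mathbb{R}^o$ and $f\colon\mathbb{R}^d\to\mathbb{R}^o$ are functions. Further, $F\colon\mathbb{R}^d\to\mathbb{R}^o$ and $G\colon[0,T]\times\mathbb{R}^d\to\mathbb{R}^o$ are functions and $\nu\colon[0,T]\times\mathbb{R}^d\to\mathbb{R}^d$ and $\tau\colon[0,T]\times\mathbb{R}^d\to\mathbb{R}^{d\times d}$ are measurable functions, thought of as perturbations of $f$, $g$, $\mu$, and $\sigma$, respectively. Norms are Euclidean/Frobenius norms. $C^{1,5}$ means once continuously differentiable in time and five times in space. $\nabla$ denotes spatial derivatives, and the trace term is the $o$-dimensional vector with entries $\mathrm{Tr}(\sigma\sigma^T\nabla^2u_i)$, $i=1,\dots,o$. Networks: a network is a concatenation $\mathcal{A}_D\circ\rho\circ\dots\circ\mathcal{A}_2\circ\rho\circ\mathcal{A}_1$ of affine functions $\mathcal{A}_j$ and a fixed nonlinearity $\rho\colon\mathbb{R}\to\mathbb{R}$, which is applied component-wise. The network has depth $D\in\mathbb{N}$. The tuple of the input and output dimensions of the affine functions comprises its architecture. Identity nodes are allowed, meaning that one may also apply the identity function instead of $\rho$ at any point in the network. The parameters that characterize the affine functions are called the parameters of the network, and $\mathcal{P}(\cdot)$ denotes the number of non-zero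 parameters; for the time-dependent $G,\nu,\tau$ this refers to the networks giving $G(t,\cdot),\nu(t,\cdot),\tau(t,\cdot)$. Augmented derivative: for differentiable $h\colon\mathbb{R}^n\to\mathbb{R}^m$, $\hat h\colon\mathbb{R}^{2n}\to\mathbb{R}^{2m}$ is $\hat h(x,y)=(h(x),\nabla h(x)^Ty)$, where $\nabla h(x)^Ty=Dh_x(y)$ is the derivative of $h$ at $x$ applied to $y$ (matrix-valued functions likewise); for time-dependent $h$, $\hat h(t,\cdot)=\widehat{h(t,\cdot)}$. Growth measures: for $k$-times differentiable $h\colon\mathbb{R}^n\to\mathbb{R}^m$ (matrix-valued functions likewise) and $r\in[0,\infty)$, $$\mathcal{G}_{k,r}(h)=\sup_{x\in\mathbb{R}^n}\sum_{i=0}^k\frac{\|\nabla^ih(x)\|}{(1+\|x\|)^{r+k-i}}\in[0,\infty];$$ for time-dependent $h$, $\mathcal{G}_{k,r}(h)=\sup_{t\in[0,T]}\mathcal{G}_{k,r}(h(t,\cdot))$. Moreover, $\mathcal{G}(h)=\mathcal{G}_{0,1}(h)$. For time-dependent $h$ and $\alpha\in(0,1]$, $r\in[0,\infty)$, $$\mathcal{H}_{\alpha,r}(h)=\sup_{s,t\in[0,T],\,0<|t-s|\le1}\ \sup_{x}\frac{\|h(t,x)-h(s,x)\|}{(1+\|x\|)^r}|t-s|^{-\alpha}\in[0,\infty].$$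
   Formalization: The quadruple F,G,ν,τ becomes a sequence (n=0,1,…), each member meeting all hypotheses (depth may vary with n; c uses suprema over n), with all four sizes between n and λ(do(n+1))^λ; for one fixed quadruple the claim fails, e.g. ρ=id, F=G=ν=τ=0, μ=σ=g=0, f=a·sin. *)

theory Defs
  imports "HOL-Analysis.Analysis"
begin

text \<open>The dimensions vary inside the statement, so they cannot be types. \<open>\<real>\<^sup>I\<close> for a finite index set
  \<open>I\<close> is the set of extensional functions on \<open>I\<close>; \<open>\<real>\<^sup>d\<close> is the case \<open>I = {..<d}\<close>, \<open>d \<times> d\<close>-matrices
  have the index set \<open>{..<d} \<times> {..<d}\<close>, and \<open>\<real>\<^sup>2\<^sup>d = \<real>\<^sup>d \<times> \<real>\<^sup>d\<close> has the index set \<open>{..<d} <+> {..<d}\<close>.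
  The Euclidean (Frobenius) norm is \<^const>\<open>L2_set\<close>; continuity uses the product topology on the
  function type, which induces the Euclidean topology on \<open>Rn I\<close>.
  A map \<open>h\<close> with values in \<open>\<real>\<^sup>J\<close> is evaluated as \<open>h x j\<close>, and only its values for \<open>x \<in> Rn I\<close>,
  \<open>j \<in> J\<close> matter.\<close>

definition Rn :: "'i set \<Rightarrow> ('i \<Rightarrow> real) set" where
  "Rn I = PiE I (\<lambda>_. UNIV)"

definition partial_deriv :: "'i \<Rightarrow> (('i \<Rightarrow> real) \<Rightarrow> real) \<Rightarrow> ('i \<Rightarrow> real) \<Rightarrow> real" where
  "partial_deriv i h x = deriv (\<lambda>s. h (x(i := s))) (x i)"

primrec partial_derivs :: "'i list \<Rightarrow> (('i \<Rightarrow> real) \<Rightarrow> real) \<Rightarrow> ('i \<Rightarrow> real) \<Rightarrow> real" where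
  "partial_derivs [] h = h"
| "partial_derivs (i # js) h = partial_deriv i (partial_derivs js h)"

definition frechet_differentiable_at ::
    "'i set \<Rightarrow> (('i \<Rightarrow> real) \<Rightarrow> real) \<Rightarrow> ('i \<Rightarrow> real) \<Rightarrow> bool" where
  "frechet_differentiable_at I h x \<longleftrightarrow>
     (\<exists>a. \<forall>e>0. \<exists>\<delta>>0. \<forall>y\<in>Rn I. L2_set (\<lambda>i. y i - x i) I < \<delta> \<longrightarrow>
        \<bar>h y - h x - (\<Sum>i\<in>I. a i * (y i - x i))\<bar> \<le> e * L2_set (\<lambda>i. y i - x i) I)"

text \<open>A function is \<open>k + 1\<close> times Frechet differentiable iff it is differentiable and all entries of
  its derivative are \<open>k\<close> times Frechet differentiable.\<close>

primrec times_differentiable :: "nat \<Rightarrow> 'i set \<Rightarrow> (('i \<Rightarrow> real) \<Rightarrow> real) \<Rightarrow> bool" where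
  "times_differentiable 0 I h = True"
| "times_differentiable (Suc k) I h =
     ((\<forall>x\<in>Rn I. frechet_differentiable_at I h x) \<and>
      (\<forall>i\<in>I. times_differentiable k I (partial_deriv i h)))"

definition differentiable_times ::
    "nat \<Rightarrow> 'i set \<Rightarrow> 'j set \<Rightarrow> (('i \<Rightarrow> real) \<Rightarrow> 'j \<Rightarrow> real) \<Rightarrow> bool" where
  "differentiable_times k I J h \<longleftrightarrow> (\<forall>j\<in>J. times_differentiable k I (\<lambda>x. h x j))"

definition cont_differentiable_times ::
    "nat \<Rightarrow> 'i set \<Rightarrow> 'j set \<Rightarrow> (('i \<Rightarrow> real) \<Rightarrow> 'j \<Rightarrow> real) \<Rightarrow> bool" where
  "cont_differentiable_times k I J h \<longleftrightarrow>
     differentiable_times k I J h \<and>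
     (\<forall>j\<in>J. \<forall>js. set js \<subseteq> I \<and> length js \<le> k \<longrightarrow>
        continuous_on (Rn I) (partial_derivs js (\<lambda>x. h x j)))"

text \<open>\<open>\<parallel>\<nabla>\<^sup>k h(x)\<parallel>\<close>, the Frobenius norm of the tensor of all partial derivatives of order \<open>k\<close>.\<close>

definition nabla_norm ::
    "nat \<Rightarrow> 'i set \<Rightarrow> 'j set \<Rightarrow> (('i \<Rightarrow> real) \<Rightarrow> 'j \<Rightarrow> real) \<Rightarrow> ('i \<Rightarrow> real) \<Rightarrow> real" where
  "nabla_norm k I J h x =
     L2_set (\<lambda>(js, j). partial_derivs js (\<lambda>y. h y j) x) ({js. set js \<subseteq> I \<and> length js = k} \<times> J)"

definition time_deriv ::
    "real \<Rightarrow> (real \<Rightarrow> ('i \<Rightarrow> real) \<Rightarrow> 'j \<Rightarrow> real) \<Rightarrow> real \<Rightarrow> ('i \<Rightarrow> real) \<Rightarrow> 'j \<Rightarrow> real" where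
  "time_deriv T h t x j = vector_derivative (\<lambda>s. h s x j) (at t within {0..T})"

text \<open>\<open>hat I h (x, y) = (h(x), Dh\<^sub>x(y))\<close>, where \<open>(x, y) \<in> \<real>\<^sup>I \<times> \<real>\<^sup>I\<close> is encoded as \<open>z\<close> with
  \<open>x i = z (Inl i)\<close> and \<open>y i = z (Inr i)\<close>.\<close>

definition hat ::
    "'i set \<Rightarrow> (('i \<Rightarrow> real) \<Rightarrow> 'j \<Rightarrow> real) \<Rightarrow> ('i + 'i \<Rightarrow> real) \<Rightarrow> 'j + 'j \<Rightarrow> real" where
  "hat I h z = (let x = (\<lambda>i\<in>I. z (Inl i)) in
     case_sum (h x) (\<lambda>j. \<Sum>i\<in>I. partial_deriv i (\<lambda>y. h y j) x * z (Inr i)))"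

definition growth ::
    "nat \<Rightarrow> real \<Rightarrow> 'i set \<Rightarrow> 'j set \<Rightarrow> (('i \<Rightarrow> real) \<Rightarrow> 'j \<Rightarrow> real) \<Rightarrow> ennreal" where
  "growth k r I J h = (SUP x\<in>Rn I.
     ennreal (\<Sum>i\<le>k. nabla_norm i I J h x / (1 + L2_set x I) powr (r + real k - real i)))"

definition growth_t ::
    "real \<Rightarrow> nat \<Rightarrow> real \<Rightarrow> 'i set \<Rightarrow> 'j set \<Rightarrow> (real \<Rightarrow> ('i \<Rightarrow> real) \<Rightarrow> 'j \<Rightarrow> real) \<Rightarrow> ennreal" where
  "growth_t T k r I J h = (SUP t\<in>{0..T}. growth k r I J (h t))"

definition hat_growth ::
    "real \<Rightarrow> 'i set \<Rightarrow> 'j set \<Rightarrow> (real \<Rightarrow> ('i \<Rightarrow> real) \<Rightarrow> 'j \<Rightarrow> real) \<Rightarrow> ennreal" where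
  "hat_growth T I J h = growth_t T 0 1 (I <+> I) (J <+> J) (\<lambda>t. hat I (h t))"

definition holder_growth ::
    "real \<Rightarrow> real \<Rightarrow> real \<Rightarrow> 'i set \<Rightarrow> 'j set \<Rightarrow> (real \<Rightarrow> ('i \<Rightarrow> real) \<Rightarrow> 'j \<Rightarrow> real) \<Rightarrow> ennreal" where
  "holder_growth T \<alpha> r I J h =
     (SUP (s, t) \<in> {(s, t). s \<in> {0..T} \<and> t \<in> {0..T} \<and> 0 < \<bar>t - s\<bar> \<and> \<bar>t - s\<bar> \<le> 1}.
      SUP x\<in>Rn I. ennreal
        (L2_set (\<lambda>j. h t x j - h s x j) J / (1 + L2_set x I) powr r * \<bar>t - s\<bar> powr (- \<alpha>)))"

definition space_measurable ::
    "real \<Rightarrow> nat \<Rightarrow> 'j set \<Rightarrow> (real \<Rightarrow> (nat \<Rightarrow> real) \<Rightarrow> 'j \<Rightarrow> real) \<Rightarrow> bool" where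
  "space_measurable T d J h \<longleftrightarrow> (\<forall>j\<in>J. (\<lambda>(t, x). h t x j) \<in>
     borel_measurable (restrict_space borel {0..T} \<Otimes>\<^sub>M PiM {..<d} (\<lambda>_. borel)))"

definition admissible_coefficient ::
    "real \<Rightarrow> nat \<Rightarrow> 'j set \<Rightarrow> (real \<Rightarrow> (nat \<Rightarrow> real) \<Rightarrow> 'j \<Rightarrow> real) \<Rightarrow> bool" where
  "admissible_coefficient T d J h \<longleftrightarrow>
     space_measurable T d J h \<and>
     (\<forall>x\<in>Rn {..<d}. \<forall>j\<in>J. continuous_on {0..T} (\<lambda>t. h t x j)) \<and>
     (\<forall>t\<in>{0..T}. cont_differentiable_times 1 {..<d} J (h t)) \<and>
     (\<exists>B. \<forall>t\<in>{0..T}. \<forall>x\<in>Rn {..<d}. nabla_norm 1 {..<d} J (h t) x \<le> B)"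

definition cont_differentiable_in_time ::
    "real \<Rightarrow> 'i set \<Rightarrow> 'j set \<Rightarrow> (real \<Rightarrow> ('i \<Rightarrow> real) \<Rightarrow> 'j \<Rightarrow> real) \<Rightarrow> bool" where
  "cont_differentiable_in_time T I J h \<longleftrightarrow> (\<forall>x\<in>Rn I. \<forall>j\<in>J.
     (\<forall>t\<in>{0..T}. (\<lambda>s. h s x j) differentiable (at t within {0..T})) \<and>
     continuous_on {0..T} (\<lambda>t. time_deriv T h t x j))"

text \<open>\<open>h \<in> C\<^sup>1\<^sup>,\<^sup>k([0,T] \<times> \<real>\<^sup>I, \<real>\<^sup>J)\<close>: the time derivative and all spatial derivatives up to order \<open>k\<close>
  exist and are jointly continuous (one-sided time derivatives at \<open>0\<close> and \<open>T\<close>).\<close>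

definition C1k ::
    "real \<Rightarrow> nat \<Rightarrow> 'i set \<Rightarrow> 'j set \<Rightarrow> (real \<Rightarrow> ('i \<Rightarrow> real) \<Rightarrow> 'j \<Rightarrow> real) \<Rightarrow> bool" where
  "C1k T k I J h \<longleftrightarrow>
     (\<forall>t\<in>{0..T}. differentiable_times k I J (h t)) \<and>
     (\<forall>x\<in>Rn I. \<forall>j\<in>J. \<forall>t\<in>{0..T}. (\<lambda>s. h s x j) differentiable (at t within {0..T})) \<and>
     (\<forall>j\<in>J. continuous_on ({0..T} \<times> Rn I) (\<lambda>(t, x). time_deriv T h t x j)) \<and>
     (\<forall>j\<in>J. \<forall>js. set js \<subseteq> I \<and> length js \<le> k \<longrightarrow>
        continuous_on ({0..T} \<times> Rn I) (\<lambda>(t, x). partial_derivs js (\<lambda>y. h t y j) x))"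

definition solves_pde ::
    "real \<Rightarrow> nat \<Rightarrow> nat \<Rightarrow> (real \<Rightarrow> (nat \<Rightarrow> real) \<Rightarrow> nat \<Rightarrow> real)
      \<Rightarrow> (real \<Rightarrow> (nat \<Rightarrow> real) \<Rightarrow> nat \<times> nat \<Rightarrow> real)
      \<Rightarrow> (real \<Rightarrow> (nat \<Rightarrow> real) \<Rightarrow> nat \<Rightarrow> real) \<Rightarrow> ((nat \<Rightarrow> real) \<Rightarrow> nat \<Rightarrow> real)
      \<Rightarrow> (real \<Rightarrow> (nat \<Rightarrow> real) \<Rightarrow> nat \<Rightarrow> real) \<Rightarrow> bool" where
  "solves_pde T d m \<mu> \<sigma> g f u \<longleftrightarrow>
     (\<forall>t\<in>{0..T}. \<forall>x\<in>Rn {..<d}. \<forall>i<m.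
        time_deriv T u t x i
        + (\<Sum>j<d. partial_deriv j (\<lambda>y. u t y i) x * \<mu> t x j)
        + 1/2 * (\<Sum>j<d. \<Sum>k<d. (\<Sum>l<d. \<sigma> t x (j, l) * \<sigma> t x (k, l))
                    * partial_derivs [k, j] (\<lambda>y. u t y i) x)
        + g t x i = 0) \<and>
     (\<forall>x\<in>Rn {..<d}. \<forall>i<m. u T x i = f x i)"

record layer =
  inputs :: nat
  outputs :: nat
  weight :: "nat \<Rightarrow> nat \<Rightarrow> real"
  bias :: "nat \<Rightarrow> real"
  identity_node :: "nat \<Rightarrow> bool"

type_synonym network = "layer list"

definition affine_map :: "layer \<Rightarrow> (nat \<Rightarrow> real) \<Rightarrow> nat \<Rightarrow> real" where
  "affine_map L x = (\<lambda>i\<in>{..<outputs L}. (\<Sum>j<inputs L. weight L i j * x j) + bias L i)"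

text \<open>After every affine map but the last, each node applies \<open>\<rho>\<close>, or the identity if it is an identity
  node.\<close>

fun realization :: "(real \<Rightarrow> real) \<Rightarrow> network \<Rightarrow> (nat \<Rightarrow> real) \<Rightarrow> nat \<Rightarrow> real" where
  "realization \<rho> [] x = x"
| "realization \<rho> [L] x = affine_map L x"
| "realization \<rho> (L # L' # Ls) x = realization \<rho> (L' # Ls)
     (\<lambda>i\<in>{..<outputs L}. if identity_node L i then affine_map L x i else \<rho> (affine_map L x i))"

definition is_network :: "nat \<Rightarrow> nat \<Rightarrow> network \<Rightarrow> bool" where
  "is_network d m N \<longleftrightarrow> N \<noteq> [] \<and> inputs (hd N) = d \<and> outputs (last N) = m \<and>
     (\<forall>L\<in>set N. inputs L > 0 \<and> outputs L > 0) \<and>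
     (\<forall>k. Suc k < length N \<longrightarrow> outputs (N ! k) = inputs (N ! Suc k))"

definition architecture :: "network \<Rightarrow> (nat \<times> nat) list" where
  "architecture N = map (\<lambda>L. (inputs L, outputs L)) N"

abbreviation depth :: "network \<Rightarrow> nat" where
  "depth N \<equiv> length N"

definition nonzero_params :: "network \<Rightarrow> nat" where
  "nonzero_params N = (\<Sum>L\<leftarrow>N.
     card {(i, j). i < outputs L \<and> j < inputs L \<and> weight L i j \<noteq> 0}
     + card {i. i < outputs L \<and> bias L i \<noteq> 0})"

text \<open>Number of parameters of a time-dependent network. Since the architecture does not depend on
  \<open>t\<close>, the supremum is a maximum.\<close>

definition nonzero_params_t :: "real \<Rightarrow> (real \<Rightarrow> network) \<Rightarrow> nat" where
  "nonzero_params_t T N = (SUP t\<in>{0..T}. nonzero_params (N t))"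

definition given_by_network ::
    "(real \<Rightarrow> real) \<Rightarrow> nat \<Rightarrow> nat \<Rightarrow> nat \<Rightarrow> network \<Rightarrow> ((nat \<Rightarrow> real) \<Rightarrow> nat \<Rightarrow> real) \<Rightarrow> bool" where
  "given_by_network \<rho> D d m N h \<longleftrightarrow> is_network d m N \<and> depth N = D \<and>
     (\<forall>x\<in>Rn {..<d}. \<forall>j<m. h x j = realization \<rho> N x j)"

definition given_by_networks ::
    "(real \<Rightarrow> real) \<Rightarrow> real \<Rightarrow> nat \<Rightarrow> nat \<Rightarrow> nat \<Rightarrow> (real \<Rightarrow> network)
      \<Rightarrow> (real \<Rightarrow> (nat \<Rightarrow> real) \<Rightarrow> nat \<Rightarrow> real) \<Rightarrow> bool" where
  "given_by_networks \<rho> T D d m N h \<longleftrightarrow>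
     (\<forall>t\<in>{0..T}. given_by_network \<rho> D d m (N t) (h t)) \<and>
     (\<exists>a. \<forall>t\<in>{0..T}. architecture (N t) = a)"

text \<open>Row-wise identification of \<open>d \<times> d\<close>-matrices with \<open>\<real>\<^bsup>d*d\<^esup>\<close>, the output space of a network.\<close>

definition flatten :: "nat \<Rightarrow> (nat \<times> nat \<Rightarrow> real) \<Rightarrow> nat \<Rightarrow> real" where
  "flatten d A k = A (k div d, k mod d)"

definition network_perturbation ::
    "(real \<Rightarrow> real) \<Rightarrow> real \<Rightarrow> nat \<Rightarrow> nat \<Rightarrow> nat
      \<Rightarrow> network \<Rightarrow> (real \<Rightarrow> network) \<Rightarrow> (real \<Rightarrow> network) \<Rightarrow> (real \<Rightarrow> network)
      \<Rightarrow> ((nat \<Rightarrow> real) \<Rightarrow> nat \<Rightarrow> real) \<Rightarrow> (real \<Rightarrow> (nat \<Rightarrow> real) \<Rightarrow> nat \<Rightarrow> real)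
      \<Rightarrow> (real \<Rightarrow> (nat \<Rightarrow> real) \<Rightarrow> nat \<Rightarrow> real) \<Rightarrow> (real \<Rightarrow> (nat \<Rightarrow> real) \<Rightarrow> nat \<times> nat \<Rightarrow> real) \<Rightarrow> bool" where
  "network_perturbation \<rho> T d m D NF NG N\<nu> N\<tau> F G \<nu> \<tau> \<longleftrightarrow>
     admissible_coefficient T d {..<d} \<nu> \<and>
     admissible_coefficient T d ({..<d} \<times> {..<d}) \<tau> \<and>
     differentiable_times 2 {..<d} {..<m} F \<and>
     (\<forall>t\<in>{0..T}. differentiable_times 2 {..<d} {..<m} (G t)
        \<and> differentiable_times 2 {..<d} {..<d} (\<nu> t)
        \<and> differentiable_times 2 {..<d} ({..<d} \<times> {..<d}) (\<tau> t)) \<and>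
     given_by_network \<rho> D d m NF F \<and>
     given_by_networks \<rho> T D d m NG G \<and>
     given_by_networks \<rho> T D d d N\<nu> \<nu> \<and>
     given_by_networks \<rho> T D d (d * d) N\<tau> (\<lambda>t x. flatten d (\<tau> t x))"

definition min_params ::
    "real \<Rightarrow> network \<Rightarrow> (real \<Rightarrow> network) \<Rightarrow> (real \<Rightarrow> network) \<Rightarrow> (real \<Rightarrow> network) \<Rightarrow> nat" where
  "min_params T NF NG N\<nu> N\<tau> = Min {nonzero_params NF, nonzero_params_t T NG,
     nonzero_params_t T N\<nu>, nonzero_params_t T N\<tau>}"

definition max_params ::
    "real \<Rightarrow> network \<Rightarrow> (real \<Rightarrow> network) \<Rightarrow> (real \<Rightarrow> network) \<Rightarrow> (real \<Rightarrow> network) \<Rightarrow> nat" where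
  "max_params T NF NG N\<nu> N\<tau> = Max {nonzero_params NF, nonzero_params_t T NG,
     nonzero_params_t T N\<nu>, nonzero_params_t T N\<tau>}"

text \<open>The accuracy \<open>\<epsilon>\<close> is arbitrary while the perturbation error is only controlled in terms of the
  size of the perturbing networks, so the perturbations have to be read as a family of networks of
  growing size: a single quadruple says nothing about accuracies below its own perturbation error.
  The \<open>n\<close>-th quadruple has at least \<open>n\<close> parameters per network, and the sizes of the four
  networks are comparable, that is, polynomially bounded in \<open>n\<close> and the dimensions.\<close>

definition sizes_sweep ::
    "real \<Rightarrow> real \<Rightarrow> nat \<Rightarrow> nat \<Rightarrow> (nat \<Rightarrow> network) \<Rightarrow> (nat \<Rightarrow> real \<Rightarrow> network)
      \<Rightarrow> (nat \<Rightarrow> real \<Rightarrow> network) \<Rightarrow> (nat \<Rightarrow> real \<Rightarrow> network) \<Rightarrow> bool" where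
  "sizes_sweep lam T d m NF NG N\<nu> N\<tau> \<longleftrightarrow> (\<forall>n.
     n \<le> min_params T (NF n) (NG n) (N\<nu> n) (N\<tau> n) \<and>
     real (max_params T (NF n) (NG n) (N\<nu> n) (N\<tau> n)) \<le> lam * (real d * real m * (real n + 1)) powr lam)"

definition unit_cube :: "nat \<Rightarrow> (nat \<Rightarrow> real) set" where
  "unit_cube d = PiE {..<d} (\<lambda>_. {0..1})"

definition L2_integrable :: "nat \<Rightarrow> ((nat \<Rightarrow> real) \<Rightarrow> real) \<Rightarrow> bool" where
  "L2_integrable d h \<longleftrightarrow> set_integrable (PiM {..<d} (\<lambda>_. lborel)) (unit_cube d) (\<lambda>x. (h x)\<^sup>2)"

definition L2_norm :: "nat \<Rightarrow> ((nat \<Rightarrow> real) \<Rightarrow> real) \<Rightarrow> real" where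
  "L2_norm d h = sqrt (LINT x:unit_cube d|PiM {..<d} (\<lambda>_. lborel). (h x)\<^sup>2)"

end

theory Submission
  imports Defs "HOL-Library.Landau_Symbols"
begin

text \<open>
  The solution at time \<open>0\<close> is approximated by a Monte Carlo average over Euler schemes for the underlying diffusion, with the
  perturbed coefficients in place of the exact ones. The functions in such a scheme are compositions of networks and affine
  maps, so each realization of the average is itself a network, and it is enough to find one good realization. The
  argument needs no stochastic analysis, as the Brownian increments are replaced by random signs.

  Let \<open>\<Phi>(x) = x + h \<nu>(t, x) + \<surd>h \<tau>(t, x) \<xi>\<close> with a vector \<open>\<xi>\<close> of signs. By Taylor's theorem and the first two moments of \<open>\<xi>\<close>,
  the average of \<open>u(t + h, \<Phi>(x))\<close> differs from \<open>u(t + h, x)\<close> by \<open>h\<close> times the generator applied to \<open>u\<close>, up to \<open>O(h\<^sup>3\<^sup>/\<^sup>2)\<close>; by the equation,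
  this compensates the change of \<open>u\<close> in time up to \<open>h\<close> times the source (\<open>one_step_defect\<close>). The coefficients are only Hoelder
  continuous in time, and the time regularity of the spatial derivatives of \<open>u\<close> is obtained by interpolation
  (\<open>u_derivs_hoelder\<close>), so the error of a step is \<open>h\<close> times a power of \<open>h\<close>, plus \<open>h\<close> times the perturbation error. The same
  computation is done for gradients: the derivative of the scheme in direction \<open>y\<close> is a scheme for the pair \<open>(x, y)\<close> whose
  coefficients are the augmented ones.

  The errors of the steps are summed in norms with weight \<open>(1 + \<parallel>x\<parallel>\<^sup>2 + \<parallel>y\<parallel>\<^sup>2)\<^sup>q\<close>. One step increases the average of the weight by a factor of at most
  \<open>1 + \<kappa> c h\<close> with \<open>\<kappa>\<close> independent of the dimension (\<open>avg_moment\<close>), which is possible because \<open>c\<close> bounds the growth of the augmented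
  coefficients. A discrete Gronwall argument (\<open>path_recursion\<close>) then bounds the bias and the second moments by \<open>e\<^bsup>\<kappa> c\<^esup>\<close> times
  polynomials in the dimension (\<open>scheme_bounds\<close>).

  The samples are selected greedily so that the mean square error of all components of the solution and its gradient on the cube
  decreases like the inverse of the number of samples (\<open>select_samples\<close>). A single network goes through all the samples and time steps, while identity nodes keep the starting point and the
  accumulated sum (\<open>computes_sample_average\<close>). Finally, the number of steps, the number of samples, and the size of the
  perturbing networks are bounded by powers of \<open>d m e\<^sup>c / \<epsilon>\<close>. For the last one this holds because the perturbation
  error is exponentially small in the size (\<open>perturbation_small\<close>).
\<close>

section \<open>Differential calculus on extensional vectors\<close>

text \<open>Differentiability becomes a little-o statement along this filter, so the calculus of asymptotic classes replaces epsilon-delta arguments.\<close>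

definition near :: "'i set \<Rightarrow> ('i \<Rightarrow> real) \<Rightarrow> ('i \<Rightarrow> real) filter" where
  "near I x = inf (filtercomap (\<lambda>y. L2_set (\<lambda>i. y i - x i) I) (nhds 0)) (principal (Rn I))"

lemma eventually_near:
  "eventually P (near I x) \<longleftrightarrow> (\<exists>\<delta>>0. \<forall>y\<in>Rn I. L2_set (\<lambda>i. y i - x i) I < \<delta> \<longrightarrow> P y)"
proof
  assume "eventually P (near I x)"
  then obtain Q where Q: "eventually Q (nhds (0::real))"
     "\<And>y. Q (L2_set (\<lambda>i. y i - x i) I) \<Longrightarrow> y \<in> Rn I \<Longrightarrow> P y"
    unfolding near_def eventually_inf_principal eventually_filtercomap by blast
  then obtain \<delta> where "\<delta> > 0" "\<And>z. dist z 0 < \<delta> \<Longrightarrow> Q z"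
    unfolding eventually_nhds_metric by blast
  then show "\<exists>\<delta>>0. \<forall>y\<in>Rn I. L2_set (\<lambda>i. y i - x i) I < \<delta> \<longrightarrow> P y"
    using Q(2) by (intro exI[of _ \<delta>]) (auto simp: dist_real_def)
next
  assume "\<exists>\<delta>>0. \<forall>y\<in>Rn I. L2_set (\<lambda>i. y i - x i) I < \<delta> \<longrightarrow> P y"
  then obtain \<delta> where d: "\<delta> > 0" "\<And>y. y\<in>Rn I \<Longrightarrow> L2_set (\<lambda>i. y i - x i) I < \<delta> \<Longrightarrow> P y" by blast
  have "eventually (\<lambda>z. z < \<delta>) (nhds (0::real))"
    using d(1) by (auto simp: eventually_nhds_metric dist_real_def intro!: exI[of _ \<delta>])
  then show "eventually P (near I x)"
    unfolding near_def eventually_inf_principal eventually_filtercomap using d(2) by blast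
qed

text \<open>The gradient is kept as an explicit vector: the scheme is differentiated by computing gradients, and uniqueness then identifies their entries with partial derivatives.\<close>

definition has_grad :: "'i set \<Rightarrow> (('i \<Rightarrow> real) \<Rightarrow> real) \<Rightarrow> ('i \<Rightarrow> real) \<Rightarrow> ('i \<Rightarrow> real) \<Rightarrow> bool" where
  "has_grad I h a x \<longleftrightarrow>
     (\<lambda>y. h y - h x - (\<Sum>i\<in>I. a i * (y i - x i))) \<in> o[near I x](\<lambda>y. L2_set (\<lambda>i. y i - x i) I)"

lemma frechet_iff_has_grad: "frechet_differentiable_at I h x \<longleftrightarrow> (\<exists>a. has_grad I h a x)"
  unfolding frechet_differentiable_at_def has_grad_def smallo_def eventually_near
  by (simp add: L2_set_nonneg)

lemma near_in: "eventually (\<lambda>y. y \<in> Rn I) (near I x)"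
  unfolding eventually_near by (auto intro: exI[of _ 1])

lemma near_tendsto: "((\<lambda>y. L2_set (\<lambda>i. y i - x i) I) \<longlongrightarrow> 0) (near I x)"
  unfolding near_def by (rule tendsto_mono[OF inf_le1]) (rule filterlim_filtercomap)

lemma has_grad_cong:
  assumes "has_grad I h a x" "x \<in> Rn I" "\<And>y. y \<in> Rn I \<Longrightarrow> h y = k y" "\<And>i. i \<in> I \<Longrightarrow> a i = b i"
  shows "has_grad I k b x"
proof -
  have e: "(\<Sum>i\<in>I. b i * (y i - x i)) = (\<Sum>i\<in>I. a i * (y i - x i))" for y
    by (rule sum.cong) (auto simp: assms(4))
  show ?thesis
  unfolding has_grad_def e
  using assms(1) unfolding has_grad_def
  by (rule landau_o.small.in_cong[THEN iffD1, rotated])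
     (use near_in in eventually_elim, simp add: assms)
qed

lemma has_grad_const: "has_grad I (\<lambda>_. c) (\<lambda>_. 0) x"
  unfolding has_grad_def by simp

lemma has_grad_proj: "finite I \<Longrightarrow> j \<in> I \<Longrightarrow> has_grad I (\<lambda>x. x j) (\<lambda>i. if i = j then 1 else 0) x"
  unfolding has_grad_def by (simp add: if_distrib[of "\<lambda>a. a * _"] cong: if_cong)

lemma has_grad_add:
  assumes "has_grad I f a x" "has_grad I g b x"
  shows "has_grad I (\<lambda>x. f x + g x) (\<lambda>i. a i + b i) x"
proof -
  have "(\<lambda>y. (f y - f x - (\<Sum>i\<in>I. a i * (y i - x i))) + (g y - g x - (\<Sum>i\<in>I. b i * (y i - x i))))
     \<in> o[near I x](\<lambda>y. L2_set (\<lambda>i. y i - x i) I)"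
    using assms unfolding has_grad_def by (rule sum_in_smallo)
  also have "(\<lambda>y. (f y - f x - (\<Sum>i\<in>I. a i * (y i - x i))) + (g y - g x - (\<Sum>i\<in>I. b i * (y i - x i))))
    = (\<lambda>y. f y + g y - (f x + g x) - (\<Sum>i\<in>I. (a i + b i) * (y i - x i)))"
    by (simp add: distrib_right sum.distrib fun_eq_iff)
  finally show ?thesis unfolding has_grad_def .
qed

lemma has_grad_cmult:
  assumes "has_grad I f a x"
  shows "has_grad I (\<lambda>x. c * f x) (\<lambda>i. c * a i) x"
proof -
  have "(\<lambda>y. c * (f y - f x - (\<Sum>i\<in>I. a i * (y i - x i))))
     \<in> o[near I x](\<lambda>y. L2_set (\<lambda>i. y i - x i) I)"
    using assms unfolding has_grad_def by (cases "c = 0") auto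
  also have "(\<lambda>y. c * (f y - f x - (\<Sum>i\<in>I. a i * (y i - x i))))
    = (\<lambda>y. c * f y - c * f x - (\<Sum>i\<in>I. (c * a i) * (y i - x i)))"
    by (simp add: algebra_simps sum_distrib_left)
  finally show ?thesis unfolding has_grad_def .
qed

lemma has_grad_sum:
  assumes "\<And>k. k \<in> A \<Longrightarrow> has_grad I (f k) (a k) x"
  shows "has_grad I (\<lambda>x. \<Sum>k\<in>A. f k x) (\<lambda>i. \<Sum>k\<in>A. a k i) x"
  using assms
  by (induction A rule: infinite_finite_induct) (auto intro: has_grad_const has_grad_add)

lemma has_grad_diff:
  assumes "has_grad I f a x" "has_grad I g b x"
  shows "has_grad I (\<lambda>x. f x - g x) (\<lambda>i. a i - b i) x"
  using has_grad_add[OF assms(1) has_grad_cmult[OF assms(2), of "-1"]] by simp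

lemma has_grad_bigo:
  assumes "finite I" "has_grad I h a x"
  shows "(\<lambda>y. h y - h x) \<in> O[near I x](\<lambda>y. L2_set (\<lambda>i. y i - x i) I)"
proof -
  have "(\<lambda>y. (\<Sum>i\<in>I. a i * (y i - x i))) \<in> O[near I x](\<lambda>y. L2_set (\<lambda>i. y i - x i) I)"
  proof (rule big_sum_in_bigo)
    fix i assume "i \<in> I"
    then have "\<bar>y i - x i\<bar> \<le> L2_set (\<lambda>i. y i - x i) I" for y
      using member_le_L2_set[OF assms(1), of i "\<lambda>i. \<bar>y i - x i\<bar>"] by (simp add: L2_set_def)
    then have "(\<lambda>y. y i - x i) \<in> O[near I x](\<lambda>y. L2_set (\<lambda>i. y i - x i) I)"
      by (intro bigoI[of _ 1] always_eventually) (simp add: L2_set_nonneg)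
    then show "(\<lambda>y. a i * (y i - x i)) \<in> O[near I x](\<lambda>y. L2_set (\<lambda>i. y i - x i) I)" by simp
  qed
  with landau_o.small_imp_big[OF assms(2)[unfolded has_grad_def]] 
  have "(\<lambda>y. (h y - h x - (\<Sum>i\<in>I. a i * (y i - x i))) + (\<Sum>i\<in>I. a i * (y i - x i)))
     \<in> O[near I x](\<lambda>y. L2_set (\<lambda>i. y i - x i) I)" by (rule sum_in_bigo)
  then show ?thesis by simp
qed

lemma L2_set_in_bigo:
  assumes "finite J" "\<And>j. j \<in> J \<Longrightarrow> (\<lambda>y. f y j) \<in> O[F](g)"
  shows "(\<lambda>y. L2_set (f y) J) \<in> O[F](g)"
proof -
  have "(\<lambda>y. \<Sum>j\<in>J. \<bar>f y j\<bar>) \<in> O[F](g)" using assms(2) by (intro big_sum_in_bigo) auto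
  moreover have "(\<lambda>y. L2_set (f y) J) \<in> O[F](\<lambda>y. \<Sum>j\<in>J. \<bar>f y j\<bar>)"
    by (intro bigoI[of _ 1] always_eventually) (auto simp: L2_set_nonneg intro!: L2_set_le_sum_abs order_trans[OF L2_set_le_sum_abs])
  ultimately show ?thesis by (rule landau_o.big_trans[rotated])
qed

text \<open>The chain rule in little-o form: the inner map is \<open>O\<close> of the increment, so the remainder of the
  outer function stays negligible along it.\<close>

lemma has_grad_along:
  assumes J: "finite J" and v: "has_grad J v a (\<Phi> x0)"
    and R: "eventually (\<lambda>x. \<Phi> x \<in> Rn J) F"
    and O: "\<And>j. j \<in> J \<Longrightarrow> (\<lambda>x. \<Phi> x j - \<Phi> x0 j) \<in> O[F](l)"
    and l: "(l \<longlongrightarrow> 0) F"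
    and D: "\<And>j. j \<in> J \<Longrightarrow> (\<lambda>x. \<Phi> x j - \<Phi> x0 j - A j x) \<in> o[F](l)"
  shows "(\<lambda>x. v (\<Phi> x) - v (\<Phi> x0) - (\<Sum>j\<in>J. a j * A j x)) \<in> o[F](l :: _ \<Rightarrow> real)"
proof -
  let ?L = "\<lambda>x. L2_set (\<lambda>j. \<Phi> x j - \<Phi> x0 j) J"
  have LO: "?L \<in> O[F](l)" using J O by (rule L2_set_in_bigo)
  have "(?L \<longlongrightarrow> 0) F"
  proof -
    have "l \<in> o[F](\<lambda>_. 1)" using l by (simp add: smalloI_tendsto)
    then have "?L \<in> o[F](\<lambda>_. 1)" using LO by (rule landau_o.big_small_trans[rotated])
    then show ?thesis by (auto dest: smalloD_tendsto)
  qed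
  then have lim: "filterlim \<Phi> (near J (\<Phi> x0)) F"
    unfolding near_def using R by (simp add: filterlim_inf filterlim_principal filterlim_filtercomap_iff o_def)
  have "(\<lambda>x. v (\<Phi> x) - v (\<Phi> x0) - (\<Sum>j\<in>J. a j * (\<Phi> x j - \<Phi> x0 j))) \<in> o[F](?L)"
    using landau_o.small.compose[OF v[unfolded has_grad_def] lim] .
  then have 1: "(\<lambda>x. v (\<Phi> x) - v (\<Phi> x0) - (\<Sum>j\<in>J. a j * (\<Phi> x j - \<Phi> x0 j))) \<in> o[F](l)"
    using LO by (rule landau_o.small_big_trans)
  have 2: "(\<lambda>x. \<Sum>j\<in>J. a j * (\<Phi> x j - \<Phi> x0 j - A j x)) \<in> o[F](l)"
  proof (rule big_sum_in_smallo)
    fix j assume "j \<in> J" from D[OF this]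
    show "(\<lambda>x. a j * (\<Phi> x j - \<Phi> x0 j - A j x)) \<in> o[F](l)" by (cases "a j = 0") auto
  qed
  from sum_in_smallo(1)[OF 1 2] show ?thesis
    by (simp add: algebra_simps sum.distrib sum_subtractf)
qed

lemma has_grad_chain:
  assumes I: "finite I" and J: "finite J" and v: "has_grad J v a (\<Phi> x)"
    and R: "\<And>y. y \<in> Rn I \<Longrightarrow> \<Phi> y \<in> Rn J"
    and D: "\<And>j. j \<in> J \<Longrightarrow> has_grad I (\<lambda>y. \<Phi> y j) (A j) x"
  shows "has_grad I (\<lambda>y. v (\<Phi> y)) (\<lambda>i. \<Sum>j\<in>J. a j * A j i) x"
proof -
  have "(\<lambda>y. v (\<Phi> y) - v (\<Phi> x) - (\<Sum>j\<in>J. a j * (\<Sum>i\<in>I. A j i * (y i - x i))))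
      \<in> o[near I x](\<lambda>y. L2_set (\<lambda>i. y i - x i) I)"
  proof (rule has_grad_along[of J v a \<Phi> x, OF J v])
    show "\<forall>\<^sub>F x in near I x. \<Phi> x \<in> Rn J" using near_in[of I x] by eventually_elim (rule R)
  qed (rule D[unfolded has_grad_def] has_grad_bigo[OF I D] near_tendsto | assumption)+
  also have "(\<lambda>y. (\<Sum>j\<in>J. a j * (\<Sum>i\<in>I. A j i * (y i - x i))))
    = (\<lambda>y. \<Sum>i\<in>I. (\<Sum>j\<in>J. a j * A j i) * (y i - x i))"
    by (simp add: sum_distrib_left sum_distrib_right sum.swap[of _ I J] mult.assoc)
  then have "(\<lambda>y. v (\<Phi> y) - v (\<Phi> x) - (\<Sum>j\<in>J. a j * (\<Sum>i\<in>I. A j i * (y i - x i))))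
    = (\<lambda>y. v (\<Phi> y) - v (\<Phi> x) - (\<Sum>i\<in>I. (\<Sum>j\<in>J. a j * A j i) * (y i - x i)))"
    by metis
  finally show ?thesis unfolding has_grad_def .
qed

text \<open>Restricting a function to a curve is what reduces all multivariate expansions below to Taylor's theorem in one variable.\<close>

lemma has_grad_curve:
  assumes J: "finite J" and v: "has_grad J v a (\<gamma> s)"
    and R: "\<And>t. \<gamma> t \<in> Rn J"
    and D: "\<And>j. j \<in> J \<Longrightarrow> ((\<lambda>t. \<gamma> t j) has_real_derivative \<gamma>' j) (at s)"
  shows "((\<lambda>t. v (\<gamma> t)) has_real_derivative (\<Sum>j\<in>J. a j * \<gamma>' j)) (at s)"
proof -
  have iff: "(f has_real_derivative D) (at s) \<longleftrightarrow>
     (\<lambda>t. f t - f s - D * (t - s)) \<in> o[at s](\<lambda>t. t - s)" for f D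
  proof -
    have "eventually (\<lambda>t. t \<noteq> s) (at s)" by (simp add: eventually_at_filter)
    then have ev: "\<forall>\<^sub>F t in at s. (f t - f s) / (t - s) - D = (f t - f s - D * (t - s)) / (t - s)"
      by eventually_elim (simp add: field_simps)
    have ne: "\<forall>\<^sub>F t in at s. t - s = 0 \<longrightarrow> f t - f s - D * (t - s) = 0" by simp
    have "(f has_real_derivative D) (at s) \<longleftrightarrow> ((\<lambda>t. (f t - f s) / (t - s)) \<longlongrightarrow> D) (at s)"
      by (simp add: has_field_derivative_iff)
    also have "\<dots> \<longleftrightarrow> ((\<lambda>t. (f t - f s) / (t - s) - D) \<longlongrightarrow> 0) (at s)"
      by (rule LIM_zero_iff[symmetric])
    also have "\<dots> \<longleftrightarrow> ((\<lambda>t. (f t - f s - D * (t - s)) / (t - s)) \<longlongrightarrow> 0) (at s)"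
      by (rule tendsto_cong[OF ev])
    also have "\<dots> \<longleftrightarrow> (\<lambda>t. f t - f s - D * (t - s)) \<in> o[at s](\<lambda>t. t - s)"
      using smalloI_tendsto[of "\<lambda>t. f t - f s - D * (t - s)" "\<lambda>t. t - s" "at s"] smalloD_tendsto
        eventually_neq_at_within[of s s UNIV] by (auto simp: eventually_at_filter)
    finally show ?thesis .
  qed
  have "(\<lambda>t. v (\<gamma> t) - v (\<gamma> s) - (\<Sum>j\<in>J. a j * (\<gamma>' j * (t - s)))) \<in> o[at s](\<lambda>t. t - s)"
  proof (rule has_grad_along[of J v a \<gamma> s, OF J v])
    show "((\<lambda>t. t - s) \<longlongrightarrow> 0) (at s)" by (simp add: LIM_zero)
    fix j assume "j \<in> J"
    then show 1: "(\<lambda>x. \<gamma> x j - \<gamma> s j - \<gamma>' j * (x - s)) \<in> o[at s](\<lambda>t. t - s)"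
      using iff[of "\<lambda>x. \<gamma> x j" "\<gamma>' j"] D by blast
    have "(\<lambda>x. (\<gamma> x j - \<gamma> s j - \<gamma>' j * (x - s)) + \<gamma>' j * (x - s)) \<in> O[at s](\<lambda>t. t - s)"
      by (rule sum_in_bigo[OF landau_o.small_imp_big[OF 1]]) simp
    then show "(\<lambda>x. \<gamma> x j - \<gamma> s j) \<in> O[at s](\<lambda>t. t - s)" by simp
  qed (use R in auto)
  then show ?thesis by (subst iff) (simp add: sum_distrib_right mult.assoc)
qed

lemma Rn_upd: "x \<in> Rn I \<Longrightarrow> i \<in> I \<Longrightarrow> x(i := s) \<in> Rn I"
  by (auto simp: Rn_def PiE_def extensional_def)

lemma Rn_restrict [simp]: "(\<lambda>i\<in>I. f i) \<in> Rn I"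
  by (auto simp: Rn_def)

lemma has_grad_partial_DERIV:
  assumes "finite I" "i \<in> I" "x \<in> Rn I" "has_grad I h a x"
  shows "((\<lambda>s. h (x(i := s))) has_real_derivative a i) (at (x i))"
proof -
  have "((\<lambda>t. h (x(i := t))) has_real_derivative (\<Sum>j\<in>I. a j * (if j = i then 1 else 0))) (at (x i))"
    by (rule has_grad_curve[of I h a "\<lambda>t. x(i := t)" "x i"]) (use assms in \<open>auto simp: Rn_upd\<close>)
  then show ?thesis using assms(1,2) by (simp add: if_distrib[of "\<lambda>a. _ * a"] cong: if_cong)
qed

lemma has_grad_partial_deriv:
  assumes "finite I" "i \<in> I" "x \<in> Rn I" "has_grad I h a x"
  shows "partial_deriv i h x = a i"
  unfolding partial_deriv_def using has_grad_partial_DERIV[OF assms] by (rule DERIV_imp_deriv)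

lemma frechet_has_grad:
  assumes "finite I" "x \<in> Rn I" "frechet_differentiable_at I h x"
  shows "has_grad I h (\<lambda>i. partial_deriv i h x) x"
proof -
  obtain a where a: "has_grad I h a x" using assms(3) frechet_iff_has_grad by blast
  show ?thesis by (rule has_grad_cong[OF a]) (use assms a in \<open>auto simp: has_grad_partial_deriv\<close>)
qed

lemma partial_deriv_cong:
  assumes "\<And>y. y \<in> Rn I \<Longrightarrow> h y = k y" "x \<in> Rn I" "i \<in> I"
  shows "partial_deriv i h x = partial_deriv i k x"
  unfolding partial_deriv_def using assms by (simp add: Rn_upd)

lemma times_differentiable_has_grad:
  assumes "finite I" "times_differentiable (Suc k) I h" "x \<in> Rn I"
  shows "has_grad I h (\<lambda>i. partial_deriv i h x) x"
  using assms by (intro frechet_has_grad) auto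

lemma times_differentiable_partial_derivs:
  assumes "times_differentiable (length js + k) I h" "set js \<subseteq> I"
  shows "times_differentiable k I (partial_derivs js h)"
  using assms
proof (induction js arbitrary: k)
  case (Cons i js)
  have "times_differentiable (Suc k) I (partial_derivs js h)"
    using Cons.prems by (intro Cons.IH) auto
  then show ?case using Cons.prems by simp
qed simp

lemma times_differentiable_mono:
  "times_differentiable k I h \<Longrightarrow> l \<le> k \<Longrightarrow> times_differentiable l I h"
proof (induction l arbitrary: k h)
  case (Suc l)
  from Suc.prems obtain k' where k: "k = Suc k'" "l \<le> k'" by (cases k) auto
  show ?case using Suc.prems(1) Suc.IH[OF _ k(2)] unfolding k by auto
qed simp

lemma DERIV_partial:
  assumes "finite I" "times_differentiable (Suc k) I h" "x \<in> Rn I" "i \<in> I"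
  shows "((\<lambda>s. h (x(i := s))) has_real_derivative partial_deriv i h (x(i := s))) (at s)"
  using has_grad_partial_DERIV[of I i "x(i := s)" h, OF _ _ _ times_differentiable_has_grad[of I k h]]
    assms by (simp add: Rn_upd)

definition along :: "'i set \<Rightarrow> ('i \<Rightarrow> real) \<Rightarrow> ('i \<Rightarrow> real) \<Rightarrow> real \<Rightarrow> 'i \<Rightarrow> real" where
  "along I x w s = (\<lambda>i\<in>I. x i + s * w i)"

lemma along_Rn [simp]: "along I x w s \<in> Rn I" by (simp add: along_def)

lemma along_0 [simp]: "x \<in> Rn I \<Longrightarrow> along I x w 0 = x"
  by (auto simp: along_def Rn_def PiE_def extensional_def restrict_def)

lemma DERIV_along:
  assumes "finite I" "times_differentiable (Suc k) I h"
  shows "((\<lambda>s. h (along I x w s)) has_real_derivative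
           (\<Sum>i\<in>I. w i * partial_deriv i h (along I x w s))) (at s)"
proof -
  have "((\<lambda>t. h (along I x w t)) has_real_derivative
           (\<Sum>i\<in>I. partial_deriv i h (along I x w s) * w i)) (at s)"
    by (rule has_grad_curve[OF assms(1) times_differentiable_has_grad[OF assms]] along_Rn)+
       (auto simp: along_def intro!: derivative_eq_intros)
  then show ?thesis by (simp add: mult.commute)
qed

lemma DERIV_along_partial_derivs:
  assumes "finite I" "times_differentiable k I h" "set js \<subseteq> I" "length js < k"
  shows "((\<lambda>s. partial_derivs js h (along I x w s)) has_real_derivative
           (\<Sum>i\<in>I. w i * partial_derivs (i # js) h (along I x w s))) (at s)"
  using DERIV_along[OF assms(1) times_differentiable_partial_derivs[of js "Suc (k - length js - 1)" I h]] assms by auto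


lemma tendsto_coordinatewise:
  fixes f :: "'a \<Rightarrow> 'b \<Rightarrow> 'c :: topological_space"
  assumes "\<And>i. ((\<lambda>n. f n i) \<longlongrightarrow> l i) F"
  shows "(f \<longlongrightarrow> l) F"
  using assms limitin_componentwise[of "\<lambda>_. euclidean" UNIV f l F]
  by (simp add: euclidean_product_topology)

text \<open>Schwarz's theorem: the mixed second difference over a rectangle is, by two applications of the
  mean value theorem, a value of either mixed derivative; now shrink the rectangle.\<close>

lemma second_difference_mean_value:
  assumes I: "finite I" and v: "times_differentiable 2 I v" and x: "x \<in> Rn I"
    and ij: "i \<in> I" "j \<in> I" "i \<noteq> j" and e: "(e::real) > 0"
  shows "\<exists>a b. x i < a \<and> a < x i + e \<and> x j < b \<and> b < x j + e \<and>
    v (x(i := x i + e, j := x j + e)) - v (x(i := x i + e)) - v (x(j := x j + e)) + v x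
      = e * e * partial_derivs [j, i] v (x(i := a, j := b))"
proof -
  have v1: "times_differentiable (Suc 1) I v" "times_differentiable (Suc 0) I (partial_deriv i v)"
    using v ij by (auto simp: numeral_2_eq_2)
  let ?f = "\<lambda>s. v (x(j := x j + e, i := s)) - v (x(i := s))"
  have D: "DERIV ?f s :> partial_deriv i v (x(j := x j + e, i := s)) - partial_deriv i v (x(i := s))" for s
    using DERIV_partial[OF I v1(1)] x ij by (intro DERIV_diff) (auto simp: Rn_upd)
  have less: "x i < x i + e" "x j < x j + e" using e by auto
  obtain a where a: "x i < a" "a < x i + e" and
    fa: "?f (x i + e) - ?f (x i) = (x i + e - x i) * (partial_deriv i v (x(j := x j + e, i := a)) - partial_deriv i v (x(i := a)))"
    using MVT2[OF less(1) D] by metis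
  have D2: "DERIV (\<lambda>s. partial_deriv i v (x(i := a, j := s))) s :> partial_derivs [j, i] v (x(i := a, j := s))" for s
    using DERIV_partial[OF I v1(2), of "x(i := a)" j s] x ij by (auto simp: Rn_upd)
  obtain b where b: "x j < b" "b < x j + e" and
    fb: "partial_deriv i v (x(i := a, j := x j + e)) - partial_deriv i v (x(i := a, j := x j))
      = (x j + e - x j) * partial_derivs [j, i] v (x(i := a, j := b))"
    using MVT2[OF less(2) D2] by metis
  have "x(i := a, j := x j) = x(i := a)" "x(j := x j + e, i := a) = x(i := a, j := x j + e)"
       "x(j := x j + e, i := x i) = x(j := x j + e)"
       "x(j := x j + e, i := x i + e) = x(i := x i + e, j := x j + e)"
    using ij by auto
  then show ?thesis using a b fa fb by (intro exI[of _ a] exI[of _ b]) (simp add: algebra_simps)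
qed

lemma partial_derivs_swap:
  assumes I: "finite I" and v: "times_differentiable 2 I v" and x: "x \<in> Rn I"
    and ij: "i \<in> I" "j \<in> I"
    and c: "continuous_on (Rn I) (partial_derivs [i, j] v)" "continuous_on (Rn I) (partial_derivs [j, i] v)"
  shows "partial_derivs [i, j] v x = partial_derivs [j, i] v x"
proof (cases "i = j")
  case False
  have lim: "(\<lambda>n. partial_derivs [k, l] v (x(l := a n, k := b n))) \<longlonglongrightarrow> partial_derivs [k, l] v x"
    if "continuous_on (Rn I) (partial_derivs [k, l] v)" "k \<in> I" "l \<in> I"
      "\<And>n. x l < a n \<and> a n < x l + inverse (real (Suc n))"
      "\<And>n. x k < b n \<and> b n < x k + inverse (real (Suc n))" for a b k l
  proof -
    have 0: "(\<lambda>n. z + inverse (real (Suc n))) \<longlonglongrightarrow> z" for z :: real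
      using tendsto_add[OF tendsto_const[of z] LIMSEQ_inverse_real_of_nat] by simp
    have al: "a \<longlonglongrightarrow> x l"
      by (rule tendsto_sandwich[OF _ _ tendsto_const 0]) (use that(4) in \<open>auto simp: less_imp_le\<close>)
    have bl: "b \<longlonglongrightarrow> x k"
      by (rule tendsto_sandwich[OF _ _ tendsto_const 0]) (use that(5) in \<open>auto simp: less_imp_le\<close>)
    have "(\<lambda>n. x(l := a n, k := b n)) \<longlonglongrightarrow> x"
      proof (rule tendsto_coordinatewise)
      fix i show "(\<lambda>n. (x(l := a n, k := b n)) i) \<longlonglongrightarrow> x i"
        using al bl by (cases "i = k"; cases "i = l") auto
    qed
    moreover have "\<forall>n. x(l := a n, k := b n) \<in> Rn I" using Rn_upd[OF Rn_upd[OF x that(3)] that(2)] by blast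
    ultimately show ?thesis
      using x by (intro continuous_on_tendsto_compose[OF that(1)]) auto
  qed
  have pos: "0 < inverse (real (Suc n))" for n by simp
  have "\<forall>n. \<exists>a b. x i < a \<and> a < x i + inverse (real (Suc n)) \<and> x j < b \<and> b < x j + inverse (real (Suc n)) \<and>
    v (x(i := x i + inverse (real (Suc n)), j := x j + inverse (real (Suc n)))) - v (x(i := x i + inverse (real (Suc n)))) - v (x(j := x j + inverse (real (Suc n)))) + v x
      = inverse (real (Suc n)) * inverse (real (Suc n)) * partial_derivs [j, i] v (x(i := a, j := b))"
    using second_difference_mean_value[OF I v x ij False pos] by blast
  then obtain a b where ab: "\<And>n. x i < a n \<and> a n < x i + inverse (real (Suc n)) \<and> x j < b n \<and> b n < x j + inverse (real (Suc n)) \<and>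
    v (x(i := x i + inverse (real (Suc n)), j := x j + inverse (real (Suc n)))) - v (x(i := x i + inverse (real (Suc n)))) - v (x(j := x j + inverse (real (Suc n)))) + v x
      = inverse (real (Suc n)) * inverse (real (Suc n)) * partial_derivs [j, i] v (x(i := a n, j := b n))" by metis
  have "\<forall>n. \<exists>a b. x j < a \<and> a < x j + inverse (real (Suc n)) \<and> x i < b \<and> b < x i + inverse (real (Suc n)) \<and>
    v (x(j := x j + inverse (real (Suc n)), i := x i + inverse (real (Suc n)))) - v (x(j := x j + inverse (real (Suc n)))) - v (x(i := x i + inverse (real (Suc n)))) + v x
      = inverse (real (Suc n)) * inverse (real (Suc n)) * partial_derivs [i, j] v (x(j := a, i := b))"
    using second_difference_mean_value[OF I v x ij(2,1) False[symmetric] pos] by blast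
  then obtain a' b' where ab': "\<And>n. x j < a' n \<and> a' n < x j + inverse (real (Suc n)) \<and> x i < b' n \<and> b' n < x i + inverse (real (Suc n)) \<and>
    v (x(j := x j + inverse (real (Suc n)), i := x i + inverse (real (Suc n)))) - v (x(j := x j + inverse (real (Suc n)))) - v (x(i := x i + inverse (real (Suc n)))) + v x
      = inverse (real (Suc n)) * inverse (real (Suc n)) * partial_derivs [i, j] v (x(j := a' n, i := b' n))" by metis
  have eq: "partial_derivs [j, i] v (x(i := a n, j := b n)) = partial_derivs [i, j] v (x(j := a' n, i := b' n))" for n
  proof -
    have sw: "x(j := x j + inverse (real (Suc n)), i := x i + inverse (real (Suc n))) = x(i := x i + inverse (real (Suc n)), j := x j + inverse (real (Suc n)))"
      using False by auto
    have "inverse (real (Suc n)) * inverse (real (Suc n)) * partial_derivs [j, i] v (x(i := a n, j := b n))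
      = inverse (real (Suc n)) * inverse (real (Suc n)) * partial_derivs [i, j] v (x(j := a' n, i := b' n))"
      using ab[of n, THEN conjunct2, THEN conjunct2, THEN conjunct2, THEN conjunct2]
        ab'[of n, THEN conjunct2, THEN conjunct2, THEN conjunct2, THEN conjunct2, unfolded sw] by argo
    then show ?thesis by (simp del: of_nat_Suc partial_derivs.simps)
  qed
  have "(\<lambda>n. partial_derivs [j, i] v (x(i := a n, j := b n))) \<longlonglongrightarrow> partial_derivs [j, i] v x"
    using ab by (intro lim[OF c(2) ij(2,1)]) auto
  moreover have "(\<lambda>n. partial_derivs [j, i] v (x(i := a n, j := b n))) \<longlonglongrightarrow> partial_derivs [i, j] v x"
    unfolding eq using ab' by (intro lim[OF c(1) ij]) auto
  ultimately show ?thesis by (metis LIMSEQ_unique)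
qed simp

section \<open>Averages over random signs\<close>

text \<open>Only finitely many random vectors are ever used, so finite averages take the place of expectations.\<close>

definition avg :: "'a set \<Rightarrow> ('a \<Rightarrow> real) \<Rightarrow> real" where
  "avg A f = (\<Sum>a\<in>A. f a) / real (card A)"

lemma avg_add: "avg A (\<lambda>a. f a + g a) = avg A f + avg A g"
  by (simp add: avg_def sum.distrib add_divide_distrib)

lemma avg_diff: "avg A (\<lambda>a. f a - g a) = avg A f - avg A g"
  by (simp add: avg_def sum_subtractf diff_divide_distrib)

lemma avg_cmult: "avg A (\<lambda>a. c * f a) = c * avg A f"
  by (simp add: avg_def sum_distrib_left)

lemma avg_multc: "avg A (\<lambda>a. f a * c) = avg A f * c"
  by (simp add: avg_def sum_distrib_right)

lemma avg_sum: "avg A (\<lambda>a. \<Sum>b\<in>B. f a b) = (\<Sum>b\<in>B. avg A (\<lambda>a. f a b))"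
  unfolding avg_def by (subst sum.swap) (simp add: sum_divide_distrib)

lemma avg_const: "finite A \<Longrightarrow> A \<noteq> {} \<Longrightarrow> avg A (\<lambda>_. c) = c"
  by (simp add: avg_def)

lemma avg_mono: "(\<And>a. a \<in> A \<Longrightarrow> f a \<le> g a) \<Longrightarrow> avg A f \<le> avg A g"
  unfolding avg_def by (intro divide_right_mono sum_mono) auto

lemma avg_abs: "\<bar>avg A f\<bar> \<le> avg A (\<lambda>a. \<bar>f a\<bar>)"
  unfolding avg_def by (simp add: abs_divide divide_right_mono)

lemma avg_cong: "(\<And>a. a \<in> A \<Longrightarrow> f a = g a) \<Longrightarrow> avg A f = avg A g"
  unfolding avg_def by simp

lemma avg_nonneg: "(\<And>a. a \<in> A \<Longrightarrow> 0 \<le> f a) \<Longrightarrow> 0 \<le> avg A f"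
  unfolding avg_def by (simp add: sum_nonneg)

text \<open>Random signs replace the Brownian increments. A weak error analysis uses the first two moments of the increments and a bound on the third, and these agree or are of the same order. In exchange, all averages are finite and all steps bounded.\<close>

definition signs :: "nat \<Rightarrow> (nat \<Rightarrow> real) set" where
  "signs d = PiE {..<d} (\<lambda>_. {-1, 1})"

lemma signs_finite [simp]: "finite (signs d)"
  by (auto simp: signs_def intro: finite_PiE)

lemma signs_nonempty [simp]: "signs d \<noteq> {}"
  by (auto simp: signs_def PiE_eq_empty_iff)

lemma signs_square: "\<xi> \<in> signs d \<Longrightarrow> l < d \<Longrightarrow> \<xi> l * \<xi> l = 1"
  by (auto simp: signs_def PiE_def Pi_def)

lemma signs_abs: "\<xi> \<in> signs d \<Longrightarrow> l < d \<Longrightarrow> \<bar>\<xi> l\<bar> = 1"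
  by (auto simp: signs_def PiE_def Pi_def)

lemma signs_flip: "\<xi> \<in> signs d \<Longrightarrow> l < d \<Longrightarrow> \<xi>(l := - \<xi> l) \<in> signs d"
  by (auto simp: signs_def PiE_def Pi_def extensional_def)

text \<open>Flipping one sign is an involution of the sample space; odd moments vanish by this symmetry.\<close>

lemma avg_signs_flip:
  assumes "l < d"
  shows "avg (signs d) (\<lambda>\<xi>. f (\<xi>(l := - \<xi> l))) = avg (signs d) f"
  unfolding avg_def using assms
  by (intro arg_cong[of _ _ "\<lambda>t. t / _"]
        sum.reindex_bij_witness[of _ "\<lambda>\<xi>. \<xi>(l := - \<xi> l)" "\<lambda>\<xi>. \<xi>(l := - \<xi> l)"]) (auto simp: signs_flip)

lemma avg_signs_single: "l < d \<Longrightarrow> avg (signs d) (\<lambda>\<xi>. \<xi> l) = 0"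
  using avg_signs_flip[of l d "\<lambda>\<xi>. \<xi> l"] avg_cmult[of "signs d" "-1" "\<lambda>\<xi>. \<xi> l"] by simp

lemma avg_signs_pair:
  assumes "l < d" "k < d"
  shows "avg (signs d) (\<lambda>\<xi>. \<xi> l * \<xi> k) = (if l = k then 1 else 0)"
proof (cases "l = k")
  case True
  have "avg (signs d) (\<lambda>\<xi>. \<xi> l * \<xi> k) = avg (signs d) (\<lambda>\<xi>. 1)"
    using True assms by (intro avg_cong) (simp add: signs_square)
  then show ?thesis using True by (simp add: avg_const)
next
  case False
  then show ?thesis
    using avg_signs_flip[OF assms(1), of "\<lambda>\<xi>. \<xi> l * \<xi> k"] avg_cmult[of "signs d" "-1" "\<lambda>\<xi>. \<xi> l * \<xi> k"] by simp
qed

lemma avg_signs_affine: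
  "avg (signs d) (\<lambda>\<xi>. a + (\<Sum>l<d. s l * \<xi> l)) = a"
  by (simp add: avg_add avg_const avg_sum avg_cmult avg_signs_single)

lemma avg_signs_product:
  "avg (signs d) (\<lambda>\<xi>. (a + (\<Sum>l<d. s l * \<xi> l)) * (a' + (\<Sum>l<d. s' l * \<xi> l))) = a * a' + (\<Sum>l<d. s l * s' l)"
proof -
  have "(\<lambda>\<xi>. (a + (\<Sum>l<d. s l * \<xi> l)) * (a' + (\<Sum>l<d. s' l * \<xi> l))) =
    (\<lambda>\<xi>. (a * a' + (\<Sum>l<d. (a * s' l + a' * s l) * \<xi> l)) + (\<Sum>l<d. \<Sum>k<d. (s l * s' k) * (\<xi> l * \<xi> k)))"
  proof
    fix \<xi> :: "nat \<Rightarrow> real"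
    have "(\<Sum>l<d. s l * \<xi> l) * (\<Sum>l<d. s' l * \<xi> l) = (\<Sum>l<d. \<Sum>k<d. (s l * s' k) * (\<xi> l * \<xi> k))"
      by (simp add: sum_product algebra_simps)
    moreover have "a * (\<Sum>l<d. s' l * \<xi> l) + a' * (\<Sum>l<d. s l * \<xi> l) = (\<Sum>l<d. (a * s' l + a' * s l) * \<xi> l)"
      by (simp add: algebra_simps sum_distrib_left sum.distrib)
    ultimately show "(a + (\<Sum>l<d. s l * \<xi> l)) * (a' + (\<Sum>l<d. s' l * \<xi> l)) =
      (a * a' + (\<Sum>l<d. (a * s' l + a' * s l) * \<xi> l)) + (\<Sum>l<d. \<Sum>k<d. (s l * s' k) * (\<xi> l * \<xi> k))"
      by (simp add: algebra_simps)
  qed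
  then have "avg (signs d) (\<lambda>\<xi>. (a + (\<Sum>l<d. s l * \<xi> l)) * (a' + (\<Sum>l<d. s' l * \<xi> l))) =
    a * a' + (\<Sum>l<d. \<Sum>k<d. (s l * s' k) * (if l = k then 1 else 0))"
    by (simp only: avg_add[of _ "\<lambda>\<xi>. a * a' + (\<Sum>l<d. (a * s' l + a' * s l) * \<xi> l)"] avg_signs_affine avg_sum avg_cmult)
      (simp add: avg_signs_pair)
  then show ?thesis by (simp add: if_distrib[of "\<lambda>x. _ * x"] cong: if_cong)
qed

section \<open>Moments of one random step\<close>

lemma power_one_plus_le:
  fixes x :: real
  assumes "\<bar>x\<bar> \<le> 1"
  shows "(1 + x) ^ q \<le> 1 + real q * x + 3 ^ q * x\<^sup>2"
proof (induction q)
  case (Suc q)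
  have q: "real q \<le> 3 ^ q" for q
  proof (induction q)
    case (Suc q)
    have "(1::real) \<le> 3 ^ q" by simp
    then show ?case using Suc unfolding power_Suc of_nat_Suc by linarith
  qed simp
  have "(1 + x) ^ Suc q \<le> (1 + x) * (1 + real q * x + 3 ^ q * x\<^sup>2)"
    using Suc assms by (simp add: mult_left_mono)
  also have "\<dots> = 1 + real (Suc q) * x + (real q + 3 ^ q + 3 ^ q * x) * x\<^sup>2"
    by (simp add: algebra_simps power2_eq_square)
  also have "\<dots> \<le> 1 + real (Suc q) * x + 3 ^ Suc q * x\<^sup>2"
  proof -
    have "3 ^ q * x \<le> 3 ^ q * 1" using assms by (intro mult_left_mono) auto
    then have "real q + 3 ^ q + 3 ^ q * x \<le> 3 ^ Suc q" using q[of q] unfolding power_Suc by linarith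
    then show ?thesis by (intro add_left_mono mult_right_mono) auto
  qed
  finally show ?case .
qed simp

text \<open>The step \<open>z \<mapsto> z + h b + \<surd>h S \<xi>\<close> changes \<open>1 + \<parallel>z\<parallel>\<^sup>2\<close> by a factor \<open>1 + X\<close>. The noise is bounded, so
  \<open>\<bar>X\<bar> \<le> 1\<close> once \<open>h d\<close> is small, and then only the first two moments of \<open>X\<close> enter. These
  are of order \<open>c h\<close> without any power of the dimension, which is what keeps the growth over all steps
  at \<open>e\<^bsup>\<kappa> c\<^esup>\<close>.\<close>

locale random_step =
  fixes J :: "'j set" and d :: nat and c h :: real and z b :: "'j \<Rightarrow> real" and S :: "'j \<Rightarrow> nat \<Rightarrow> real"
  assumes J: "finite J" and d: "d \<ge> 1" and c: "c \<ge> 0" and h: "h \<ge> 0" and hd: "64 * h * real d * (c + 1)\<^sup>2 \<le> 1"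
    and b: "(\<Sum>j\<in>J. (b j)\<^sup>2) \<le> 2 * c\<^sup>2 * (1 + (\<Sum>j\<in>J. (z j)\<^sup>2))"
    and S: "(\<Sum>j\<in>J. \<Sum>l<d. (S j l)\<^sup>2) \<le> 2 * c * (1 + (\<Sum>j\<in>J. (z j)\<^sup>2))"
begin

definition Q where "Q = 1 + (\<Sum>j\<in>J. (z j)\<^sup>2)"
definition step where "step \<xi> j = h * b j + sqrt h * (\<Sum>l<d. S j l * \<xi> l)"

lemma Q1: "Q \<ge> 1" by (simp add: Q_def sum_nonneg)

lemma hdc: "h * real d * c \<le> 1 / 64" "h * c \<le> 1 / 64" "(h * c)\<^sup>2 \<le> h * c / 64"
proof -
  have c1: "c \<le> (c + 1)\<^sup>2" using c by (simp add: power2_eq_square algebra_simps)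
  have "h * real d * c \<le> h * real d * (c + 1)\<^sup>2"
    using c1 h by (intro mult_left_mono) auto
  then show 1: "h * real d * c \<le> 1 / 64" using hd by simp
  have "h * c * 1 \<le> h * c * real d" using c h d by (intro mult_left_mono) auto
  then show 2: "h * c \<le> 1 / 64" using 1 by (simp add: algebra_simps)
  show "(h * c)\<^sup>2 \<le> h * c / 64"
    using mult_left_mono[OF 2, of "h * c"] c h by (simp add: power2_eq_square)
qed

lemma step_affine: "step \<xi> j = h * b j + (\<Sum>l<d. (sqrt h * S j l) * \<xi> l)"
  by (simp add: step_def sum_distrib_left mult.assoc)

text \<open>Cauchy-Schwarz over the signs costs a factor \<open>d\<close>. It is compensated by the condition on \<open>h d (c + 1)\<^sup>2\<close> and does not enter the averages below.\<close>

lemma step_square: assumes "\<xi> \<in> signs d" shows "(\<Sum>j\<in>J. (step \<xi> j)\<^sup>2) \<le> Q / 9"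
proof -
  have "(step \<xi> j)\<^sup>2 \<le> 2 * (h\<^sup>2 * (b j)\<^sup>2) + 2 * h * real d * (\<Sum>l<d. (S j l)\<^sup>2)" for j
  proof -
    have "(\<Sum>l<d. S j l * \<xi> l)\<^sup>2 \<le> (\<Sum>l<d. (S j l)\<^sup>2) * (\<Sum>l<d. (\<xi> l)\<^sup>2)"
      by (rule Cauchy_Schwarz_ineq_sum)
    also have "(\<Sum>l<d. (\<xi> l)\<^sup>2) = real d"
      using assms by (simp add: power2_eq_square signs_square)
    finally have 1: "(\<Sum>l<d. S j l * \<xi> l)\<^sup>2 \<le> real d * (\<Sum>l<d. (S j l)\<^sup>2)" by (simp add: mult.commute)
    have "(step \<xi> j)\<^sup>2 \<le> 2 * (h * b j)\<^sup>2 + 2 * (sqrt h * (\<Sum>l<d. S j l * \<xi> l))\<^sup>2"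
      unfolding step_def using sum_squares_bound[of "h * b j" "sqrt h * (\<Sum>l<d. S j l * \<xi> l)"]
      by (simp add: power2_sum)
    also have "\<dots> = 2 * (h\<^sup>2 * (b j)\<^sup>2) + 2 * h * (\<Sum>l<d. S j l * \<xi> l)\<^sup>2"
      using h by (simp add: power_mult_distrib)
    also have "\<dots> \<le> 2 * (h\<^sup>2 * (b j)\<^sup>2) + 2 * h * (real d * (\<Sum>l<d. (S j l)\<^sup>2))"
      using 1 h by (intro add_left_mono mult_left_mono) auto
    finally show ?thesis by (simp add: mult.assoc)
  qed
  then have "(\<Sum>j\<in>J. (step \<xi> j)\<^sup>2) \<le> (\<Sum>j\<in>J. 2 * (h\<^sup>2 * (b j)\<^sup>2) + 2 * h * real d * (\<Sum>l<d. (S j l)\<^sup>2))"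
    by (rule sum_mono)
  also have "\<dots> = 2 * h\<^sup>2 * (\<Sum>j\<in>J. (b j)\<^sup>2) + 2 * h * real d * (\<Sum>j\<in>J. \<Sum>l<d. (S j l)\<^sup>2)"
    by (simp add: sum.distrib sum_distrib_left mult.assoc)
  also have "\<dots> \<le> 2 * h\<^sup>2 * (2 * c\<^sup>2 * Q) + 2 * h * real d * (2 * c * Q)"
    using b S h unfolding Q_def by (intro add_mono mult_left_mono) auto
  also have "\<dots> = (4 * (h * c)\<^sup>2 + 4 * (h * real d * c)) * Q"
    by (simp add: algebra_simps power2_eq_square)
  also have "\<dots> \<le> (1 / 9) * Q"
    using hdc Q1 by (intro mult_right_mono) auto
  finally show ?thesis by simp
qed

lemma Q_step: "1 + (\<Sum>j\<in>J. (z j + step \<xi> j)\<^sup>2) = Q + (2 * (\<Sum>j\<in>J. z j * step \<xi> j) + (\<Sum>j\<in>J. (step \<xi> j)\<^sup>2))"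
  unfolding Q_def by (simp add: power2_sum sum.distrib sum_distrib_left algebra_simps)

lemma increment_le: assumes "\<xi> \<in> signs d"
  shows "\<bar>2 * (\<Sum>j\<in>J. z j * step \<xi> j) + (\<Sum>j\<in>J. (step \<xi> j)\<^sup>2)\<bar> \<le> Q"
proof -
  have "\<bar>2 * (\<Sum>j\<in>J. z j * step \<xi> j)\<bar> \<le> (\<Sum>j\<in>J. \<bar>2 * (z j * step \<xi> j)\<bar>)"
    unfolding sum_distrib_left by (rule sum_abs)
  also have "\<dots> \<le> (\<Sum>j\<in>J. (z j)\<^sup>2 / 3 + 3 * (step \<xi> j)\<^sup>2)"
  proof (rule sum_mono)
    fix j
    have "0 \<le> (z j - 3 * step \<xi> j)\<^sup>2 / 3" "0 \<le> (z j + 3 * step \<xi> j)\<^sup>2 / 3" by auto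
    then show "\<bar>2 * (z j * step \<xi> j)\<bar> \<le> (z j)\<^sup>2 / 3 + 3 * (step \<xi> j)\<^sup>2"
      by (simp add: power2_eq_square algebra_simps abs_le_iff)
  qed
  also have "\<dots> = (Q - 1) / 3 + 3 * (\<Sum>j\<in>J. (step \<xi> j)\<^sup>2)"
    by (simp add: Q_def sum.distrib sum_divide_distrib sum_distrib_left)
  finally have "\<bar>2 * (\<Sum>j\<in>J. z j * step \<xi> j)\<bar> \<le> (Q - 1) / 3 + 3 * (\<Sum>j\<in>J. (step \<xi> j)\<^sup>2)" .
  moreover have "\<bar>x\<bar> \<le> (Q - 1) / 3 + 3 * y \<Longrightarrow> y \<le> Q / 9 \<Longrightarrow> 0 \<le> y \<Longrightarrow> \<bar>x + y\<bar> \<le> Q" for x y :: real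
  proof -
    assume a: "\<bar>x\<bar> \<le> (Q - 1) / 3 + 3 * y" "y \<le> Q / 9" "0 \<le> y"
    have "x \<le> (Q - 1) / 3 + 3 * y" "- x \<le> (Q - 1) / 3 + 3 * y" using a(1) by auto
    then have "x + y \<le> Q" "- (x + y) \<le> Q" using a(2,3) Q1 by (simp_all add: field_simps)
    then show "\<bar>x + y\<bar> \<le> Q" by simp
  qed
  ultimately show ?thesis using step_square[OF assms] sum_nonneg[of J "\<lambda>j. (step \<xi> j)\<^sup>2", OF zero_le_power2] by blast
qed

lemma avg_step_square: "avg (signs d) (\<lambda>\<xi>. \<Sum>j\<in>J. (step \<xi> j)\<^sup>2) \<le> 4 * (h * c) * Q"
proof -
  have "avg (signs d) (\<lambda>\<xi>. \<Sum>j\<in>J. (step \<xi> j)\<^sup>2) = (\<Sum>j\<in>J. h\<^sup>2 * (b j)\<^sup>2 + h * (\<Sum>l<d. (S j l)\<^sup>2))"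
  proof -
    have "sqrt h * y * (sqrt h * y) = h * y\<^sup>2" for y
      using h power_mult_distrib[of "sqrt h" y 2] by (simp add: power2_eq_square)
    then have "(\<Sum>l<d. sqrt h * S j l * (sqrt h * S j l)) = h * (\<Sum>l<d. (S j l)\<^sup>2)" for j
      by (simp add: sum_distrib_left)
    then show ?thesis
      unfolding avg_sum power2_eq_square step_affine avg_signs_product
      by (simp add: power2_eq_square algebra_simps)
  qed
  also have "\<dots> = h\<^sup>2 * (\<Sum>j\<in>J. (b j)\<^sup>2) + h * (\<Sum>j\<in>J. \<Sum>l<d. (S j l)\<^sup>2)"
    by (simp add: sum.distrib sum_distrib_left)
  also have "\<dots> \<le> h\<^sup>2 * (2 * c\<^sup>2 * Q) + h * (2 * c * Q)"
    using b S h unfolding Q_def by (intro add_mono mult_left_mono) auto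
  also have "\<dots> = (2 * (h * c)\<^sup>2 + 2 * (h * c)) * Q"
    by (simp add: algebra_simps power2_eq_square)
  also have "\<dots> \<le> (4 * (h * c)) * Q"
    using hdc mult_nonneg_nonneg[OF h c] Q1 by (intro mult_right_mono) linarith+
  finally show ?thesis by simp
qed

lemma drift_le: "\<bar>\<Sum>j\<in>J. z j * b j\<bar> \<le> 2 * c * Q"
proof -
  have "(\<Sum>j\<in>J. z j * b j)\<^sup>2 \<le> (\<Sum>j\<in>J. (z j)\<^sup>2) * (\<Sum>j\<in>J. (b j)\<^sup>2)"
    by (rule Cauchy_Schwarz_ineq_sum)
  also have "\<dots> \<le> Q * (2 * c\<^sup>2 * Q)"
    using b Q1 unfolding Q_def by (intro mult_mono) (auto intro!: sum_nonneg)
  also have "\<dots> \<le> (2 * c * Q)\<^sup>2" using c Q1 by (simp add: power2_eq_square algebra_simps)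
  finally show ?thesis using c Q1 by (simp add: abs_le_square_iff[symmetric])
qed

lemma avg_inner: "avg (signs d) (\<lambda>\<xi>. \<Sum>j\<in>J. z j * step \<xi> j) = h * (\<Sum>j\<in>J. z j * b j)"
  unfolding avg_sum step_affine avg_cmult avg_signs_affine by (simp add: sum_distrib_left algebra_simps)

lemma avg_inner_square: "avg (signs d) (\<lambda>\<xi>. (\<Sum>j\<in>J. z j * step \<xi> j)\<^sup>2) \<le> 6 * (h * c) * Q\<^sup>2"
proof -
  have e: "(\<Sum>j\<in>J. z j * step \<xi> j) = h * (\<Sum>j\<in>J. z j * b j) + (\<Sum>l<d. (sqrt h * (\<Sum>j\<in>J. z j * S j l)) * \<xi> l)" for \<xi>
    unfolding step_def
    by (simp add: algebra_simps sum.distrib sum_distrib_left sum_distrib_right sum.swap[of _ J "{..<d}"])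
  have "avg (signs d) (\<lambda>\<xi>. (\<Sum>j\<in>J. z j * step \<xi> j)\<^sup>2) =
      h\<^sup>2 * (\<Sum>j\<in>J. z j * b j)\<^sup>2 + h * (\<Sum>l<d. (\<Sum>j\<in>J. z j * S j l)\<^sup>2)"
  proof -
    have "(\<Sum>l<d. sqrt h * (\<Sum>j\<in>J. z j * S j l) * (sqrt h * (\<Sum>j\<in>J. z j * S j l))) = h * (\<Sum>l<d. (\<Sum>j\<in>J. z j * S j l)\<^sup>2)"
    proof -
      have "sqrt h * y * (sqrt h * y) = h * y\<^sup>2" for y
        using h power_mult_distrib[of "sqrt h" y 2] by (simp add: power2_eq_square)
      then show ?thesis by (simp add: sum_distrib_left[of h])
    qed
    then show ?thesis
      unfolding e power2_eq_square avg_signs_product by (simp add: power2_eq_square algebra_simps)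
  qed
  also have "\<dots> \<le> h\<^sup>2 * (2 * c * Q)\<^sup>2 + h * (Q * (2 * c * Q))"
  proof (intro add_mono mult_left_mono)
    show "(\<Sum>j\<in>J. z j * b j)\<^sup>2 \<le> (2 * c * Q)\<^sup>2"
      using drift_le c Q1 by (simp add: abs_le_square_iff[symmetric])
    have "(\<Sum>l<d. (\<Sum>j\<in>J. z j * S j l)\<^sup>2) \<le> (\<Sum>l<d. (\<Sum>j\<in>J. (z j)\<^sup>2) * (\<Sum>j\<in>J. (S j l)\<^sup>2))"
      by (intro sum_mono Cauchy_Schwarz_ineq_sum)
    also have "\<dots> = (\<Sum>j\<in>J. (z j)\<^sup>2) * (\<Sum>j\<in>J. \<Sum>l<d. (S j l)\<^sup>2)"
      by (simp add: sum_distrib_left[symmetric] sum.swap[of _ J "{..<d}"])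
    also have "\<dots> \<le> Q * (2 * c * Q)"
      using S Q1 unfolding Q_def by (intro mult_mono) (auto intro!: sum_nonneg)
    finally show "(\<Sum>l<d. (\<Sum>j\<in>J. z j * S j l)\<^sup>2) \<le> Q * (2 * c * Q)" .
  qed (use h in auto)
  also have "\<dots> = (4 * (h * c)\<^sup>2 + 2 * (h * c)) * Q\<^sup>2"
    by (simp add: algebra_simps power2_eq_square)
  also have "\<dots> \<le> (6 * (h * c)) * Q\<^sup>2"
    using hdc mult_nonneg_nonneg[OF h c] by (intro mult_right_mono) (linarith | simp)+
  finally show ?thesis by simp
qed

lemma avg_moment:
  "avg (signs d) (\<lambda>\<xi>. (1 + (\<Sum>j\<in>J. (z j + step \<xi> j)\<^sup>2)) ^ q) \<le> (1 + (8 * real q + 56 * 3 ^ q) * c * h) * Q ^ q"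
proof -
  define P where "P \<xi> = 2 * (\<Sum>j\<in>J. z j * step \<xi> j)" for \<xi>
  define R where "R \<xi> = (\<Sum>j\<in>J. (step \<xi> j)\<^sup>2)" for \<xi>
  have Q0: "Q > 0" using Q1 by simp
  have "(1 + (\<Sum>j\<in>J. (z j + step \<xi> j)\<^sup>2)) ^ q \<le>
     Q ^ q * (1 + real q / Q * P \<xi> + real q / Q * R \<xi> + 2 * 3 ^ q / Q\<^sup>2 * (P \<xi>)\<^sup>2 + 2 * 3 ^ q / Q * R \<xi>)"
    if "\<xi> \<in> signs d" for \<xi>
  proof -
    have R: "0 \<le> R \<xi>" "R \<xi> \<le> Q" using step_square[OF that] Q1 by (auto simp: R_def sum_nonneg)
    have "1 + (\<Sum>j\<in>J. (z j + step \<xi> j)\<^sup>2) = Q * (1 + (P \<xi> + R \<xi>) / Q)"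
      using Q0 by (simp add: Q_step P_def R_def field_simps)
    then have "(1 + (\<Sum>j\<in>J. (z j + step \<xi> j)\<^sup>2)) ^ q = Q ^ q * (1 + (P \<xi> + R \<xi>) / Q) ^ q"
      by (simp add: power_mult_distrib)
    also have "\<dots> \<le> Q ^ q * (1 + real q * ((P \<xi> + R \<xi>) / Q) + 3 ^ q * ((P \<xi> + R \<xi>) / Q)\<^sup>2)"
      using increment_le[OF that] Q0 by (intro mult_left_mono power_one_plus_le) (auto simp: P_def R_def)
    also have "\<dots> \<le> Q ^ q * (1 + real q * ((P \<xi> + R \<xi>) / Q) + 3 ^ q * (2 / Q\<^sup>2 * (P \<xi>)\<^sup>2 + 2 / Q * R \<xi>))"
    proof (intro mult_left_mono add_left_mono)
      have "(P \<xi> + R \<xi>)\<^sup>2 \<le> 2 * (P \<xi>)\<^sup>2 + 2 * (R \<xi>)\<^sup>2"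
        using sum_squares_bound[of "P \<xi>" "R \<xi>"] by (simp add: power2_sum)
      also have "(R \<xi>)\<^sup>2 \<le> Q * R \<xi>" using R by (simp add: power2_eq_square mult_right_mono)
      finally have "(P \<xi> + R \<xi>)\<^sup>2 / Q\<^sup>2 \<le> (2 * (P \<xi>)\<^sup>2 + 2 * (Q * R \<xi>)) / Q\<^sup>2"
        by (simp add: divide_right_mono)
      then show "((P \<xi> + R \<xi>) / Q)\<^sup>2 \<le> 2 / Q\<^sup>2 * (P \<xi>)\<^sup>2 + 2 / Q * R \<xi>"
        using Q0 by (simp add: power_divide power2_eq_square field_simps)
    qed (use Q0 in auto)
    also have "\<dots> = Q ^ q * (1 + real q / Q * P \<xi> + real q / Q * R \<xi> + 2 * 3 ^ q / Q\<^sup>2 * (P \<xi>)\<^sup>2 + 2 * 3 ^ q / Q * R \<xi>)"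
      by (simp add: add_divide_distrib algebra_simps)
    finally show ?thesis .
  qed
  then have "avg (signs d) (\<lambda>\<xi>. (1 + (\<Sum>j\<in>J. (z j + step \<xi> j)\<^sup>2)) ^ q) \<le>
     avg (signs d) (\<lambda>\<xi>. Q ^ q * (1 + real q / Q * P \<xi> + real q / Q * R \<xi> + 2 * 3 ^ q / Q\<^sup>2 * (P \<xi>)\<^sup>2 + 2 * 3 ^ q / Q * R \<xi>))"
    by (rule avg_mono)
  also have "\<dots> = Q ^ q * (1 + real q / Q * avg (signs d) P + real q / Q * avg (signs d) R
      + 2 * 3 ^ q / Q\<^sup>2 * avg (signs d) (\<lambda>\<xi>. (P \<xi>)\<^sup>2) + 2 * 3 ^ q / Q * avg (signs d) R)"
    by (simp only: avg_cmult avg_add) (simp add: avg_const)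
  also have "\<dots> \<le> Q ^ q * (1 + real q / Q * (4 * (h * c) * Q) + real q / Q * (4 * (h * c) * Q)
      + 2 * 3 ^ q / Q\<^sup>2 * (24 * (h * c) * Q\<^sup>2) + 2 * 3 ^ q / Q * (4 * (h * c) * Q))"
  proof (intro mult_left_mono add_mono order_refl)
    have "2 * h * (\<Sum>j\<in>J. z j * b j) \<le> 2 * h * (2 * c * Q)"
      using drift_le h by (intro mult_left_mono) auto
    then show "avg (signs d) P \<le> 4 * (h * c) * Q"
      unfolding P_def avg_cmult avg_inner by (simp add: algebra_simps)
    show "avg (signs d) R \<le> 4 * (h * c) * Q" "avg (signs d) R \<le> 4 * (h * c) * Q"
      unfolding R_def by (rule avg_step_square)+
    show "avg (signs d) (\<lambda>\<xi>. (P \<xi>)\<^sup>2) \<le> 24 * (h * c) * Q\<^sup>2"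
      unfolding P_def power_mult_distrib avg_cmult using avg_inner_square by (simp del: avg_inner_square add: algebra_simps)
  qed (use Q0 in auto)
  also have "\<dots> = (1 + (8 * real q + 56 * 3 ^ q) * c * h) * Q ^ q"
    using Q0 by (simp add: field_simps)
  finally show ?thesis .
qed

end

section \<open>Taylor expansion of a jet along a random step\<close>

text \<open>Repeated differentiation along a line produces nested sums; \<open>line_deriv I v w k js\<close> is the \<open>k\<close>-th derivative in direction \<open>w\<close> of the partial derivative of \<open>v\<close> with respect to \<open>js\<close>.\<close>

primrec line_deriv :: "'i set \<Rightarrow> (('i \<Rightarrow> real) \<Rightarrow> real) \<Rightarrow> ('i \<Rightarrow> real) \<Rightarrow> nat \<Rightarrow> 'i list \<Rightarrow> ('i \<Rightarrow> real) \<Rightarrow> real" where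
  "line_deriv I v w 0 js x = partial_derivs js v x"
| "line_deriv I v w (Suc k) js x = (\<Sum>j\<in>I. w j * line_deriv I v w k (j # js) x)"

lemma DERIV_line_deriv:
  assumes "finite I" "times_differentiable n I v" "set js \<subseteq> I" "length js + k < n"
  shows "((\<lambda>s. line_deriv I v w k js (along I x w s)) has_real_derivative
           line_deriv I v w (Suc k) js (along I x w s)) (at s)"
  using assms(3,4)
proof (induction k arbitrary: js)
  case 0
  then show ?case using DERIV_along_partial_derivs[OF assms(1,2)] by simp
next
  case (Suc k)
  show ?case unfolding line_deriv.simps(2)[of I v w "Suc k"] line_deriv.simps(2)[of I v w k js]
    by (intro DERIV_sum DERIV_cmult Suc.IH) (use Suc.prems in auto)
qed

lemma line_deriv_bound:
  assumes "\<And>js. set js \<subseteq> I \<Longrightarrow> length js = n \<Longrightarrow> \<bar>partial_derivs js v x\<bar> \<le> R"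
    and "\<And>j. j \<in> I \<Longrightarrow> \<bar>w j\<bar> \<le> \<delta>" "\<delta> \<ge> 0"
    and "set js \<subseteq> I" "length js + k = n"
  shows "\<bar>line_deriv I v w k js x\<bar> \<le> (real (card I) * \<delta>) ^ k * R"
  using assms(4,5)
proof (induction k arbitrary: js)
  case (Suc k)
  have "\<bar>line_deriv I v w (Suc k) js x\<bar> \<le> (\<Sum>j\<in>I. \<bar>w j * line_deriv I v w k (j # js) x\<bar>)"
    unfolding line_deriv.simps by (rule sum_abs)
  also have "\<dots> \<le> (\<Sum>j\<in>I. \<delta> * ((real (card I) * \<delta>) ^ k * R))"
    unfolding abs_mult using Suc.prems assms(2,3) by (intro sum_mono mult_mono Suc.IH) auto
  also have "\<dots> = (real (card I) * \<delta>) ^ Suc k * R" by simp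
  finally show ?case .
qed (use assms(1) in auto)

text \<open>The map \<open>\<theta> \<mapsto> \<eta> v(x + \<theta> w) + \<langle>y + \<theta> a, \<nabla>v(x + \<theta> w)\<rangle>\<close> is expanded to second order. For \<open>\<eta> = 1\<close>,
  \<open>y = a = 0\<close> this concerns the value of \<open>v\<close>; for \<open>\<eta> = 0\<close> and \<open>a\<close> the derivative of the displacement
  \<open>w\<close> in direction \<open>y\<close>, it concerns the derivative of \<open>x \<mapsto> v(x + w(x))\<close> in direction \<open>y\<close>. Both cases are needed, and treating them
  together avoids doing the computation twice.\<close>

lemma jet_taylor:
  fixes x w y a :: "'i \<Rightarrow> real" and \<eta> :: real
  assumes I: "finite I" "I \<noteq> {}" and v: "times_differentiable 4 I v" and x: "x \<in> Rn I"
    and R: "\<And>js \<theta>. set js \<subseteq> I \<Longrightarrow> length js \<le> 4 \<Longrightarrow> 0 \<le> \<theta> \<Longrightarrow> \<theta> \<le> 1 \<Longrightarrow> \<bar>partial_derivs js v (along I x w \<theta>)\<bar> \<le> R"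
    and w: "\<And>j. j \<in> I \<Longrightarrow> \<bar>w j\<bar> \<le> \<delta>" and a: "\<And>j. j \<in> I \<Longrightarrow> \<bar>a j\<bar> \<le> \<delta>" and y: "\<And>j. j \<in> I \<Longrightarrow> \<bar>y j\<bar> \<le> 1"
    and \<eta>: "\<bar>\<eta>\<bar> \<le> 1" and \<delta>: "\<delta> \<ge> 0"
  shows "\<bar>\<eta> * v (along I x w 1) + (\<Sum>m\<in>I. (y m + a m) * partial_deriv m v (along I x w 1))
     - (\<eta> * v x + (\<Sum>m\<in>I. y m * partial_deriv m v x))
     - (\<eta> * line_deriv I v w 1 [] x + (\<Sum>m\<in>I. a m * partial_deriv m v x + y m * line_deriv I v w 1 [m] x))
     - 1 / 2 * (\<eta> * line_deriv I v w 2 [] x + (\<Sum>m\<in>I. 2 * a m * line_deriv I v w 1 [m] x + y m * line_deriv I v w 2 [m] x))\<bar>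
     \<le> real (card I) ^ 4 * (1 + \<delta>) * \<delta> ^ 3 * R"
proof -
  define L where "L k js \<theta> = line_deriv I v w k js (along I x w \<theta>)" for k js \<theta>
  define A where "A n \<theta> = \<eta> * L n [] \<theta> + (\<Sum>m\<in>I. real n * (a m * L (n - 1) [m] \<theta>) + (y m + \<theta> * a m) * L n [m] \<theta>)" for n \<theta>
  have DL: "DERIV (L k js) \<theta> :> L (Suc k) js \<theta>" if "set js \<subseteq> I" "length js + k < 4" for k js \<theta>
    using DERIV_line_deriv[OF I(1) v that] unfolding L_def .
  have DA: "DERIV (A n) \<theta> :> A (Suc n) \<theta>" if "n < 3" for n \<theta>
  proof -
    have "DERIV (A n) \<theta> :> \<eta> * L (Suc n) [] \<theta> + (\<Sum>m\<in>I. real n * (a m * L (Suc (n - 1)) [m] \<theta>) + (a m * L n [m] \<theta> + (y m + \<theta> * a m) * L (Suc n) [m] \<theta>))"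
      unfolding A_def using that
      by (intro DERIV_add DERIV_sum DERIV_cmult DL) (auto intro!: derivative_eq_intros DL[of "[_]", THEN DERIV_cong])
    also have "(\<Sum>m\<in>I. real n * (a m * L (Suc (n - 1)) [m] \<theta>) + (a m * L n [m] \<theta> + (y m + \<theta> * a m) * L (Suc n) [m] \<theta>))
       = (\<Sum>m\<in>I. real (Suc n) * (a m * L n [m] \<theta>) + (y m + \<theta> * a m) * L (Suc n) [m] \<theta>)"
      by (rule sum.cong) (cases n; simp add: algebra_simps)+
    finally show ?thesis unfolding A_def by simp
  qed
  have "\<exists>t>0. t < 1 \<and> A 0 1 = (\<Sum>m<3. A m 0 / fact m * 1 ^ m) + A 3 t / fact 3 * 1 ^ 3"
    by (rule Maclaurin) (use DA in auto)
  then obtain t where t: "0 < t" "t < 1" "A 0 1 = A 0 0 + A 1 0 + A 2 0 / 2 + A 3 t / 6"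
    by (auto simp: eval_nat_numeral)
  have n: "real (card I) \<ge> 1" using I by (simp add: Suc_leI card_gt_0_iff)
  have Lb: "\<bar>L k js t\<bar> \<le> (real (card I) * \<delta>) ^ k * R" if "set js \<subseteq> I" "length js + k \<le> 4" for k js
    unfolding L_def using that t R w \<delta> by (intro line_deriv_bound[where n = "length js + k"]) auto
  have R0: "R \<ge> 0" using R[of "[]" 0] by force
  have "\<bar>A 3 t\<bar> \<le> \<bar>\<eta>\<bar> * \<bar>L 3 [] t\<bar> + (\<Sum>m\<in>I. 3 * (\<bar>a m\<bar> * \<bar>L 2 [m] t\<bar>) + (\<bar>y m\<bar> + t * \<bar>a m\<bar>) * \<bar>L 3 [m] t\<bar>)"
  proof -
    have "\<bar>A 3 t\<bar> \<le> \<bar>\<eta> * L 3 [] t\<bar> + (\<Sum>m\<in>I. \<bar>3 * (a m * L 2 [m] t) + (y m + t * a m) * L 3 [m] t\<bar>)"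
      unfolding A_def by (intro order_trans[OF abs_triangle_ineq] add_mono order_refl) (use sum_abs in \<open>auto\<close>)
    also have "\<dots> \<le> \<bar>\<eta>\<bar> * \<bar>L 3 [] t\<bar> + (\<Sum>m\<in>I. 3 * (\<bar>a m\<bar> * \<bar>L 2 [m] t\<bar>) + (\<bar>y m\<bar> + t * \<bar>a m\<bar>) * \<bar>L 3 [m] t\<bar>)"
    proof (intro add_mono sum_mono)
      fix m
      have "\<bar>y m + t * a m\<bar> \<le> \<bar>y m\<bar> + t * \<bar>a m\<bar>"
        using abs_triangle_ineq[of "y m" "t * a m"] t by (simp add: abs_mult)
      then have "\<bar>(y m + t * a m) * L 3 [m] t\<bar> \<le> (\<bar>y m\<bar> + t * \<bar>a m\<bar>) * \<bar>L 3 [m] t\<bar>"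
        unfolding abs_mult by (rule mult_right_mono) simp
      moreover have "\<bar>3 * (a m * L 2 [m] t)\<bar> = 3 * (\<bar>a m\<bar> * \<bar>L 2 [m] t\<bar>)" by (simp add: abs_mult)
      ultimately show "\<bar>3 * (a m * L 2 [m] t) + (y m + t * a m) * L 3 [m] t\<bar> \<le> 3 * (\<bar>a m\<bar> * \<bar>L 2 [m] t\<bar>) + (\<bar>y m\<bar> + t * \<bar>a m\<bar>) * \<bar>L 3 [m] t\<bar>"
        by linarith
    qed (simp add: abs_mult)
    finally show ?thesis .
  qed
  also have "\<dots> \<le> 1 * ((real (card I) * \<delta>) ^ 3 * R) + (\<Sum>m\<in>I. 3 * (\<delta> * ((real (card I) * \<delta>) ^ 2 * R)) + (1 + 1 * \<delta>) * ((real (card I) * \<delta>) ^ 3 * R))"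
    using t \<eta> a y \<delta> R0 by (intro add_mono sum_mono mult_mono mult_left_mono Lb) auto
  also have "\<dots> = 4 * real (card I) ^ 3 * \<delta> ^ 3 * R + real (card I) ^ 4 * (1 + \<delta>) * \<delta> ^ 3 * R"
    by (simp add: algebra_simps eval_nat_numeral)
  also have "\<dots> \<le> 4 * real (card I) ^ 4 * (1 + \<delta>) * \<delta> ^ 3 * R + real (card I) ^ 4 * (1 + \<delta>) * \<delta> ^ 3 * R"
  proof (intro add_right_mono mult_right_mono)
    have "4 * real (card I) ^ 3 * 1 \<le> 4 * real (card I) ^ 4 * (1 + \<delta>)"
      using n \<delta> by (intro mult_mono mult_left_mono power_increasing) auto
    then show "4 * real (card I) ^ 3 \<le> 4 * real (card I) ^ 4 * (1 + \<delta>)" by simp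
  qed (use \<delta> R0 in auto)
  also have "\<dots> \<le> 6 * (real (card I) ^ 4 * (1 + \<delta>) * \<delta> ^ 3 * R)" using \<delta> R0 by simp
  finally have "\<bar>A 3 t / 6\<bar> \<le> real (card I) ^ 4 * (1 + \<delta>) * \<delta> ^ 3 * R" by simp
  moreover have "A 3 t / 6 = A 0 1 - A 0 0 - A 1 0 - 1 / 2 * A 2 0" using t(3) by simp
  moreover have "A 0 1 = \<eta> * v (along I x w 1) + (\<Sum>m\<in>I. (y m + a m) * partial_deriv m v (along I x w 1))"
    by (simp add: A_def L_def)
  moreover have "A 0 0 = \<eta> * v x + (\<Sum>m\<in>I. y m * partial_deriv m v x)"
    using x by (simp add: A_def L_def)
  moreover have "A 1 0 = \<eta> * line_deriv I v w 1 [] x + (\<Sum>m\<in>I. a m * partial_deriv m v x + y m * line_deriv I v w 1 [m] x)"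
    using x by (simp add: A_def L_def del: line_deriv.simps(2))
  moreover have "A 2 0 = \<eta> * line_deriv I v w 2 [] x + (\<Sum>m\<in>I. 2 * a m * line_deriv I v w 1 [m] x + y m * line_deriv I v w 2 [m] x)"
    using x by (simp add: A_def L_def mult.assoc del: line_deriv.simps(2))
  ultimately show ?thesis by simp
qed

text \<open>The generator with drift \<open>b\<close> and diffusion \<open>S\<close>, times \<open>\<eta>\<close>, plus its derivative in direction \<open>y\<close>, where \<open>b'\<close>
  and \<open>S'\<close> stand for the derivatives of the coefficients.\<close>

definition jet_generator :: "nat \<Rightarrow> ((nat \<Rightarrow> real) \<Rightarrow> real) \<Rightarrow> real \<Rightarrow> (nat \<Rightarrow> real) \<Rightarrow> (nat \<Rightarrow> real) \<Rightarrow> (nat \<Rightarrow> real)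
    \<Rightarrow> (nat \<Rightarrow> nat \<Rightarrow> real) \<Rightarrow> (nat \<Rightarrow> nat \<Rightarrow> real) \<Rightarrow> (nat \<Rightarrow> real) \<Rightarrow> real" where
  "jet_generator d v \<eta> y b b' S S' x = \<eta> * (\<Sum>j<d. b j * partial_derivs [j] v x)
     + (\<Sum>m<d. b' m * partial_derivs [m] v x + y m * (\<Sum>j<d. b j * partial_derivs [j, m] v x))
     + 1 / 2 * (\<eta> * (\<Sum>j<d. \<Sum>k<d. (\<Sum>l<d. S j l * S k l) * partial_derivs [k, j] v x)
        + (\<Sum>m<d. 2 * (\<Sum>j<d. (\<Sum>l<d. S' m l * S j l) * partial_derivs [j, m] v x)
            + y m * (\<Sum>j<d. \<Sum>k<d. (\<Sum>l<d. S j l * S k l) * partial_derivs [k, j, m] v x)))"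

text \<open>Averaging the expansion over the signs leaves the generator, because the first and second moments of the signs are
  those of Brownian increments.\<close>

lemma avg_jet_taylor:
  fixes x y b b' :: "nat \<Rightarrow> real" and S S' :: "nat \<Rightarrow> nat \<Rightarrow> real" and \<eta> h :: real and d :: nat
  defines "w \<equiv> (\<lambda>\<xi> j. h * b j + sqrt h * (\<Sum>l<d. S j l * \<xi> l))"
  defines "a \<equiv> (\<lambda>\<xi> j. h * b' j + sqrt h * (\<Sum>l<d. S' j l * \<xi> l))"
  defines "I \<equiv> {..<d}"
  assumes d: "d \<ge> 1" and h: "0 \<le> h" and v: "times_differentiable 4 I v" and x: "x \<in> Rn I"
    and R: "\<And>js \<theta> \<xi>. set js \<subseteq> I \<Longrightarrow> length js \<le> 4 \<Longrightarrow> 0 \<le> \<theta> \<Longrightarrow> \<theta> \<le> 1 \<Longrightarrow> \<xi> \<in> signs d \<Longrightarrow>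
       \<bar>partial_derivs js v (along I x (w \<xi>) \<theta>)\<bar> \<le> R"
    and w: "\<And>j \<xi>. j \<in> I \<Longrightarrow> \<xi> \<in> signs d \<Longrightarrow> \<bar>w \<xi> j\<bar> \<le> \<delta>"
    and a: "\<And>j \<xi>. j \<in> I \<Longrightarrow> \<xi> \<in> signs d \<Longrightarrow> \<bar>a \<xi> j\<bar> \<le> \<delta>" and y: "\<And>j. j \<in> I \<Longrightarrow> \<bar>y j\<bar> \<le> 1"
    and \<eta>: "\<bar>\<eta>\<bar> \<le> 1" and \<delta>: "\<delta> \<ge> 0"
    and b: "\<And>j. j \<in> I \<Longrightarrow> \<bar>b j\<bar> \<le> \<beta>" "\<And>j. j \<in> I \<Longrightarrow> \<bar>b' j\<bar> \<le> \<beta>"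
  shows "\<bar>avg (signs d) (\<lambda>\<xi>. \<eta> * v (along I x (w \<xi>) 1) + (\<Sum>m\<in>I. (y m + a \<xi> m) * partial_deriv m v (along I x (w \<xi>) 1)))
     - (\<eta> * v x + (\<Sum>m\<in>I. y m * partial_deriv m v x))
     - h * jet_generator d v \<eta> y b b' S S' x\<bar>
     \<le> real d ^ 4 * (1 + \<delta>) * \<delta> ^ 3 * R + 2 * h\<^sup>2 * real d ^ 3 * \<beta>\<^sup>2 * R"
proof -
  have I: "finite I" "I \<noteq> {}" "card I = d" using d by (auto simp: I_def lessThan_empty_iff)
  define P where "P js = partial_derivs js v x" for js
  define U where "U \<xi> = \<eta> * v (along I x (w \<xi>) 1) + (\<Sum>m\<in>I. (y m + a \<xi> m) * partial_deriv m v (along I x (w \<xi>) 1))" for \<xi>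
  define V where "V = \<eta> * v x + (\<Sum>m\<in>I. y m * partial_deriv m v x)"
  define A1 where "A1 \<xi> = \<eta> * (\<Sum>j\<in>I. w \<xi> j * P [j]) + (\<Sum>m\<in>I. a \<xi> m * P [m] + y m * (\<Sum>j\<in>I. w \<xi> j * P [j, m]))" for \<xi>
  define A2 where "A2 \<xi> = \<eta> * (\<Sum>j\<in>I. \<Sum>k\<in>I. (w \<xi> j * w \<xi> k) * P [k, j])
     + (\<Sum>m\<in>I. 2 * (\<Sum>j\<in>I. (a \<xi> m * w \<xi> j) * P [j, m]) + y m * (\<Sum>j\<in>I. \<Sum>k\<in>I. (w \<xi> j * w \<xi> k) * P [k, j, m]))" for \<xi>
  have 1: "\<bar>U \<xi> - V - A1 \<xi> - 1 / 2 * A2 \<xi>\<bar> \<le> real d ^ 4 * (1 + \<delta>) * \<delta> ^ 3 * R" if "\<xi> \<in> signs d" for \<xi>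
  proof -
    have "A1 \<xi> = \<eta> * line_deriv I v (w \<xi>) 1 [] x + (\<Sum>m\<in>I. a \<xi> m * partial_deriv m v x + y m * line_deriv I v (w \<xi>) 1 [m] x)"
      by (simp add: A1_def P_def)
    moreover have "A2 \<xi> = \<eta> * line_deriv I v (w \<xi>) 2 [] x + (\<Sum>m\<in>I. 2 * a \<xi> m * line_deriv I v (w \<xi>) 1 [m] x + y m * line_deriv I v (w \<xi>) 2 [m] x)"
      by (simp add: A2_def P_def numeral_2_eq_2 sum_distrib_left mult.assoc)
    ultimately show ?thesis
      using jet_taylor[OF I(1,2) v x, of "w \<xi>" R \<delta> "a \<xi>" y \<eta>] R w a y \<eta> \<delta> that
      unfolding U_def V_def I(3) by auto
  qed
  define Z1 where "Z1 = \<eta> * (\<Sum>j\<in>I. b j * P [j]) + (\<Sum>m\<in>I. b' m * P [m] + y m * (\<Sum>j\<in>I. b j * P [j, m]))"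
  define Z2 where "Z2 T T' = \<eta> * (\<Sum>j\<in>I. \<Sum>k\<in>I. T j k * P [k, j])
       + (\<Sum>m\<in>I. 2 * (\<Sum>j\<in>I. T' m j * P [j, m]) + y m * (\<Sum>j\<in>I. \<Sum>k\<in>I. T j k * P [k, j, m]))" for T T' :: "nat \<Rightarrow> nat \<Rightarrow> real"
  have ss: "sqrt h * u * (sqrt h * u') = h * (u * u')" for u u'
    using h by (simp add: mult.assoc mult.left_commute[of u])
  have wa: "w \<xi> j = h * b j + (\<Sum>l<d. (sqrt h * S j l) * \<xi> l)" "a \<xi> j = h * b' j + (\<Sum>l<d. (sqrt h * S' j l) * \<xi> l)" for \<xi> j
    by (simp_all add: w_def a_def sum_distrib_left mult.assoc)
  have aw: "avg (signs d) (\<lambda>\<xi>. w \<xi> j) = h * b j" "avg (signs d) (\<lambda>\<xi>. a \<xi> j) = h * b' j" for j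
    unfolding wa avg_signs_affine by auto
  have aww: "avg (signs d) (\<lambda>\<xi>. w \<xi> j * w \<xi> k) = h\<^sup>2 * (b j * b k) + h * (\<Sum>l<d. S j l * S k l)"
       "avg (signs d) (\<lambda>\<xi>. a \<xi> j * w \<xi> k) = h\<^sup>2 * (b' j * b k) + h * (\<Sum>l<d. S' j l * S k l)" for j k
    unfolding wa avg_signs_product ss by (auto simp: power2_eq_square sum_distrib_left)
  have A1: "avg (signs d) A1 = h * Z1"
    unfolding A1_def Z1_def avg_add avg_cmult avg_sum avg_multc aw
    by (simp add: algebra_simps sum_distrib_left sum.distrib)
  have Z2: "Z2 (\<lambda>j k. h\<^sup>2 * T j k + h * U j k) (\<lambda>j k. h\<^sup>2 * T' j k + h * U' j k) = h\<^sup>2 * Z2 T T' + h * Z2 U U'" for T T' U U'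
    unfolding Z2_def by (simp add: algebra_simps sum_distrib_left sum.distrib)
  have "avg (signs d) A2 = Z2 (\<lambda>j k. h\<^sup>2 * (b j * b k) + h * (\<Sum>l<d. S j l * S k l)) (\<lambda>j k. h\<^sup>2 * (b' j * b k) + h * (\<Sum>l<d. S' j l * S k l))"
    unfolding A2_def Z2_def avg_add avg_cmult avg_sum avg_multc aww ..
  then have A2: "avg (signs d) A2 = h\<^sup>2 * Z2 (\<lambda>j k. b j * b k) (\<lambda>j k. b' j * b k)
      + h * Z2 (\<lambda>j k. \<Sum>l<d. S j l * S k l) (\<lambda>j k. \<Sum>l<d. S' j l * S k l)"
    unfolding Z2 .
  have P: "\<bar>P js\<bar> \<le> R" if "set js \<subseteq> I" "length js \<le> 4" for js
  proof -
    obtain \<xi> where "\<xi> \<in> signs d" using signs_nonempty by blast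
    from R[OF that _ _ this, of 0] show ?thesis using x by (simp add: P_def)
  qed
  have R0: "R \<ge> 0" using P[of "[]"] by force
  have "d > 0" using d by simp
  then have \<beta>0: "\<beta> \<ge> 0" using b(1)[of 0] abs_ge_zero[of "b 0"] unfolding I_def by fastforce
  have pr: "\<bar>u * u' * P js\<bar> \<le> \<beta> * \<beta> * R" if "set js \<subseteq> I" "length js \<le> 4" "\<bar>u\<bar> \<le> \<beta>" "\<bar>u'\<bar> \<le> \<beta>" for u u' js
    unfolding abs_mult using P[OF that(1,2)] that(3,4) \<beta>0 by (intro mult_mono) auto
  have sb: "\<bar>sum f I\<bar> \<le> real d * C" if "\<And>j. j \<in> I \<Longrightarrow> \<bar>f j\<bar> \<le> C" for f and C :: real
    using order_trans[OF sum_abs sum_bounded_above[of I "\<lambda>j. \<bar>f j\<bar>" C]] that I(3) by auto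
  have "\<bar>Z2 (\<lambda>j k. b j * b k) (\<lambda>j k. b' j * b k)\<bar> \<le> 1 * (real d * (real d * (\<beta> * \<beta> * R))) + real d * (2 * (real d * (\<beta> * \<beta> * R)) + 1 * (real d * (real d * (\<beta> * \<beta> * R))))"
    unfolding Z2_def
  proof (intro order_trans[OF abs_triangle_ineq] add_mono sb)
    show "\<bar>\<eta> * (\<Sum>j\<in>I. \<Sum>k\<in>I. b j * b k * P [k, j])\<bar> \<le> 1 * (real d * (real d * (\<beta> * \<beta> * R)))"
      unfolding abs_mult[of \<eta>] using \<eta> b by (intro mult_mono sb pr) auto
    fix m assume m: "m \<in> I"
    show "\<bar>2 * (\<Sum>j\<in>I. b' m * b j * P [j, m])\<bar> \<le> 2 * (real d * (\<beta> * \<beta> * R))"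
      unfolding abs_mult[of 2] using b m by (intro mult_mono sb pr) auto
    show "\<bar>y m * (\<Sum>j\<in>I. \<Sum>k\<in>I. b j * b k * P [k, j, m])\<bar> \<le> 1 * (real d * (real d * (\<beta> * \<beta> * R)))"
      unfolding abs_mult[of "y m"] using y[OF m] b m by (intro mult_mono sb pr) auto
  qed
  also have "\<dots> = (3 * real d ^ 2 + real d ^ 3) * (\<beta>\<^sup>2 * R)" by (simp add: algebra_simps eval_nat_numeral)
  also have "\<dots> \<le> (3 * real d ^ 3 + real d ^ 3) * (\<beta>\<^sup>2 * R)"
    using d R0 by (intro mult_right_mono add_right_mono mult_left_mono power_increasing) auto
  finally have Zb: "\<bar>Z2 (\<lambda>j k. b j * b k) (\<lambda>j k. b' j * b k)\<bar> \<le> 4 * real d ^ 3 * \<beta>\<^sup>2 * R" by simp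
  have "\<bar>avg (signs d) (\<lambda>\<xi>. U \<xi> - V - A1 \<xi> - 1 / 2 * A2 \<xi>)\<bar> \<le> avg (signs d) (\<lambda>\<xi>. \<bar>U \<xi> - V - A1 \<xi> - 1 / 2 * A2 \<xi>\<bar>)"
    by (rule avg_abs)
  also have "\<dots> \<le> avg (signs d) (\<lambda>\<xi>. real d ^ 4 * (1 + \<delta>) * \<delta> ^ 3 * R)"
    by (rule avg_mono) (rule 1)
  also have "\<dots> = real d ^ 4 * (1 + \<delta>) * \<delta> ^ 3 * R" by (rule avg_const) auto
  also have "avg (signs d) (\<lambda>\<xi>. U \<xi> - V - A1 \<xi> - 1 / 2 * A2 \<xi>) = avg (signs d) U - V - h * Z1
     - 1 / 2 * (h\<^sup>2 * Z2 (\<lambda>j k. b j * b k) (\<lambda>j k. b' j * b k)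
      + h * Z2 (\<lambda>j k. \<Sum>l<d. S j l * S k l) (\<lambda>j k. \<Sum>l<d. S' j l * S k l))"
    unfolding avg_diff avg_cmult A1 A2 by (simp add: avg_const)
  finally have "\<bar>avg (signs d) U - V - h * (Z1 + 1 / 2 * Z2 (\<lambda>j k. \<Sum>l<d. S j l * S k l) (\<lambda>j k. \<Sum>l<d. S' j l * S k l))
     - 1 / 2 * (h\<^sup>2 * Z2 (\<lambda>j k. b j * b k) (\<lambda>j k. b' j * b k))\<bar> \<le> real d ^ 4 * (1 + \<delta>) * \<delta> ^ 3 * R"
    by (simp add: algebra_simps)
  moreover have "\<bar>1 / 2 * (h\<^sup>2 * Z2 (\<lambda>j k. b j * b k) (\<lambda>j k. b' j * b k))\<bar> \<le> 1 / 2 * (h\<^sup>2 * (4 * real d ^ 3 * \<beta>\<^sup>2 * R))"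
    unfolding abs_mult using Zb by (intro mult_mono) auto
  ultimately have "\<bar>avg (signs d) U - V - h * (Z1 + 1 / 2 * Z2 (\<lambda>j k. \<Sum>l<d. S j l * S k l) (\<lambda>j k. \<Sum>l<d. S' j l * S k l))\<bar>
     \<le> real d ^ 4 * (1 + \<delta>) * \<delta> ^ 3 * R + 2 * h\<^sup>2 * real d ^ 3 * \<beta>\<^sup>2 * R"
    by (simp add: algebra_simps)
  then show ?thesis unfolding U_def V_def Z1_def Z2_def P_def jet_generator_def I_def .
qed

section \<open>Regularity in time\<close>

text \<open>Polynomial growth is measured by powers of \<open>1 + \<parallel>x\<parallel>\<^sup>2\<close>, because the averages of these powers over a random step are controlled.\<close>

definition sqweight :: "'i set \<Rightarrow> ('i \<Rightarrow> real) \<Rightarrow> real" where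
  "sqweight I x = 1 + (\<Sum>i\<in>I. (x i)\<^sup>2)"

lemma sqweight_ge_1: "sqweight I x \<ge> 1"
  by (simp add: sqweight_def sum_nonneg)

lemma sqweight_pos: "sqweight I x > 0"
  using sqweight_ge_1[of I x] by linarith

lemma sqweight_add_le: "sqweight I (\<lambda>i. x i + w i) \<le> 2 * sqweight I x + 2 * (\<Sum>i\<in>I. (w i)\<^sup>2)"
proof -
  have "(\<Sum>i\<in>I. (x i + w i)\<^sup>2) \<le> (\<Sum>i\<in>I. 2 * (x i)\<^sup>2 + 2 * (w i)\<^sup>2)"
  proof (rule sum_mono)
    fix i show "(x i + w i)\<^sup>2 \<le> 2 * (x i)\<^sup>2 + 2 * (w i)\<^sup>2"
      using sum_squares_bound[of "x i" "w i"] by (simp add: power2_sum)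
  qed
  then show ?thesis by (simp add: sqweight_def sum.distrib sum_distrib_left)
qed

lemma sqweight_cong: "(\<And>i. i \<in> I \<Longrightarrow> x i = y i) \<Longrightarrow> sqweight I x = sqweight I y"
  by (simp add: sqweight_def)

lemma sqweight_upd_le:
  assumes "finite I" "i \<in> I" "\<bar>t\<bar> \<le> 1"
  shows "sqweight I (x(i := x i + t)) \<le> 3 * sqweight I x"
proof -
  have e: "sqweight I y = 1 + (y i)\<^sup>2 + (\<Sum>j\<in>I - {i}. (y j)\<^sup>2)" for y :: "'a \<Rightarrow> real"
    using sum.remove[OF assms(1,2), of "\<lambda>j. (y j)\<^sup>2"] by (simp add: sqweight_def)
  have "t\<^sup>2 \<le> 1" using assms(3) by (simp add: abs_square_le_1)
  moreover have "(x i + t)\<^sup>2 \<le> 2 * (x i)\<^sup>2 + 2 * t\<^sup>2"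
    using sum_squares_bound[of "x i" t] by (simp add: power2_sum)
  moreover have "(\<Sum>j\<in>I - {i}. (x j)\<^sup>2) \<ge> 0" "(x i)\<^sup>2 \<ge> 0" by (auto intro: sum_nonneg)
  moreover have "(\<Sum>j\<in>I - {i}. ((x(i := x i + t)) j)\<^sup>2) = (\<Sum>j\<in>I - {i}. (x j)\<^sup>2)"
    by (rule sum.cong) auto
  moreover have "1 + a + s \<le> 3 * (1 + q + s)" if "r \<le> 1" "a \<le> 2 * q + 2 * r" "s \<ge> 0" "q \<ge> 0" for a q r s :: real
    using that by simp
  ultimately show ?thesis unfolding e fun_upd_same by metis
qed

lemma sqweight_upd_power_le:
  assumes "finite I" "i \<in> I" "\<bar>t\<bar> \<le> 1"
  shows "sqweight I (x(i := x i + t)) ^ p \<le> 3 ^ p * sqweight I x ^ p"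
  using power_mono[OF sqweight_upd_le[OF assms], of x p] sqweight_pos[of I] by (simp add: power_mult_distrib less_imp_le)

lemma DERIV_shift_line: "DERIV f (a + s) :> D \<Longrightarrow> DERIV (\<lambda>s. f (a + s)) s :> (D :: real)"
  using DERIV_shift[of f D s a] by (simp add: add.commute)

text \<open>Interpolation: closeness in value and bounded second derivatives give closeness of first
  derivatives, at the price of a square root. This yields Hoelder continuity in time of
  spatial derivatives from Lipschitz continuity of the values, without differentiating the equation.\<close>

lemma partial_deriv_interpolation:
  fixes f g :: "('i \<Rightarrow> real) \<Rightarrow> real"
  assumes I: "finite I" "i \<in> I" and x: "x \<in> Rn I"
    and f: "times_differentiable 2 I f" and g: "times_differentiable 2 I g"
    and close: "\<And>y. y \<in> Rn I \<Longrightarrow> \<bar>f y - g y\<bar> \<le> C * \<eta> * sqweight I y ^ p"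
    and f2: "\<And>y. y \<in> Rn I \<Longrightarrow> \<bar>partial_derivs [i, i] f y\<bar> \<le> C * sqweight I y ^ p"
    and g2: "\<And>y. y \<in> Rn I \<Longrightarrow> \<bar>partial_derivs [i, i] g y\<bar> \<le> C * sqweight I y ^ p"
    and \<eta>: "0 < \<eta>" "\<eta> \<le> 1" and C: "C \<ge> 0"
  shows "\<bar>partial_deriv i f x - partial_deriv i g x\<bar> \<le> 3 * 3 ^ p * C * sqrt \<eta> * sqweight I x ^ p"
proof -
  define y where "y s = x(i := x i + s)" for s
  define K where "K = 3 ^ p * C * sqweight I x ^ p"
  have y: "y s \<in> Rn I" for s using x I by (simp add: y_def Rn_upd)
  have y0: "y 0 = x" by (simp add: y_def)
  define \<phi> where "\<phi> n s = partial_derivs (replicate n i) f (y s) - partial_derivs (replicate n i) g (y s)" for n s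
  have D: "DERIV (\<phi> n) s :> \<phi> (Suc n) s" if "n < 2" for n s
  proof -
    have "((\<lambda>s. partial_derivs (replicate n i) h (y s)) has_real_derivative partial_derivs (replicate (Suc n) i) h (y s)) (at s)"
      if "times_differentiable 2 I h" for h
    proof -
      have "times_differentiable (Suc (1 - n)) I (partial_derivs (replicate n i) h)"
        using that \<open>n < 2\<close> I by (intro times_differentiable_partial_derivs) (auto simp: numeral_2_eq_2)
      from DERIV_partial[OF I(1) this x I(2), of "x i + s"]
      have "((\<lambda>t. partial_derivs (replicate n i) h (x(i := t))) has_real_derivative partial_derivs (replicate (Suc n) i) h (y s)) (at (x i + s))"
        by (simp add: y_def)
      from DERIV_shift_line[OF this] show ?thesis by (simp add: y_def)
    qed
    then show ?thesis unfolding \<phi>_def using f g by (intro DERIV_diff) auto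
  qed
  \<comment> \<open>A step of length \<open>\<surd>\<eta>\<close> balances the difference quotient, of order \<open>\<eta> / \<delta>\<close>, against the second derivative term, of order \<open>\<delta>\<close>.\<close>
  define \<delta> where "\<delta> = sqrt \<eta>"
  have \<delta>: "\<delta> > 0" "\<delta> \<le> 1" "\<delta> * \<delta> = \<eta>" using \<eta> by (auto simp: \<delta>_def)
  have "\<exists>t>0. t < \<delta> \<and> \<phi> 0 \<delta> = (\<Sum>m<2. \<phi> m 0 / fact m * \<delta> ^ m) + \<phi> 2 t / fact 2 * \<delta> ^ 2"
    by (rule Maclaurin) (use D \<delta> in auto)
  then obtain t where t: "0 < t" "t < \<delta>" "\<phi> 0 \<delta> = \<phi> 0 0 + \<phi> 1 0 * \<delta> + \<phi> 2 t / 2 * \<delta>\<^sup>2"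
    by (auto simp: eval_nat_numeral)
  have wK: "C * sqweight I (y s) ^ p \<le> K" if "0 \<le> s" "s \<le> 1" for s
    using sqweight_upd_power_le[OF I, of s x p] that C unfolding y_def K_def
    by (metis (no_types, lifting) abs_of_nonneg mult.assoc mult.left_commute mult_left_mono)
  have v: "\<bar>\<phi> 0 s\<bar> \<le> \<eta> * K" if "0 \<le> s" "s \<le> 1" for s
  proof -
    have "\<bar>\<phi> 0 s\<bar> \<le> \<eta> * (C * sqweight I (y s) ^ p)" using close[OF y, of s] by (simp add: \<phi>_def mult_ac)
    also have "\<dots> \<le> \<eta> * K" using wK[OF that] \<eta> by (intro mult_left_mono) auto
    finally show ?thesis .
  qed
  have "\<bar>\<phi> 2 t\<bar> \<le> \<bar>partial_derivs [i, i] f (y t)\<bar> + \<bar>partial_derivs [i, i] g (y t)\<bar>"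
    unfolding \<phi>_def by (simp add: numeral_2_eq_2)
  also have "\<dots> \<le> 2 * K" using f2[OF y, of t] g2[OF y, of t] wK[of t] t \<delta> by auto
  finally have s2: "\<bar>\<phi> 2 t\<bar> \<le> 2 * K" .
  have "\<bar>\<phi> 1 0\<bar> * \<delta> = \<bar>\<phi> 0 \<delta> - \<phi> 0 0 - \<phi> 2 t / 2 * \<delta>\<^sup>2\<bar>"
    unfolding t(3) using \<delta>(1) by (simp add: abs_mult)
  also have "\<dots> \<le> \<bar>\<phi> 0 \<delta>\<bar> + \<bar>\<phi> 0 0\<bar> + \<bar>\<phi> 2 t / 2 * \<delta>\<^sup>2\<bar>" by linarith
  also have "\<dots> \<le> \<eta> * K + \<eta> * K + K * \<delta>\<^sup>2"
    using v[of \<delta>] v[of 0] \<delta> s2 by (intro add_mono) (auto simp: abs_mult intro!: mult_right_mono)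
  also have "\<dots> = (3 * K * \<delta>) * \<delta>" using \<delta>(3) by (simp add: power2_eq_square)
  finally have "\<bar>\<phi> 1 0\<bar> \<le> 3 * K * \<delta>" using \<delta>(1) by simp
  then show ?thesis by (simp add: \<phi>_def y0 K_def \<delta>_def mult_ac)
qed

lemma DERIV_bound_of_increment:
  assumes D: "DERIV f (a::real) :> D" and b: "\<And>\<theta>. 0 < \<theta> \<Longrightarrow> \<theta> \<le> 1 \<Longrightarrow> \<bar>f (a + \<theta>) - f a\<bar> \<le> K * \<theta>"
  shows "\<bar>D\<bar> \<le> K"
proof -
  have "((\<lambda>\<theta>. \<bar>(f (a + \<theta>) - f a) / \<theta>\<bar>) \<longlongrightarrow> \<bar>D\<bar>) (at 0)"
    using D unfolding DERIV_def by (rule tendsto_rabs)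
  then have "((\<lambda>\<theta>. \<bar>(f (a + \<theta>) - f a) / \<theta>\<bar>) \<longlongrightarrow> \<bar>D\<bar>) (at_right 0)"
    by (rule tendsto_within_subset) auto
  moreover have "eventually (\<lambda>\<theta>. \<bar>(f (a + \<theta>) - f a) / \<theta>\<bar> \<le> K) (at_right 0)"
    unfolding eventually_at_right[of 0 1, OF zero_less_one]
    using b by (intro exI[of _ 1]) (auto simp: divide_le_eq abs_divide)
  ultimately show ?thesis
    by (intro tendsto_upperbound) (auto simp: trivial_limit_at_right_real)
qed

text \<open>If the time derivative of \<open>u\<close> differs from a fixed function \<open>H\<close> by an error that is small together
  with its spatial derivative, then the increment of \<open>u\<close> over a time step of length \<open>h\<close> is \<open>h H\<close> up to
  \<open>h\<close> times this error, again together with the spatial derivative. The spatial derivative is obtained from difference quotients,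
  so that time and space derivatives need not be interchanged.\<close>

lemma time_increment_jet:
  fixes u :: "real \<Rightarrow> ('i \<Rightarrow> real) \<Rightarrow> real"
  assumes I: "finite I" "i \<in> I" and x: "x \<in> Rn I" and h: "h > 0" "t \<ge> 0" "t + h \<le> T"
    and ut: "\<And>s y. s \<in> {0..T} \<Longrightarrow> y \<in> Rn I \<Longrightarrow> ((\<lambda>s. u s y) has_real_derivative u' s y) (at s within {0..T})"
    and u: "times_differentiable 1 I (u t)" "times_differentiable 1 I (u (t + h))"
    and E: "\<And>s y. s \<in> {t..t + h} \<Longrightarrow> y \<in> Rn I \<Longrightarrow> \<bar>u' s y - H y\<bar> \<le> K * sqweight I y ^ p"
    and D: "\<And>s y. s \<in> {t..t + h} \<Longrightarrow> y \<in> Rn I \<Longrightarrow> \<exists>D. DERIV (\<lambda>r. u' s (y(i := r)) - H (y(i := r))) (y i) :> D \<and> \<bar>D\<bar> \<le> K * sqweight I y ^ p"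
    and H: "DERIV (\<lambda>r. H (x(i := r))) (x i) :> H'" and K: "K \<ge> 0"
  shows "\<bar>u (t + h) x - u t x - h * H x\<bar> \<le> h * (K * sqweight I x ^ p)"
    and "\<bar>partial_deriv i (u (t + h)) x - partial_deriv i (u t) x - h * H'\<bar> \<le> h * (3 ^ p * K * sqweight I x ^ p)"
proof -
  have ut': "((\<lambda>s. u s y) has_real_derivative u' s y) (at s within {t..t + h})" if "s \<in> {t..t + h}" "y \<in> Rn I" for s y
  proof -
    have "s \<in> {0..T}" using that(1) h by auto
    from ut[OF this that(2)] show ?thesis by (rule DERIV_subset) (use h in auto)
  qed
  have mvt: "\<bar>\<psi> (t + h) - \<psi> t\<bar> \<le> h * M"
    if "\<And>s. s \<in> {t..t + h} \<Longrightarrow> (\<psi> has_real_derivative \<psi>' s) (at s within {t..t + h})"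
       "\<And>s. s \<in> {t..t + h} \<Longrightarrow> \<bar>\<psi>' s\<bar> \<le> M" for \<psi> \<psi>' :: "real \<Rightarrow> real" and M
  proof -
    have "norm (\<psi> (t + h) - \<psi> t) \<le> M * norm (t + h - t)"
      by (rule field_differentiable_bound[of "{t..t + h}" \<psi> \<psi>']) (use that h in \<open>simp_all\<close>)
    then show ?thesis using h by (simp add: mult.commute)
  qed
  have "\<bar>(u (t + h) x - (t + h) * H x) - (u t x - t * H x)\<bar> \<le> h * (K * sqweight I x ^ p)"
    by (rule mvt[of "\<lambda>s. u s x - s * H x" "\<lambda>s. u' s x - H x"])
      (use E x in \<open>auto intro!: derivative_eq_intros ut'\<close>)
  then show "\<bar>u (t + h) x - u t x - h * H x\<bar> \<le> h * (K * sqweight I x ^ p)" by (simp add: algebra_simps)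
  define L where "L = 3 ^ p * K * sqweight I x ^ p"
  define y where "y \<theta> = x(i := x i + \<theta>)" for \<theta>
  have y: "y \<theta> \<in> Rn I" for \<theta> using x I by (simp add: y_def Rn_upd)
  define \<Psi> where "\<Psi> \<theta> = u (t + h) (x(i := \<theta>)) - u t (x(i := \<theta>)) - h * H (x(i := \<theta>))" for \<theta>
  have 1: "\<bar>\<Psi> (x i + \<theta>) - \<Psi> (x i)\<bar> \<le> (h * L) * \<theta>" if \<theta>: "0 < \<theta>" "\<theta> \<le> 1" for \<theta>
  proof -
    define \<psi> where "\<psi> s = (u s (y \<theta>) - s * H (y \<theta>)) - (u s x - s * H x)" for s
    have "\<bar>\<psi> (t + h) - \<psi> t\<bar> \<le> h * (L * \<theta>)"
    proof (rule mvt[of \<psi> "\<lambda>s. (u' s (y \<theta>) - H (y \<theta>)) - (u' s x - H x)"])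
      fix s assume s: "s \<in> {t..t + h}"
      show "(\<psi> has_real_derivative (u' s (y \<theta>) - H (y \<theta>)) - (u' s x - H x)) (at s within {t..t + h})"
        unfolding \<psi>_def using s x y by (auto intro!: derivative_eq_intros ut')
      define e where "e r = u' s (y r) - H (y r)" for r
      have "\<exists>D. DERIV e r :> D \<and> \<bar>D\<bar> \<le> K * sqweight I (y r) ^ p" for r
      proof -
        obtain D' where D': "DERIV (\<lambda>q. u' s ((y r)(i := q)) - H ((y r)(i := q))) (y r i) :> D'" "\<bar>D'\<bar> \<le> K * sqweight I (y r) ^ p"
          using D[OF s y, of r] by blast
        have "DERIV (\<lambda>q. u' s (x(i := q)) - H (x(i := q))) (x i + r) :> D'"
          using D'(1) by (simp add: y_def)
        from DERIV_shift_line[OF this] have "DERIV e r :> D'" by (simp add: e_def[abs_def] y_def)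
        with D'(2) show ?thesis by blast
      qed
      then obtain e' where e': "\<And>r. DERIV e r :> e' r" "\<And>r. \<bar>e' r\<bar> \<le> K * sqweight I (y r) ^ p" by metis
      obtain r where r: "0 < r" "r < \<theta>" "e \<theta> - e 0 = (\<theta> - 0) * e' r" using MVT2[of 0 \<theta> e e'] e'(1) \<theta> by blast
      have "\<bar>e' r\<bar> \<le> L"
        using e'(2)[of r] sqweight_upd_power_le[OF I, of r x p] r \<theta> K unfolding y_def L_def
        by (smt (verit) mult.assoc mult.left_commute mult_left_mono)
      then have "\<bar>e \<theta> - e 0\<bar> \<le> L * \<theta>" unfolding r(3) using \<theta> by (simp add: abs_mult mult.commute mult_right_mono)
      then show "\<bar>(u' s (y \<theta>) - H (y \<theta>)) - (u' s x - H x)\<bar> \<le> L * \<theta>" by (simp add: e_def y_def)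
    qed
    then show ?thesis unfolding \<psi>_def \<Psi>_def y_def by (simp add: algebra_simps)
  qed
  have DP: "DERIV (\<lambda>s. v (x(i := s))) (x i) :> partial_deriv i v x" if "times_differentiable 1 I v" for v
    using DERIV_partial[OF I(1) _ x I(2), of 0 v "x i"] that by simp
  have "DERIV \<Psi> (x i) :> partial_deriv i (u (t + h)) x - partial_deriv i (u t) x - h * H'"
    unfolding \<Psi>_def by (intro DERIV_diff DERIV_cmult DP u H)
  from DERIV_bound_of_increment[OF this 1]
  show "\<bar>partial_deriv i (u (t + h)) x - partial_deriv i (u t) x - h * H'\<bar> \<le> h * (3 ^ p * K * sqweight I x ^ p)"
    unfolding L_def by simp
qed

section \<open>Comparing products together with a derivative\<close>

text \<open>Both functions and their derivatives in direction \<open>i\<close> are bounded by \<open>R\<close> at \<open>x\<close>, and they differ by at most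
  \<open>\<theta> R\<close>. This is stable under sums and products, so it passes from the coefficients to the generator.\<close>

definition jet_close :: "('i \<Rightarrow> real) \<Rightarrow> 'i \<Rightarrow> real \<Rightarrow> real \<Rightarrow> (('i \<Rightarrow> real) \<Rightarrow> real) \<Rightarrow> real \<Rightarrow> (('i \<Rightarrow> real) \<Rightarrow> real) \<Rightarrow> real \<Rightarrow> bool" where
  "jet_close x i \<theta> R f f' g g' \<longleftrightarrow>
     DERIV (\<lambda>s. f (x(i := s))) (x i) :> f' \<and> DERIV (\<lambda>s. g (x(i := s))) (x i) :> g' \<and>
     \<bar>f x\<bar> \<le> R \<and> \<bar>f'\<bar> \<le> R \<and> \<bar>g x\<bar> \<le> R \<and> \<bar>g'\<bar> \<le> R \<and> \<bar>f x - g x\<bar> \<le> \<theta> * R \<and> \<bar>f' - g'\<bar> \<le> \<theta> * R"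

lemma product_diff_le:
  fixes a b c e :: real
  assumes "\<bar>a\<bar> \<le> R" "\<bar>b\<bar> \<le> R" "\<bar>c\<bar> \<le> S" "\<bar>e\<bar> \<le> S" "\<bar>a - b\<bar> \<le> \<theta> * R" "\<bar>c - e\<bar> \<le> \<theta> * S"
  shows "\<bar>a * c - b * e\<bar> \<le> 2 * (\<theta> * (R * S))" "\<bar>a * c\<bar> \<le> R * S"
proof -
  have R: "R \<ge> 0" "S \<ge> 0" using assms by auto
  have "\<bar>a * c - b * e\<bar> = \<bar>(a - b) * c + b * (c - e)\<bar>" by (simp add: algebra_simps)
  also have "\<dots> \<le> \<bar>a - b\<bar> * \<bar>c\<bar> + \<bar>b\<bar> * \<bar>c - e\<bar>" using abs_triangle_ineq[of "(a - b) * c" "b * (c - e)"] by (simp add: abs_mult)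
  also have "\<dots> \<le> (\<theta> * R) * S + R * (\<theta> * S)"
    using assms R abs_ge_zero[of "a - b"] by (intro add_mono mult_mono) (auto intro: order_trans)
  finally show "\<bar>a * c - b * e\<bar> \<le> 2 * (\<theta> * (R * S))" by (simp add: mult_ac)
  show "\<bar>a * c\<bar> \<le> R * S" unfolding abs_mult using assms R by (intro mult_mono) auto
qed

lemma jet_close_mult:
  assumes a: "jet_close x i \<theta> R f f' g g'" and b: "jet_close x i \<theta> S k k' l l'" and \<theta>: "\<theta> \<ge> 0"
  shows "jet_close x i \<theta> (4 * R * S) (\<lambda>y. f y * k y) (f' * k x + f x * k') (\<lambda>y. g y * l y) (g' * l x + g x * l')"
proof -
  note A = a[unfolded jet_close_def] b[unfolded jet_close_def]
  have R: "R \<ge> 0" "S \<ge> 0" using A abs_ge_zero order_trans by blast+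
  then have RS: "R * S \<ge> 0" "\<theta> * (R * S) \<ge> 0" using \<theta> by auto
  have 1: "\<bar>f x * k x - g x * l x\<bar> \<le> 2 * (\<theta> * (R * S))" "\<bar>f x * k x\<bar> \<le> R * S" "\<bar>g x * l x\<bar> \<le> R * S"
    using A product_diff_le[of "f x" R "g x" "k x" S "l x" \<theta>] product_diff_le[of "g x" R "f x" "l x" S "k x" \<theta>] by (auto simp: abs_minus_commute)
  have 2: "\<bar>f' * k x - g' * l x\<bar> \<le> 2 * (\<theta> * (R * S))" "\<bar>f' * k x\<bar> \<le> R * S" "\<bar>g' * l x\<bar> \<le> R * S"
    using A product_diff_le[of "f'" R "g'" "k x" S "l x" \<theta>] product_diff_le[of "g'" R "f'" "l x" S "k x" \<theta>] by (auto simp: abs_minus_commute)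
  have 3: "\<bar>f x * k' - g x * l'\<bar> \<le> 2 * (\<theta> * (R * S))" "\<bar>f x * k'\<bar> \<le> R * S" "\<bar>g x * l'\<bar> \<le> R * S"
    using A product_diff_le[of "f x" R "g x" "k'" S "l'" \<theta>] product_diff_le[of "g x" R "f x" "l'" S "k'" \<theta>] by (auto simp: abs_minus_commute)
  have D: "DERIV (\<lambda>s. f (x(i := s)) * k (x(i := s))) (x i) :> f' * k x + f x * k'"
     "DERIV (\<lambda>s. g (x(i := s)) * l (x(i := s))) (x i) :> g' * l x + g x * l'"
    using A by (auto intro!: derivative_eq_intros)
  have add: "\<bar>a + b\<bar> \<le> 4 * C" if "\<bar>a\<bar> \<le> C" "\<bar>b\<bar> \<le> C" for a b C :: real
    using that by (simp add: abs_le_iff)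
  have add2: "\<bar>(a + b) - (c + e)\<bar> \<le> 4 * C" if "\<bar>a - c\<bar> \<le> 2 * C" "\<bar>b - e\<bar> \<le> 2 * C" for a b c e C :: real
    using that by (simp add: abs_le_iff)
  have e: "4 * R * S = 4 * (R * S)" "\<theta> * (4 * (R * S)) = 4 * (\<theta> * (R * S))" by simp_all
  show ?thesis unfolding jet_close_def e
    by (intro conjI D add add2 2 3) (use 1 RS in linarith)+
qed

lemma jet_close_sum:
  assumes "\<And>j. j \<in> A \<Longrightarrow> jet_close x i \<theta> (R j) (f j) (f' j) (g j) (g' j)"
  shows "jet_close x i \<theta> (\<Sum>j\<in>A. R j) (\<lambda>y. \<Sum>j\<in>A. f j y) (\<Sum>j\<in>A. f' j) (\<lambda>y. \<Sum>j\<in>A. g j y) (\<Sum>j\<in>A. g' j)"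
proof -
  have s: "\<bar>sum a A\<bar> \<le> sum b A" if "\<And>j. j \<in> A \<Longrightarrow> \<bar>a j\<bar> \<le> b j" for a b :: "_ \<Rightarrow> real"
    using that by (intro order_trans[OF sum_abs sum_mono])
  show ?thesis
    using assms unfolding jet_close_def sum_subtractf[symmetric] sum_distrib_left
    by (intro conjI DERIV_sum s) blast+
qed

lemma jet_close_sum_const:
  assumes "\<And>j. j \<in> A \<Longrightarrow> jet_close x i \<theta> R (f j) (f' j) (g j) (g' j)"
  shows "jet_close x i \<theta> (real (card A) * R) (\<lambda>y. \<Sum>j\<in>A. f j y) (\<Sum>j\<in>A. f' j) (\<lambda>y. \<Sum>j\<in>A. g j y) (\<Sum>j\<in>A. g' j)"
  using jet_close_sum[OF assms] by simp

lemma jet_close_add: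
  assumes "jet_close x i \<theta> R f f' g g'" "jet_close x i \<theta> S k k' l l'"
  shows "jet_close x i \<theta> (R + S) (\<lambda>y. f y + k y) (f' + k') (\<lambda>y. g y + l y) (g' + l')"
proof -
  have add: "\<bar>a + b\<bar> \<le> C + C'" if "\<bar>a\<bar> \<le> C" "\<bar>b\<bar> \<le> C'" for a b C C' :: real
    using that by (simp add: abs_le_iff)
  show ?thesis
    using assms unfolding jet_close_def distrib_left add_diff_add
    by (intro conjI DERIV_add add) blast+
qed

lemma jet_close_half:
  assumes "jet_close x i \<theta> R f f' g g'"
  shows "jet_close x i \<theta> (1 / 2 * R) (\<lambda>y. 1 / 2 * f y) (1 / 2 * f') (\<lambda>y. 1 / 2 * g y) (1 / 2 * g')"
  using assms unfolding jet_close_def by (auto intro!: DERIV_cmult[of _ _ _ _ "1 / 2", simplified] simp: right_diff_distrib[symmetric] simp flip: diff_divide_distrib)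

lemma jet_close_mono: "jet_close x i \<theta> R f f' g g' \<Longrightarrow> R \<le> S \<Longrightarrow> \<theta> \<ge> 0 \<Longrightarrow> jet_close x i \<theta> S f f' g g'"
  unfolding jet_close_def by (meson mult_left_mono order_trans)

section \<open>The defect of one step of the scheme\<close>

text \<open>The differential operator of the equation, with the coefficients at one time, and its partial derivative in direction \<open>i\<close> according to the product rule.\<close>

definition generator :: "nat \<Rightarrow> ((nat \<Rightarrow> real) \<Rightarrow> real) \<Rightarrow> ((nat \<Rightarrow> real) \<Rightarrow> nat \<Rightarrow> real) \<Rightarrow> ((nat \<Rightarrow> real) \<Rightarrow> nat \<times> nat \<Rightarrow> real) \<Rightarrow> (nat \<Rightarrow> real) \<Rightarrow> real" where
  "generator d v b S x = (\<Sum>j<d. b x j * partial_deriv j v x)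
     + 1 / 2 * (\<Sum>j<d. \<Sum>k<d. \<Sum>l<d. (S x (j, l) * S x (k, l)) * partial_derivs [k, j] v x)"

definition generator_deriv :: "nat \<Rightarrow> nat \<Rightarrow> ((nat \<Rightarrow> real) \<Rightarrow> real) \<Rightarrow> ((nat \<Rightarrow> real) \<Rightarrow> nat \<Rightarrow> real) \<Rightarrow> ((nat \<Rightarrow> real) \<Rightarrow> nat \<times> nat \<Rightarrow> real) \<Rightarrow> (nat \<Rightarrow> real) \<Rightarrow> real" where
  "generator_deriv d i v b S x =
     (\<Sum>j<d. partial_deriv i (\<lambda>x. b x j) x * partial_deriv j v x + b x j * partial_derivs [i, j] v x)
     + 1 / 2 * (\<Sum>j<d. \<Sum>k<d. \<Sum>l<d.
         (partial_deriv i (\<lambda>x. S x (j, l)) x * S x (k, l) + S x (j, l) * partial_deriv i (\<lambda>x. S x (k, l)) x) * partial_derivs [k, j] v x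
         + (S x (j, l) * S x (k, l)) * partial_derivs [i, k, j] v x)"

lemma jet_close_generator:
  assumes b: "\<And>j. j < d \<Longrightarrow> jet_close x i \<theta> R (\<lambda>x. b x j) (partial_deriv i (\<lambda>x. b x j) x) (\<lambda>x. e x j) (partial_deriv i (\<lambda>x. e x j) x)"
    and S: "\<And>j l. j < d \<Longrightarrow> l < d \<Longrightarrow> jet_close x i \<theta> R (\<lambda>x. S x (j, l)) (partial_deriv i (\<lambda>x. S x (j, l)) x) (\<lambda>x. U x (j, l)) (partial_deriv i (\<lambda>x. U x (j, l)) x)"
    and v: "\<And>js. set js \<subseteq> {..<d} \<Longrightarrow> length js \<le> 2 \<Longrightarrow> jet_close x i \<theta> R (partial_derivs js v) (partial_derivs (i # js) v x) (partial_derivs js w) (partial_derivs (i # js) w x)"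
    and \<theta>: "\<theta> \<ge> 0"
  shows "jet_close x i \<theta> (real d * (4 * R * R) + 1 / 2 * (real d * (real d * (real d * (4 * (4 * R * R) * R)))))
      (generator d v b S) (generator_deriv d i v b S x) (generator d w e U) (generator_deriv d i w e U x)"
proof -
  have v1: "jet_close x i \<theta> R (partial_deriv j v) (partial_derivs [i, j] v x) (partial_deriv j w) (partial_derivs [i, j] w x)" if "j < d" for j
    using v[of "[j]"] that by simp
  have c: "real d = real (card {..<d})" by simp
  show ?thesis
    unfolding generator_def[abs_def] generator_deriv_def unfolding c
    by (intro jet_close_add jet_close_half jet_close_sum_const jet_close_mult b S v1 v \<theta>) auto
qed

definition jet_bounded :: "'i set \<Rightarrow> nat \<Rightarrow> real \<Rightarrow> (('i \<Rightarrow> real) \<Rightarrow> real) \<Rightarrow> ('i \<Rightarrow> real) \<Rightarrow> bool" where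
  "jet_bounded I k R v x \<longleftrightarrow> (\<forall>js. set js \<subseteq> I \<and> length js \<le> k \<longrightarrow> \<bar>partial_derivs js v x\<bar> \<le> R)"

definition jet_diff :: "'i set \<Rightarrow> real \<Rightarrow> (('i \<Rightarrow> real) \<Rightarrow> real) \<Rightarrow> (('i \<Rightarrow> real) \<Rightarrow> real) \<Rightarrow> ('i \<Rightarrow> real) \<Rightarrow> bool" where
  "jet_diff I R v w x \<longleftrightarrow> (\<forall>js. set js \<subseteq> I \<and> length js \<le> 1 \<longrightarrow> \<bar>partial_derivs js v x - partial_derivs js w x\<bar> \<le> R)"

lemma jet_boundedD:
  assumes "jet_bounded I k R v x"
  shows "\<bar>v x\<bar> \<le> R" and "k \<ge> 1 \<Longrightarrow> i \<in> I \<Longrightarrow> \<bar>partial_deriv i v x\<bar> \<le> R"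
  using assms[unfolded jet_bounded_def, rule_format, of "[]"] assms[unfolded jet_bounded_def, rule_format, of "[i]"] by auto

lemma jet_diffD:
  assumes "jet_diff I R v w x"
  shows "\<bar>v x - w x\<bar> \<le> R" and "i \<in> I \<Longrightarrow> \<bar>partial_deriv i v x - partial_deriv i w x\<bar> \<le> R"
  using assms[unfolded jet_diff_def, rule_format, of "[]"] assms[unfolded jet_diff_def, rule_format, of "[i]"] by auto

lemma jet_diff_trans: "jet_diff I R v w x \<Longrightarrow> jet_diff I S w z x \<Longrightarrow> jet_diff I (R + S) v z x"
  unfolding jet_diff_def
proof (intro allI impI)
  fix js
  assume a: "\<forall>js. set js \<subseteq> I \<and> length js \<le> 1 \<longrightarrow> \<bar>partial_derivs js v x - partial_derivs js w x\<bar> \<le> R"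
    "\<forall>js. set js \<subseteq> I \<and> length js \<le> 1 \<longrightarrow> \<bar>partial_derivs js w x - partial_derivs js z x\<bar> \<le> S"
    "set js \<subseteq> I \<and> length js \<le> 1"
  have "\<bar>partial_derivs js v x - partial_derivs js w x\<bar> \<le> R" "\<bar>partial_derivs js w x - partial_derivs js z x\<bar> \<le> S"
    using a by blast+
  then show "\<bar>partial_derivs js v x - partial_derivs js z x\<bar> \<le> R + S" by linarith
qed

lemma jet_diff_mono: "jet_diff I R v w x \<Longrightarrow> R \<le> S \<Longrightarrow> jet_diff I S v w x"
  unfolding jet_diff_def by (meson order_trans)

lemma jet_bounded_mono: "jet_bounded I k R v x \<Longrightarrow> R \<le> S \<Longrightarrow> l \<le> k \<Longrightarrow> jet_bounded I l S v x"
  unfolding jet_bounded_def by (meson order_trans)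

lemma jet_closeI:
  assumes "finite I" "i \<in> I" "x \<in> Rn I" "times_differentiable 1 I v" "times_differentiable 1 I w"
    and "jet_bounded I 1 R v x" "jet_bounded I 1 R w x" "jet_diff I (\<theta> * R) v w x"
  shows "jet_close x i \<theta> R v (partial_deriv i v x) w (partial_deriv i w x)"
proof -
  have D: "DERIV (\<lambda>s. z (x(i := s))) (x i) :> partial_deriv i z x" if "times_differentiable 1 I z" for z
    using DERIV_partial[of I 0 z x i "x i"] assms that by simp
  show ?thesis unfolding jet_close_def
    using D assms(4,5) jet_boundedD[OF assms(6)] jet_boundedD[OF assms(7)] jet_diffD[OF assms(8)] assms(2) by blast
qed

text \<open>One component of the solution \<open>u\<close>, with exact data \<open>\<mu>\<close>, \<open>\<sigma>\<close>, \<open>g\<close>, \<open>f\<close> and perturbed data \<open>\<nu>\<close>, \<open>\<tau>\<close>, \<open>G\<close>, \<open>F\<close> at distance \<open>\<delta>\<close>. The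
  constant \<open>B\<close> and the power \<open>p\<close> may depend on the dimension and enter the error polynomially. The constant \<open>c\<close>, which bounds the
  linear growth of the perturbed coefficients together with their derivatives, is kept separate because it enters exponentially.
  The components of \<open>u\<close> do not interact, so the dimension of its range appears only when they are put together.\<close>

locale euler_setting =
  fixes d p :: nat and T B \<delta> \<alpha> c :: real
    and \<mu> \<nu> :: "real \<Rightarrow> (nat \<Rightarrow> real) \<Rightarrow> nat \<Rightarrow> real" and \<sigma> \<tau> :: "real \<Rightarrow> (nat \<Rightarrow> real) \<Rightarrow> nat \<times> nat \<Rightarrow> real"
    and u g G :: "real \<Rightarrow> (nat \<Rightarrow> real) \<Rightarrow> real" and f F :: "(nat \<Rightarrow> real) \<Rightarrow> real"
  assumes d: "d \<ge> 1" and p: "p \<ge> 1" and T: "T > 0" and B: "B \<ge> 1" and \<delta>: "0 \<le> \<delta>" and \<alpha>: "0 < \<alpha>" and c: "c \<ge> 0"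
    and u_diff: "t \<in> {0..T} \<Longrightarrow> times_differentiable 5 {..<d} (u t)"
    and u_cont: "t \<in> {0..T} \<Longrightarrow> set js \<subseteq> {..<d} \<Longrightarrow> length js \<le> 3 \<Longrightarrow> continuous_on (Rn {..<d}) (partial_derivs js (u t))"
    and u_bound: "t \<in> {0..T} \<Longrightarrow> x \<in> Rn {..<d} \<Longrightarrow> jet_bounded {..<d} 5 (B * sqweight {..<d} x ^ p) (u t) x"
    and u_time: "t \<in> {0..T} \<Longrightarrow> x \<in> Rn {..<d} \<Longrightarrow>
        ((\<lambda>s. u s x) has_real_derivative - (generator d (u t) (\<mu> t) (\<sigma> t) x + g t x)) (at t within {0..T})"
    and u_final: "x \<in> Rn {..<d} \<Longrightarrow> u T x = f x"
    and \<mu>_diff: "t \<in> {0..T} \<Longrightarrow> j < d \<Longrightarrow> times_differentiable 1 {..<d} (\<lambda>x. \<mu> t x j)"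
    and \<nu>_diff: "t \<in> {0..T} \<Longrightarrow> j < d \<Longrightarrow> times_differentiable 1 {..<d} (\<lambda>x. \<nu> t x j)"
    and \<sigma>_diff: "t \<in> {0..T} \<Longrightarrow> j < d \<Longrightarrow> l < d \<Longrightarrow> times_differentiable 1 {..<d} (\<lambda>x. \<sigma> t x (j, l))"
    and \<tau>_diff: "t \<in> {0..T} \<Longrightarrow> j < d \<Longrightarrow> l < d \<Longrightarrow> times_differentiable 1 {..<d} (\<lambda>x. \<tau> t x (j, l))"
    and g_diff: "t \<in> {0..T} \<Longrightarrow> times_differentiable 2 {..<d} (g t)"
    and G_diff: "t \<in> {0..T} \<Longrightarrow> times_differentiable 1 {..<d} (G t)"
    and F_diff: "times_differentiable 1 {..<d} F"
    and \<mu>_bound: "t \<in> {0..T} \<Longrightarrow> j < d \<Longrightarrow> x \<in> Rn {..<d} \<Longrightarrow> jet_bounded {..<d} 1 (B * sqweight {..<d} x ^ p) (\<lambda>x. \<mu> t x j) x"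
    and \<nu>_bound: "t \<in> {0..T} \<Longrightarrow> j < d \<Longrightarrow> x \<in> Rn {..<d} \<Longrightarrow> jet_bounded {..<d} 1 (B * sqweight {..<d} x ^ p) (\<lambda>x. \<nu> t x j) x"
    and \<sigma>_bound: "t \<in> {0..T} \<Longrightarrow> j < d \<Longrightarrow> l < d \<Longrightarrow> x \<in> Rn {..<d} \<Longrightarrow> jet_bounded {..<d} 1 (B * sqweight {..<d} x ^ p) (\<lambda>x. \<sigma> t x (j, l)) x"
    and \<tau>_bound: "t \<in> {0..T} \<Longrightarrow> j < d \<Longrightarrow> l < d \<Longrightarrow> x \<in> Rn {..<d} \<Longrightarrow> jet_bounded {..<d} 1 (B * sqweight {..<d} x ^ p) (\<lambda>x. \<tau> t x (j, l)) x"
    and g_bound: "t \<in> {0..T} \<Longrightarrow> x \<in> Rn {..<d} \<Longrightarrow> jet_bounded {..<d} 2 (B * sqweight {..<d} x ^ p) (g t) x"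
    and G_bound: "t \<in> {0..T} \<Longrightarrow> x \<in> Rn {..<d} \<Longrightarrow> jet_bounded {..<d} 1 (B * sqweight {..<d} x ^ p) (G t) x"
    and F_bound: "x \<in> Rn {..<d} \<Longrightarrow> jet_bounded {..<d} 1 (B * sqweight {..<d} x ^ p) F x"
    and \<mu>_hoelder: "s \<in> {0..T} \<Longrightarrow> t \<in> {0..T} \<Longrightarrow> \<bar>s - t\<bar> \<le> 1 \<Longrightarrow> j < d \<Longrightarrow> x \<in> Rn {..<d} \<Longrightarrow>
        jet_diff {..<d} (\<bar>s - t\<bar> powr \<alpha> * (B * sqweight {..<d} x ^ p)) (\<lambda>x. \<mu> s x j) (\<lambda>x. \<mu> t x j) x"
    and \<sigma>_hoelder: "s \<in> {0..T} \<Longrightarrow> t \<in> {0..T} \<Longrightarrow> \<bar>s - t\<bar> \<le> 1 \<Longrightarrow> j < d \<Longrightarrow> l < d \<Longrightarrow> x \<in> Rn {..<d} \<Longrightarrow>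
        jet_diff {..<d} (\<bar>s - t\<bar> powr \<alpha> * (B * sqweight {..<d} x ^ p)) (\<lambda>x. \<sigma> s x (j, l)) (\<lambda>x. \<sigma> t x (j, l)) x"
    and g_lipschitz: "s \<in> {0..T} \<Longrightarrow> t \<in> {0..T} \<Longrightarrow> x \<in> Rn {..<d} \<Longrightarrow> \<bar>g s x - g t x\<bar> \<le> B * \<bar>s - t\<bar> * sqweight {..<d} x ^ p"
    and \<mu>_\<nu>: "t \<in> {0..T} \<Longrightarrow> j < d \<Longrightarrow> x \<in> Rn {..<d} \<Longrightarrow> jet_diff {..<d} (\<delta> * (B * sqweight {..<d} x ^ p)) (\<lambda>x. \<mu> t x j) (\<lambda>x. \<nu> t x j) x"
    and \<sigma>_\<tau>: "t \<in> {0..T} \<Longrightarrow> j < d \<Longrightarrow> l < d \<Longrightarrow> x \<in> Rn {..<d} \<Longrightarrow> jet_diff {..<d} (\<delta> * (B * sqweight {..<d} x ^ p)) (\<lambda>x. \<sigma> t x (j, l)) (\<lambda>x. \<tau> t x (j, l)) x"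
    and g_G: "t \<in> {0..T} \<Longrightarrow> x \<in> Rn {..<d} \<Longrightarrow> jet_diff {..<d} (\<delta> * (B * sqweight {..<d} x ^ p)) (g t) (G t) x"
    and f_F: "x \<in> Rn {..<d} \<Longrightarrow> jet_diff {..<d} (\<delta> * (B * sqweight {..<d} x ^ p)) f F x"
    and \<nu>_growth: "t \<in> {0..T} \<Longrightarrow> x \<in> Rn {..<d} \<Longrightarrow> y \<in> Rn {..<d} \<Longrightarrow>
        (\<Sum>j<d. (\<nu> t x j)\<^sup>2) + (\<Sum>j<d. (\<Sum>i<d. partial_deriv i (\<lambda>x. \<nu> t x j) x * y i)\<^sup>2)
          \<le> 2 * c\<^sup>2 * (1 + (\<Sum>i<d. (x i)\<^sup>2) + (\<Sum>i<d. (y i)\<^sup>2))"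
    and \<tau>_growth: "t \<in> {0..T} \<Longrightarrow> x \<in> Rn {..<d} \<Longrightarrow> y \<in> Rn {..<d} \<Longrightarrow>
        (\<Sum>j<d. \<Sum>l<d. (\<tau> t x (j, l))\<^sup>2) + (\<Sum>j<d. \<Sum>l<d. (\<Sum>i<d. partial_deriv i (\<lambda>x. \<tau> t x (j, l)) x * y i)\<^sup>2)
          \<le> 2 * c * (1 + (\<Sum>i<d. (x i)\<^sup>2) + (\<Sum>i<d. (y i)\<^sup>2))"
begin

abbreviation I where "I \<equiv> {..<d}"
abbreviation Q where "Q \<equiv> sqweight {..<d}"

lemma d_pos: "0 < d" and d_real: "1 \<le> real d" using d by auto

lemma Q_power_ge_1: "1 \<le> Q x ^ n"
  using sqweight_ge_1 by (rule one_le_power)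

lemma Q_power_mono: "n \<le> m \<Longrightarrow> Q x ^ n \<le> Q x ^ m"
  using sqweight_ge_1 by (rule power_increasing[rotated])

definition C1 where "C1 = 3 * real d ^ 3 * B ^ 3"

lemma C1_ge: "B \<le> C1" "1 \<le> C1"
proof -
  have "1 \<le> real d ^ 3" using d_real by (rule one_le_power)
  moreover have "B * 1 \<le> B * B\<^sup>2" using B by (intro mult_left_mono one_le_power) auto
  ultimately have "1 * B \<le> real d ^ 3 * B ^ 3" using B by (intro mult_mono) (auto simp: eval_nat_numeral)
  then show "B \<le> C1" using B by (simp add: C1_def)
  then show "1 \<le> C1" using B by simp
qed

lemma sum_abs_bound: "(\<And>j. j < d \<Longrightarrow> \<bar>a j\<bar> \<le> C) \<Longrightarrow> \<bar>\<Sum>j<d. a j\<bar> \<le> real d * (C :: real)"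
  using order_trans[OF sum_abs sum_bounded_above[of "{..<d}" "\<lambda>j. \<bar>a j\<bar>" C]] by auto

lemma u_time_bound:
  assumes t: "t \<in> {0..T}" and x: "x \<in> Rn I"
  shows "\<bar>generator d (u t) (\<mu> t) (\<sigma> t) x + g t x\<bar> \<le> C1 * Q x ^ (3 * p)"
proof -
  define R where "R = B * Q x ^ p"
  have R1: "1 \<le> R" unfolding R_def using B Q_power_ge_1[of x p] by (metis mult_mono' mult_1 zero_le_one)
  have ub: "\<bar>partial_derivs js (u t) x\<bar> \<le> R" if "set js \<subseteq> I" "length js \<le> 5" for js
    using u_bound[OF t x] that unfolding jet_bounded_def R_def by blast
  have mb: "\<bar>\<mu> t x j\<bar> \<le> R" if "j < d" for j using jet_boundedD(1)[OF \<mu>_bound[OF t that x]] by (simp add: R_def)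
  have sb: "\<bar>\<sigma> t x (j, l)\<bar> \<le> R" if "j < d" "l < d" for j l using jet_boundedD(1)[OF \<sigma>_bound[OF t that x]] by (simp add: R_def)
  have gb: "\<bar>g t x\<bar> \<le> R" using jet_boundedD(1)[OF g_bound[OF t x]] by (simp add: R_def)
  have f1: "\<bar>\<Sum>j<d. \<mu> t x j * partial_deriv j (u t) x\<bar> \<le> real d * (R * R)"
    unfolding abs_mult using R1 ub[of "[_]"] by (intro sum_abs_bound) (auto simp: abs_mult intro!: mult_mono mb)
  have f3: "\<bar>\<Sum>j<d. \<Sum>k<d. \<Sum>l<d. \<sigma> t x (j, l) * \<sigma> t x (k, l) * partial_derivs [k, j] (u t) x\<bar> \<le> real d * (real d * (real d * (R * R * R)))"
  proof (intro sum_abs_bound)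
    fix j k l assume "j < d" "k < d" "l < d"
    then show "\<bar>\<sigma> t x (j, l) * \<sigma> t x (k, l) * partial_derivs [k, j] (u t) x\<bar> \<le> R * R * R"
      unfolding abs_mult using R1 by (intro mult_mono sb ub) auto
  qed
  have f2: "real d * (R * R) \<le> real d ^ 3 * R ^ 3"
  proof -
    have "real d * (R * R) \<le> real d ^ 3 * (R * R * R)"
      using R1 d_real self_le_power[of "real d" 3] by (intro mult_mono) auto
    then show ?thesis by (simp add: eval_nat_numeral)
  qed
  have f4: "R \<le> real d ^ 3 * R ^ 3"
  proof -
    have "1 * R \<le> real d ^ 3 * R ^ 3"
      using R1 d_real self_le_power[of R 3] by (intro mult_mono one_le_power) auto
    then show ?thesis by simp
  qed
  have f5: "real d * (real d * (real d * (R * R * R))) = real d ^ 3 * R ^ 3" by (simp add: eval_nat_numeral)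
  have lin: "\<bar>a + 1 / 2 * b + e\<bar> \<le> 3 * D" if "\<bar>a\<bar> \<le> a'" "a' \<le> D" "\<bar>b\<bar> \<le> D" "\<bar>e\<bar> \<le> R" "R \<le> D" for a b e a' D :: real
    using that by (simp add: abs_le_iff)
  have "\<bar>generator d (u t) (\<mu> t) (\<sigma> t) x + g t x\<bar> \<le> 3 * (real d ^ 3 * R ^ 3)"
    unfolding generator_def by (rule lin[OF f1 f2 f3[unfolded f5] gb f4])
  also have "\<dots> = C1 * Q x ^ (3 * p)"
    by (simp add: C1_def R_def power_mult_distrib power_mult[symmetric] mult.commute)
  finally show ?thesis .
qed

lemma u_lipschitz:
  assumes s: "s \<in> {0..T}" and t: "t \<in> {0..T}" and x: "x \<in> Rn I"
  shows "\<bar>u s x - u t x\<bar> \<le> C1 * \<bar>s - t\<bar> * Q x ^ (3 * p)"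
proof -
  have "norm (u s x - u t x) \<le> (C1 * Q x ^ (3 * p)) * norm (s - t)"
    by (rule field_differentiable_bound[of "{0..T}" "\<lambda>s. u s x"])
      (use u_time u_time_bound x s t in \<open>auto simp: abs_minus_commute simp del: minus_add_distrib\<close>)
  then show ?thesis by (simp add: mult_ac)
qed

definition Ci :: real where "Ci = 3 * 3 ^ (3 * p)"

lemma Ci_ge: "1 \<le> Ci" unfolding Ci_def using one_le_power[of "3::real" "3 * p"] by linarith

text \<open>Every spatial derivative halves the Hoelder exponent in time. Third derivatives occur in the gradient of the generator, and hence the exponent \<open>1 / 8\<close> in the rate; interpolation for them uses spatial derivatives of order four.\<close>

lemma u_derivs_hoelder:
  assumes s: "s \<in> {0..T}" and t: "t \<in> {0..T}" and st: "\<bar>s - t\<bar> \<le> h" and h: "0 < h" "h \<le> 1"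
    and js: "set js \<subseteq> I" "length js \<le> 3" and x: "x \<in> Rn I"
  shows "\<bar>partial_derivs js (u s) x - partial_derivs js (u t) x\<bar>
     \<le> (Ci ^ length js * C1) * (h powr ((1 / 2) ^ length js)) * Q x ^ (3 * p)"
  using js x
proof (induction js arbitrary: x)
  case Nil
  have "C1 * \<bar>s - t\<bar> * Q x ^ (3 * p) \<le> C1 * h * Q x ^ (3 * p)"
    using st C1_ge Q_power_ge_1[of x "3 * p"] by (intro mult_right_mono mult_left_mono) auto
  then show ?case using u_lipschitz[OF s t, of x] Nil h by simp
next
  case (Cons i js)
  let ?C = "Ci ^ length js * C1"
  have C: "C1 \<le> ?C" using Ci_ge C1_ge one_le_power[OF Ci_ge, of "length js"] by simp
  have td: "times_differentiable 2 I (partial_derivs js (u r))" if "r \<in> {0..T}" for r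
    using Cons.prems times_differentiable_mono[OF u_diff[OF that], of "length js + 2"]
    by (intro times_differentiable_partial_derivs) auto
  have bd: "\<bar>partial_derivs [i, i] (partial_derivs js (u r)) y\<bar> \<le> ?C * Q y ^ (3 * p)" if r: "r \<in> {0..T}" and y: "y \<in> Rn I" for r y
  proof -
    have "\<bar>partial_derivs (i # i # js) (u r) y\<bar> \<le> B * Q y ^ p"
      using u_bound[OF r y, unfolded jet_bounded_def, rule_format, of "i # i # js"] Cons.prems by auto
    also have "\<dots> \<le> ?C * Q y ^ (3 * p)"
      using order_trans[OF C1_ge(1) C] B Q_power_ge_1[of y p] Q_power_mono[of p "3 * p" y] by (intro mult_mono) auto
    finally show ?thesis by simp
  qed
  have "\<bar>partial_deriv i (partial_derivs js (u s)) x - partial_deriv i (partial_derivs js (u t)) x\<bar>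
     \<le> 3 * 3 ^ (3 * p) * ?C * sqrt (h powr ((1 / 2) ^ length js)) * Q x ^ (3 * p)"
  proof (rule partial_deriv_interpolation)
    show "\<bar>partial_derivs js (u s) y - partial_derivs js (u t) y\<bar> \<le> ?C * h powr (1 / 2) ^ length js * Q y ^ (3 * p)"
      if "y \<in> Rn I" for y using Cons that by auto
    show "h powr (1 / 2) ^ length js \<le> 1" using h by (simp add: powr_le1)
  qed (use Cons.prems td s t bd h C C1_ge in auto)
  also have "sqrt (h powr ((1 / 2) ^ length js)) = h powr ((1 / 2) ^ length (i # js))"
    using h by (simp add: powr_half_sqrt[symmetric] powr_powr)
  finally show ?case by (simp add: Ci_def mult_ac)
qed

definition C4 where "C4 = Ci ^ 4 * C1"

lemma C4_ge: "C1 \<le> C4" "B \<le> C4" "1 \<le> C4" "n \<le> 4 \<Longrightarrow> Ci ^ n * C1 \<le> C4"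
proof -
  show 1: "C1 \<le> C4" using one_le_power[OF Ci_ge, of 4] C1_ge by (simp add: C4_def)
  show "B \<le> C4" "1 \<le> C4" using 1 C1_ge by auto
  show "Ci ^ n * C1 \<le> C4" if "n \<le> 4"
    unfolding C4_def using that Ci_ge C1_ge by (intro mult_right_mono power_increasing) auto
qed

definition rate where "rate h = \<delta> + h powr (min \<alpha> (1 / 8))"

lemma rate_nonneg: "0 \<le> rate h" by (simp add: rate_def \<delta>)

lemma rate_ge: assumes "0 < h" "h \<le> 1" "a \<ge> min \<alpha> (1 / 8)" shows "\<delta> + h powr a \<le> rate h" "h powr a \<le> rate h"
proof -
  show "\<delta> + h powr a \<le> rate h" unfolding rate_def using assms powr_mono' by auto
  then show "h powr a \<le> rate h" using \<delta> by simp
qed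

definition K2 where "K2 = 13 * real d ^ 3 * C4 ^ 3"

text \<open>On a time step, the exact coefficients at running time and the perturbed coefficients at the left end point
  differ by the rate, and so do the generators applied to \<open>u\<close>.\<close>

lemma generator_close:
  assumes s: "s \<in> {t..t + h}" and t: "0 \<le> t" "t + h \<le> T" and h: "0 < h" "h \<le> 1" and x: "x \<in> Rn I" and i: "i < d"
  shows "jet_close x i (rate h) (K2 * Q x ^ (9 * p))
     (\<lambda>x. generator d (u s) (\<mu> s) (\<sigma> s) x + g s x) (generator_deriv d i (u s) (\<mu> s) (\<sigma> s) x + partial_deriv i (g s) x)
     (\<lambda>x. generator d (u (t + h)) (\<nu> t) (\<tau> t) x + G t x) (generator_deriv d i (u (t + h)) (\<nu> t) (\<tau> t) x + partial_deriv i (G t) x)"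
proof -
  define R where "R = C4 * Q x ^ (3 * p)"
  have ts: "s \<in> {0..T}" "t \<in> {0..T}" "t + h \<in> {0..T}" using s t h by auto
  have BR: "B * Q x ^ p \<le> R"
    unfolding R_def using C4_ge B Q_power_ge_1[of x p] Q_power_mono[of p "3 * p" x] by (intro mult_mono) auto
  have R1: "1 \<le> R" unfolding R_def using C4_ge Q_power_ge_1[of x "3 * p"] by (metis mult_mono' mult_1 zero_le_one)
  have st: "\<bar>s - t\<bar> \<le> h" "\<bar>s - t\<bar> \<le> 1" "\<bar>s - (t + h)\<bar> \<le> h" using s h by auto
  have hp: "\<bar>s - t\<bar> powr \<alpha> + \<delta> \<le> rate h"
    using rate_ge(1)[OF h, of \<alpha>] powr_mono2[of \<alpha> "\<bar>s - t\<bar>" h] st \<alpha> by simp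
  have scale: "a * (B * Q x ^ p) + b * (B * Q x ^ p) \<le> rate h * R" if "a + b \<le> rate h" "0 \<le> a + b" for a b
  proof -
    have "(a + b) * (B * Q x ^ p) \<le> rate h * R" using that BR B Q_power_ge_1[of x p] by (intro mult_mono) auto
    then show ?thesis by (simp add: distrib_right)
  qed
  have v: "jet_close x i (rate h) R (partial_derivs js (u s)) (partial_derivs (i # js) (u s) x) (partial_derivs js (u (t + h))) (partial_derivs (i # js) (u (t + h)) x)"
    if js: "set js \<subseteq> I" "length js \<le> 2" for js
  proof -
    have bd: "\<bar>partial_derivs ks (u r) x\<bar> \<le> R" if "set ks \<subseteq> I" "length ks \<le> 3" "r \<in> {0..T}" for ks r
      using u_bound[OF that(3) x, unfolded jet_bounded_def, rule_format, of ks] BR that by auto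
    have df: "\<bar>partial_derivs ks (u s) x - partial_derivs ks (u (t + h)) x\<bar> \<le> rate h * R" if ks: "set ks \<subseteq> I" "length ks \<le> 3" for ks
    proof -
      have "\<bar>partial_derivs ks (u s) x - partial_derivs ks (u (t + h)) x\<bar> \<le> (Ci ^ length ks * C1) * (h powr ((1 / 2) ^ length ks)) * Q x ^ (3 * p)"
        by (rule u_derivs_hoelder) (use ts st h ks x in auto)
      also have "\<dots> \<le> C4 * rate h * Q x ^ (3 * p)"
      proof (intro mult_mono)
        have "(1 / 2 :: real) ^ 3 \<le> (1 / 2) ^ length ks" using ks by (intro power_decreasing) auto
        then show "h powr (1 / 2) ^ length ks \<le> rate h" by (intro rate_ge h) (simp add: eval_nat_numeral)
        show "Ci ^ length ks * C1 \<le> C4" using ks by (intro C4_ge) auto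
      qed (use C4_ge(3) rate_nonneg[of h] sqweight_pos[of I x] in \<open>auto simp: less_imp_le\<close>)
      finally show ?thesis by (simp add: R_def mult_ac)
    qed
    have D: "DERIV (\<lambda>q. partial_derivs js (u r) (x(i := q))) (x i) :> partial_derivs (i # js) (u r) x" if r: "r \<in> {0..T}" for r
    proof -
      have "times_differentiable (Suc 0) I (partial_derivs js (u r))"
        using js times_differentiable_mono[OF u_diff[OF r], of "length js + Suc 0"]
        by (intro times_differentiable_partial_derivs) auto
      from DERIV_partial[OF _ this x, of i "x i"] i show ?thesis by simp
    qed
    show ?thesis unfolding jet_close_def
      using D ts bd[of js] bd[of "i # js"] df[of js] df[of "i # js"] js i by (auto simp del: partial_derivs.simps)
  qed
  have I: "finite I" "i \<in> I" using i by auto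
  have b: "jet_close x i (rate h) R (\<lambda>x. \<mu> s x j) (partial_deriv i (\<lambda>x. \<mu> s x j) x) (\<lambda>x. \<nu> t x j) (partial_deriv i (\<lambda>x. \<nu> t x j) x)" if j: "j < d" for j
  proof (rule jet_closeI[OF I x \<mu>_diff[OF ts(1) j] \<nu>_diff[OF ts(2) j]])
    show "jet_bounded I 1 R (\<lambda>x. \<mu> s x j) x" by (rule jet_bounded_mono[OF \<mu>_bound[OF ts(1) j x] BR order_refl])
    show "jet_bounded I 1 R (\<lambda>x. \<nu> t x j) x" by (rule jet_bounded_mono[OF \<nu>_bound[OF ts(2) j x] BR order_refl])
    show "jet_diff I (rate h * R) (\<lambda>x. \<mu> s x j) (\<lambda>x. \<nu> t x j) x"
      by (rule jet_diff_mono[OF jet_diff_trans[OF \<mu>_hoelder[OF ts(1,2) st(2) j x] \<mu>_\<nu>[OF ts(2) j x]] scale[OF hp]]) (simp add: \<delta>)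
  qed
  have S: "jet_close x i (rate h) R (\<lambda>x. \<sigma> s x (j, l)) (partial_deriv i (\<lambda>x. \<sigma> s x (j, l)) x) (\<lambda>x. \<tau> t x (j, l)) (partial_deriv i (\<lambda>x. \<tau> t x (j, l)) x)" if j: "j < d" "l < d" for j l
  proof (rule jet_closeI[OF I x \<sigma>_diff[OF ts(1) j] \<tau>_diff[OF ts(2) j]])
    show "jet_bounded I 1 R (\<lambda>x. \<sigma> s x (j, l)) x" by (rule jet_bounded_mono[OF \<sigma>_bound[OF ts(1) j x] BR order_refl])
    show "jet_bounded I 1 R (\<lambda>x. \<tau> t x (j, l)) x" by (rule jet_bounded_mono[OF \<tau>_bound[OF ts(2) j x] BR order_refl])
    show "jet_diff I (rate h * R) (\<lambda>x. \<sigma> s x (j, l)) (\<lambda>x. \<tau> t x (j, l)) x"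
      by (rule jet_diff_mono[OF jet_diff_trans[OF \<sigma>_hoelder[OF ts(1,2) st(2) j x] \<sigma>_\<tau>[OF ts(2) j x]] scale[OF hp]]) (simp add: \<delta>)
  qed
  have gG: "jet_close x i (rate h) R (g s) (partial_deriv i (g s) x) (G t) (partial_deriv i (G t) x)"
  proof (rule jet_closeI[OF I x times_differentiable_mono[OF g_diff[OF ts(1)]] G_diff[OF ts(2)]])
    show "jet_bounded I 1 R (g s) x" by (rule jet_bounded_mono[OF g_bound[OF ts(1) x] BR]) simp
    show "jet_bounded I 1 R (G t) x" by (rule jet_bounded_mono[OF G_bound[OF ts(2) x] BR order_refl])
    have l: "\<bar>g s y - g t y\<bar> \<le> B * h * Q y ^ p" if y: "y \<in> Rn I" for y
    proof -
      have "B * \<bar>s - t\<bar> * Q y ^ p \<le> B * h * Q y ^ p"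
        using st B Q_power_ge_1[of y p] by (intro mult_right_mono mult_left_mono) auto
      then show ?thesis using g_lipschitz[OF ts(1,2) y] by simp
    qed
    have l': "\<bar>partial_deriv k (g s) x - partial_deriv k (g t) x\<bar> \<le> 3 * 3 ^ p * B * sqrt h * Q x ^ p" if k: "k \<in> I" for k
    proof (rule partial_deriv_interpolation[OF I(1) k x g_diff[OF ts(1)] g_diff[OF ts(2)] l _ _ h])
      show "\<bar>partial_derivs [k, k] (g s) y\<bar> \<le> B * Q y ^ p" "\<bar>partial_derivs [k, k] (g t) y\<bar> \<le> B * Q y ^ p" if "y \<in> Rn I" for y
        using g_bound[OF ts(1) that] g_bound[OF ts(2) that] k unfolding jet_bounded_def by (auto simp del: partial_derivs.simps)
    qed (use B in auto)
    have sq: "sqrt h = h powr (1 / 2)" using h by (simp add: powr_half_sqrt)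
    have hs: "h \<le> sqrt h" using h by (simp add: real_le_rsqrt power2_eq_square mult_left_le)
    have c3: "3 * 3 ^ p * B \<le> C4"
    proof -
      have "3 * 3 ^ p * B \<le> Ci * C1" unfolding Ci_def using C1_ge B by (intro mult_mono power_increasing) auto
      also have "\<dots> \<le> C4" using C4_ge(4)[of 1] by simp
      finally show ?thesis .
    qed
    have gg: "jet_diff I (sqrt h * R) (g s) (g t) x"
      unfolding jet_diff_def
    proof (intro allI impI)
      fix js assume js: "set js \<subseteq> I \<and> length js \<le> 1"
      have Q3: "Q x ^ p \<le> Q x ^ (3 * p)" by (rule Q_power_mono) simp
      show "\<bar>partial_derivs js (g s) x - partial_derivs js (g t) x\<bar> \<le> sqrt h * R"
      proof (cases js)
        case Nil
        have "B * h * Q x ^ p \<le> C4 * sqrt h * Q x ^ (3 * p)"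
          using hs h B C4_ge Q3 Q_power_ge_1[of x p] by (intro mult_mono) auto
        then show ?thesis using l[OF x] Nil by (simp add: R_def mult_ac)
      next
        case (Cons k ks)
        then have k: "js = [k]" "k \<in> I" using js by auto
        have "3 * 3 ^ p * B * sqrt h * Q x ^ p \<le> C4 * sqrt h * Q x ^ (3 * p)"
          using c3 h B C4_ge Q3 Q_power_ge_1[of x p] by (intro mult_mono) auto
        then show ?thesis using l'[OF k(2)] k(1) by (simp add: R_def mult_ac)
      qed
    qed
    have "sqrt h * R + \<delta> * (B * Q x ^ p) \<le> (\<delta> + sqrt h) * R"
      using BR \<delta> by (simp add: distrib_right mult_left_mono)
    also have "\<dots> \<le> rate h * R" using rate_ge(1)[OF h, of "1 / 2"] R1 unfolding sq by (intro mult_right_mono) auto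
    finally show "jet_diff I (rate h * R) (g s) (G t) x"
      by (rule jet_diff_mono[OF jet_diff_trans[OF gg g_G[OF ts(2) x]]])
  qed simp
  have "jet_close x i (rate h) (real d * (4 * R * R) + 1 / 2 * (real d * (real d * (real d * (4 * (4 * R * R) * R)))) + R)
     (\<lambda>x. generator d (u s) (\<mu> s) (\<sigma> s) x + g s x) (generator_deriv d i (u s) (\<mu> s) (\<sigma> s) x + partial_deriv i (g s) x)
     (\<lambda>x. generator d (u (t + h)) (\<nu> t) (\<tau> t) x + G t x) (generator_deriv d i (u (t + h)) (\<nu> t) (\<tau> t) x + partial_deriv i (G t) x)"
    by (intro jet_close_add jet_close_generator b S v gG rate_nonneg)
  then show ?thesis
  proof (rule jet_close_mono)
    have "real d * (R * R) \<le> real d ^ 3 * (R * R * R)"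
      using R1 d_real self_le_power[of "real d" 3] by (intro mult_mono) auto
    moreover have "1 * R \<le> real d ^ 3 * (R * R * R)"
      using R1 d_real self_le_power[of R 3] by (intro mult_mono one_le_power) (auto simp: eval_nat_numeral)
    ultimately have "real d * (4 * R * R) + 1 / 2 * (real d * (real d * (real d * (4 * (4 * R * R) * R)))) + R \<le> 13 * (real d ^ 3 * (R * R * R))"
      by (simp add: eval_nat_numeral algebra_simps)
    also have "\<dots> = K2 * Q x ^ (9 * p)"
      by (simp add: K2_def R_def eval_nat_numeral power_add algebra_simps)
    finally show "real d * (4 * R * R) + 1 / 2 * (real d * (real d * (real d * (4 * (4 * R * R) * R)))) + R \<le> K2 * Q x ^ (9 * p)" .
  qed (rule rate_nonneg)
qed


definition disp where "disp t h \<xi> x j = h * \<nu> t x j + sqrt h * (\<Sum>l<d. \<tau> t x (j, l) * \<xi> l)"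

definition disp_deriv where
  "disp_deriv t h \<xi> x i j = h * partial_deriv i (\<lambda>x. \<nu> t x j) x + sqrt h * (\<Sum>l<d. partial_deriv i (\<lambda>x. \<tau> t x (j, l)) x * \<xi> l)"

definition move where "move t h \<xi> x = (\<lambda>j\<in>I. x j + disp t h \<xi> x j)"

lemma move_along: "move t h \<xi> x = along I x (disp t h \<xi> x) 1"
  by (simp add: move_def along_def)

lemma move_Rn [simp]: "move t h \<xi> x \<in> Rn I" by (simp add: move_def)

lemma disp_square:
  assumes t: "t \<in> {0..T}" and x: "x \<in> Rn I" and h: "0 \<le> h" "64 * h * real d * (c + 1)\<^sup>2 \<le> 1" and \<xi>: "\<xi> \<in> signs d"
  shows "(\<Sum>j<d. (disp t h \<xi> x j)\<^sup>2) \<le> Q x / 9"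
proof -
  have y: "(\<lambda>i\<in>I. 0) \<in> Rn I" by simp
  interpret st: random_step I d c h x "\<nu> t x" "\<lambda>j l. \<tau> t x (j, l)"
    using \<nu>_growth[OF t x y] \<tau>_growth[OF t x y] d c h by unfold_locales auto
  show ?thesis using st.step_square[OF \<xi>] unfolding st.step_def disp_def st.Q_def by (simp add: sqweight_def)
qed

lemma disp_bounds:
  assumes t: "t \<in> {0..T}" and x: "x \<in> Rn I" and h: "0 < h" "h \<le> 1" and \<xi>: "\<xi> \<in> signs d" and j: "j < d"
  shows "\<bar>disp t h \<xi> x j\<bar> \<le> 2 * real d * sqrt h * (B * Q x ^ p)"
    and "i < d \<Longrightarrow> \<bar>disp_deriv t h \<xi> x i j\<bar> \<le> 2 * real d * sqrt h * (B * Q x ^ p)"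
proof -
  define R where "R = B * Q x ^ p"
  have R: "R \<ge> 0" unfolding R_def using B Q_power_ge_1[of x p] by simp
  have key: "\<bar>h * a + sqrt h * (\<Sum>l<d. b l * \<xi> l)\<bar> \<le> 2 * real d * sqrt h * R"
    if "\<bar>a\<bar> \<le> R" "\<And>l. l < d \<Longrightarrow> \<bar>b l\<bar> \<le> R" for a b
  proof -
    have hs: "h \<le> sqrt h" using h by (simp add: real_le_rsqrt power2_eq_square mult_left_le)
    have "\<bar>\<Sum>l<d. b l * \<xi> l\<bar> \<le> real d * R"
      using that(2) by (intro sum_abs_bound) (simp add: abs_mult signs_abs[OF \<xi>])
    then have "\<bar>h * a\<bar> + \<bar>sqrt h * (\<Sum>l<d. b l * \<xi> l)\<bar> \<le> sqrt h * R + sqrt h * (real d * R)"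
      unfolding abs_mult using that(1) h hs R by (intro add_mono mult_mono) auto
    also have "\<dots> \<le> real d * (sqrt h * R) + sqrt h * (real d * R)"
    proof -
      have "1 * (sqrt h * R) \<le> real d * (sqrt h * R)" using d_real R h by (intro mult_right_mono) auto
      then show ?thesis by linarith
    qed
    finally show ?thesis using abs_triangle_ineq[of "h * a" "sqrt h * (\<Sum>l<d. b l * \<xi> l)"] by (simp add: mult_ac)
  qed
  show "\<bar>disp t h \<xi> x j\<bar> \<le> 2 * real d * sqrt h * (B * Q x ^ p)"
    unfolding disp_def R_def[symmetric]
    using jet_boundedD(1)[OF \<nu>_bound[OF t j x]] jet_boundedD(1)[OF \<tau>_bound[OF t j _ x]] by (intro key) (auto simp: R_def)
  show "\<bar>disp_deriv t h \<xi> x i j\<bar> \<le> 2 * real d * sqrt h * (B * Q x ^ p)" if "i < d"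
    unfolding disp_deriv_def R_def[symmetric]
    using jet_boundedD(2)[OF \<nu>_bound[OF t j x], of i] jet_boundedD(2)[OF \<tau>_bound[OF t j _ x], of _ i] that by (intro key) (auto simp: R_def)
qed

definition K1 where "K1 = 26 * 3 ^ p * real d ^ 8 * B ^ 5"

lemma taylor_remainder_le:
  fixes x :: "nat \<Rightarrow> real" and h :: real
  assumes h: "0 < h" "h \<le> 1"
  defines "b \<equiv> 2 * real d * sqrt h * (B * Q x ^ p)"
  shows "real d ^ 4 * (1 + b) * b ^ 3 * (3 ^ p * (B * Q x ^ p)) + 2 * h\<^sup>2 * real d ^ 3 * (B * Q x ^ p)\<^sup>2 * (3 ^ p * (B * Q x ^ p))
    \<le> h * sqrt h * (K1 * Q x ^ (5 * p))"
proof -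
  define R where "R = B * Q x ^ p"
  have R: "R \<ge> 1" unfolding R_def using B Q_power_ge_1[of x p] by (metis mult_mono' mult_1 zero_le_one)
  have dR: "real d * R \<ge> 1" using d_real R by (metis mult_mono' mult_1 zero_le_one)
  have s: "sqrt h \<le> 1" "sqrt h ^ 2 = h" using h by auto
  have "real d * (sqrt h * R) \<le> real d * (1 * R)" using s R by (intro mult_left_mono mult_right_mono) auto
  then have b1: "1 + b \<le> 3 * (real d * R)" using dR unfolding b_def R_def[symmetric] by (simp add: mult_ac)
  have "real d ^ 4 * (1 + b) * b ^ 3 * (3 ^ p * R) \<le> real d ^ 4 * (3 * (real d * R)) * b ^ 3 * (3 ^ p * R)"
    using b1 R h unfolding b_def R_def[symmetric] by (intro mult_right_mono mult_left_mono) auto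
  also have "\<dots> = h * sqrt h * (24 * 3 ^ p * real d ^ 8 * R ^ 5)"
    unfolding b_def R_def[symmetric] using s(2) by (simp add: eval_nat_numeral mult_ac)
  finally have 1: "real d ^ 4 * (1 + b) * b ^ 3 * (3 ^ p * R) \<le> h * sqrt h * (24 * 3 ^ p * real d ^ 8 * R ^ 5)" .
  have "2 * h\<^sup>2 * real d ^ 3 * R\<^sup>2 * (3 ^ p * R) = h * h * (2 * 3 ^ p * real d ^ 3 * R ^ 3)"
    by (simp add: eval_nat_numeral mult_ac)
  also have "\<dots> \<le> h * sqrt h * (2 * 3 ^ p * real d ^ 8 * R ^ 5)"
  proof (intro mult_mono)
    show "h \<le> sqrt h" using h by (simp add: real_le_rsqrt power2_eq_square mult_left_le)
  qed (use h R d_real in \<open>auto intro!: power_increasing\<close>)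
  finally have 2: "2 * h\<^sup>2 * real d ^ 3 * R\<^sup>2 * (3 ^ p * R) \<le> h * sqrt h * (2 * 3 ^ p * real d ^ 8 * R ^ 5)" .
  have R5: "R ^ 5 = B ^ 5 * Q x ^ (5 * p)"
    by (simp add: R_def power_mult_distrib power_mult[symmetric] mult.commute)
  have "h * sqrt h * (24 * 3 ^ p * real d ^ 8 * R ^ 5) + h * sqrt h * (2 * 3 ^ p * real d ^ 8 * R ^ 5) = h * sqrt h * (K1 * Q x ^ (5 * p))"
    unfolding K1_def R5 by (simp add: algebra_simps)
  with 1 2 show ?thesis unfolding R_def[symmetric] by linarith
qed

text \<open>The average of \<open>u\<close> over one random step, and its spatial derivative, agree with the generator up to order \<open>h\<^sup>3\<^sup>/\<^sup>2\<close>.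
  Schwarz's theorem reconciles the order of differentiation on both sides.\<close>

lemma step_average:
  assumes t: "0 \<le> t" "t + h \<le> T" and h: "0 < h" "h \<le> 1" "64 * h * real d * (c + 1)\<^sup>2 \<le> 1" and x: "x \<in> Rn I"
  shows "\<bar>avg (signs d) (\<lambda>\<xi>. u (t + h) (move t h \<xi> x)) - u (t + h) x - h * generator d (u (t + h)) (\<nu> t) (\<tau> t) x\<bar>
      \<le> h * sqrt h * (K1 * Q x ^ (5 * p))"
    and "i < d \<Longrightarrow> \<bar>avg (signs d) (\<lambda>\<xi>. \<Sum>m<d. ((if m = i then 1 else 0) + disp_deriv t h \<xi> x i m) * partial_deriv m (u (t + h)) (move t h \<xi> x))
        - partial_deriv i (u (t + h)) x - h * generator_deriv d i (u (t + h)) (\<nu> t) (\<tau> t) x\<bar>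
      \<le> h * sqrt h * (K1 * Q x ^ (5 * p))"
proof -
  define v where "v = u (t + h)"
  define R where "R = B * Q x ^ p"
  have ts: "t \<in> {0..T}" "t + h \<in> {0..T}" using t h by auto
  have v: "times_differentiable 4 I v" using times_differentiable_mono[OF u_diff[OF ts(2)]] by (simp add: v_def)
  have R0: "R \<ge> 0" unfolding R_def using B Q_power_ge_1[of x p] by simp
  have seg: "\<bar>partial_derivs js v (along I x (disp t h \<xi> x) \<theta>)\<bar> \<le> 3 ^ p * R"
    if "set js \<subseteq> I" "length js \<le> 4" "0 \<le> \<theta>" "\<theta> \<le> 1" "\<xi> \<in> signs d" for js \<theta> \<xi>
  proof -
    have "Q (along I x (disp t h \<xi> x) \<theta>) = Q (\<lambda>i. x i + \<theta> * disp t h \<xi> x i)"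
      by (rule sqweight_cong) (simp add: along_def)
    also have "\<dots> \<le> 2 * Q x + 2 * (\<Sum>i<d. (\<theta> * disp t h \<xi> x i)\<^sup>2)" by (rule sqweight_add_le)
    also have "(\<Sum>i<d. (\<theta> * disp t h \<xi> x i)\<^sup>2) \<le> (\<Sum>i<d. (disp t h \<xi> x i)\<^sup>2)"
      using that by (intro sum_mono) (auto simp: power_mult_distrib power_le_one intro!: mult_left_le_one_le)
    also have "\<dots> \<le> Q x / 9" by (rule disp_square) (use ts x h that in auto)
    finally have "Q (along I x (disp t h \<xi> x) \<theta>) \<le> 3 * Q x" using sqweight_ge_1[of I x] by simp
    then have "Q (along I x (disp t h \<xi> x) \<theta>) ^ p \<le> (3 * Q x) ^ p"
      by (rule power_mono) (simp add: sqweight_pos less_imp_le)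
    then have "B * Q (along I x (disp t h \<xi> x) \<theta>) ^ p \<le> B * (3 * Q x) ^ p" using B by (intro mult_left_mono) auto
    moreover have "\<bar>partial_derivs js v (along I x (disp t h \<xi> x) \<theta>)\<bar> \<le> B * Q (along I x (disp t h \<xi> x) \<theta>) ^ p"
      using u_bound[OF ts(2) along_Rn, unfolded jet_bounded_def, rule_format, of js x] that unfolding v_def by auto
    ultimately show ?thesis by (simp add: R_def power_mult_distrib mult_ac)
  qed
  define b where "b = 2 * real d * sqrt h * R"
  have b0: "b \<ge> 0" using R0 h by (simp add: b_def)
  have \<nu>b: "\<bar>\<nu> t x j\<bar> \<le> R" "i < d \<Longrightarrow> \<bar>partial_deriv i (\<lambda>x. \<nu> t x j) x\<bar> \<le> R" if "j < d" for j i
    using jet_boundedD[OF \<nu>_bound[OF ts(1) that x]] by (auto simp: R_def)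
  have rem: "real d ^ 4 * (1 + b) * b ^ 3 * (3 ^ p * R) + 2 * h\<^sup>2 * real d ^ 3 * R\<^sup>2 * (3 ^ p * R) \<le> h * sqrt h * (K1 * Q x ^ (5 * p))"
    using taylor_remainder_le[OF h(1,2), of x] unfolding b_def R_def .
  note jt = avg_jet_taylor[OF d _ v x, of h "\<nu> t x" "\<lambda>j l. \<tau> t x (j, l)" "3 ^ p * R" b, folded disp_def]
  have "\<bar>avg (signs d) (\<lambda>\<xi>. 1 * v (along I x (disp t h \<xi> x) 1) + (\<Sum>m<d. (0 + (h * 0 + sqrt h * (\<Sum>l<d. 0 * \<xi> l))) * partial_deriv m v (along I x (disp t h \<xi> x) 1)))
     - (1 * v x + (\<Sum>m<d. 0 * partial_deriv m v x))
     - h * jet_generator d v 1 (\<lambda>_. 0) (\<nu> t x) (\<lambda>_. 0) (\<lambda>j l. \<tau> t x (j, l)) (\<lambda>_ _. 0) x\<bar>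
     \<le> real d ^ 4 * (1 + b) * b ^ 3 * (3 ^ p * R) + 2 * h\<^sup>2 * real d ^ 3 * R\<^sup>2 * (3 ^ p * R)"
    by (rule jt[of "\<lambda>_. 0" "\<lambda>_ _. 0" "\<lambda>_. 0" 1 R])
      (use seg disp_bounds(1)[OF ts(1) x h(1,2)] b0 h \<nu>b R0 in \<open>auto simp: b_def R_def\<close>)
  also note rem
  finally show "\<bar>avg (signs d) (\<lambda>\<xi>. u (t + h) (move t h \<xi> x)) - u (t + h) x - h * generator d (u (t + h)) (\<nu> t) (\<tau> t) x\<bar>
      \<le> h * sqrt h * (K1 * Q x ^ (5 * p))"
    by (simp add: generator_def jet_generator_def move_along v_def sum_distrib_right)
  assume i: "i < d"
  define e where "e m = (if m = i then 1 else 0 :: real)" for m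
  have e: "(\<Sum>m<d. e m * z m) = z i" for z using i by (simp add: e_def if_distrib[of "\<lambda>a. a * _"] cong: if_cong)
  have "\<bar>avg (signs d) (\<lambda>\<xi>. 0 * v (along I x (disp t h \<xi> x) 1) + (\<Sum>m<d. (e m + disp_deriv t h \<xi> x i m) * partial_deriv m v (along I x (disp t h \<xi> x) 1)))
     - (0 * v x + (\<Sum>m<d. e m * partial_deriv m v x))
     - h * jet_generator d v 0 e (\<nu> t x) (\<lambda>m. partial_deriv i (\<lambda>x. \<nu> t x m) x) (\<lambda>j l. \<tau> t x (j, l)) (\<lambda>m l. partial_deriv i (\<lambda>x. \<tau> t x (m, l)) x) x\<bar>
     \<le> real d ^ 4 * (1 + b) * b ^ 3 * (3 ^ p * R) + 2 * h\<^sup>2 * real d ^ 3 * R\<^sup>2 * (3 ^ p * R)"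
    by (rule jt[of "\<lambda>m. partial_deriv i (\<lambda>x. \<nu> t x m) x" "\<lambda>m l. partial_deriv i (\<lambda>x. \<tau> t x (m, l)) x" e 0 R, folded disp_deriv_def])
      (use seg disp_bounds[OF ts(1) x h(1,2)] b0 h \<nu>b R0 i in \<open>auto simp: b_def R_def e_def\<close>)
  also note rem
  also have "jet_generator d v 0 e (\<nu> t x) (\<lambda>m. partial_deriv i (\<lambda>x. \<nu> t x m) x) (\<lambda>j l. \<tau> t x (j, l)) (\<lambda>m l. partial_deriv i (\<lambda>x. \<tau> t x (m, l)) x) x
      = generator_deriv d i v (\<nu> t) (\<tau> t) x"
  proof -
    have sw: "partial_derivs [j, k] w y = partial_derivs [k, j] w y" if "j < d" "k < d" "y \<in> Rn I" "w = v \<or> (\<exists>m<d. w = partial_deriv m v)" for j k y w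
    proof (rule partial_derivs_swap)
      show "times_differentiable 2 I w"
        using that(4)
      proof (elim disjE exE conjE)
        fix m assume m: "m < d" "w = partial_deriv m v"
        have "times_differentiable (length [m] + 2) I v" by (rule times_differentiable_mono[OF v]) simp
        from times_differentiable_partial_derivs[OF this] m show ?thesis by simp
      qed (use times_differentiable_mono[OF v, of 2] in simp)
      show "continuous_on (Rn I) (partial_derivs [j, k] w)" "continuous_on (Rn I) (partial_derivs [k, j] w)"
        using that u_cont[OF ts(2), of "[j, k]"] u_cont[OF ts(2), of "[k, j]"] u_cont[OF ts(2), of "[j, k, _]"] u_cont[OF ts(2), of "[k, j, _]"]
        unfolding v_def by auto
    qed (use that in auto)
    have sw3: "partial_derivs [k, j, i] v x = partial_derivs [i, k, j] v x" if "j < d" "k < d" for j k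
    proof -
      have "partial_derivs [k, j, i] v x = partial_deriv k (partial_derivs [j, i] v) x" by simp
      also have "\<dots> = partial_deriv k (partial_derivs [i, j] v) x"
        using sw[OF that(1) i] x that by (intro partial_deriv_cong[of I]) auto
      also have "\<dots> = partial_derivs [k, i] (partial_deriv j v) x" by simp
      also have "\<dots> = partial_derivs [i, k] (partial_deriv j v) x" using sw[OF that(2) i x] that by blast
      finally show ?thesis by simp
    qed
    have A: "(\<Sum>m<d. partial_deriv i (\<lambda>x. \<nu> t x m) x * partial_derivs [m] v x + e m * (\<Sum>j<d. \<nu> t x j * partial_derivs [j, m] v x))
       = (\<Sum>j<d. partial_deriv i (\<lambda>x. \<nu> t x j) x * partial_deriv j v x + \<nu> t x j * partial_derivs [i, j] v x)"
      unfolding sum.distrib e using sw[OF _ i x] by simp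
    define a where "a j k = (\<Sum>l<d. partial_deriv i (\<lambda>x. \<tau> t x (j, l)) x * \<tau> t x (k, l))" for j k
    have a2: "(\<Sum>l<d. \<tau> t x (j, l) * partial_deriv i (\<lambda>x. \<tau> t x (k, l)) x) = a k j" for j k
      by (simp add: a_def mult.commute)
    have "(\<Sum>j<d. \<Sum>k<d. a k j * partial_derivs [k, j] v x) = (\<Sum>j<d. \<Sum>k<d. a j k * partial_derivs [j, k] v x)"
      by (rule sum.swap)
    also have "\<dots> = (\<Sum>j<d. \<Sum>k<d. a j k * partial_derivs [k, j] v x)"
      using sw x by (intro sum.cong refl arg_cong[of _ _ "\<lambda>z. _ * z"]) auto
    finally have ab: "(\<Sum>j<d. \<Sum>k<d. a k j * partial_derivs [k, j] v x) = (\<Sum>j<d. \<Sum>k<d. a j k * partial_derivs [k, j] v x)" .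
    have "(\<Sum>j<d. \<Sum>k<d. \<Sum>l<d.
         (partial_deriv i (\<lambda>x. \<tau> t x (j, l)) x * \<tau> t x (k, l) + \<tau> t x (j, l) * partial_deriv i (\<lambda>x. \<tau> t x (k, l)) x) * partial_derivs [k, j] v x
         + (\<tau> t x (j, l) * \<tau> t x (k, l)) * partial_derivs [i, k, j] v x)
       = (\<Sum>j<d. \<Sum>k<d. (a j k + a k j) * partial_derivs [k, j] v x + (\<Sum>l<d. \<tau> t x (j, l) * \<tau> t x (k, l)) * partial_derivs [i, k, j] v x)"
      by (simp only: sum.distrib sum_distrib_right[symmetric] a2) (simp only: a_def)
    also have "\<dots> = (\<Sum>m<d. 2 * (\<Sum>j<d. a m j * partial_derivs [j, m] v x))
         + (\<Sum>j<d. \<Sum>k<d. (\<Sum>l<d. \<tau> t x (j, l) * \<tau> t x (k, l)) * partial_derivs [i, k, j] v x)"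
      by (simp only: sum.distrib distrib_right ab mult_2)
    also have "(\<Sum>j<d. \<Sum>k<d. (\<Sum>l<d. \<tau> t x (j, l) * \<tau> t x (k, l)) * partial_derivs [i, k, j] v x)
        = (\<Sum>m<d. e m * (\<Sum>j<d. \<Sum>k<d. (\<Sum>l<d. \<tau> t x (j, l) * \<tau> t x (k, l)) * partial_derivs [k, j, m] v x))"
      unfolding e by (intro sum.cong refl) (simp only: sw3 lessThan_iff)
    finally show ?thesis unfolding generator_deriv_def jet_generator_def A a_def by (simp only: sum.distrib mult_zero_left add_0_left add_0_right)
  qed
  also have "(0 * v x + (\<Sum>m<d. e m * partial_deriv m v x)) = partial_deriv i v x" by (simp add: e)
  finally show "\<bar>avg (signs d) (\<lambda>\<xi>. \<Sum>m<d. ((if m = i then 1 else 0) + disp_deriv t h \<xi> x i m) * partial_deriv m (u (t + h)) (move t h \<xi> x))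
        - partial_deriv i (u (t + h)) x - h * generator_deriv d i (u (t + h)) (\<nu> t) (\<tau> t) x\<bar>
      \<le> h * sqrt h * (K1 * Q x ^ (5 * p))"
    by (simp add: move_along v_def e_def)
qed

definition K where "K = K1 + 3 ^ (9 * p) * K2"

lemma K_nonneg: "K1 \<ge> 0" "K2 \<ge> 0" "K \<ge> 0"
proof -
  show "K1 \<ge> 0" "K2 \<ge> 0" unfolding K1_def K2_def using B C4_ge by auto
  then show "K \<ge> 0" by (simp add: K_def)
qed

text \<open>The solution moves by \<open>-h\<close> times generator and source in time, and by \<open>h\<close> times the generator over the random step. The two contributions of the generator cancel, and the source remains.\<close>

lemma one_step_defect:
  assumes t: "0 \<le> t" "t + h \<le> T" and h: "0 < h" "h \<le> 1" "64 * h * real d * (c + 1)\<^sup>2 \<le> 1" and x: "x \<in> Rn I"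
  shows "\<bar>u t x - (h * G t x + avg (signs d) (\<lambda>\<xi>. u (t + h) (move t h \<xi> x)))\<bar> \<le> h * (rate h * K * Q x ^ (9 * p))"
    and "i < d \<Longrightarrow> \<bar>partial_deriv i (u t) x - (h * partial_deriv i (G t) x
        + avg (signs d) (\<lambda>\<xi>. \<Sum>m<d. ((if m = i then 1 else 0) + disp_deriv t h \<xi> x i m) * partial_deriv m (u (t + h)) (move t h \<xi> x)))\<bar>
      \<le> h * (rate h * K * Q x ^ (9 * p))"
proof -
  have ts: "t \<in> {0..T}" "t + h \<in> {0..T}" using t h by auto
  define H where "H y = - (generator d (u (t + h)) (\<nu> t) (\<tau> t) y + G t y)" for y
  define u' where "u' s y = - (generator d (u s) (\<mu> s) (\<sigma> s) y + g s y)" for s y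
  have E: "\<bar>u' s y - H y\<bar> \<le> (rate h * K2) * Q y ^ (9 * p)" if "s \<in> {t..t + h}" "y \<in> Rn I" for s y
    using generator_close[OF that(1) t h(1,2) that(2) d_pos] unfolding jet_close_def u'_def H_def minus_diff_minus abs_minus_cancel by (simp only: mult.assoc)
  have D: "\<exists>D. DERIV (\<lambda>r. u' s (y(i := r)) - H (y(i := r))) (y i) :> D \<and> \<bar>D\<bar> \<le> (rate h * K2) * Q y ^ (9 * p)"
    if "s \<in> {t..t + h}" "y \<in> Rn I" "i < d" for s y i
  proof -
    note c = generator_close[OF that(1) t h(1,2) that(2,3), unfolded jet_close_def]
    from c have "DERIV (\<lambda>r. u' s (y(i := r)) - H (y(i := r))) (y i) :>
       - (generator_deriv d i (u s) (\<mu> s) (\<sigma> s) y + partial_deriv i (g s) y) - - (generator_deriv d i (u (t + h)) (\<nu> t) (\<tau> t) y + partial_deriv i (G t) y)"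
      unfolding u'_def H_def by (intro DERIV_diff DERIV_minus) blast+
    moreover have "\<bar>- (generator_deriv d i (u s) (\<mu> s) (\<sigma> s) y + partial_deriv i (g s) y) - - (generator_deriv d i (u (t + h)) (\<nu> t) (\<tau> t) y + partial_deriv i (G t) y)\<bar> \<le> (rate h * K2) * Q y ^ (9 * p)"
      using c unfolding minus_diff_minus abs_minus_cancel by (simp only: mult.assoc)
    ultimately show ?thesis by blast
  qed
  have H': "DERIV (\<lambda>r. H (x(i := r))) (x i) :> - (generator_deriv d i (u (t + h)) (\<nu> t) (\<tau> t) x + partial_deriv i (G t) x)" if "i < d" for i
  proof -
    have "t \<in> {t..t + h}" using h by simp
    from generator_close[OF this t h(1,2) x that, unfolded jet_close_def]
    show ?thesis unfolding H_def by (intro DERIV_minus) blast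
  qed
  have ti: "\<bar>u (t + h) x - u t x - h * H x\<bar> \<le> h * ((rate h * K2) * Q x ^ (9 * p))"
     "\<bar>partial_deriv i (u (t + h)) x - partial_deriv i (u t) x - h * (- (generator_deriv d i (u (t + h)) (\<nu> t) (\<tau> t) x + partial_deriv i (G t) x))\<bar>
        \<le> h * (3 ^ (9 * p) * (rate h * K2) * Q x ^ (9 * p))" if "i < d" for i
    using time_increment_jet[of I i x h t T u u' H "rate h * K2" "9 * p", OF _ _ x h(1) t _ _ _ E D[OF _ _ that] H'[OF that]]
      u_time[folded u'_def] that rate_nonneg K_nonneg times_differentiable_mono[OF u_diff[OF ts(1)], of 1] times_differentiable_mono[OF u_diff[OF ts(2)], of 1]
    by auto
  have s: "sqrt h \<le> rate h" using rate_ge(2)[OF h(1,2), of "1 / 2"] h by (simp add: powr_half_sqrt)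
  have "h * sqrt h * (K1 * Q x ^ (5 * p)) \<le> h * rate h * (K1 * Q x ^ (9 * p))"
    using s h K_nonneg rate_nonneg[of h] Q_power_mono[of "5 * p" "9 * p" x] Q_power_ge_1[of x "5 * p"] by (intro mult_mono mult_left_mono mult_nonneg_nonneg) auto
  moreover have "h * ((rate h * K2) * Q x ^ (9 * p)) \<le> h * (3 ^ (9 * p) * (rate h * K2) * Q x ^ (9 * p))"
    using h K_nonneg rate_nonneg[of h] Q_power_ge_1[of x "9 * p"] one_le_power[of "3::real" "9 * p"]
      mult_right_mono[of 1 "3 ^ (9 * p)" "h * (rate h * K2 * Q x ^ (9 * p))"] by (simp add: mult_ac)
  moreover have "h * rate h * (K1 * Q x ^ (9 * p)) + h * (3 ^ (9 * p) * (rate h * K2) * Q x ^ (9 * p)) = h * (rate h * K * Q x ^ (9 * p))"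
    by (simp add: K_def algebra_simps)
  ultimately have sum: "\<bar>a\<bar> \<le> h * sqrt h * (K1 * Q x ^ (5 * p)) \<Longrightarrow> \<bar>b\<bar> \<le> h * (3 ^ (9 * p) * (rate h * K2) * Q x ^ (9 * p)) \<Longrightarrow> \<bar>- b - a\<bar> \<le> h * (rate h * K * Q x ^ (9 * p))"
    and mono: "h * ((rate h * K2) * Q x ^ (9 * p)) \<le> h * (3 ^ (9 * p) * (rate h * K2) * Q x ^ (9 * p))" for a b
    by linarith+
  show "\<bar>u t x - (h * G t x + avg (signs d) (\<lambda>\<xi>. u (t + h) (move t h \<xi> x)))\<bar> \<le> h * (rate h * K * Q x ^ (9 * p))"
    using sum[OF step_average(1)[OF t h x] order_trans[OF ti(1)[OF d_pos] mono]] by (simp add: H_def algebra_simps)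
  show "\<bar>partial_deriv i (u t) x - (h * partial_deriv i (G t) x
        + avg (signs d) (\<lambda>\<xi>. \<Sum>m<d. ((if m = i then 1 else 0) + disp_deriv t h \<xi> x i m) * partial_deriv m (u (t + h)) (move t h \<xi> x)))\<bar>
      \<le> h * (rate h * K * Q x ^ (9 * p))" if "i < d"
    using sum[OF step_average(2)[OF t h x that] ti(2)[OF that]] by (simp add: algebra_simps)
qed

end

section \<open>Averages along paths\<close>

definition paths :: "'a set \<Rightarrow> nat \<Rightarrow> 'a list set" where
  "paths A n = {xs. set xs \<subseteq> A \<and> length xs = n}"

lemma finite_paths: "finite A \<Longrightarrow> finite (paths A n)"
  unfolding paths_def by (rule finite_lists_length_eq)

lemma paths_nonempty:
  assumes "A \<noteq> {}" shows "paths A n \<noteq> {}"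
proof -
  obtain a where "a \<in> A" using assms by blast
  then have "replicate n a \<in> paths A n" by (auto simp: paths_def)
  then show ?thesis by blast
qed

lemma avg_paths_0: "avg (paths A 0) f = f []"
proof -
  have "paths A 0 = {[]}" by (auto simp: paths_def)
  then show ?thesis by (simp add: avg_def)
qed

lemma avg_paths_Suc:
  assumes "finite A"
  shows "avg (paths A (Suc n)) f = avg A (\<lambda>a. avg (paths A n) (\<lambda>w. f (a # w)))"
proof -
  have b: "bij_betw (\<lambda>(a, w). a # w) (A \<times> paths A n) (paths A (Suc n))"
    unfolding bij_betw_def
  proof
    show "inj_on (\<lambda>(a, w). a # w) (A \<times> paths A n)" by (auto simp: inj_on_def)
    show "(\<lambda>(a, w). a # w) ` (A \<times> paths A n) = paths A (Suc n)"
      by (auto simp: paths_def length_Suc_conv image_iff)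
  qed
  have "(\<Sum>w\<in>paths A (Suc n). f w) = (\<Sum>a\<in>A. \<Sum>w\<in>paths A n. f (a # w))"
    using sum.reindex_bij_betw[OF b, of f] by (simp add: sum.cartesian_product case_prod_beta')
  moreover have "card (paths A (Suc n)) = card A * card (paths A n)"
    using bij_betw_same_card[OF b] by (simp add: card_cartesian_product)
  ultimately show ?thesis by (simp add: avg_def sum_divide_distrib mult.commute divide_divide_eq_left)
qed

text \<open>A discrete Gronwall argument. The weight \<open>W\<close> grows by at most the factor \<open>1 + L h\<close> on average in each step, and hence so
  does every quantity that is measured relative to it. The function \<open>U\<close> is compared with the average of the path functional \<open>v\<close>.\<close>

locale path_recursion =
  fixes A :: "'a set" and D :: "'z set" and N :: nat and h L :: real
    and next_state :: "nat \<Rightarrow> 'a \<Rightarrow> 'z \<Rightarrow> 'z" and v :: "nat \<Rightarrow> 'a list \<Rightarrow> 'z \<Rightarrow> real"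
    and F :: "'z \<Rightarrow> real" and G :: "nat \<Rightarrow> 'z \<Rightarrow> real" and W :: "'z \<Rightarrow> real"
  assumes A: "finite A" "A \<noteq> {}" and h: "h \<ge> 0" and L: "L \<ge> 0"
    and closed: "k < N \<Longrightarrow> a \<in> A \<Longrightarrow> z \<in> D \<Longrightarrow> next_state k a z \<in> D"
    and v_Nil: "v k [] z = F z" and v_Cons: "v k (a # w) z = h * G k z + v (Suc k) w (next_state k a z)"
    and W: "W z \<ge> 0" and W_step: "k < N \<Longrightarrow> z \<in> D \<Longrightarrow> avg A (\<lambda>a. W (next_state k a z)) \<le> (1 + L * h) * W z"
begin

lemma bias_bound:
  assumes \<eta>: "\<eta> \<ge> 0" and \<delta>: "\<delta> \<ge> 0"
    and defect: "\<And>k z. k < N \<Longrightarrow> z \<in> D \<Longrightarrow> \<bar>U k z - (h * G k z + avg A (\<lambda>a. U (Suc k) (next_state k a z)))\<bar> \<le> h * \<eta> * W z"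
    and final: "\<And>z. z \<in> D \<Longrightarrow> \<bar>U N z - F z\<bar> \<le> \<delta> * W z"
  shows "k + n = N \<Longrightarrow> z \<in> D \<Longrightarrow> \<bar>U k z - avg (paths A n) (\<lambda>w. v k w z)\<bar> \<le> (1 + L * h) ^ n * (\<delta> + real n * h * \<eta>) * W z"
proof (induction n arbitrary: k z)
  case 0
  then show ?case using final by (simp add: avg_paths_0 v_Nil)
next
  case (Suc n)
  then have k: "k < N" by simp
  define C where "C = (1 + L * h) ^ n * (\<delta> + real n * h * \<eta>)"
  have C: "C \<ge> 0" unfolding C_def using L h \<eta> \<delta> by simp
  have "avg (paths A (Suc n)) (\<lambda>w. v k w z) = h * G k z + avg A (\<lambda>a. avg (paths A n) (\<lambda>w. v (Suc k) w (next_state k a z)))"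
    unfolding avg_paths_Suc[OF A(1)] v_Cons avg_add using A finite_paths[OF A(1)] paths_nonempty[OF A(2)] by (simp add: avg_const)
  then have "\<bar>U k z - avg (paths A (Suc n)) (\<lambda>w. v k w z)\<bar>
     \<le> \<bar>U k z - (h * G k z + avg A (\<lambda>a. U (Suc k) (next_state k a z)))\<bar>
       + \<bar>avg A (\<lambda>a. U (Suc k) (next_state k a z) - avg (paths A n) (\<lambda>w. v (Suc k) w (next_state k a z)))\<bar>"
    unfolding avg_diff by linarith
  also have "\<dots> \<le> h * \<eta> * W z + avg A (\<lambda>a. \<bar>U (Suc k) (next_state k a z) - avg (paths A n) (\<lambda>w. v (Suc k) w (next_state k a z))\<bar>)"
    by (intro add_mono defect k Suc.prems avg_abs)
  also have "\<dots> \<le> h * \<eta> * W z + avg A (\<lambda>a. C * W (next_state k a z))"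
    unfolding C_def using Suc.prems closed[OF k] by (intro add_left_mono avg_mono Suc.IH) auto
  also have "\<dots> \<le> h * \<eta> * W z + C * ((1 + L * h) * W z)"
    unfolding avg_cmult using W_step[OF k Suc.prems(2)] C by (intro add_left_mono mult_left_mono) auto
  also have "\<dots> \<le> (1 + L * h) ^ Suc n * (h * \<eta>) * W z + C * ((1 + L * h) * W z)"
  proof (rule add_right_mono)
    have "1 \<le> (1 + L * h) ^ Suc n" using L h by (intro one_le_power) simp
    from mult_right_mono[OF this, of "h * \<eta> * W z"] show "h * \<eta> * W z \<le> (1 + L * h) ^ Suc n * (h * \<eta>) * W z"
      using h \<eta> W by (simp add: mult.assoc)
  qed
  also have "\<dots> = (1 + L * h) ^ Suc n * (\<delta> + real (Suc n) * h * \<eta>) * W z"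
    unfolding C_def by (simp add: algebra_simps)
  finally show ?case .
qed

lemma second_moment_bound:
  assumes b: "b \<ge> 0"
    and G: "\<And>k z. k < N \<Longrightarrow> z \<in> D \<Longrightarrow> (G k z)\<^sup>2 \<le> b * W z"
    and F: "\<And>z. z \<in> D \<Longrightarrow> (F z)\<^sup>2 \<le> b * W z"
  shows "k + n = N \<Longrightarrow> z \<in> D \<Longrightarrow> avg (paths A n) (\<lambda>w. (v k w z)\<^sup>2) \<le> ((1 + h) * (1 + L * h)) ^ n * (1 + real n * h) * b * W z"
proof (induction n arbitrary: k z)
  case 0
  then show ?case using F by (simp add: avg_paths_0 v_Nil)
next
  case (Suc n)
  then have k: "k < N" by simp
  define E where "E = (1 + h) * (1 + L * h)"
  have E1: "E \<ge> 1 + h" unfolding E_def using h L mult_left_mono[of 1 "1 + L * h" "1 + h"] by auto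
  have E: "E \<ge> 1 + h" "E \<ge> 1" using E1 h by auto
  define C where "C = E ^ n * (1 + real n * h) * b"
  have C: "C \<ge> 0" unfolding C_def using E h b by simp
  \<comment> \<open>A weighted square that loses only a factor \<open>1 + h\<close> per step, so that the loss over all steps stays bounded.\<close>
  have sq: "(h * x + y)\<^sup>2 \<le> (1 + h) * y\<^sup>2 + h * (1 + h) * x\<^sup>2" for x y
  proof -
    have "0 \<le> h * (x - y)\<^sup>2" using h by simp
    then show ?thesis by (simp add: power2_eq_square algebra_simps)
  qed
  have "avg (paths A (Suc n)) (\<lambda>w. (v k w z)\<^sup>2) \<le> avg A (\<lambda>a. avg (paths A n) (\<lambda>w. (1 + h) * (v (Suc k) w (next_state k a z))\<^sup>2 + h * (1 + h) * (G k z)\<^sup>2))"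
    unfolding avg_paths_Suc[OF A(1)] v_Cons by (intro avg_mono sq)
  also have "\<dots> = (1 + h) * avg A (\<lambda>a. avg (paths A n) (\<lambda>w. (v (Suc k) w (next_state k a z))\<^sup>2)) + h * (1 + h) * (G k z)\<^sup>2"
    unfolding avg_add avg_cmult using A finite_paths[OF A(1)] paths_nonempty[OF A(2)] by (simp add: avg_const)
  also have "\<dots> \<le> (1 + h) * avg A (\<lambda>a. C * W (next_state k a z)) + h * (1 + h) * (b * W z)"
    unfolding C_def E_def using Suc.prems closed[OF k] h k
    by (intro add_mono mult_left_mono avg_mono Suc.IH G) auto
  also have "\<dots> \<le> (1 + h) * (C * ((1 + L * h) * W z)) + h * (1 + h) * (b * W z)"
    unfolding avg_cmult using W_step[OF k Suc.prems(2)] C h by (intro add_right_mono mult_left_mono) auto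
  also have "\<dots> \<le> (1 + h) * (C * ((1 + L * h) * W z)) + E ^ Suc n * (h * (b * W z))"
  proof (rule add_left_mono)
    have "1 + h \<le> E ^ Suc n" using order_trans[OF E(1) self_le_power[OF E(2), of "Suc n"]] by blast
    from mult_right_mono[OF this, of "h * (b * W z)"] show "h * (1 + h) * (b * W z) \<le> E ^ Suc n * (h * (b * W z))"
      using h b W by (simp add: mult_ac)
  qed
  also have "\<dots> = E ^ Suc n * (1 + real (Suc n) * h) * b * W z"
    unfolding C_def by (simp add: E_def algebra_simps)
  finally show ?case unfolding E_def .
qed

end

section \<open>The scheme and its derivative\<close>

context euler_setting
begin

text \<open>The functional of a path whose average approximates \<open>u\<close>: the final datum at the end point plus the Riemann sum of the source.\<close>

primrec path_value :: "real \<Rightarrow> nat \<Rightarrow> (nat \<Rightarrow> real) list \<Rightarrow> (nat \<Rightarrow> real) \<Rightarrow> real" where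
  "path_value h k [] x = F x"
| "path_value h k (\<xi> # w) x = h * G (real k * h) x + path_value h (Suc k) w (move (real k * h) h \<xi> x)"

definition move_deriv where
  "move_deriv t h \<xi> x y = (\<lambda>j\<in>I. y j + (\<Sum>i<d. disp_deriv t h \<xi> x i j * y i))"

text \<open>The derivative of the path functional at \<open>x\<close> in direction \<open>y\<close> satisfies a recursion of the same type on pairs \<open>(x, y)\<close>, in which the direction is carried along by the linearized step.\<close>

primrec path_deriv :: "real \<Rightarrow> nat \<Rightarrow> (nat \<Rightarrow> real) list \<Rightarrow> (nat \<Rightarrow> real) \<times> (nat \<Rightarrow> real) \<Rightarrow> real" where
  "path_deriv h k [] z = (\<Sum>i<d. partial_deriv i F (fst z) * snd z i)"
| "path_deriv h k (\<xi> # w) z = h * (\<Sum>i<d. partial_deriv i (G (real k * h)) (fst z) * snd z i)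
     + path_deriv h (Suc k) w (move (real k * h) h \<xi> (fst z), move_deriv (real k * h) h \<xi> (fst z) (snd z))"

lemma has_grad_move:
  assumes t: "t \<in> {0..T}" and x: "x \<in> Rn I" and j: "j < d"
  shows "has_grad I (\<lambda>x. move t h \<xi> x j) (\<lambda>i. (if i = j then 1 else 0) + disp_deriv t h \<xi> x i j) x"
proof -
  have "has_grad I (\<lambda>x. x j + (h * \<nu> t x j + sqrt h * (\<Sum>l<d. \<xi> l * \<tau> t x (j, l))))
     (\<lambda>i. (if i = j then 1 else 0) + (h * partial_deriv i (\<lambda>x. \<nu> t x j) x + sqrt h * (\<Sum>l<d. \<xi> l * partial_deriv i (\<lambda>x. \<tau> t x (j, l)) x))) x"
    using j x \<nu>_diff[OF t j] \<tau>_diff[OF t j]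
    by (intro has_grad_add has_grad_cmult has_grad_sum has_grad_proj times_differentiable_has_grad[of I 0]) auto
  then show ?thesis
    by (rule has_grad_cong) (use x j in \<open>auto simp: move_def disp_def disp_deriv_def mult.commute\<close>)
qed

lemma has_grad_path_value:
  assumes h: "h \<ge> 0" and x: "x \<in> Rn I" and k: "real (k + length w) * h \<le> T"
  shows "\<exists>a. has_grad I (path_value h k w) a x \<and> (\<forall>y. path_deriv h k w (x, y) = (\<Sum>i<d. a i * y i))"
  using x k
proof (induction w arbitrary: k x)
  case Nil
  have "has_grad I F (\<lambda>i. partial_deriv i F x) x"
    by (rule times_differentiable_has_grad[of I 0]) (use F_diff Nil in auto)
  then show ?case by (intro exI[of _ "\<lambda>i. partial_deriv i F x"]) (auto simp: has_grad_def)
next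
  case (Cons \<xi> w)
  define t where "t = real k * h"
  have "real k * h \<le> real (k + length (\<xi> # w)) * h" using h by (intro mult_right_mono) auto
  then have t: "t \<in> {0..T}" using Cons.prems h by (simp add: t_def)
  obtain a where a: "has_grad I (path_value h (Suc k) w) a (move t h \<xi> x)"
      "\<And>y. path_deriv h (Suc k) w (move t h \<xi> x, y) = (\<Sum>i<d. a i * y i)"
    using Cons.IH[of "move t h \<xi> x" "Suc k"] Cons.prems by auto
  define e where "e j i = (if i = j then 1 else 0) + disp_deriv t h \<xi> x i j" for j i
  have "has_grad I (\<lambda>x. path_value h (Suc k) w (move t h \<xi> x)) (\<lambda>i. \<Sum>j<d. a j * e j i) x"
    unfolding e_def by (rule has_grad_chain) (use a has_grad_move[OF t Cons.prems(1)] in auto)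
  moreover have "has_grad I (G t) (\<lambda>i. partial_deriv i (G t) x) x"
    by (rule times_differentiable_has_grad[of I 0]) (use G_diff[OF t] Cons.prems in auto)
  ultimately have "has_grad I (\<lambda>x. h * G t x + path_value h (Suc k) w (move t h \<xi> x)) (\<lambda>i. h * partial_deriv i (G t) x + (\<Sum>j<d. a j * e j i)) x"
    by (intro has_grad_add has_grad_cmult)
  then have 1: "has_grad I (path_value h k (\<xi> # w)) (\<lambda>i. h * partial_deriv i (G t) x + (\<Sum>j<d. a j * e j i)) x"
    by (simp add: t_def fun_eq_iff has_grad_def)
  have "path_deriv h k (\<xi> # w) (x, y) = (\<Sum>i<d. (h * partial_deriv i (G t) x + (\<Sum>j<d. a j * e j i)) * y i)" for y
  proof -
    have "(\<Sum>j<d. a j * move_deriv t h \<xi> x y j) = (\<Sum>j<d. a j * (\<Sum>i<d. e j i * y i))"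
      by (intro sum.cong refl) (simp add: move_deriv_def e_def distrib_right sum.distrib if_distrib[of "\<lambda>a. a * _"] cong: if_cong)
    also have "\<dots> = (\<Sum>i<d. (\<Sum>j<d. a j * e j i) * y i)"
      unfolding sum_distrib_left sum_distrib_right by (subst sum.swap) (simp add: mult.assoc)
    finally show ?thesis
      using a(2) by (simp add: t_def[symmetric] distrib_right sum.distrib sum_distrib_left mult.assoc)
  qed
  with 1 show ?case by blast
qed

definition pair_weight :: "(nat \<Rightarrow> real) \<times> (nat \<Rightarrow> real) \<Rightarrow> real" where
  "pair_weight z = 1 + (\<Sum>i<d. (fst z i)\<^sup>2) + (\<Sum>i<d. (snd z i)\<^sup>2)"

lemma pair_weight_ge: "pair_weight z \<ge> 1" "Q (fst z) \<le> pair_weight z" "i < d \<Longrightarrow> \<bar>snd z i\<bar> \<le> pair_weight z"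
proof -
  have n: "(\<Sum>i<d. (fst z i)\<^sup>2) \<ge> 0" "(\<Sum>i<d. (snd z i)\<^sup>2) \<ge> 0" by (auto intro: sum_nonneg)
  then show "pair_weight z \<ge> 1" "Q (fst z) \<le> pair_weight z" by (auto simp: pair_weight_def sqweight_def)
  show "\<bar>snd z i\<bar> \<le> pair_weight z" if "i < d"
  proof -
    have "(snd z i)\<^sup>2 \<le> (\<Sum>i<d. (snd z i)\<^sup>2)" using that by (intro member_le_sum) auto
    moreover have "\<bar>snd z i\<bar> \<le> 1 + (snd z i)\<^sup>2"
    proof -
      have "0 \<le> (\<bar>snd z i\<bar> - 1)\<^sup>2" by simp
      then show ?thesis by (simp add: power2_diff)
    qed
    ultimately show ?thesis using n by (simp add: pair_weight_def)
  qed
qed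

definition rate_c where "rate_c q = (8 * real q + 56 * 3 ^ q) * c"

text \<open>A pair of a point and a direction also performs a random step, now in \<open>\<real>\<^sup>2\<^sup>d\<close> and with the augmented coefficients. Their linear growth is bounded by \<open>c\<close>, so the moment estimate for a single step covers gradients as well.\<close>

lemma pair_weight_step:
  assumes t: "t \<in> {0..T}" and h: "0 \<le> h" "64 * h * real d * (c + 1)\<^sup>2 \<le> 1" and z: "fst z \<in> Rn I" "snd z \<in> Rn I"
  shows "avg (signs d) (\<lambda>\<xi>. pair_weight (move t h \<xi> (fst z), move_deriv t h \<xi> (fst z) (snd z)) ^ q) \<le> (1 + rate_c q * h) * pair_weight z ^ q"
proof -
  obtain x y where xy: "z = (x, y)" by (cases z)
  define zz where "zz = case_sum x y"
  define bb where "bb = case_sum (\<nu> t x) (\<lambda>j. \<Sum>i<d. partial_deriv i (\<lambda>x. \<nu> t x j) x * y i)"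
  define SS where "SS = case_sum (\<lambda>j l. \<tau> t x (j, l)) (\<lambda>j l. \<Sum>i<d. partial_deriv i (\<lambda>x. \<tau> t x (j, l)) x * y i)"
  have P: "(\<Sum>j\<in>I <+> I. f j) = (\<Sum>j<d. f (Inl j)) + (\<Sum>j<d. f (Inr j))" for f :: "nat + nat \<Rightarrow> real"
    by (simp add: sum.Plus)
  interpret st: random_step "I <+> I" d c h zz bb SS
    using \<nu>_growth[OF t z[unfolded xy fst_conv snd_conv]] \<tau>_growth[OF t z[unfolded xy fst_conv snd_conv]] d c h
    by unfold_locales (auto simp: P zz_def bb_def SS_def add.assoc)
  have "st.Q = pair_weight z" unfolding st.Q_def P unfolding zz_def xy pair_weight_def by simp
  moreover have "1 + (\<Sum>j\<in>I <+> I. (zz j + st.step \<xi> j)\<^sup>2) = pair_weight (move t h \<xi> x, move_deriv t h \<xi> x y)" for \<xi>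
  proof -
    have "st.step \<xi> (Inl j) = disp t h \<xi> x j" for j
      unfolding st.step_def unfolding bb_def SS_def disp_def by simp
    moreover have "st.step \<xi> (Inr j) = (\<Sum>i<d. disp_deriv t h \<xi> x i j * y i)" for j
    proof -
      have "(\<Sum>l<d. (\<Sum>i<d. partial_deriv i (\<lambda>x. \<tau> t x (j, l)) x * y i) * \<xi> l) = (\<Sum>i<d. (\<Sum>l<d. partial_deriv i (\<lambda>x. \<tau> t x (j, l)) x * \<xi> l) * y i)"
        unfolding sum_distrib_right by (subst sum.swap) (simp add: mult_ac)
      then show ?thesis
        unfolding st.step_def unfolding bb_def SS_def disp_deriv_def
        by (simp only: sum.case distrib_right sum.distrib mult.assoc sum_distrib_left[symmetric])
    qed
    ultimately show ?thesis by (simp add: P zz_def pair_weight_def move_def move_deriv_def)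
  qed
  ultimately show ?thesis using st.avg_moment[of q] by (simp add: xy rate_c_def mult.assoc)
qed

lemma linear_bound:
  assumes "\<And>i. i < d \<Longrightarrow> \<bar>a i\<bar> \<le> C * Q (fst z) ^ n" "C \<ge> 0"
  shows "\<bar>\<Sum>i<d. a i * snd z i\<bar> \<le> real d * C * pair_weight z ^ Suc n"
proof -
  have "\<bar>\<Sum>i<d. a i * snd z i\<bar> \<le> real d * ((C * pair_weight z ^ n) * pair_weight z)"
  proof (intro sum_abs_bound)
    fix i assume i: "i < d"
    have "C * Q (fst z) ^ n \<le> C * pair_weight z ^ n"
      using pair_weight_ge(2) assms(2) sqweight_pos[of I] by (intro mult_left_mono power_mono) (auto simp: less_imp_le)
    then show "\<bar>a i * snd z i\<bar> \<le> (C * pair_weight z ^ n) * pair_weight z"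
      unfolding abs_mult using assms(1)[OF i] pair_weight_ge(3)[OF i] pair_weight_ge(1)[of z] assms(2) by (intro mult_mono) auto
  qed
  then show ?thesis by (simp add: mult_ac)
qed

lemma value_bound:
  assumes "\<bar>a\<bar> \<le> C * Q (fst z) ^ n" "C \<ge> 0" "n \<le> m"
  shows "\<bar>a\<bar> \<le> real d * C * pair_weight z ^ m"
proof -
  have "C * Q (fst z) ^ n \<le> C * pair_weight z ^ n"
    using pair_weight_ge(2) assms(2) sqweight_pos[of I] by (intro mult_left_mono power_mono) (auto simp: less_imp_le)
  also have "\<dots> \<le> (real d * C) * pair_weight z ^ m"
    using d_real pair_weight_ge(1)[of z] assms mult_right_mono[OF d_real, of C] by (intro mult_mono power_increasing) auto
  finally show ?thesis using assms(1) by simp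
qed

text \<open>The Gronwall argument is used twice on pairs of a point and a direction, once for the values and once for the directional derivatives; both are measured by the weight of the pair.\<close>

theorem scheme_bounds:
  fixes N :: nat
  defines "h \<equiv> T / real N" and "q \<equiv> 9 * p + 1"
  assumes N: "N > 0" and h1: "h \<le> 1" and hd: "64 * h * real d * (c + 1)\<^sup>2 \<le> 1" and x: "x \<in> Rn I" and y: "y \<in> Rn I"
  shows "\<bar>u 0 x - avg (paths (signs d) N) (\<lambda>w. path_value h 0 w x)\<bar>
           \<le> exp (rate_c q * T) * (real d * (B + T * K) * rate h) * pair_weight (x, y) ^ q" (is ?A)
    and "\<bar>(\<Sum>i<d. partial_deriv i (u 0) x * y i) - avg (paths (signs d) N) (\<lambda>w. path_deriv h 0 w (x, y))\<bar>
           \<le> exp (rate_c q * T) * (real d * (B + T * K) * rate h) * pair_weight (x, y) ^ q" (is ?B)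
    and "avg (paths (signs d) N) (\<lambda>w. (path_value h 0 w x)\<^sup>2)
           \<le> exp (T + rate_c q * T) * (1 + T) * (real d * B)\<^sup>2 * pair_weight (x, y) ^ q" (is ?C)
    and "avg (paths (signs d) N) (\<lambda>w. (path_deriv h 0 w (x, y))\<^sup>2)
           \<le> exp (T + rate_c q * T) * (1 + T) * (real d * B)\<^sup>2 * pair_weight (x, y) ^ q" (is ?D)
proof -
  have h0: "h > 0" "h \<ge> 0" using N T by (auto simp: h_def)
  have Nh: "real N * h = T" using N by (simp add: h_def)
  have L: "rate_c q \<ge> 0" using c by (simp add: rate_c_def)
  have tk: "real k * h \<in> {0..T}" "real k * h + h \<le> T" "real (Suc k) * h = real k * h + h" if "k < N" for k
  proof -
    have "real (Suc k) * h \<le> real N * h" using that h0 by (intro mult_right_mono) auto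
    then show "real k * h + h \<le> T" "real (Suc k) * h = real k * h + h" using Nh by (auto simp: algebra_simps)
    then show "real k * h \<in> {0..T}" using h0 by auto
  qed
  define D where "D = Rn I \<times> Rn I"
  define st where "st k \<xi> z = (move (real k * h) h \<xi> (fst z), move_deriv (real k * h) h \<xi> (fst z) (snd z))" for k \<xi> z
  have W_step: "avg (signs d) (\<lambda>\<xi>. pair_weight (st k \<xi> z) ^ q) \<le> (1 + rate_c q * h) * pair_weight z ^ q" if "k < N" "z \<in> D" for k z
    unfolding st_def using that tk h0 hd by (intro pair_weight_step) (auto simp: D_def)
  have closed: "st k \<xi> z \<in> D" for k \<xi> z by (simp add: st_def D_def move_deriv_def)
  interpret V: path_recursion "signs d" D N h "rate_c q" st "\<lambda>k w z. path_value h k w (fst z)" "\<lambda>z. F (fst z)" "\<lambda>k z. G (real k * h) (fst z)" "\<lambda>z. pair_weight z ^ q"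
    by unfold_locales (use h0 L W_step closed pair_weight_ge(1) in \<open>auto simp: st_def intro!: order_trans[OF zero_le_one] one_le_power\<close>)
  interpret P: path_recursion "signs d" D N h "rate_c q" st "path_deriv h"
      "\<lambda>z. \<Sum>i<d. partial_deriv i F (fst z) * snd z i" "\<lambda>k z. \<Sum>i<d. partial_deriv i (G (real k * h)) (fst z) * snd z i" "\<lambda>z. pair_weight z ^ q"
    by unfold_locales (use h0 L W_step closed pair_weight_ge(1) in \<open>auto simp: st_def intro!: order_trans[OF zero_le_one] one_le_power\<close>)
  define \<eta> where "\<eta> = real d * (rate h * K)"
  have \<eta>: "\<eta> \<ge> 0" by (simp add: \<eta>_def rate_nonneg K_nonneg)
  have xy: "(x, y) \<in> D" using x y by (simp add: D_def)
  have dB: "real d * (\<delta> * B) \<ge> 0" using \<delta> B by simp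
  have total: "(1 + rate_c q * h) ^ N * (real d * (\<delta> * B) + real N * h * \<eta>) * pair_weight (x, y) ^ q
      \<le> exp (rate_c q * T) * (real d * (B + T * K) * rate h) * pair_weight (x, y) ^ q"
  proof (intro mult_right_mono mult_mono)
    have "(1 + rate_c q * h) ^ N \<le> exp (rate_c q * h) ^ N" using L h0 by (intro power_mono) auto
    also have "\<dots> = exp (rate_c q * T)" by (simp add: exp_of_nat_mult[symmetric] Nh[symmetric] mult_ac)
    finally show "(1 + rate_c q * h) ^ N \<le> exp (rate_c q * T)" .
    have "\<delta> * B \<le> rate h * B" using B by (intro mult_right_mono) (auto simp: rate_def)
    then have "real d * (\<delta> * B) \<le> real d * (rate h * B)" by (intro mult_left_mono) auto
    then show "real d * (\<delta> * B) + real N * h * \<eta> \<le> real d * (B + T * K) * rate h"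
      unfolding Nh \<eta>_def by (simp add: algebra_simps)
  qed (use dB \<eta> h0 pair_weight_ge(1)[of "(x, y)"] in auto)
  have "\<bar>u (real 0 * h) (fst (x, y)) - avg (paths (signs d) N) (\<lambda>w. path_value h 0 w (fst (x, y)))\<bar>
      \<le> (1 + rate_c q * h) ^ N * (real d * (\<delta> * B) + real N * h * \<eta>) * pair_weight (x, y) ^ q"
  proof (rule V.bias_bound[where U = "\<lambda>k z. u (real k * h) (fst z)", OF \<eta> dB _ _ _ xy])
    fix k z assume k: "k < N" and z: "z \<in> D"
    have "\<bar>u (real k * h) (fst z) - (h * G (real k * h) (fst z) + avg (signs d) (\<lambda>\<xi>. u (real k * h + h) (move (real k * h) h \<xi> (fst z))))\<bar> \<le> (h * (rate h * K)) * Q (fst z) ^ (9 * p)"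
      using one_step_defect(1)[of "real k * h" h "fst z"] tk[OF k] h0 h1 hd z by (auto simp: D_def mult.assoc)
    moreover have "0 \<le> h * (rate h * K)" using h0 rate_nonneg[of h] K_nonneg by simp
    ultimately have "\<bar>u (real k * h) (fst z) - (h * G (real k * h) (fst z) + avg (signs d) (\<lambda>\<xi>. u (real k * h + h) (move (real k * h) h \<xi> (fst z))))\<bar> \<le> real d * (h * (rate h * K)) * pair_weight z ^ q"
      by (rule value_bound) (simp add: q_def)
    then show "\<bar>u (real k * h) (fst z) - (h * G (real k * h) (fst z) + avg (signs d) (\<lambda>\<xi>. u (real (Suc k) * h) (fst (st k \<xi> z))))\<bar> \<le> h * \<eta> * pair_weight z ^ q"
      unfolding tk(3)[OF k] st_def fst_conv \<eta>_def by (simp only: mult.assoc mult.left_commute[of h])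
  next
    fix z assume z: "z \<in> D"
    then have "\<bar>u T (fst z) - F (fst z)\<bar> \<le> (\<delta> * B) * Q (fst z) ^ p"
      using jet_diffD(1)[OF f_F, of "fst z"] u_final[of "fst z"] by (auto simp: D_def mult.assoc)
    from value_bound[OF this, of q] show "\<bar>u (real N * h) (fst z) - F (fst z)\<bar> \<le> real d * (\<delta> * B) * pair_weight z ^ q"
      using \<delta> B unfolding Nh by (simp add: q_def)
  qed simp
  with total show ?A by simp
  have "\<bar>(\<Sum>i<d. partial_deriv i (u (real 0 * h)) (fst (x, y)) * snd (x, y) i) - avg (paths (signs d) N) (\<lambda>w. path_deriv h 0 w (x, y))\<bar>
      \<le> (1 + rate_c q * h) ^ N * (real d * (\<delta> * B) + real N * h * \<eta>) * pair_weight (x, y) ^ q"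
  proof (rule P.bias_bound[where U = "\<lambda>k z. \<Sum>i<d. partial_deriv i (u (real k * h)) (fst z) * snd z i", OF \<eta> dB _ _ _ xy])
    fix k z assume k: "k < N" and z: "z \<in> D"
    define t where "t = real k * h"
    have "\<bar>partial_deriv i (u t) (fst z) - (h * partial_deriv i (G t) (fst z)
        + avg (signs d) (\<lambda>\<xi>. \<Sum>m<d. ((if m = i then 1 else 0) + disp_deriv t h \<xi> (fst z) i m) * partial_deriv m (u (t + h)) (move t h \<xi> (fst z))))\<bar>
       \<le> (h * (rate h * K)) * Q (fst z) ^ (9 * p)" if "i < d" for i
      using one_step_defect(2)[of t h "fst z" i] tk[OF k] h0 h1 hd z that by (auto simp: D_def mult.assoc t_def)
    from linear_bound[OF this] have "\<bar>\<Sum>i<d. (partial_deriv i (u t) (fst z) - (h * partial_deriv i (G t) (fst z)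
        + avg (signs d) (\<lambda>\<xi>. \<Sum>m<d. ((if m = i then 1 else 0) + disp_deriv t h \<xi> (fst z) i m) * partial_deriv m (u (t + h)) (move t h \<xi> (fst z))))) * snd z i\<bar>
      \<le> h * \<eta> * pair_weight z ^ q"
      using h0 rate_nonneg[of h] K_nonneg by (simp add: \<eta>_def q_def mult_ac)
    moreover have "(\<Sum>i<d. avg (signs d) (\<lambda>\<xi>. \<Sum>m<d. ((if m = i then 1 else 0) + disp_deriv t h \<xi> (fst z) i m) * partial_deriv m (u (t + h)) (move t h \<xi> (fst z))) * snd z i)
      = avg (signs d) (\<lambda>\<xi>. \<Sum>m<d. partial_deriv m (u (t + h)) (move t h \<xi> (fst z)) * move_deriv t h \<xi> (fst z) (snd z) m)"
    proof -
      have "(\<Sum>i<d. (\<Sum>m<d. ((if m = i then 1 else 0) + disp_deriv t h \<xi> (fst z) i m) * b m) * snd z i)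
         = (\<Sum>m<d. b m * move_deriv t h \<xi> (fst z) (snd z) m)" for \<xi> b
      proof -
        have "(\<Sum>i<d. (\<Sum>m<d. ((if m = i then 1 else 0) + disp_deriv t h \<xi> (fst z) i m) * b m) * snd z i)
          = (\<Sum>m<d. \<Sum>i<d. b m * (((if m = i then 1 else 0) + disp_deriv t h \<xi> (fst z) i m) * snd z i))"
          unfolding sum_distrib_right by (subst sum.swap) (simp add: mult_ac)
        also have "\<dots> = (\<Sum>m<d. b m * move_deriv t h \<xi> (fst z) (snd z) m)"
          by (intro sum.cong refl) (simp add: move_deriv_def sum_distrib_left[symmetric] distrib_right sum.distrib if_distrib[of "\<lambda>a. a * _"] cong: if_cong)
        finally show ?thesis .
      qed
      then show ?thesis unfolding avg_multc[symmetric] avg_sum[symmetric] by simp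
    qed
    ultimately show "\<bar>(\<Sum>i<d. partial_deriv i (u (real k * h)) (fst z) * snd z i) - (h * (\<Sum>i<d. partial_deriv i (G (real k * h)) (fst z) * snd z i)
        + avg (signs d) (\<lambda>\<xi>. \<Sum>i<d. partial_deriv i (u (real (Suc k) * h)) (fst (st k \<xi> z)) * snd (st k \<xi> z) i))\<bar> \<le> h * \<eta> * pair_weight z ^ q"
      unfolding tk(3)[OF k] by (simp add: st_def t_def[symmetric] left_diff_distrib distrib_right sum_subtractf sum.distrib sum_distrib_left mult.assoc)
  next
    fix z assume z: "z \<in> D"
    have uT: "partial_deriv i (u T) (fst z) = partial_deriv i f (fst z)" if "i < d" for i
      by (rule partial_deriv_cong[of I]) (use u_final that z in \<open>auto simp: D_def\<close>)
    have "\<bar>partial_deriv i (u T) (fst z) - partial_deriv i F (fst z)\<bar> \<le> (\<delta> * B) * Q (fst z) ^ p" if "i < d" for i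
      using jet_diffD(2)[OF f_F, of "fst z" i] uT[OF that] z that by (auto simp: D_def mult.assoc)
    from linear_bound[OF this] have "\<bar>\<Sum>i<d. (partial_deriv i (u T) (fst z) - partial_deriv i F (fst z)) * snd z i\<bar> \<le> real d * (\<delta> * B) * pair_weight z ^ Suc p"
      using \<delta> B by simp
    also have "\<dots> \<le> real d * (\<delta> * B) * pair_weight z ^ q"
      using dB pair_weight_ge(1)[of z] p by (intro mult_left_mono power_increasing) (auto simp: q_def)
    finally show "\<bar>(\<Sum>i<d. partial_deriv i (u (real N * h)) (fst z) * snd z i) - (\<Sum>i<d. partial_deriv i F (fst z) * snd z i)\<bar> \<le> real d * (\<delta> * B) * pair_weight z ^ q"
      unfolding Nh by (simp add: left_diff_distrib sum_subtractf)
  qed simp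
  with total show ?B by simp
  have mom: "((1 + h) * (1 + rate_c q * h)) ^ N * (1 + real N * h) * (real d * B)\<^sup>2 * pair_weight (x, y) ^ q
     \<le> exp (T + rate_c q * T) * (1 + T) * (real d * B)\<^sup>2 * pair_weight (x, y) ^ q"
  proof (intro mult_right_mono)
    have "((1 + h) * (1 + rate_c q * h)) ^ N \<le> (exp h * exp (rate_c q * h)) ^ N"
      using L h0 by (intro power_mono mult_mono) auto
    also have "\<dots> = exp (real N * h + rate_c q * (real N * h))" by (simp add: exp_of_nat_mult[symmetric] exp_add[symmetric] algebra_simps)
    finally show "((1 + h) * (1 + rate_c q * h)) ^ N * (1 + real N * h) \<le> exp (T + rate_c q * T) * (1 + T)"
      unfolding Nh using T by (intro mult_right_mono) auto
  qed (use pair_weight_ge(1)[of "(x, y)"] in auto)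
  have sq: "a\<^sup>2 \<le> (real d * B)\<^sup>2 * pair_weight z ^ q" if "\<bar>a\<bar> \<le> real d * B * pair_weight z ^ Suc p" for a z
  proof -
    have "a\<^sup>2 \<le> (real d * B * pair_weight z ^ Suc p)\<^sup>2" using that by (intro abs_le_square_iff[THEN iffD1]) auto
    also have "\<dots> = (real d * B)\<^sup>2 * pair_weight z ^ (2 * Suc p)" by (simp add: power_mult_distrib power_mult[symmetric] mult.commute del: power_Suc)
    also have "\<dots> \<le> (real d * B)\<^sup>2 * pair_weight z ^ q"
      using pair_weight_ge(1)[of z] p by (intro mult_left_mono power_increasing) (auto simp: q_def)
    finally show ?thesis .
  qed
  have "avg (paths (signs d) N) (\<lambda>w. (path_value h 0 w (fst (x, y)))\<^sup>2) \<le> ((1 + h) * (1 + rate_c q * h)) ^ N * (1 + real N * h) * (real d * B)\<^sup>2 * pair_weight (x, y) ^ q"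
  proof (rule V.second_moment_bound[OF _ _ _ _ xy])
    show "(G (real k * h) (fst z))\<^sup>2 \<le> (real d * B)\<^sup>2 * pair_weight z ^ q" if "k < N" "z \<in> D" for k z
      using jet_boundedD(1)[OF G_bound[OF tk(1)[OF that(1)], of "fst z"]] that B by (intro sq value_bound) (auto simp: D_def)
    show "(F (fst z))\<^sup>2 \<le> (real d * B)\<^sup>2 * pair_weight z ^ q" if "z \<in> D" for z
      using jet_boundedD(1)[OF F_bound, of "fst z"] that B by (intro sq value_bound) (auto simp: D_def)
  qed auto
  with mom show ?C by simp
  have "avg (paths (signs d) N) (\<lambda>w. (path_deriv h 0 w (x, y))\<^sup>2) \<le> ((1 + h) * (1 + rate_c q * h)) ^ N * (1 + real N * h) * (real d * B)\<^sup>2 * pair_weight (x, y) ^ q"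
  proof (rule P.second_moment_bound[OF _ _ _ _ xy])
    show "(\<Sum>i<d. partial_deriv i (G (real k * h)) (fst z) * snd z i)\<^sup>2 \<le> (real d * B)\<^sup>2 * pair_weight z ^ q" if "k < N" "z \<in> D" for k z
      using jet_boundedD(2)[OF G_bound[OF tk(1)[OF that(1)], of "fst z"]] that B by (intro sq linear_bound) (auto simp: D_def)
    show "(\<Sum>i<d. partial_deriv i F (fst z) * snd z i)\<^sup>2 \<le> (real d * B)\<^sup>2 * pair_weight z ^ q" if "z \<in> D" for z
      using jet_boundedD(2)[OF F_bound, of "fst z"] that B by (intro sq linear_bound) (auto simp: D_def)
  qed auto
  with mom show ?D by simp
qed

end

section \<open>Measurability on the cube\<close>

lemma has_grad_continuous:
  assumes I: "finite I" and g: "\<And>x. x \<in> Rn I \<Longrightarrow> \<exists>a. has_grad I h a x"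
  shows "continuous_on (Rn I) h"
  unfolding continuous_on_def
proof
  fix x assume x: "x \<in> Rn I"
  obtain a where a: "has_grad I h a x" using g[OF x] by blast
  let ?l = "\<lambda>y. L2_set (\<lambda>i. y i - x i) I"
  have "((\<lambda>y. y i) \<longlongrightarrow> x i) (at x within Rn I)" for i
    using continuous_on_subset[OF continuous_on_product_coordinates, of "Rn I" i] x unfolding continuous_on_def by blast
  then have "(?l \<longlongrightarrow> sqrt (\<Sum>i\<in>I. (x i - x i)\<^sup>2)) (at x within Rn I)"
    unfolding L2_set_def by (intro tendsto_real_sqrt tendsto_sum tendsto_power tendsto_diff tendsto_const)
  then have l0: "(?l \<longlongrightarrow> 0) (at x within Rn I)" by simp
  have "eventually (\<lambda>y. y \<in> Rn I) (at x within Rn I)" by (simp add: eventually_at_filter)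
  then have lim: "filterlim (\<lambda>y. y) (near I x) (at x within Rn I)"
    unfolding near_def using l0 by (simp add: filterlim_inf filterlim_principal filterlim_filtercomap_iff o_def)
  have "(\<lambda>y. h y - h x) \<in> O[at x within Rn I](?l)"
    by (rule landau_o.big.compose[OF has_grad_bigo[OF I a] lim])
  moreover have "?l \<in> o[at x within Rn I](\<lambda>_. 1)" using l0 by (simp add: smalloI_tendsto)
  ultimately have "(\<lambda>y. h y - h x) \<in> o[at x within Rn I](\<lambda>_. 1)" by (rule landau_o.big_small_trans)
  then have "((\<lambda>y. h y - h x) \<longlongrightarrow> 0) (at x within Rn I)" by (auto dest: smalloD_tendsto)
  then show "(h \<longlongrightarrow> h x) (at x within Rn I)" by (simp add: LIM_zero_iff)
qed

lemma continuous_measurable_PiM: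
  fixes h :: "(nat \<Rightarrow> real) \<Rightarrow> real"
  assumes "continuous_on (Rn I) h"
  shows "h \<in> borel_measurable (PiM I (\<lambda>_. lborel))"
proof -
  have sp: "space (PiM I (\<lambda>_. lborel :: real measure)) = Rn I" by (simp add: space_PiM Rn_def)
  have "(\<lambda>x. x) \<in> measurable (PiM I (\<lambda>_. lborel)) (PiM UNIV (\<lambda>_. borel :: real measure))"
  proof (rule measurable_PiM_single')
    fix i :: nat
    show "(\<lambda>x. x i) \<in> borel_measurable (PiM I (\<lambda>_. lborel :: real measure))"
    proof (cases "i \<in> I")
      case True
      then have "(\<lambda>x. x i) \<in> measurable (PiM I (\<lambda>_. lborel :: real measure)) (lborel :: real measure)" by (rule measurable_component_singleton)
      then show ?thesis by simp
    next
      case False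
      then have "(\<lambda>x. x i) \<in> borel_measurable (PiM I (\<lambda>_. lborel :: real measure)) \<longleftrightarrow> (\<lambda>x. undefined :: real) \<in> borel_measurable (PiM I (\<lambda>_. lborel :: real measure))"
        by (intro measurable_cong) (auto simp: sp Rn_def PiE_def extensional_def)
      then show ?thesis by simp
    qed
  qed (auto simp: PiE_def extensional_def)
  then have "(\<lambda>x. x) \<in> measurable (PiM I (\<lambda>_. lborel)) (borel :: (nat \<Rightarrow> real) measure)"
    using measurable_cong_sets[OF refl sets_PiM_equal_borel] by blast
  then have "(\<lambda>x. x) \<in> measurable (PiM I (\<lambda>_. lborel)) (restrict_space borel (Rn I))"
    by (rule measurable_restrict_space2[rotated]) (simp add: sp[symmetric])
  from measurable_compose[OF this borel_measurable_continuous_on_restrict[OF assms]]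
  show ?thesis by simp
qed

text \<open>A differentiable function is continuous, and its partial derivatives are measurable as limits of difference quotients.\<close>

lemma has_grad_measurable:
  fixes h :: "(nat \<Rightarrow> real) \<Rightarrow> real"
  assumes I: "finite I" and g: "\<And>x. x \<in> Rn I \<Longrightarrow> \<exists>a. has_grad I h a x"
  shows "h \<in> borel_measurable (PiM I (\<lambda>_. lborel))"
    and "k \<in> I \<Longrightarrow> partial_deriv k h \<in> borel_measurable (PiM I (\<lambda>_. lborel))"
proof -
  have c: "continuous_on (Rn I) h" by (rule has_grad_continuous[OF assms])
  then show hm: "h \<in> borel_measurable (PiM I (\<lambda>_. lborel))" by (rule continuous_measurable_PiM)
  assume k: "k \<in> I"
  have sp: "space (PiM I (\<lambda>_. lborel :: real measure)) = Rn I" by (simp add: space_PiM Rn_def)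
  show "partial_deriv k h \<in> borel_measurable (PiM I (\<lambda>_. lborel))"
  proof (rule borel_measurable_LIMSEQ_real)
    fix n :: nat
    let ?c = "inverse (real (Suc n))"
    have "continuous_on (Rn I) (\<lambda>x. (x(k := x k + ?c)) i)" for i
      by (cases "i = k") (auto intro!: continuous_intros continuous_on_subset[OF continuous_on_product_coordinates])
    then have "continuous_on (Rn I) (\<lambda>x. x(k := x k + ?c))"
      by (rule continuous_on_coordinatewise_then_product)
    then have "continuous_on (Rn I) (\<lambda>x. h (x(k := x k + ?c)))"
      by (rule continuous_on_compose2[OF c]) (use k in \<open>auto simp: Rn_upd\<close>)
    from continuous_measurable_PiM[OF this] hm
    show "(\<lambda>x. (h (x(k := x k + ?c)) - h x) / ?c) \<in> borel_measurable (PiM I (\<lambda>_. lborel))"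
      by (intro borel_measurable_divide borel_measurable_diff) auto
  next
    fix x assume "x \<in> space (PiM I (\<lambda>_. lborel :: real measure))"
    then have x: "x \<in> Rn I" by (simp add: sp)
    obtain a where a: "has_grad I h a x" using g[OF x] by blast
    have "DERIV (\<lambda>s. h (x(k := s))) (x k) :> partial_deriv k h x"
      using has_grad_partial_DERIV[OF I k x a] has_grad_partial_deriv[OF I k x a] by simp
    then have "(\<lambda>c. (h (x(k := x k + c)) - h (x(k := x k))) / c) \<midarrow>0\<rightarrow> partial_deriv k h x"
      unfolding DERIV_def .
    moreover have "filterlim (\<lambda>n. inverse (real (Suc n))) (at 0) sequentially"
      unfolding filterlim_at using LIMSEQ_inverse_real_of_nat by auto
    ultimately show "(\<lambda>n. (h (x(k := x k + inverse (real (Suc n)))) - h x) / inverse (real (Suc n))) \<longlonglongrightarrow> partial_deriv k h x"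
      using filterlim_compose by fastforce
  qed
qed

definition cube_measure :: "nat \<Rightarrow> (nat \<Rightarrow> real) measure" where
  "cube_measure d = restrict_space (PiM {..<d} (\<lambda>_. lborel)) (unit_cube d)"

lemma unit_cube_sets: "unit_cube d \<in> sets (PiM {..<d} (\<lambda>_. lborel))"
  unfolding unit_cube_def by (rule sets_PiM_I_finite) auto

lemma unit_cube_Rn: "unit_cube d \<subseteq> Rn {..<d}"
  by (auto simp: unit_cube_def Rn_def PiE_def)

lemma space_cube_measure: "space (cube_measure d) = unit_cube d"
  using unit_cube_Rn by (auto simp: cube_measure_def space_restrict_space space_PiM Rn_def)

lemma emeasure_cube_measure: "emeasure (cube_measure d) (space (cube_measure d)) = 1"
proof -
  interpret product_sigma_finite "\<lambda>_. lborel :: real measure" by standard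
  have "emeasure (PiM {..<d} (\<lambda>_. lborel)) (unit_cube d) = 1"
    unfolding unit_cube_def by (subst emeasure_PiM) auto
  then show ?thesis
    unfolding space_cube_measure unfolding cube_measure_def
    using unit_cube_sets by (subst emeasure_restrict_space) auto
qed

lemma measurable_cube_measure:
  "h \<in> borel_measurable (PiM {..<d} (\<lambda>_. lborel)) \<Longrightarrow> h \<in> borel_measurable (cube_measure d)"
  unfolding cube_measure_def by (rule measurable_restrict_space1)

lemma L2_norm_le:
  assumes m: "\<phi> \<in> borel_measurable (PiM {..<d} (\<lambda>_. lborel))" and s: "s \<ge> 0"
    and b: "(\<integral>\<^sup>+x. ennreal ((\<phi> x)\<^sup>2) \<partial>cube_measure d) \<le> ennreal (s\<^sup>2)"
  shows "L2_integrable d \<phi> \<and> L2_norm d \<phi> \<le> s"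
proof
  have m2: "(\<lambda>x. (\<phi> x)\<^sup>2) \<in> borel_measurable (cube_measure d)"
    using measurable_cube_measure[OF m] by (rule borel_measurable_power)
  have fin: "(\<integral>\<^sup>+x. ennreal ((\<phi> x)\<^sup>2) \<partial>cube_measure d) < \<infinity>"
    using b by (simp add: le_less_trans)
  have int: "integrable (cube_measure d) (\<lambda>x. (\<phi> x)\<^sup>2)"
    by (rule integrableI_nonneg[OF m2 _ fin]) simp
  have eq: "integrable (cube_measure d) f \<longleftrightarrow> set_integrable (PiM {..<d} (\<lambda>_. lborel)) (unit_cube d) f" for f :: "_ \<Rightarrow> real"
    unfolding cube_measure_def set_integrable_def using unit_cube_sets by (intro integrable_restrict_space) auto
  show "L2_integrable d \<phi>" using int unfolding L2_integrable_def eq .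
  have "(LINT x:unit_cube d|PiM {..<d} (\<lambda>_. lborel). (\<phi> x)\<^sup>2) = integral\<^sup>L (cube_measure d) (\<lambda>x. (\<phi> x)\<^sup>2)"
    unfolding cube_measure_def set_lebesgue_integral_def using unit_cube_sets by (intro integral_restrict_space[symmetric]) auto
  also have "\<dots> \<le> s\<^sup>2"
    using b nn_integral_eq_integral[OF int] s by simp
  finally show "L2_norm d \<phi> \<le> s" unfolding L2_norm_def using s by (simp add: real_le_lsqrt real_sqrt_le_iff[of _ "s\<^sup>2", simplified])
qed

section \<open>Selecting good samples\<close>

text \<open>Monte Carlo without probability: the samples are chosen one after the other. On average over the next sample, the square of
  the centred sum increases by at most the second moment, since the mixed term averages to zero; hence some
  sample does not increase it by more.\<close>

lemma select_samples:
  fixes V :: "'f \<Rightarrow> 'a \<Rightarrow> 'x \<Rightarrow> real"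
  assumes A: "finite A" "A \<noteq> {}" and \<Phi>: "finite \<Phi>"
    and V: "\<And>f a. f \<in> \<Phi> \<Longrightarrow> a \<in> A \<Longrightarrow> V f a \<in> borel_measurable M"
  shows "\<exists>ws. set ws \<subseteq> A \<and> length ws = n \<and>
     (\<integral>\<^sup>+x. ennreal (\<Sum>f\<in>\<Phi>. (\<Sum>w\<leftarrow>ws. V f w x - avg A (\<lambda>a. V f a x))\<^sup>2) \<partial>M)
       \<le> of_nat n * (\<integral>\<^sup>+x. ennreal (\<Sum>f\<in>\<Phi>. avg A (\<lambda>a. (V f a x)\<^sup>2)) \<partial>M)"
proof (induction n)
  case 0
  show ?case by (intro exI[of _ "[]"]) simp
next
  case (Suc n)
  then obtain ws where ws: "set ws \<subseteq> A" "length ws = n" and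
    IH: "(\<integral>\<^sup>+x. ennreal (\<Sum>f\<in>\<Phi>. (\<Sum>w\<leftarrow>ws. V f w x - avg A (\<lambda>a. V f a x))\<^sup>2) \<partial>M)
       \<le> of_nat n * (\<integral>\<^sup>+x. ennreal (\<Sum>f\<in>\<Phi>. avg A (\<lambda>a. (V f a x)\<^sup>2)) \<partial>M)" by blast
  define mean where "mean f x = avg A (\<lambda>a. V f a x)" for f x
  define S where "S f x = (\<Sum>w\<leftarrow>ws. V f w x - mean f x)" for f x
  define m2 where "m2 = (\<integral>\<^sup>+x. ennreal (\<Sum>f\<in>\<Phi>. avg A (\<lambda>a. (V f a x)\<^sup>2)) \<partial>M)"
  define J where "J a = (\<integral>\<^sup>+x. ennreal (\<Sum>f\<in>\<Phi>. (V f a x - mean f x + S f x)\<^sup>2) \<partial>M)" for a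
  have mean_m: "mean f \<in> borel_measurable M" if "f \<in> \<Phi>" for f
    unfolding mean_def[abs_def] avg_def using V[OF that] by (intro borel_measurable_divide borel_measurable_sum) auto
  have S_m: "S f \<in> borel_measurable M" if "f \<in> \<Phi>" for f
    using ws(1) unfolding S_def[abs_def]
    by (induction ws) (auto intro!: borel_measurable_add borel_measurable_diff V that mean_m)
  have cA: "real (card A) > 0" using A by (simp add: card_gt_0_iff)
  have "(\<Sum>a\<in>A. J a) = (\<integral>\<^sup>+x. (\<Sum>a\<in>A. ennreal (\<Sum>f\<in>\<Phi>. (V f a x - mean f x + S f x)\<^sup>2)) \<partial>M)"
    unfolding J_def by (rule nn_integral_sum[symmetric]) (auto intro!: borel_measurable_sum borel_measurable_power borel_measurable_add borel_measurable_diff V S_m mean_m measurable_compose[OF _ measurable_ennreal])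
  also have "\<dots> \<le> (\<integral>\<^sup>+x. of_nat (card A) * (ennreal (\<Sum>f\<in>\<Phi>. (S f x)\<^sup>2) + ennreal (\<Sum>f\<in>\<Phi>. avg A (\<lambda>a. (V f a x)\<^sup>2))) \<partial>M)"
  proof (rule nn_integral_mono)
    fix x
    have pt: "(\<Sum>a\<in>A. (V f a x - mean f x + S f x)\<^sup>2) \<le> real (card A) * ((S f x)\<^sup>2 + avg A (\<lambda>a. (V f a x)\<^sup>2))" for f
    proof -
      have "avg A (\<lambda>a. (V f a x - mean f x + S f x)\<^sup>2) = avg A (\<lambda>a. (V f a x)\<^sup>2 + (2 * (S f x - mean f x)) * V f a x + (S f x - mean f x)\<^sup>2)"
        by (rule avg_cong) (simp add: power2_eq_square algebra_simps)
      also have "\<dots> = avg A (\<lambda>a. (V f a x)\<^sup>2) + (2 * (S f x - mean f x)) * mean f x + (S f x - mean f x)\<^sup>2"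
        unfolding avg_add avg_cmult mean_def by (simp add: avg_const[OF A])
      also have "\<dots> = (S f x)\<^sup>2 + avg A (\<lambda>a. (V f a x)\<^sup>2) - (mean f x)\<^sup>2"
        by (simp add: power2_eq_square algebra_simps)
      also have "\<dots> \<le> (S f x)\<^sup>2 + avg A (\<lambda>a. (V f a x)\<^sup>2)" by simp
      finally show ?thesis using cA by (simp add: avg_def divide_le_eq mult.commute)
    qed
    have "(\<Sum>a\<in>A. ennreal (\<Sum>f\<in>\<Phi>. (V f a x - mean f x + S f x)\<^sup>2)) = ennreal (\<Sum>f\<in>\<Phi>. \<Sum>a\<in>A. (V f a x - mean f x + S f x)\<^sup>2)"
      by (simp add: sum_ennreal sum_nonneg sum.swap[of _ \<Phi> A])
    also have "\<dots> \<le> ennreal (\<Sum>f\<in>\<Phi>. real (card A) * ((S f x)\<^sup>2 + avg A (\<lambda>a. (V f a x)\<^sup>2)))"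
      using pt by (intro ennreal_leI sum_mono)
    also have "\<dots> = of_nat (card A) * (ennreal (\<Sum>f\<in>\<Phi>. (S f x)\<^sup>2) + ennreal (\<Sum>f\<in>\<Phi>. avg A (\<lambda>a. (V f a x)\<^sup>2)))"
      by (simp add: sum_distrib_left[symmetric] sum.distrib ennreal_mult ennreal_plus sum_nonneg avg_nonneg ennreal_of_nat_eq_real_of_nat)
    finally show "(\<Sum>a\<in>A. ennreal (\<Sum>f\<in>\<Phi>. (V f a x - mean f x + S f x)\<^sup>2)) \<le> of_nat (card A) * (ennreal (\<Sum>f\<in>\<Phi>. (S f x)\<^sup>2) + ennreal (\<Sum>f\<in>\<Phi>. avg A (\<lambda>a. (V f a x)\<^sup>2)))" .
  qed
  also have "\<dots> = of_nat (card A) * ((\<integral>\<^sup>+x. ennreal (\<Sum>f\<in>\<Phi>. (S f x)\<^sup>2) \<partial>M) + m2)"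
  proof -
    have a: "(\<lambda>x. ennreal (\<Sum>f\<in>\<Phi>. (S f x)\<^sup>2)) \<in> borel_measurable M"
      by (intro measurable_compose[OF _ measurable_ennreal] borel_measurable_sum borel_measurable_power S_m)
    have b: "(\<lambda>x. ennreal (\<Sum>f\<in>\<Phi>. avg A (\<lambda>a. (V f a x)\<^sup>2))) \<in> borel_measurable M"
      unfolding avg_def
      by (intro measurable_compose[OF _ measurable_ennreal] borel_measurable_sum borel_measurable_divide borel_measurable_power V borel_measurable_const)
    show ?thesis unfolding m2_def using a b by (simp add: nn_integral_cmult nn_integral_add)
  qed
  also have "\<dots> \<le> of_nat (card A) * (of_nat (Suc n) * m2)"
    using IH unfolding m2_def[symmetric] S_def mean_def by (intro mult_left_mono) (auto simp: distrib_right add.commute intro!: add_mono)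
  finally have total: "(\<Sum>a\<in>A. J a) \<le> of_nat (card A) * (of_nat (Suc n) * m2)" .
  \<comment> \<open>The best sample is at least as good as the average one.\<close>
  obtain a where a: "a \<in> A" "\<And>b. b \<in> A \<Longrightarrow> J a \<le> J b"
    using arg_min_if_finite(1)[OF A, of J] arg_min_least[OF A, of _ J] by blast
  have "of_nat (card A) * J a \<le> (\<Sum>b\<in>A. J b)" using sum_bounded_below[of A "J a" J] a(2) by simp
  also note total
  finally have Ja: "J a \<le> of_nat (Suc n) * m2"
    using A by (subst (asm) ennreal_mult_le_mult_iff) auto
  show ?case
  proof (intro exI[of _ "a # ws"] conjI)
    show "set (a # ws) \<subseteq> A" "length (a # ws) = Suc n" using a ws by auto
    show "(\<integral>\<^sup>+x. ennreal (\<Sum>f\<in>\<Phi>. (\<Sum>w\<leftarrow>a # ws. V f w x - avg A (\<lambda>a. V f a x))\<^sup>2) \<partial>M)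
       \<le> of_nat (Suc n) * (\<integral>\<^sup>+x. ennreal (\<Sum>f\<in>\<Phi>. avg A (\<lambda>a. (V f a x)\<^sup>2)) \<partial>M)"
      using Ja unfolding J_def m2_def S_def mean_def by simp
  qed
qed

text \<open>The mean square error splits into the squared bias and the fluctuation of the sample mean, which decreases with the number of samples.\<close>

lemma sample_average_exists:
  fixes V :: "'f \<Rightarrow> 'a \<Rightarrow> 'x \<Rightarrow> real"
  assumes A: "finite A" "A \<noteq> {}" and \<Phi>: "finite \<Phi>" and n: "n > 0"
    and V: "\<And>f a. f \<in> \<Phi> \<Longrightarrow> a \<in> A \<Longrightarrow> V f a \<in> borel_measurable M"
    and M: "emeasure M (space M) = 1"
    and bias: "\<And>f x. f \<in> \<Phi> \<Longrightarrow> x \<in> space M \<Longrightarrow> \<bar>U f x - avg A (\<lambda>a. V f a x)\<bar> \<le> b"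
    and moment: "\<And>f x. f \<in> \<Phi> \<Longrightarrow> x \<in> space M \<Longrightarrow> avg A (\<lambda>a. (V f a x)\<^sup>2) \<le> s"
    and s: "s \<ge> 0"
  shows "\<exists>ws. set ws \<subseteq> A \<and> length ws = n \<and>
     (\<integral>\<^sup>+x. ennreal (\<Sum>f\<in>\<Phi>. (U f x - (\<Sum>w\<leftarrow>ws. V f w x) / real n)\<^sup>2) \<partial>M) \<le> ennreal (real (card \<Phi>) * (2 * b\<^sup>2 + 2 * s / real n))"
proof -
  obtain ws where ws: "set ws \<subseteq> A" "length ws = n" and
    I: "(\<integral>\<^sup>+x. ennreal (\<Sum>f\<in>\<Phi>. (\<Sum>w\<leftarrow>ws. V f w x - avg A (\<lambda>a. V f a x))\<^sup>2) \<partial>M)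
       \<le> of_nat n * (\<integral>\<^sup>+x. ennreal (\<Sum>f\<in>\<Phi>. avg A (\<lambda>a. (V f a x)\<^sup>2)) \<partial>M)"
    using select_samples[where M = M and n = n and V = V, OF A \<Phi> V] by blast
  define S where "S f x = (\<Sum>w\<leftarrow>ws. V f w x - avg A (\<lambda>a. V f a x))" for f x
  have S_m: "S f \<in> borel_measurable M" if "f \<in> \<Phi>" for f
    using ws(1) unfolding S_def[abs_def] avg_def
    by (induction ws) (auto intro!: borel_measurable_add borel_measurable_diff borel_measurable_divide borel_measurable_sum V that)
  have "(\<integral>\<^sup>+x. ennreal (\<Sum>f\<in>\<Phi>. avg A (\<lambda>a. (V f a x)\<^sup>2)) \<partial>M) \<le> (\<integral>\<^sup>+x. ennreal (real (card \<Phi>) * s) \<partial>M)"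
    using moment by (intro nn_integral_mono ennreal_leI sum_bounded_above) auto
  also have "\<dots> = ennreal (real (card \<Phi>) * s)" by (simp add: M)
  finally have "(\<integral>\<^sup>+x. ennreal (\<Sum>f\<in>\<Phi>. (S f x)\<^sup>2) \<partial>M) \<le> of_nat n * ennreal (real (card \<Phi>) * s)"
    using I unfolding S_def by (meson mult_left_mono order_trans zero_le)
  then have S: "(\<integral>\<^sup>+x. ennreal (\<Sum>f\<in>\<Phi>. (S f x)\<^sup>2) \<partial>M) \<le> ennreal (real n * (real (card \<Phi>) * s))"
    by (simp add: ennreal_mult' ennreal_of_nat_eq_real_of_nat)
  have sum_eq: "(\<Sum>w\<leftarrow>ws. V f w x) = S f x + real n * avg A (\<lambda>a. V f a x)" for f x
    unfolding S_def using ws(2) by (induction ws arbitrary: n) (auto simp: algebra_simps)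
  have "(\<integral>\<^sup>+x. ennreal (\<Sum>f\<in>\<Phi>. (U f x - (\<Sum>w\<leftarrow>ws. V f w x) / real n)\<^sup>2) \<partial>M)
     \<le> (\<integral>\<^sup>+x. ennreal (real (card \<Phi>) * (2 * b\<^sup>2)) + ennreal (2 / (real n)\<^sup>2) * ennreal (\<Sum>f\<in>\<Phi>. (S f x)\<^sup>2) \<partial>M)"
  proof (rule nn_integral_mono)
    fix x assume x: "x \<in> space M"
    have "(U f x - (\<Sum>w\<leftarrow>ws. V f w x) / real n)\<^sup>2 \<le> 2 * b\<^sup>2 + 2 / (real n)\<^sup>2 * (S f x)\<^sup>2" if f: "f \<in> \<Phi>" for f
    proof -
      define e where "e = U f x - avg A (\<lambda>a. V f a x)"
      have "U f x - (\<Sum>w\<leftarrow>ws. V f w x) / real n = e - S f x / real n"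
        using n by (simp add: sum_eq e_def field_simps)
      moreover have "(e - S f x / real n)\<^sup>2 \<le> 2 * e\<^sup>2 + 2 * (S f x / real n)\<^sup>2"
      proof -
        have "0 \<le> (e + S f x / real n)\<^sup>2" by simp
        then show ?thesis by (simp add: power2_sum power2_diff)
      qed
      moreover have "e\<^sup>2 \<le> b\<^sup>2" using bias[OF f x] unfolding e_def by (intro abs_le_square_iff[THEN iffD1]) auto
      ultimately show ?thesis by (simp add: power_divide)
    qed
    then have "(\<Sum>f\<in>\<Phi>. (U f x - (\<Sum>w\<leftarrow>ws. V f w x) / real n)\<^sup>2) \<le> (\<Sum>f\<in>\<Phi>. 2 * b\<^sup>2 + 2 / (real n)\<^sup>2 * (S f x)\<^sup>2)"
      by (rule sum_mono)
    also have "\<dots> = real (card \<Phi>) * (2 * b\<^sup>2) + 2 / (real n)\<^sup>2 * (\<Sum>f\<in>\<Phi>. (S f x)\<^sup>2)"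
      by (simp add: sum.distrib sum_distrib_left)
    finally have "ennreal (\<Sum>f\<in>\<Phi>. (U f x - (\<Sum>w\<leftarrow>ws. V f w x) / real n)\<^sup>2) \<le> ennreal (real (card \<Phi>) * (2 * b\<^sup>2) + 2 / (real n)\<^sup>2 * (\<Sum>f\<in>\<Phi>. (S f x)\<^sup>2))"
      by (rule ennreal_leI)
    also have "\<dots> = ennreal (real (card \<Phi>) * (2 * b\<^sup>2)) + ennreal (2 / (real n)\<^sup>2) * ennreal (\<Sum>f\<in>\<Phi>. (S f x)\<^sup>2)"
      by (subst ennreal_plus) (auto simp: ennreal_mult'[of "2 / (real n)\<^sup>2", symmetric] sum_nonneg simp del: ennreal_plus)
    finally show "ennreal (\<Sum>f\<in>\<Phi>. (U f x - (\<Sum>w\<leftarrow>ws. V f w x) / real n)\<^sup>2) \<le> ennreal (real (card \<Phi>) * (2 * b\<^sup>2)) + ennreal (2 / (real n)\<^sup>2) * ennreal (\<Sum>f\<in>\<Phi>. (S f x)\<^sup>2)" .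
  qed
  also have "\<dots> = ennreal (real (card \<Phi>) * (2 * b\<^sup>2)) + ennreal (2 / (real n)\<^sup>2) * (\<integral>\<^sup>+x. ennreal (\<Sum>f\<in>\<Phi>. (S f x)\<^sup>2) \<partial>M)"
  proof -
    have a: "(\<lambda>x. ennreal (\<Sum>f\<in>\<Phi>. (S f x)\<^sup>2)) \<in> borel_measurable M"
      by (intro measurable_compose[OF _ measurable_ennreal] borel_measurable_sum borel_measurable_power S_m)
    then show ?thesis by (simp add: nn_integral_add nn_integral_cmult M)
  qed
  also have "\<dots> \<le> ennreal (real (card \<Phi>) * (2 * b\<^sup>2)) + ennreal (2 / (real n)\<^sup>2) * ennreal (real n * (real (card \<Phi>) * s))"
    using S by (intro add_left_mono mult_left_mono) auto
  also have "\<dots> = ennreal (real (card \<Phi>) * (2 * b\<^sup>2) + 2 / (real n)\<^sup>2 * (real n * (real (card \<Phi>) * s)))"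
  proof -
    have "ennreal (2 / (real n)\<^sup>2) * ennreal (real n * (real (card \<Phi>) * s)) = ennreal (2 / (real n)\<^sup>2 * (real n * (real (card \<Phi>) * s)))"
      using s by (intro ennreal_mult[symmetric]) auto
    then show ?thesis using s by (subst ennreal_plus) auto
  qed
  also have "real (card \<Phi>) * (2 * b\<^sup>2) + 2 / (real n)\<^sup>2 * (real n * (real (card \<Phi>) * s)) = real (card \<Phi>) * (2 * b\<^sup>2 + 2 * s / real n)"
    using n by (simp add: field_simps power2_eq_square)
  finally show ?thesis using ws by blast
qed

section \<open>Building networks\<close>

lemma is_network_Cons:
  "is_network a b (L # L' # N) \<longleftrightarrow> inputs L = a \<and> a > 0 \<and> outputs L > 0 \<and> is_network (outputs L) b (L' # N)"
proof -
  have "(\<forall>k. Suc k < length (L # L' # N) \<longrightarrow> outputs ((L # L' # N) ! k) = inputs ((L # L' # N) ! Suc k)) \<longleftrightarrow>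
     outputs L = inputs L' \<and> (\<forall>k. Suc k < length (L' # N) \<longrightarrow> outputs ((L' # N) ! k) = inputs ((L' # N) ! Suc k))"
    (is "?l \<longleftrightarrow> ?r")
  proof
    assume l: ?l
    show ?r using l[rule_format, of 0] l[rule_format, of "Suc k" for k] by auto
  next
    assume r: ?r
    show ?l
    proof (intro allI impI)
      fix k assume "Suc k < length (L # L' # N)"
      then show "outputs ((L # L' # N) ! k) = inputs ((L # L' # N) ! Suc k)"
        using r by (cases k) auto
    qed
  qed
  then show ?thesis unfolding is_network_def by auto
qed

lemma is_network_single: "is_network a b [L] \<longleftrightarrow> inputs L = a \<and> outputs L = b \<and> a > 0 \<and> b > 0"
  by (auto simp: is_network_def)

lemma affine_map_Rn: "affine_map L x \<in> Rn {..<outputs L}"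
  by (auto simp: affine_map_def Rn_def)

lemma realization_Rn: "is_network a b N \<Longrightarrow> realization \<rho> N x \<in> Rn {..<b}"
proof (induction \<rho> N x arbitrary: a rule: realization.induct)
  case (1 \<rho> x) then show ?case by (simp add: is_network_def)
next
  case (2 \<rho> L x) then show ?case using affine_map_Rn[of L x] by (simp add: is_network_single)
next
  case (3 \<rho> L L' Ls x)
  then have "is_network (outputs L) b (L' # Ls)" by (simp only: is_network_Cons)
  from 3(1)[OF this] show ?case by (simp only: realization.simps)
qed

text \<open>Two networks are put in series by making the last nodes of the first one identity nodes.\<close>

definition open_layer :: "layer \<Rightarrow> layer" where
  "open_layer L = L\<lparr>identity_node := \<lambda>_. True\<rparr>"

definition in_series :: "network \<Rightarrow> network \<Rightarrow> network" where
  "in_series N N' = butlast N @ open_layer (last N) # N'"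

lemma open_layer_simps [simp]:
  "inputs (open_layer L) = inputs L" "outputs (open_layer L) = outputs L" "weight (open_layer L) = weight L"
  "bias (open_layer L) = bias L" "identity_node (open_layer L) i"
  by (simp_all add: open_layer_def)

lemma in_series_Cons: "in_series (L # L' # N) N' = L # in_series (L' # N) N'"
  by (simp add: in_series_def)

lemma in_series_nonempty: "\<exists>K Ks. in_series N N' = K # Ks \<and> (N \<noteq> [] \<longrightarrow> inputs K = inputs (hd N))"
  by (cases N; cases "tl N") (auto simp: in_series_def)

lemma realization_in_series:
  assumes "N \<noteq> []" "N' \<noteq> []"
  shows "realization \<rho> (in_series N N') x = realization \<rho> N' (realization \<rho> N x)"
  using assms
proof (induction \<rho> N x rule: realization.induct)
  case (2 \<rho> L x)
  obtain K Ks where K: "N' = K # Ks" using 2 by (cases N') auto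
  have "(\<lambda>i\<in>{..<outputs L}. affine_map L x i) = affine_map L x"
    by (auto simp: affine_map_def)
  moreover have "affine_map (open_layer L) x = affine_map L x" by (simp add: affine_map_def)
  ultimately show ?case unfolding K in_series_def by simp
next
  case (3 \<rho> L L' Ls x)
  obtain K Ks where K: "in_series (L' # Ls) N' = K # Ks" using in_series_nonempty by blast
  show ?case unfolding in_series_Cons K realization.simps using 3(1)[OF _ 3(3), unfolded K] by blast
qed simp

lemma is_network_in_series:
  assumes "is_network a b N" "is_network b e N'"
  shows "is_network a e (in_series N N')"
  using assms(1)
proof (induction N arbitrary: a rule: induct_list012)
  case (2 L)
  obtain K Ks where K: "N' = K # Ks" using assms(2) by (cases N') (auto simp: is_network_def)
  show ?case using 2 assms(2) unfolding K in_series_def by (simp add: is_network_Cons is_network_single)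
next
  case (3 L L' Ls)
  obtain K Ks where K: "in_series (L' # Ls) N' = K # Ks" using in_series_nonempty by blast
  show ?case using 3 unfolding in_series_Cons K by (simp add: is_network_Cons)
qed (simp add: is_network_def)

lemma nonzero_params_in_series:
  assumes "N \<noteq> []" shows "nonzero_params (in_series N N') = nonzero_params N + nonzero_params N'"
proof -
  have "nonzero_params N = nonzero_params (butlast N @ [last N])" using assms by simp
  then show ?thesis unfolding in_series_def nonzero_params_def by simp
qed

text \<open>Only the number of non-zero parameters matters, so networks are composed through existence statements with a bound \<open>P\<close> on this number.\<close>

definition computes :: "(real \<Rightarrow> real) \<Rightarrow> nat \<Rightarrow> nat \<Rightarrow> nat \<Rightarrow> ((nat \<Rightarrow> real) \<Rightarrow> nat \<Rightarrow> real) \<Rightarrow> bool" where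
  "computes \<rho> a b P f \<longleftrightarrow> (\<exists>N. is_network a b N \<and> nonzero_params N \<le> P \<and>
     (\<forall>x\<in>Rn {..<a}. realization \<rho> N x = restrict (f x) {..<b}))"

lemma computes_mono: "computes \<rho> a b P f \<Longrightarrow> P \<le> P' \<Longrightarrow> computes \<rho> a b P' f"
  unfolding computes_def using le_trans by blast

lemma computes_compose:
  assumes "computes \<rho> a b P f" "computes \<rho> b e P' g"
  shows "computes \<rho> a e (P + P') (\<lambda>x. g (restrict (f x) {..<b}))"
proof -
  obtain N where N: "is_network a b N" "nonzero_params N \<le> P" "\<And>x. x \<in> Rn {..<a} \<Longrightarrow> realization \<rho> N x = restrict (f x) {..<b}"
    using assms(1) unfolding computes_def by blast
  obtain N' where N': "is_network b e N'" "nonzero_params N' \<le> P'" "\<And>x. x \<in> Rn {..<b} \<Longrightarrow> realization \<rho> N' x = restrict (g x) {..<e}"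
    using assms(2) unfolding computes_def by blast
  have ne: "N \<noteq> []" "N' \<noteq> []" using N(1) N'(1) by (auto simp: is_network_def)
  have "restrict (f x) {..<b} \<in> Rn {..<b}" for x by (auto simp: Rn_def)
  then show ?thesis unfolding computes_def
    using is_network_in_series[OF N(1) N'(1)] N(2,3) N'(2,3) ne
    by (intro exI[of _ "in_series N N'"]) (auto simp: nonzero_params_in_series realization_in_series)
qed

lemma layer_params_le:
  "card {(i, j). i < (b::nat) \<and> j < (a::nat) \<and> W i j \<noteq> (0::real)} + card {i. i < b \<and> \<beta> i \<noteq> (0::real)} \<le> b * a + b"
proof (rule add_mono)
  have "{(i, j). i < b \<and> j < a \<and> W i j \<noteq> 0} \<subseteq> {..<b} \<times> {..<a}" by auto
  from card_mono[OF _ this] show "card {(i, j). i < b \<and> j < a \<and> W i j \<noteq> 0} \<le> b * a" by simp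
  have "{i. i < b \<and> \<beta> i \<noteq> 0} \<subseteq> {..<b}" by auto
  from card_mono[OF _ this] show "card {i. i < b \<and> \<beta> i \<noteq> 0} \<le> b" by simp
qed

lemma computes_affine:
  assumes "a > 0" "b > 0"
  shows "computes \<rho> a b (b * a + b) (\<lambda>x i. (\<Sum>j<a. W i j * x j) + \<beta> i)"
  unfolding computes_def
proof (intro exI conjI)
  let ?N = "[\<lparr>inputs = a, outputs = b, weight = W, bias = \<beta>, identity_node = \<lambda>_. True\<rparr>]"
  show "is_network a b ?N" using assms by (simp add: is_network_single)
  show "nonzero_params ?N \<le> b * a + b" using layer_params_le by (simp add: nonzero_params_def)
  show "\<forall>x\<in>Rn {..<a}. realization \<rho> ?N x = restrict (\<lambda>i. (\<Sum>j<a. W i j * x j) + \<beta> i) {..<b}"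
    by (simp add: affine_map_def)
qed

lemma computes_fold:
  assumes n: "n > 0" and fs: "\<And>f. f \<in> set fs \<Longrightarrow> computes \<rho> n n C f"
  shows "computes \<rho> n n (C * length fs + (n * n + n)) (\<lambda>s. fold (\<lambda>f s. restrict (f s) {..<n}) fs s)"
  using fs
proof (induction fs rule: rev_induct)
  case Nil
  have "computes \<rho> n n (n * n + n) (\<lambda>x i. (\<Sum>j<n. (if j = i then 1 else 0) * x j) + 0)"
    using n by (intro computes_affine) auto
  moreover have "restrict (\<lambda>i. (\<Sum>j<n. (if j = i then 1 else 0) * x j) + 0) {..<n} = restrict x {..<n}" for x :: "nat \<Rightarrow> real"
    by (auto simp: if_distrib[of "\<lambda>a. a * _"] cong: if_cong)
  ultimately show ?case unfolding computes_def by simp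
next
  case (snoc f fs)
  have "computes \<rho> n n (C * length fs + (n * n + n) + C) (\<lambda>s. f (restrict (fold (\<lambda>f s. restrict (f s) {..<n}) fs s) {..<n}))"
    using snoc by (intro computes_compose) auto
  moreover have "restrict (f (restrict (fold (\<lambda>f s. restrict (f s) {..<n}) fs s) {..<n})) {..<n} = restrict (fold (\<lambda>f s. restrict (f s) {..<n}) (fs @ [f]) s) {..<n}"
    if "s \<in> Rn {..<n}" for s
  proof -
    have "restrict (fold (\<lambda>f s. restrict (f s) {..<n}) fs s) {..<n} = fold (\<lambda>f s. restrict (f s) {..<n}) fs s"
      using that by (cases fs rule: rev_cases) (auto simp: Rn_def PiE_def extensional_def restrict_def)
    then show ?thesis by simp
  qed
  ultimately show ?case unfolding computes_def by (simp add: algebra_simps)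
qed

text \<open>A network runs beside an unchanged state when every layer is extended by identity nodes.\<close>

definition pad_layer :: "nat \<Rightarrow> layer \<Rightarrow> layer" where
  "pad_layer n L = \<lparr>inputs = inputs L + n, outputs = outputs L + n,
     weight = (\<lambda>i j. if i < outputs L then (if j < inputs L then weight L i j else 0)
        else if j = inputs L + (i - outputs L) then 1 else 0),
     bias = (\<lambda>i. if i < outputs L then bias L i else 0),
     identity_node = (\<lambda>i. i < outputs L \<longrightarrow> identity_node L i)\<rparr>"

definition join :: "nat \<Rightarrow> nat \<Rightarrow> (nat \<Rightarrow> real) \<Rightarrow> (nat \<Rightarrow> real) \<Rightarrow> nat \<Rightarrow> real" where
  "join a n x z = (\<lambda>i\<in>{..<a + n}. if i < a then x i else z (i - a))"

lemma sum_lessThan_add: "(\<Sum>j<a + n. f j) = (\<Sum>j<a. f j) + (\<Sum>j<n. f (a + j) :: real)" for a n :: nat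
  by (induction n) (auto simp: add.assoc)

lemma affine_map_pad:
  "affine_map (pad_layer n L) (join (inputs L) n x z) = join (outputs L) n (affine_map L x) z"
proof
  fix i
  show "affine_map (pad_layer n L) (join (inputs L) n x z) i = join (outputs L) n (affine_map L x) z i"
  proof (cases "i < outputs L + n")
    case True
    show ?thesis
    proof (cases "i < outputs L")
      case True
      then show ?thesis by (simp add: affine_map_def pad_layer_def join_def sum_lessThan_add)
    next
      case False
      define k where "k = i - outputs L"
      have i: "i = outputs L + k" "k < n" using True False by (auto simp: k_def)
      have "(\<Sum>j<n. (if j = k then 1 else 0) * z j) = z k"
        using i by (simp add: if_distrib[of "\<lambda>a. a * _"] cong: if_cong)
      then show ?thesis unfolding i(1) using i(2) by (simp add: affine_map_def pad_layer_def join_def sum_lessThan_add)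
    qed
  qed (simp add: affine_map_def pad_layer_def join_def)
qed

lemma pad_layer_simps: "inputs (pad_layer n L) = inputs L + n" "outputs (pad_layer n L) = outputs L + n"
  by (simp_all add: pad_layer_def)

lemma realization_pad:
  "is_network a b N \<Longrightarrow> realization \<rho> (map (pad_layer n) N) (join a n x z) = join b n (realization \<rho> N x) z"
proof (induction \<rho> N x arbitrary: a rule: realization.induct)
  case (2 \<rho> L x)
  then show ?case using affine_map_pad[of n L x z] by (simp add: is_network_single)
next
  case (3 \<rho> L L' Ls x)
  let ?y = "\<lambda>i\<in>{..<outputs L}. if identity_node L i then affine_map L x i else \<rho> (affine_map L x i)"
  have e: "(\<lambda>i\<in>{..<outputs (pad_layer n L)}. if identity_node (pad_layer n L) i then affine_map (pad_layer n L) (join a n x z) i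
       else \<rho> (affine_map (pad_layer n L) (join a n x z) i)) = join (outputs L) n ?y z"
    using 3(2) affine_map_pad[of n L x z] by (auto simp: is_network_Cons join_def pad_layer_def fun_eq_iff)
  have "is_network (outputs L) b (L' # Ls)" using 3(2) by (simp only: is_network_Cons)
  from 3(1)[OF this] show ?case unfolding list.map realization.simps e .
qed (simp add: is_network_def)

lemma is_network_pad: "is_network a b N \<Longrightarrow> is_network (a + n) (b + n) (map (pad_layer n) N)"
  by (induction N arbitrary: a rule: induct_list012)
    (auto simp: is_network_Cons is_network_single pad_layer_simps is_network_def[of _ _ "[]"])

lemma nonzero_params_pad: "nonzero_params (map (pad_layer n) N) \<le> nonzero_params N + length N * n"
proof -
  have "card {(i, j). i < outputs (pad_layer n L) \<and> j < inputs (pad_layer n L) \<and> weight (pad_layer n L) i j \<noteq> 0}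
     + card {i. i < outputs (pad_layer n L) \<and> bias (pad_layer n L) i \<noteq> 0}
     \<le> card {(i, j). i < outputs L \<and> j < inputs L \<and> weight L i j \<noteq> 0} + card {i. i < outputs L \<and> bias L i \<noteq> 0} + n" for L
  proof -
    have fin: "finite {(i, j). i < outputs L \<and> j < inputs L \<and> weight L i j \<noteq> 0}"
      by (rule finite_subset[of _ "{..<outputs L} \<times> {..<inputs L}"]) auto
    have "{(i, j). i < outputs (pad_layer n L) \<and> j < inputs (pad_layer n L) \<and> weight (pad_layer n L) i j \<noteq> 0}
       \<subseteq> {(i, j). i < outputs L \<and> j < inputs L \<and> weight L i j \<noteq> 0} \<union> (\<lambda>k. (outputs L + k, inputs L + k)) ` {..<n}"
    proof clarify
      fix i j assume a: "i < outputs (pad_layer n L)" "j < inputs (pad_layer n L)" "weight (pad_layer n L) i j \<noteq> 0"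
        "(i, j) \<notin> (\<lambda>k. (outputs L + k, inputs L + k)) ` {..<n}"
      show "i < outputs L \<and> j < inputs L \<and> weight L i j \<noteq> 0"
      proof (cases "i < outputs L")
        case True
        then show ?thesis using a by (auto simp: pad_layer_def split: if_splits)
      next
        case False
        define k where "k = i - outputs L"
        have "i = outputs L + k" "k < n" "j = inputs L + k"
          using False a(1,3) by (auto simp: pad_layer_def k_def split: if_splits)
        then show ?thesis using a(4) by blast
      qed
    qed
    from card_mono[OF _ this] fin have "card {(i, j). i < outputs (pad_layer n L) \<and> j < inputs (pad_layer n L) \<and> weight (pad_layer n L) i j \<noteq> 0}
      \<le> card ({(i, j). i < outputs L \<and> j < inputs L \<and> weight L i j \<noteq> 0} \<union> (\<lambda>k. (outputs L + k, inputs L + k)) ` {..<n})" by auto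
    also have "\<dots> \<le> card {(i, j). i < outputs L \<and> j < inputs L \<and> weight L i j \<noteq> 0} + n"
      by (rule order_trans[OF card_Un_le]) (use card_image_le[of "{..<n}"] in auto)
    finally have 1: "card {(i, j). i < outputs (pad_layer n L) \<and> j < inputs (pad_layer n L) \<and> weight (pad_layer n L) i j \<noteq> 0}
      \<le> card {(i, j). i < outputs L \<and> j < inputs L \<and> weight L i j \<noteq> 0} + n" .
    have "{i. i < outputs (pad_layer n L) \<and> bias (pad_layer n L) i \<noteq> 0} \<subseteq> {i. i < outputs L \<and> bias L i \<noteq> 0}"
      by (auto simp: pad_layer_def split: if_splits)
    from card_mono[OF _ this] have "card {i. i < outputs (pad_layer n L) \<and> bias (pad_layer n L) i \<noteq> 0} \<le> card {i. i < outputs L \<and> bias L i \<noteq> 0}" by simp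
    with 1 show ?thesis by simp
  qed
  note layer = this
  show ?thesis
  proof (induction N)
    case (Cons L N)
    then show ?case using layer[of L] by (simp add: nonzero_params_def)
  qed (simp add: nonzero_params_def)
qed

text \<open>A network with fewer non-zero parameters than layers has a layer without parameters and is therefore
  constant. So its depth may be assumed to be bounded by the number of its parameters.\<close>

lemma realization_zero_layer:
  assumes "is_network a b N" "L \<in> set N" "\<And>i j. i < outputs L \<Longrightarrow> j < inputs L \<Longrightarrow> weight L i j = 0" "\<And>i. i < outputs L \<Longrightarrow> bias L i = 0"
  shows "realization \<rho> N x = realization \<rho> N x'"
  using assms(1,2)
proof (induction \<rho> N x arbitrary: a x' rule: realization.induct)
  case (2 \<rho> K x)
  then show ?case using assms(3,4) by (auto simp: affine_map_def intro!: restrict_ext)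
next
  case (3 \<rho> K K' Ks x)
  show ?case
  proof (cases "K = L")
    case True
    then have "affine_map K x = affine_map K x'" using assms(3,4) by (auto simp: affine_map_def intro!: restrict_ext)
    then show ?thesis by (simp only: realization.simps)
  next
    case False
    have "is_network (outputs K) b (K' # Ks)" "L \<in> set (K' # Ks)" using 3(2,3) False by (auto simp only: is_network_Cons set_simps)
    from 3(1)[OF this] show ?thesis by (simp only: realization.simps)
  qed
qed simp

lemma bounded_depth:
  assumes N: "is_network a b N"
  obtains N' where "is_network a b N'" "length N' \<le> nonzero_params N + 1" "nonzero_params N' \<le> nonzero_params N + b"
    "\<And>x. realization \<rho> N' x = realization \<rho> N x"
proof (cases "length N \<le> nonzero_params N")
  case True
  then show ?thesis using that[of N] N by auto
next
  case False
  define pc :: "layer \<Rightarrow> nat" where "pc L = card {(i, j). i < outputs L \<and> j < inputs L \<and> weight L i j \<noteq> 0} + card {i. i < outputs L \<and> bias L i \<noteq> 0}" for L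
  have "\<exists>L\<in>set N. pc L = 0"
  proof (rule ccontr)
    assume "\<not> (\<exists>L\<in>set N. pc L = 0)"
    then have "length N \<le> (\<Sum>L\<leftarrow>N. pc L)" by (induction N) force+
    then show False using False by (simp add: nonzero_params_def pc_def)
  qed
  then obtain L where L: "L \<in> set N" "pc L = 0" by blast
  have fin: "finite {(i, j). i < outputs L \<and> j < inputs L \<and> weight L i j \<noteq> 0}"
    by (rule finite_subset[of _ "{..<outputs L} \<times> {..<inputs L}"]) auto
  have z: "weight L i j = 0" "bias L i = 0" if "i < outputs L" "j < inputs L" for i j
  proof -
    have "{(i, j). i < outputs L \<and> j < inputs L \<and> weight L i j \<noteq> 0} = {}" "{i. i < outputs L \<and> bias L i \<noteq> 0} = {}"
      using L(2) fin unfolding pc_def by auto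
    then show "weight L i j = 0" "bias L i = 0" using that by auto
  qed
  have in0: "inputs L > 0" using N L(1) by (auto simp: is_network_def)
  have c: "realization \<rho> N x = realization \<rho> N undefined" for x
    by (rule realization_zero_layer[OF N L(1)]) (use z in0 in auto)
  let ?K = "\<lparr>inputs = a, outputs = b, weight = \<lambda>_ _. 0, bias = realization \<rho> N undefined, identity_node = \<lambda>_. True\<rparr>"
  have ab: "a > 0" "b > 0" using N by (auto simp: is_network_def)
  show ?thesis
  proof (rule that[of "[?K]"])
    have "card {i. i < b \<and> realization \<rho> N undefined i \<noteq> 0} \<le> b"
      using card_mono[of "{..<b}" "{i. i < b \<and> realization \<rho> N undefined i \<noteq> 0}"] by auto
    then show "nonzero_params [?K] \<le> nonzero_params N + b" by (simp add: nonzero_params_def)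
    show "realization \<rho> [?K] x = realization \<rho> N x" for x
      using c[of x] realization_Rn[OF N, of \<rho> x] by (auto simp: affine_map_def Rn_def PiE_def extensional_def fun_eq_iff)
  qed (use ab in \<open>auto simp: is_network_single\<close>)
qed

text \<open>One instruction of a program on states in \<open>\<real>\<^sup>n\<close>: coordinates are copied, and a linear function of the output of a
  given network, applied to the first \<open>d\<close> coordinates, is added.\<close>

definition instruction :: "nat \<Rightarrow> nat \<Rightarrow> (nat \<Rightarrow> nat) \<Rightarrow> (nat \<Rightarrow> nat \<Rightarrow> real) \<Rightarrow> ((nat \<Rightarrow> real) \<Rightarrow> nat \<Rightarrow> real) \<Rightarrow> (nat \<Rightarrow> real) \<Rightarrow> nat \<Rightarrow> real" where
  "instruction d e \<pi> W \<phi> s = (\<lambda>i. s (\<pi> i) + (\<Sum>k<e. W i k * \<phi> (restrict s {..<d}) k))"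

lemma computes_instruction:
  assumes N: "is_network d e N" "\<And>x j. x \<in> Rn {..<d} \<Longrightarrow> j < e \<Longrightarrow> \<phi> x j = realization \<rho> N x j" "nonzero_params N \<le> P"
    and n: "d \<le> n" "e \<le> n ^ 2" and \<pi>: "\<And>i. i < n \<Longrightarrow> \<pi> i < n"
  shows "computes \<rho> n n (11 * (P + 1) * n ^ 3) (instruction d e \<pi> W \<phi>)"
proof -
  obtain N' where N': "is_network d e N'" "length N' \<le> nonzero_params N + 1" "nonzero_params N' \<le> nonzero_params N + e"
    "\<And>x. realization \<rho> N' x = realization \<rho> N x"
    using bounded_depth[OF N(1)] by blast
  have de: "d > 0" "e > 0" using N(1) by (auto simp: is_network_def)
  have n0: "n > 0" using de n by simp
  have 1: "computes \<rho> n (d + n) ((d + n) * n + (d + n)) (\<lambda>x i. (\<Sum>j<n. (if j = (if i < d then i else i - d) then 1 else 0) * x j) + 0)"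
    using n0 by (intro computes_affine) auto
  have 2: "computes \<rho> (d + n) (e + n) (nonzero_params N' + length N' * n) (\<lambda>y. join e n (\<phi> (restrict y {..<d})) (\<lambda>i. y (d + i)))"
    unfolding computes_def
  proof (intro exI conjI ballI)
    show "is_network (d + n) (e + n) (map (pad_layer n) N')" by (rule is_network_pad[OF N'(1)])
    show "nonzero_params (map (pad_layer n) N') \<le> nonzero_params N' + length N' * n" by (rule nonzero_params_pad)
    fix y assume y: "y \<in> Rn {..<d + n}"
    have "y = join d n (restrict y {..<d}) (\<lambda>i. y (d + i))"
      using y by (auto simp: join_def Rn_def PiE_def extensional_def fun_eq_iff)
    then have "realization \<rho> (map (pad_layer n) N') y = join e n (realization \<rho> N (restrict y {..<d})) (\<lambda>i. y (d + i))"
      using realization_pad[OF N'(1)] N'(4) by metis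
    also have "\<dots> = restrict (join e n (\<phi> (restrict y {..<d})) (\<lambda>i. y (d + i))) {..<e + n}"
    proof -
      have "restrict y {..<d} \<in> Rn {..<d}" by (auto simp: Rn_def)
      then show ?thesis using N(2) by (auto simp: join_def fun_eq_iff)
    qed
    finally show "realization \<rho> (map (pad_layer n) N') y = restrict (join e n (\<phi> (restrict y {..<d})) (\<lambda>i. y (d + i))) {..<e + n}" .
  qed
  have 3: "computes \<rho> (e + n) n (n * (e + n) + n) (\<lambda>x i. (\<Sum>j<e + n. (if j < e then W i j else if j = e + \<pi> i then 1 else 0) * x j) + 0)"
    using n0 by (intro computes_affine) auto
  let ?P = "(d + n) * n + (d + n) + (nonzero_params N' + length N' * n) + (n * (e + n) + n)"
  have c: "computes \<rho> n n ?P (\<lambda>x. (\<lambda>x i. (\<Sum>j<e + n. (if j < e then W i j else if j = e + \<pi> i then 1 else 0) * x j) + 0)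
     (restrict ((\<lambda>y. join e n (\<phi> (restrict y {..<d})) (\<lambda>i. y (d + i)))
       (restrict (\<lambda>i. (\<Sum>j<n. (if j = (if i < d then i else i - d) then 1 else 0) * x j) + 0) {..<d + n})) {..<e + n}))"
    by (rule computes_compose[OF computes_compose[OF 1 2] 3])
  have eq: "restrict ((\<lambda>x i. (\<Sum>j<e + n. (if j < e then W i j else if j = e + \<pi> i then 1 else 0) * x j) + 0)
     (restrict ((\<lambda>y. join e n (\<phi> (restrict y {..<d})) (\<lambda>i. y (d + i)))
       (restrict (\<lambda>i. (\<Sum>j<n. (if j = (if i < d then i else i - d) then 1 else 0) * x j) + 0) {..<d + n})) {..<e + n})) {..<n}
     = restrict (instruction d e \<pi> W \<phi> x) {..<n}" for x
  proof -
    let ?y = "restrict (\<lambda>i. (\<Sum>j<n. (if j = (if i < d then i else i - d) then 1 else 0) * x j) + 0) {..<d + n}"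
    have y: "?y = join d n x x"
      using n by (auto simp: join_def fun_eq_iff if_distrib[of "\<lambda>a. a * _"] cong: if_cong)
    have y1: "restrict ?y {..<d} = restrict x {..<d}" unfolding y by (auto simp: join_def fun_eq_iff)
    have y2: "join e n z (\<lambda>i. ?y (d + i)) = join e n z x" for z
      unfolding y by (auto simp: join_def fun_eq_iff)
    have "(\<Sum>j<e + n. (if j < e then W i j else if j = e + \<pi> i then 1 else 0) * restrict (join e n (\<phi> (restrict x {..<d})) x) {..<e + n} j)
        = (\<Sum>k<e. W i k * \<phi> (restrict x {..<d}) k) + x (\<pi> i)" if "i < n" for i
      using \<pi>[OF that] unfolding sum_lessThan_add by (simp add: join_def if_distrib[of "\<lambda>a. a * _"] cong: if_cong)
    then show ?thesis unfolding y1 y2 instruction_def by (auto simp: fun_eq_iff)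
  qed
  have "computes \<rho> n n ?P (instruction d e \<pi> W \<phi>)"
    using c unfolding computes_def eq .
  moreover have "?P \<le> 11 * (P + 1) * n ^ 3"
  proof -
    have p: "n \<le> n ^ 3" "n ^ 2 \<le> n ^ 3" "1 \<le> n ^ 3" using n0 by (auto intro: power_increasing self_le_power)
    have "(d + n) * n + (d + n) \<le> 2 * n ^ 3 + 2 * n ^ 3"
    proof (rule add_mono)
      have "(d + n) * n \<le> (2 * n) * n" using n by (intro mult_le_mono1) simp
      also have "\<dots> = 2 * n ^ 2" by (simp add: power2_eq_square)
      also have "\<dots> \<le> 2 * n ^ 3" using p(2) by simp
      finally show "(d + n) * n \<le> 2 * n ^ 3" .
      show "d + n \<le> 2 * n ^ 3" using n p by simp
    qed
    moreover have "nonzero_params N' \<le> (P + 1) * n ^ 3"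
    proof -
      have "nonzero_params N' \<le> P + n ^ 3" using N'(3) N(3) n(2) p(2) by simp
      also have "\<dots> \<le> P * n ^ 3 + n ^ 3" using p(3) by simp
      finally show ?thesis by simp
    qed
    moreover have "length N' * n \<le> (P + 1) * n ^ 3"
      using N'(2) N(3) p(1) by (intro mult_le_mono) auto
    moreover have "n * (e + n) + n \<le> 3 * n ^ 3"
    proof -
      have "n * e \<le> n ^ 3" using n(2) mult_le_mono2[of e "n ^ 2" n] by (simp add: eval_nat_numeral)
      then show ?thesis using p(1,2) by (simp add: distrib_left power2_eq_square)
    qed
    ultimately have "?P \<le> 7 * n ^ 3 + 2 * ((P + 1) * n ^ 3)" by linarith
    also have "\<dots> \<le> 11 * (P + 1) * n ^ 3" by (simp add: algebra_simps)
    finally show ?thesis .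
  qed
  ultimately show ?thesis by (rule computes_mono)
qed

section \<open>The scheme as a network\<close>

definition euler_move :: "nat \<Rightarrow> (real \<Rightarrow> (nat \<Rightarrow> real) \<Rightarrow> nat \<Rightarrow> real) \<Rightarrow> (real \<Rightarrow> (nat \<Rightarrow> real) \<Rightarrow> nat \<times> nat \<Rightarrow> real) \<Rightarrow> real \<Rightarrow> real \<Rightarrow> (nat \<Rightarrow> real) \<Rightarrow> (nat \<Rightarrow> real) \<Rightarrow> nat \<Rightarrow> real" where
  "euler_move d \<nu> \<tau> t h \<xi> x = (\<lambda>j\<in>{..<d}. x j + (h * \<nu> t x j + sqrt h * (\<Sum>l<d. \<tau> t x (j, l) * \<xi> l)))"

primrec euler_path :: "nat \<Rightarrow> (real \<Rightarrow> (nat \<Rightarrow> real) \<Rightarrow> nat \<Rightarrow> real) \<Rightarrow> (real \<Rightarrow> (nat \<Rightarrow> real) \<Rightarrow> nat \<times> nat \<Rightarrow> real)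
    \<Rightarrow> (real \<Rightarrow> (nat \<Rightarrow> real) \<Rightarrow> nat \<Rightarrow> real) \<Rightarrow> ((nat \<Rightarrow> real) \<Rightarrow> nat \<Rightarrow> real) \<Rightarrow> real \<Rightarrow> nat \<Rightarrow> (nat \<Rightarrow> real) list \<Rightarrow> (nat \<Rightarrow> real) \<Rightarrow> nat \<Rightarrow> real" where
  "euler_path d \<nu> \<tau> G F h k [] x = F x"
| "euler_path d \<nu> \<tau> G F h k (\<xi> # w) x = (\<lambda>i. h * G (real k * h) x i + euler_path d \<nu> \<tau> G F h (Suc k) w (euler_move d \<nu> \<tau> (real k * h) h \<xi> x) i)"

lemma sum_flatten:
  fixes f :: "nat \<Rightarrow> nat \<Rightarrow> real"
  assumes "d > 0" shows "(\<Sum>k<d * d. f (k div d) (k mod d)) = (\<Sum>i<d. \<Sum>l<d. f i l)"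
proof -
  have "(\<Sum>k<d * d. f (k div d) (k mod d)) = (\<Sum>(i, l)\<in>{..<d} \<times> {..<d}. f i l)"
  proof (rule sum.reindex_bij_witness[of _ "\<lambda>(i, l). i * d + l" "\<lambda>k. (k div d, k mod d)"])
    fix b assume b: "b \<in> {..<d} \<times> {..<d}"
    obtain i l where il: "b = (i, l)" "i < d" "l < d" using b by auto
    have "i * d + l < Suc i * d" using il by simp
    also have "\<dots> \<le> d * d" using il by (intro mult_le_mono1) simp
    finally show "(case b of (i, l) \<Rightarrow> i * d + l) \<in> {..<d * d}" using il by simp
    show "((case b of (i, l) \<Rightarrow> i * d + l) div d, (case b of (i, l) \<Rightarrow> i * d + l) mod d) = b" using il by simp
  qed (use assms in \<open>auto simp: less_mult_imp_div_less\<close>)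
  then show ?thesis by (simp add: sum.cartesian_product)
qed

text \<open>The state holds the current position, the next position, the starting point, and the accumulated sum.
  Each sample resets the position to the starting point, so the network handles all samples one after the other.\<close>

definition state :: "nat \<Rightarrow> nat \<Rightarrow> (nat \<Rightarrow> real) \<Rightarrow> (nat \<Rightarrow> real) \<Rightarrow> (nat \<Rightarrow> real) \<Rightarrow> (nat \<Rightarrow> real) \<Rightarrow> nat \<Rightarrow> real" where
  "state d m y z x a = (\<lambda>i\<in>{..<3 * d + m}. if i < d then y i else if i < 2 * d then z (i - d) else if i < 3 * d then x (i - 2 * d) else a (i - 3 * d))"

locale scheme_network =
  fixes \<rho> :: "real \<Rightarrow> real" and T :: real and d m P :: nat
    and \<nu> :: "real \<Rightarrow> (nat \<Rightarrow> real) \<Rightarrow> nat \<Rightarrow> real" and \<tau> :: "real \<Rightarrow> (nat \<Rightarrow> real) \<Rightarrow> nat \<times> nat \<Rightarrow> real"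
    and G :: "real \<Rightarrow> (nat \<Rightarrow> real) \<Rightarrow> nat \<Rightarrow> real" and F :: "(nat \<Rightarrow> real) \<Rightarrow> nat \<Rightarrow> real"
    and N\<nu> N\<tau> NG :: "real \<Rightarrow> network" and NF :: network
  assumes d: "d > 0" and m: "m > 0"
    and N\<nu>: "t \<in> {0..T} \<Longrightarrow> is_network d d (N\<nu> t) \<and> nonzero_params (N\<nu> t) \<le> P \<and> (\<forall>x\<in>Rn {..<d}. \<forall>j<d. \<nu> t x j = realization \<rho> (N\<nu> t) x j)"
    and N\<tau>: "t \<in> {0..T} \<Longrightarrow> is_network d (d * d) (N\<tau> t) \<and> nonzero_params (N\<tau> t) \<le> P \<and> (\<forall>x\<in>Rn {..<d}. \<forall>j<d * d. flatten d (\<tau> t x) j = realization \<rho> (N\<tau> t) x j)"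
    and NG: "t \<in> {0..T} \<Longrightarrow> is_network d m (NG t) \<and> nonzero_params (NG t) \<le> P \<and> (\<forall>x\<in>Rn {..<d}. \<forall>j<m. G t x j = realization \<rho> (NG t) x j)"
    and NF: "is_network d m NF \<and> nonzero_params NF \<le> P \<and> (\<forall>x\<in>Rn {..<d}. \<forall>j<m. F x j = realization \<rho> NF x j)"
begin

abbreviation n where "n \<equiv> 3 * d + m"
definition cost where "cost = 11 * (P + 1) * n ^ 3"
abbreviation run where "run fs s \<equiv> fold (\<lambda>f s. restrict (f s) {..<n}) fs s"

definition add_source where "add_source t h = instruction d m id (\<lambda>i k. if 3 * d \<le> i \<and> k = i - 3 * d then h else 0) (G t)"
definition drift where "drift t h = instruction d d (\<lambda>i. if d \<le> i \<and> i < 2 * d then i - d else i) (\<lambda>i k. if d \<le> i \<and> i < 2 * d \<and> k = i - d then h else 0) (\<nu> t)"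
definition diffuse where "diffuse t h \<xi> = instruction d (d * d) (\<lambda>i. if i < d then i + d else i)
   (\<lambda>i k. if i < d \<and> k div d = i then sqrt h * \<xi> (k mod d) else 0) (\<lambda>x. flatten d (\<tau> t x))"
definition finish where "finish = instruction d m (\<lambda>i. if i < d then i + 2 * d else i) (\<lambda>i k. if 3 * d \<le> i \<and> k = i - 3 * d then 1 else 0) F"

lemma d_le: "d \<le> n" "m \<le> n ^ 2" "d \<le> n ^ 2" "d * d \<le> n ^ 2"
proof -
  have n: "n \<le> n ^ 2" unfolding power2_eq_square by (rule le_square)
  show "d \<le> n" by simp
  show "m \<le> n ^ 2" "d \<le> n ^ 2" using n by auto
  show "d * d \<le> n ^ 2" unfolding power2_eq_square by (intro mult_le_mono) auto
qed

lemma computes_instructions: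
  assumes "t \<in> {0..T}"
  shows "computes \<rho> n n cost (add_source t h)" "computes \<rho> n n cost (drift t h)" "computes \<rho> n n cost (diffuse t h \<xi>)" "computes \<rho> n n cost finish"
proof -
  show "computes \<rho> n n cost (add_source t h)"
    unfolding add_source_def cost_def using NG[OF assms] d_le by (intro computes_instruction[where N = "NG t"]) auto
  show "computes \<rho> n n cost (drift t h)"
    unfolding drift_def cost_def using N\<nu>[OF assms] d_le by (intro computes_instruction[where N = "N\<nu> t"]) auto
  show "computes \<rho> n n cost (diffuse t h \<xi>)"
    unfolding diffuse_def cost_def using N\<tau>[OF assms] d_le by (intro computes_instruction[where N = "N\<tau> t"]) auto
  show "computes \<rho> n n cost finish"
    unfolding finish_def cost_def using NF d_le by (intro computes_instruction[where N = NF]) auto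
qed

lemma restrict_state: "y \<in> Rn {..<d} \<Longrightarrow> restrict (state d m y z x a) {..<d} = y"
  by (auto simp: state_def Rn_def PiE_def extensional_def fun_eq_iff)

lemma delta_sum: "(\<Sum>k<e. (if Q \<and> k = j then c else 0) * f k) = (if Q \<and> j < e then c * f j else (0::real))" for e j :: nat
  by (cases Q) (auto simp: if_distrib[of "\<lambda>a. a * _"] cong: if_cong)

lemma run_step:
  assumes y: "y \<in> Rn {..<d}"
  shows "\<exists>z'. run [add_source t h, drift t h, diffuse t h \<xi>] (state d m y z x a) = state d m (euler_move d \<nu> \<tau> t h \<xi> y) z' x (\<lambda>i. a i + h * G t y i)"
proof -
  define z' where "z' j = y j + h * \<nu> t y j" for j
  have 1: "restrict (add_source t h (state d m y z x a)) {..<n} = state d m y z x (\<lambda>i. a i + h * G t y i)"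
    unfolding add_source_def instruction_def restrict_state[OF y] delta_sum by (auto simp: state_def fun_eq_iff)
  have 2: "restrict (drift t h (state d m y z x (\<lambda>i. a i + h * G t y i))) {..<n} = state d m y z' x (\<lambda>i. a i + h * G t y i)"
    unfolding drift_def instruction_def restrict_state[OF y] conj_assoc[symmetric] delta_sum by (auto simp: state_def z'_def fun_eq_iff)
  have s: "(\<Sum>k<d * d. (if i < d \<and> k div d = i then sqrt h * \<xi> (k mod d) else 0) * flatten d (\<tau> t y) k)
      = (if i < d then sqrt h * (\<Sum>l<d. \<tau> t y (i, l) * \<xi> l) else 0)" for i
  proof -
    have "(\<Sum>k<d * d. (if i < d \<and> k div d = i then sqrt h * \<xi> (k mod d) else 0) * flatten d (\<tau> t y) k)
      = (\<Sum>j<d. \<Sum>l<d. (if i < d \<and> j = i then sqrt h * \<xi> l else 0) * \<tau> t y (j, l))"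
      unfolding flatten_def by (rule sum_flatten[OF d])
    also have "\<dots> = (\<Sum>j<d. (if j = i then (\<Sum>l<d. sqrt h * (\<tau> t y (i, l) * \<xi> l)) else 0))"
      by (intro sum.cong refl) (auto simp: mult_ac)
    finally show ?thesis by (simp add: sum_distrib_left)
  qed
  have 3: "restrict (diffuse t h \<xi> (state d m y z' x (\<lambda>i. a i + h * G t y i))) {..<n} = state d m (euler_move d \<nu> \<tau> t h \<xi> y) z' x (\<lambda>i. a i + h * G t y i)"
    unfolding diffuse_def instruction_def restrict_state[OF y] s by (auto simp: state_def z'_def euler_move_def fun_eq_iff)
  show ?thesis using 1 2 3 by (intro exI[of _ z']) simp
qed

lemma run_finish:
  assumes y: "y \<in> Rn {..<d}"
  shows "run [finish] (state d m y z x a) = state d m x z x (\<lambda>i. a i + F y i)"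
proof -
  have "restrict (finish (state d m y z x a)) {..<n} = state d m x z x (\<lambda>i. a i + F y i)"
    unfolding finish_def instruction_def restrict_state[OF y] delta_sum by (auto simp: state_def fun_eq_iff)
  then show ?thesis by simp
qed

primrec path_program where
  "path_program h k [] = [finish]"
| "path_program h k (\<xi> # w) = [add_source (real k * h) h, drift (real k * h) h, diffuse (real k * h) h \<xi>] @ path_program h (Suc k) w"

lemma run_path:
  "y \<in> Rn {..<d} \<Longrightarrow> \<exists>z'. run (path_program h k w) (state d m y z x a) = state d m x z' x (\<lambda>i. a i + euler_path d \<nu> \<tau> G F h k w y i)"
proof (induction w arbitrary: k y z a)
  case Nil
  then show ?case by (intro exI[of _ z]) (simp only: path_program.simps euler_path.simps run_finish)
next
  case (Cons \<xi> w)
  let ?t = "real k * h"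
  obtain z1 where z1: "run [add_source ?t h, drift ?t h, diffuse ?t h \<xi>] (state d m y z x a) = state d m (euler_move d \<nu> \<tau> ?t h \<xi> y) z1 x (\<lambda>i. a i + h * G ?t y i)"
    using run_step[OF Cons.prems] by blast
  have "euler_move d \<nu> \<tau> ?t h \<xi> y \<in> Rn {..<d}" by (auto simp: euler_move_def Rn_def)
  from Cons.IH[OF this] obtain z2 where z2: "run (path_program h (Suc k) w) (state d m (euler_move d \<nu> \<tau> ?t h \<xi> y) z1 x (\<lambda>i. a i + h * G ?t y i))
     = state d m x z2 x (\<lambda>i. a i + h * G ?t y i + euler_path d \<nu> \<tau> G F h (Suc k) w (euler_move d \<nu> \<tau> ?t h \<xi> y) i)" by blast
  show ?case unfolding path_program.simps fold_append o_apply z1 z2 by (intro exI[of _ z2]) (simp add: add.assoc)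
qed

lemma length_path_program: "length (path_program h k w) = 3 * length w + 1"
  by (induction w arbitrary: k) auto

lemma computes_path_program:
  assumes "h \<ge> 0" "real (k + length w) * h \<le> T" "f \<in> set (path_program h k w)"
  shows "computes \<rho> n n cost f"
  using assms(2,3)
proof (induction w arbitrary: k)
  case Nil
  then have "0 \<in> {0..T}" using assms(1) by (auto intro: order_trans[of 0 "real k * h"])
  then show ?case using Nil computes_instructions(4) by auto
next
  case (Cons \<xi> w)
  have "real k * h \<le> real (k + length (\<xi> # w)) * h" using assms(1) by (intro mult_right_mono) auto
  then have t: "real k * h \<in> {0..T}" using Cons.prems assms(1) by simp
  have "real (Suc k + length w) * h \<le> T" using Cons.prems by simp
  from Cons.IH[OF this] show ?case using Cons.prems computes_instructions[OF t] by auto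
qed

text \<open>All samples together need one copy of each perturbing network per time step and sample; hence the size is linear in the number of steps, in the number of samples, and in the size of the given networks.\<close>

lemma computes_sample_average:
  assumes h: "h \<ge> 0" "real N * h \<le> T" and ws: "\<And>w. w \<in> set ws \<Longrightarrow> length w = N" and ne: "ws \<noteq> []"
  shows "computes \<rho> d m (22 * (P + 1) * n ^ 3 * (length ws * (3 * N + 1) + 1)) (\<lambda>x i. (\<Sum>w\<leftarrow>ws. euler_path d \<nu> \<tau> G F h 0 w x i) / real (length ws))"
proof -
  define fs where "fs = concat (map (path_program h 0) ws)"
  have n0: "n > 0" using m by simp
  have r: "\<exists>z'. run fs (state d m x z x a) = state d m x z' x (\<lambda>i. a i + (\<Sum>w\<leftarrow>ws. euler_path d \<nu> \<tau> G F h 0 w x i))" if x: "x \<in> Rn {..<d}" for x z a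
    unfolding fs_def
  proof (induction ws arbitrary: z a)
    case (Cons w ws)
    obtain z1 where z1: "run (path_program h 0 w) (state d m x z x a) = state d m x z1 x (\<lambda>i. a i + euler_path d \<nu> \<tau> G F h 0 w x i)"
      using run_path[OF x] by blast
    obtain z2 where z2: "run (concat (map (path_program h 0) ws)) (state d m x z1 x (\<lambda>i. a i + euler_path d \<nu> \<tau> G F h 0 w x i))
      = state d m x z2 x (\<lambda>i. a i + euler_path d \<nu> \<tau> G F h 0 w x i + (\<Sum>w\<leftarrow>ws. euler_path d \<nu> \<tau> G F h 0 w x i))"
      using Cons[of z1 "\<lambda>i. a i + euler_path d \<nu> \<tau> G F h 0 w x i"] by blast
    show ?case unfolding list.map concat.simps fold_append o_apply z1 z2 by (intro exI[of _ z2]) (simp add: add.assoc)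
  qed auto
  have len: "length fs = length ws * (3 * N + 1)"
    using ws unfolding fs_def by (induction ws) (auto simp: length_path_program)
  have cfs: "computes \<rho> n n cost f" if "f \<in> set fs" for f
  proof -
    obtain w where w: "w \<in> set ws" "f \<in> set (path_program h 0 w)" using \<open>f \<in> set fs\<close> unfolding fs_def by auto
    have "real (0 + length w) * h \<le> T" using ws[OF w(1)] h by simp
    from computes_path_program[OF h(1) this w(2)] show ?thesis .
  qed
  have 1: "computes \<rho> d n (n * d + n) (\<lambda>x i. (\<Sum>j<d. (if j = (if i < d then i else if i < 2 * d then d else i - 2 * d) then 1 else 0) * x j) + 0)"
    using d n0 by (intro computes_affine) auto
  have 2: "computes \<rho> n n (cost * length fs + (n * n + n)) (\<lambda>s. run fs s)"
    using n0 cfs by (intro computes_fold) auto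
  have 3: "computes \<rho> n m (m * n + m) (\<lambda>x i. (\<Sum>j<n. (if j = 3 * d + i then 1 / real (length ws) else 0) * x j) + 0)"
    using m n0 by (intro computes_affine) auto
  let ?P = "n * d + n + (cost * length fs + (n * n + n)) + (m * n + m)"
  have c: "computes \<rho> d m ?P (\<lambda>x. (\<lambda>x i. (\<Sum>j<n. (if j = 3 * d + i then 1 / real (length ws) else 0) * x j) + 0)
      (restrict (run fs (restrict (\<lambda>i. (\<Sum>j<d. (if j = (if i < d then i else if i < 2 * d then d else i - 2 * d) then 1 else 0) * x j) + 0) {..<n})) {..<n}))"
    by (rule computes_compose[OF computes_compose[OF 1 2] 3])
  have eq: "restrict (\<lambda>i. (\<Sum>j<n. (if j = 3 * d + i then 1 / real (length ws) else 0) *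
      restrict (run fs (restrict (\<lambda>i. (\<Sum>j<d. (if j = (if i < d then i else if i < 2 * d then d else i - 2 * d) then 1 else 0) * x j) + 0) {..<n})) {..<n} j) + 0) {..<m}
     = restrict (\<lambda>i. (\<Sum>w\<leftarrow>ws. euler_path d \<nu> \<tau> G F h 0 w x i) / real (length ws)) {..<m}" if x: "x \<in> Rn {..<d}" for x
  proof -
    have i: "restrict (\<lambda>i. (\<Sum>j<d. (if j = (if i < d then i else if i < 2 * d then d else i - 2 * d) then 1 else 0) * x j) + 0) {..<n} = state d m x (\<lambda>_. 0) x' (\<lambda>_. 0)"
      if "x' = x" for x'
    proof -
      have "(\<Sum>j<d. (if j = k then 1 else 0) * x j) = (if k < d then x k else 0)" for k
        by (simp add: if_distrib[of "\<lambda>a. a * _"] cong: if_cong)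
      then show ?thesis unfolding that state_def by (auto simp: fun_eq_iff)
    qed
    obtain z' where z': "run fs (state d m x (\<lambda>_. 0) x (\<lambda>_. 0)) = state d m x z' x (\<lambda>i. 0 + (\<Sum>w\<leftarrow>ws. euler_path d \<nu> \<tau> G F h 0 w x i))"
      using r[OF x] by blast
    have "(\<Sum>j<n. (if j = 3 * d + i then 1 / real (length ws) else 0) * s j) = s (3 * d + i) / real (length ws)" if "i < m" for i s
      using that by (simp add: if_distrib[of "\<lambda>a. a * _"] cong: if_cong)
    then show ?thesis unfolding i[OF refl] z' by (auto simp: state_def fun_eq_iff)
  qed
  have "computes \<rho> d m ?P (\<lambda>x i. (\<Sum>w\<leftarrow>ws. euler_path d \<nu> \<tau> G F h 0 w x i) / real (length ws))"
    using c unfolding computes_def using eq by auto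
  moreover have "?P \<le> 22 * (P + 1) * n ^ 3 * (length ws * (3 * N + 1) + 1)"
  proof -
    have p: "n \<le> n ^ 3" "n ^ 2 \<le> n ^ 3" using n0 by (auto intro: power_increasing self_le_power)
    have q: "n * d \<le> n ^ 2" "m * n \<le> n ^ 2" "m \<le> n" "n * n \<le> n ^ 2"
      unfolding power2_eq_square by (intro mult_le_mono; simp)+ simp_all
    have sum6: "a + b + (e + b) + (f + g) \<le> 6 * k" if "a \<le> k" "b \<le> k" "e \<le> k" "f \<le> k" "g \<le> k" for a b e f g k :: nat
      using that by simp
    have "n * d + n + (n * n + n) + (m * n + m) \<le> 6 * n ^ 3"
      by (rule sum6[OF order_trans[OF q(1) p(2)] p(1) order_trans[OF q(4) p(2)] order_trans[OF q(2) p(2)] order_trans[OF q(3) p(1)]])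
    also have "\<dots> \<le> cost" unfolding cost_def by simp
    finally have "?P \<le> cost * (length fs + 1)" by (simp add: algebra_simps)
    also have "\<dots> \<le> 22 * (P + 1) * n ^ 3 * (length ws * (3 * N + 1) + 1)"
      unfolding cost_def len by (intro mult_le_mono) auto
    finally show ?thesis .
  qed
  ultimately show ?thesis by (rule computes_mono)
qed

end

section \<open>Consequences of the growth conditions\<close>

text \<open>Powers of \<open>1 + \<parallel>x\<parallel>\<close> with a real exponent are absorbed into a natural power of \<open>1 + \<parallel>x\<parallel>\<^sup>2\<close>.\<close>

lemma L2_set_weight: "(1 + L2_set x I)\<^sup>2 \<le> 2 * sqweight I x"
proof -
  have "(L2_set x I)\<^sup>2 = (\<Sum>i\<in>I. (x i)\<^sup>2)" by (simp add: L2_set_def sum_nonneg)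
  moreover have "(1 + a)\<^sup>2 \<le> 2 * (1 + a\<^sup>2)" for a :: real
    using sum_squares_bound[of 1 a] by (simp add: power2_sum)
  ultimately show ?thesis by (metis sqweight_def)
qed

lemma powr_weight_le:
  assumes "s \<le> real q" "1 \<le> a" "a\<^sup>2 \<le> k * sqweight I x" "k \<ge> 0"
  shows "a powr s \<le> k ^ q * sqweight I x ^ q"
proof -
  have "a powr s \<le> a powr real q" using assms by (intro powr_mono) auto
  also have "\<dots> = a ^ q" using assms by (simp add: powr_realpow)
  also have "\<dots> \<le> (a\<^sup>2) ^ q" using assms self_le_power[of a 2] by (intro power_mono) auto
  also have "\<dots> \<le> (k * sqweight I x) ^ q" using assms by (intro power_mono) auto
  finally show ?thesis by (simp add: power_mult_distrib)
qed

lemma growth_tD: "growth_t T k r I J h \<le> B \<Longrightarrow> t \<in> {0..T} \<Longrightarrow> growth k r I J (h t) \<le> B"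
  unfolding growth_t_def by (meson SUP_upper order_trans)

lemma finite_index_lists: "finite I \<Longrightarrow> finite {js. set js \<subseteq> I \<and> length js = k}"
  by (rule finite_lists_length_eq)

text \<open>Each partial derivative is a single entry of the tensor whose norm is controlled.\<close>

lemma growth_jet_bounded:
  fixes h :: "('i \<Rightarrow> real) \<Rightarrow> 'j \<Rightarrow> real"
  assumes I: "finite I" "finite J" and g: "growth k r I J h \<le> ennreal b" and b: "b \<ge> 0"
    and r: "r + real k \<le> real q" and x: "x \<in> Rn I" and j: "j \<in> J"
  shows "jet_bounded I k (b * (2 ^ q * sqweight I x ^ q)) (\<lambda>x. h x j) x"
  unfolding jet_bounded_def
proof (intro allI impI)
  fix js assume js: "set js \<subseteq> I \<and> length js \<le> k"
  define a where "a = 1 + L2_set x I"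
  have a: "a \<ge> 1" by (simp add: a_def L2_set_nonneg)
  have nn: "nabla_norm i I J h x \<ge> 0" for i by (simp add: nabla_norm_def L2_set_nonneg)
  have "ennreal (\<Sum>i\<le>k. nabla_norm i I J h x / a powr (r + real k - real i)) \<le> growth k r I J h"
    unfolding growth_def a_def by (rule SUP_upper[OF x])
  also note g
  finally have s: "(\<Sum>i\<le>k. nabla_norm i I J h x / a powr (r + real k - real i)) \<le> b" using b by simp
  have "nabla_norm (length js) I J h x / a powr (r + real k - real (length js)) \<le> (\<Sum>i\<le>k. nabla_norm i I J h x / a powr (r + real k - real i))"
    using js nn by (intro member_le_sum) auto
  also note s
  finally have "nabla_norm (length js) I J h x \<le> b * a powr (r + real k - real (length js))"
    using a by (simp add: divide_le_eq)
  also have "\<dots> \<le> b * (2 ^ q * sqweight I x ^ q)"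
    using b r a L2_set_weight[of x I] by (intro mult_left_mono powr_weight_le) (auto simp: a_def)
  finally have 1: "nabla_norm (length js) I J h x \<le> b * (2 ^ q * sqweight I x ^ q)" .
  have "\<bar>partial_derivs js (\<lambda>y. h y j) x\<bar> = \<bar>(\<lambda>(js, j). partial_derivs js (\<lambda>y. h y j) x) (js, j)\<bar>" by simp
  also have "\<dots> \<le> L2_set (\<lambda>z. \<bar>(\<lambda>(js, j). partial_derivs js (\<lambda>y. h y j) x) z\<bar>) ({ks. set ks \<subseteq> I \<and> length ks = length js} \<times> J)"
    using js j I finite_index_lists[OF I(1)] by (intro member_le_L2_set) auto
  also have "\<dots> = nabla_norm (length js) I J h x" by (simp add: nabla_norm_def L2_set_def)
  finally show "\<bar>partial_derivs js (\<lambda>x. h x j) x\<bar> \<le> b * (2 ^ q * sqweight I x ^ q)" using 1 by linarith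
qed

lemma growth_jet_diff:
  fixes h k :: "('i \<Rightarrow> real) \<Rightarrow> 'j \<Rightarrow> real"
  assumes I: "finite I" "finite J" and g: "growth 1 0 I J (\<lambda>x i. h x i - k x i) \<le> ennreal b" and b: "b \<ge> 0"
    and q: "1 \<le> q" and x: "x \<in> Rn I" and j: "j \<in> J"
    and h: "times_differentiable 1 I (\<lambda>x. h x j)" and k: "times_differentiable 1 I (\<lambda>x. k x j)"
  shows "jet_diff I (b * (2 ^ q * sqweight I x ^ q)) (\<lambda>x. h x j) (\<lambda>x. k x j) x"
  unfolding jet_diff_def
proof (intro allI impI)
  fix js assume js: "set js \<subseteq> I \<and> length js \<le> 1"
  have jb: "jet_bounded I 1 (b * (2 ^ q * sqweight I x ^ q)) (\<lambda>x. h x j - k x j) x"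
    using growth_jet_bounded[OF I g b _ x j] q by simp
  have p: "partial_deriv i (\<lambda>x. h x j - k x j) x = partial_deriv i (\<lambda>x. h x j) x - partial_deriv i (\<lambda>x. k x j) x" if "i \<in> I" for i
    using has_grad_diff[OF times_differentiable_has_grad[of I 0, OF I(1) _ x] times_differentiable_has_grad[of I 0, OF I(1) _ x]] h k
    by (intro has_grad_partial_deriv[OF I(1) that x]) simp
  show "\<bar>partial_derivs js (\<lambda>x. h x j) x - partial_derivs js (\<lambda>x. k x j) x\<bar> \<le> b * (2 ^ q * sqweight I x ^ q)"
  proof (cases js)
    case Nil
    then show ?thesis using jet_boundedD(1)[OF jb] by simp
  next
    case (Cons i ks)
    then have "js = [i]" "i \<in> I" using js by auto
    then show ?thesis using jet_boundedD(2)[OF jb, of i] p by simp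
  qed
qed

definition pair_point :: "'i set \<Rightarrow> ('i \<Rightarrow> real) \<Rightarrow> ('i \<Rightarrow> real) \<Rightarrow> 'i + 'i \<Rightarrow> real" where
  "pair_point I x y = (\<lambda>k\<in>I <+> I. case_sum x y k)"

lemma pair_point_Rn: "pair_point I x y \<in> Rn (I <+> I)"
  by (simp add: pair_point_def)

lemma L2_set_pair_point: "finite I \<Longrightarrow> (L2_set (pair_point I x y) (I <+> I))\<^sup>2 = (\<Sum>i\<in>I. (x i)\<^sup>2) + (\<Sum>i\<in>I. (y i)\<^sup>2)"
  by (simp add: L2_set_def sum_nonneg sum.Plus pair_point_def)

lemma hat_pair_point:
  assumes "x \<in> Rn I"
  shows "hat I h (pair_point I x y) (Inl j) = h x j"
    and "hat I h (pair_point I x y) (Inr j) = (\<Sum>i\<in>I. partial_deriv i (\<lambda>y. h y j) x * y i)"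
proof -
  have "(\<lambda>i\<in>I. pair_point I x y (Inl i)) = x"
    using assms by (auto simp: pair_point_def Rn_def PiE_def extensional_def fun_eq_iff)
  then show "hat I h (pair_point I x y) (Inl j) = h x j"
    "hat I h (pair_point I x y) (Inr j) = (\<Sum>i\<in>I. partial_deriv i (\<lambda>y. h y j) x * y i)"
    by (auto simp: hat_def Let_def pair_point_def intro!: sum.cong)
qed

text \<open>The augmented map at \<open>(x, y)\<close> collects the values and the derivatives in direction \<open>y\<close>, so one growth bound controls both.\<close>

lemma hat_growth_bound:
  assumes I: "finite I" "finite J" and g: "hat_growth T I J h \<le> ennreal C" and C: "C \<ge> 0" and t: "t \<in> {0..T}"
    and x: "x \<in> Rn I"
  shows "(\<Sum>j\<in>J. (h t x j)\<^sup>2) + (\<Sum>j\<in>J. (\<Sum>i\<in>I. partial_deriv i (\<lambda>x. h t x j) x * y i)\<^sup>2)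
     \<le> 2 * C\<^sup>2 * (1 + (\<Sum>i\<in>I. (x i)\<^sup>2) + (\<Sum>i\<in>I. (y i)\<^sup>2))"
proof -
  define z where "z = pair_point I x y"
  define a where "a = 1 + L2_set z (I <+> I)"
  have a: "a \<ge> 1" by (simp add: a_def L2_set_nonneg)
  have "ennreal (\<Sum>i\<le>0. nabla_norm i (I <+> I) (J <+> J) (hat I (h t)) z / a powr (1 + real 0 - real i)) \<le> growth 0 1 (I <+> I) (J <+> J) (hat I (h t))"
    unfolding growth_def a_def using pair_point_Rn[of I x y] unfolding z_def[symmetric] by (rule SUP_upper)
  also have "\<dots> \<le> ennreal C" using growth_tD[OF g[unfolded hat_growth_def] t] .
  finally have "nabla_norm 0 (I <+> I) (J <+> J) (hat I (h t)) z / a \<le> C" using C a by simp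
  then have "nabla_norm 0 (I <+> I) (J <+> J) (hat I (h t)) z \<le> C * a" using a by (simp add: divide_le_eq)
  moreover have "nabla_norm 0 (I <+> I) (J <+> J) (hat I (h t)) z = L2_set (hat I (h t) z) (J <+> J)"
  proof -
    have e: "{js. set js \<subseteq> I <+> I \<and> length js = 0} \<times> (J <+> J) = Pair [] ` (J <+> J)" by auto
    show ?thesis unfolding nabla_norm_def L2_set_def e by (subst sum.reindex) (auto simp: inj_on_def)
  qed
  ultimately have "(L2_set (hat I (h t) z) (J <+> J))\<^sup>2 \<le> (C * a)\<^sup>2" by (intro power_mono) (auto simp: L2_set_nonneg)
  also have "(L2_set (hat I (h t) z) (J <+> J))\<^sup>2 = (\<Sum>j\<in>J. (h t x j)\<^sup>2) + (\<Sum>j\<in>J. (\<Sum>i\<in>I. partial_deriv i (\<lambda>x. h t x j) x * y i)\<^sup>2)"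
    using I unfolding z_def by (simp add: L2_set_def sum_nonneg sum.Plus hat_pair_point[OF x] del: power2_eq_square)
  also have "(C * a)\<^sup>2 \<le> C\<^sup>2 * (2 * (1 + (L2_set z (I <+> I))\<^sup>2))"
    unfolding power_mult_distrib a_def using sum_squares_bound[of 1 "L2_set z (I <+> I)"]
    by (intro mult_left_mono) (auto simp: power2_sum)
  also have "\<dots> = 2 * C\<^sup>2 * (1 + (\<Sum>i\<in>I. (x i)\<^sup>2) + (\<Sum>i\<in>I. (y i)\<^sup>2))"
    unfolding z_def L2_set_pair_point[OF I(1)] by simp
  finally show ?thesis .
qed

text \<open>The bound is evaluated at \<open>(x, 0)\<close> for the values and at \<open>(x, e\<^sub>i)\<close> for the derivative in direction \<open>i\<close>; at these points the weight is comparable to that of \<open>x\<close>.\<close>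

lemma holder_growth_jet_diff:
  fixes h :: "real \<Rightarrow> ('i \<Rightarrow> real) \<Rightarrow> 'j \<Rightarrow> real"
  assumes I: "finite I" "finite J" "I \<noteq> {}" and g: "holder_growth T \<alpha> r (I <+> I) (J <+> J) (\<lambda>t. hat I (h t)) \<le> ennreal b" and b: "b \<ge> 0"
    and r: "r \<le> real q" and s: "s \<in> {0..T}" and t: "t \<in> {0..T}" and st: "\<bar>s - t\<bar> \<le> 1" and x: "x \<in> Rn I" and j: "j \<in> J"
  shows "jet_diff I (\<bar>s - t\<bar> powr \<alpha> * (b * (4 ^ q * sqweight I x ^ q))) (\<lambda>x. h s x j) (\<lambda>x. h t x j) x"
proof (cases "s = t")
  case True
  then show ?thesis by (simp add: jet_diff_def)
next
  case False
  define \<tau> where "\<tau> = \<bar>s - t\<bar>"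
  have \<tau>: "\<tau> > 0" using False by (simp add: \<tau>_def)
  have key: "\<bar>hat I (h s) (pair_point I x y) l - hat I (h t) (pair_point I x y) l\<bar> \<le> \<tau> powr \<alpha> * (b * (4 ^ q * sqweight I x ^ q))"
    if y: "(\<Sum>i\<in>I. (y i)\<^sup>2) \<le> 1" and l: "l \<in> J <+> J" for y l
  proof -
    let ?z = "pair_point I x y"
    define a where "a = 1 + L2_set ?z (I <+> I)"
    have a: "a \<ge> 1" by (simp add: a_def L2_set_nonneg)
    have "ennreal (L2_set (\<lambda>j. hat I (h s) ?z j - hat I (h t) ?z j) (J <+> J) / a powr r * \<tau> powr (- \<alpha>))
       \<le> (SUP x\<in>Rn (I <+> I). ennreal (L2_set (\<lambda>j. hat I (h s) x j - hat I (h t) x j) (J <+> J) / (1 + L2_set x (I <+> I)) powr r * \<bar>s - t\<bar> powr (- \<alpha>)))"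
      unfolding a_def \<tau>_def by (rule SUP_upper[OF pair_point_Rn])
    also have "\<dots> \<le> holder_growth T \<alpha> r (I <+> I) (J <+> J) (\<lambda>t. hat I (h t))"
      unfolding holder_growth_def using s t st False by (intro SUP_upper2[of "(t, s)"]) (auto simp: abs_minus_commute)
    also note g
    finally have "L2_set (\<lambda>j. hat I (h s) ?z j - hat I (h t) ?z j) (J <+> J) / a powr r * \<tau> powr (- \<alpha>) \<le> b" using b by simp
    then have "L2_set (\<lambda>j. hat I (h s) ?z j - hat I (h t) ?z j) (J <+> J) \<le> b * (a powr r) * \<tau> powr \<alpha>"
      using a \<tau> by (simp add: powr_minus divide_le_eq field_simps)
    also have "\<dots> \<le> b * (4 ^ q * sqweight I x ^ q) * \<tau> powr \<alpha>"
    proof (intro mult_right_mono mult_left_mono powr_weight_le)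
      have "a\<^sup>2 \<le> 2 * (1 + (L2_set ?z (I <+> I))\<^sup>2)"
        unfolding a_def using sum_squares_bound[of 1 "L2_set ?z (I <+> I)"] by (simp add: power2_sum)
      also have "\<dots> \<le> 2 * (1 + (\<Sum>i\<in>I. (x i)\<^sup>2) + 1)" unfolding L2_set_pair_point[OF I(1)] using y by simp
      also have "\<dots> \<le> 4 * sqweight I x" using sqweight_ge_1[of I x] by (simp add: sqweight_def)
      finally show "a\<^sup>2 \<le> 4 * sqweight I x" .
    qed (use r a b in auto)
    also have "\<bar>hat I (h s) ?z l - hat I (h t) ?z l\<bar> \<le> L2_set (\<lambda>j. \<bar>hat I (h s) ?z j - hat I (h t) ?z j\<bar>) (J <+> J)"
      using l I by (intro member_le_L2_set[of _ _ "\<lambda>j. \<bar>hat I (h s) ?z j - hat I (h t) ?z j\<bar>"]) auto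
    then have "\<bar>hat I (h s) ?z l - hat I (h t) ?z l\<bar> \<le> L2_set (\<lambda>j. hat I (h s) ?z j - hat I (h t) ?z j) (J <+> J)"
      by (simp add: L2_set_def)
    finally show ?thesis by (simp add: mult.commute)
  qed
  have j2: "Inl j \<in> J <+> J" "Inr j \<in> J <+> J" using j by auto
  show ?thesis unfolding jet_diff_def \<tau>_def[symmetric]
  proof (intro allI impI)
    fix js assume js: "set js \<subseteq> I \<and> length js \<le> 1"
    show "\<bar>partial_derivs js (\<lambda>x. h s x j) x - partial_derivs js (\<lambda>x. h t x j) x\<bar> \<le> \<tau> powr \<alpha> * (b * (4 ^ q * sqweight I x ^ q))"
    proof (cases js)
      case Nil
      then show ?thesis using key[OF _ j2(1), of "\<lambda>_. 0"] by (simp add: hat_pair_point[OF x])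
    next
      case (Cons i ks)
      then have i: "js = [i]" "i \<in> I" using js by auto
      let ?e = "\<lambda>k. if k = i then 1 else 0 :: real"
      have sq: "(?e k)\<^sup>2 = ?e k" for k by simp
      have "(\<Sum>k\<in>I. (?e k)\<^sup>2) \<le> 1" unfolding sq using I(1) i(2) by simp
      from key[OF this j2(2)] show ?thesis
        using i I(1) by (simp add: hat_pair_point[OF x] if_distrib[of "\<lambda>a. _ * a"] cong: if_cong)
    qed
  qed
qed

text \<open>All the conditions on a single component follow with one polynomial weight. The power \<open>q\<close> dominates all growth exponents that occur, up to \<open>r + 5\<close>,
  and the factor \<open>4\<^sup>q\<close> comes from passing to the weight \<open>1 + \<parallel>x\<parallel>\<^sup>2\<close>.\<close>

lemma euler_setting_of_growth:
  fixes T B b c \<delta> r \<alpha> :: real and d m i :: nat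
    and \<mu> \<nu> :: "real \<Rightarrow> (nat \<Rightarrow> real) \<Rightarrow> nat \<Rightarrow> real" and \<sigma> \<tau> :: "real \<Rightarrow> (nat \<Rightarrow> real) \<Rightarrow> nat \<times> nat \<Rightarrow> real"
    and u g G :: "real \<Rightarrow> (nat \<Rightarrow> real) \<Rightarrow> nat \<Rightarrow> real" and f F :: "(nat \<Rightarrow> real) \<Rightarrow> nat \<Rightarrow> real"
  defines "q \<equiv> nat \<lceil>r\<rceil> + 6"
  defines "X \<equiv> {..<d}" and "M \<equiv> {..<d} \<times> {..<d}" and "Y \<equiv> {..<m}"
  assumes d: "d \<ge> 1" and T: "T \<ge> 1" and b: "b \<ge> 1" and \<delta>: "\<delta> \<ge> 0" and c: "c \<ge> 0" and r: "r \<ge> 0" and \<alpha>: "0 < \<alpha>" and i: "i < m"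
    and diff: "\<And>t. t \<in> {0..T} \<Longrightarrow> cont_differentiable_times 3 X X (\<mu> t) \<and> cont_differentiable_times 3 X M (\<sigma> t) \<and> cont_differentiable_times 3 X Y (g t)"
    and g_time: "cont_differentiable_in_time T X Y g"
    and f_diff: "cont_differentiable_times 5 X Y f"
    and u: "C1k T 5 X Y u" and pde: "solves_pde T d m \<mu> \<sigma> g f u"
    and F_diff: "differentiable_times 2 X Y F"
    and pert: "\<And>t. t \<in> {0..T} \<Longrightarrow> differentiable_times 2 X Y (G t) \<and> differentiable_times 2 X X (\<nu> t) \<and> differentiable_times 2 X M (\<tau> t)"
    and hats: "hat_growth T X X \<nu> \<le> ennreal c" "(hat_growth T X M \<tau>)\<^sup>2 \<le> ennreal c" 
    and hats_b: "c \<le> b"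
    and gr: "growth_t T 2 0 X X \<mu> \<le> ennreal b" "growth_t T 2 0 X M \<sigma> \<le> ennreal b" "growth_t T 2 0 X Y g \<le> ennreal b"
      "growth 1 r X Y F \<le> ennreal b" "growth_t T 1 r X Y G \<le> ennreal b" "growth_t T 1 r X Y (time_deriv T g) \<le> ennreal b"
      "growth_t T 5 r X Y u \<le> ennreal b"
      "holder_growth T \<alpha> r (X <+> X) (X <+> X) (\<lambda>t. hat X (\<mu> t)) \<le> ennreal b"
      "holder_growth T \<alpha> r (X <+> X) (M <+> M) (\<lambda>t. hat X (\<sigma> t)) \<le> ennreal b"
    and close: "growth_t T 1 0 X X (\<lambda>t x i. \<mu> t x i - \<nu> t x i) \<le> ennreal \<delta>"
      "growth_t T 1 0 X M (\<lambda>t x i. \<sigma> t x i - \<tau> t x i) \<le> ennreal \<delta>"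
      "growth 1 0 X Y (\<lambda>x i. f x i - F x i) \<le> ennreal \<delta>"
      "growth_t T 1 0 X Y (\<lambda>t x i. g t x i - G t x i) \<le> ennreal \<delta>"
  shows "euler_setting d q T (2 * (real d + 1) * 4 ^ q * b) \<delta> \<alpha> c \<mu> \<nu> \<sigma> \<tau> (\<lambda>t x. u t x i) (\<lambda>t x. g t x i) (\<lambda>t x. G t x i) (\<lambda>x. f x i) (\<lambda>x. F x i)"
proof -
  define BB where "BB = 2 * (real d + 1) * 4 ^ q * b"
  have X: "finite X" "finite M" "finite Y" "X \<noteq> {}" using d by (auto simp: X_def M_def Y_def lessThan_empty_iff)
  have iY: "i \<in> Y" using i by (simp add: Y_def)
  have rq: "r + 5 \<le> real q" "r \<le> real q" "1 \<le> q" unfolding q_def using r by (auto; linarith)+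
  have b0: "b \<ge> 0" using b by simp
  have Bb: "b * (4 ^ q * w) \<le> BB * w" "b * (2 ^ q * w) \<le> BB * w" "\<delta> * (2 ^ q * w) \<le> \<delta> * (BB * w)" if "w \<ge> 0" for w
  proof -
    have 1: "b * 4 ^ q \<le> BB" unfolding BB_def using b d mult_right_mono[of 1 "2 * (real d + 1)" "4 ^ q * b"] by (simp add: mult_ac)
    then show "b * (4 ^ q * w) \<le> BB * w" using mult_right_mono[OF 1 that] by (simp add: mult.assoc)
    have 24: "(2::real) ^ q \<le> 4 ^ q" by (intro power_mono) auto
    have "b * 2 ^ q \<le> b * 4 ^ q" using 24 b0 by (intro mult_left_mono) auto
    then have 2: "b * 2 ^ q \<le> BB" using 1 by linarith
    then show "b * (2 ^ q * w) \<le> BB * w" using mult_right_mono[OF 2 that] by (simp add: mult.assoc)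
    have "1 * 2 ^ q \<le> b * 2 ^ q" using b by (intro mult_right_mono) auto
    then have "2 ^ q \<le> BB" using 2 by linarith
    then show "\<delta> * (2 ^ q * w) \<le> \<delta> * (BB * w)" using that \<delta> by (intro mult_left_mono mult_right_mono) auto
  qed
  have w0: "sqweight X x ^ q \<ge> 0" for x using sqweight_pos[of X x] by (simp add: less_imp_le)
  have jb: "jet_bounded X k (BB * sqweight X x ^ q) (\<lambda>x. h x j) x"
    if "growth l s X J h \<le> ennreal b" "finite J" "j \<in> J" "x \<in> Rn X" "s + real l \<le> real q" "k \<le> l" for l s J k j x and h :: "(nat \<Rightarrow> real) \<Rightarrow> 'z \<Rightarrow> real"
    by (rule jet_bounded_mono[OF growth_jet_bounded[OF X(1) that(2,1) b0 that(5,4,3)] Bb(2)[OF w0] that(6)])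
  have jd: "jet_diff X (\<delta> * (BB * sqweight X x ^ q)) (\<lambda>x. h x j) (\<lambda>x. k x j) x"
    if "growth 1 0 X J (\<lambda>x i. h x i - k x i) \<le> ennreal \<delta>" "finite J" "j \<in> J" "x \<in> Rn X" "times_differentiable 1 X (\<lambda>x. h x j)" "times_differentiable 1 X (\<lambda>x. k x j)"
    for J j x and h k :: "(nat \<Rightarrow> real) \<Rightarrow> 'z \<Rightarrow> real"
    by (rule jet_diff_mono[OF growth_jet_diff[OF X(1) that(2,1) \<delta> rq(3) that(4,3,5,6)] Bb(3)[OF w0]])
  have hb: "hat_growth T X M \<tau> \<le> ennreal (sqrt c)"
  proof -
    have fin: "hat_growth T X M \<tau> \<noteq> top"
    proof
      assume "hat_growth T X M \<tau> = top"
      then show False using hats(2) by (simp add: ennreal_top_mult power2_eq_square top_unique)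
    qed
    define a where "a = enn2real (hat_growth T X M \<tau>)"
    have a: "hat_growth T X M \<tau> = ennreal a" "a \<ge> 0" using fin by (auto simp: a_def less_top)
    have "a\<^sup>2 \<le> c" using hats(2) a c by (simp add: power2_eq_square ennreal_mult'[symmetric])
    then show ?thesis unfolding a(1) by (intro ennreal_leI) (simp add: real_le_rsqrt)
  qed
  have td: "times_differentiable k X (\<lambda>x. h x j)" if "differentiable_times l X J h" "j \<in> J" "k \<le> l" for k l J j and h :: "(nat \<Rightarrow> real) \<Rightarrow> 'z \<Rightarrow> real"
    using that unfolding differentiable_times_def by (blast intro: times_differentiable_mono)
  have cd: "differentiable_times l X J h" if "cont_differentiable_times l X J h" for l J and h :: "(nat \<Rightarrow> real) \<Rightarrow> 'z \<Rightarrow> real"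
    using that unfolding cont_differentiable_times_def by blast
  have u5: "differentiable_times 5 X Y (u t)" if "t \<in> {0..T}" for t using u that unfolding C1k_def by blast
  \<comment> \<open>The perturbed coefficients are bounded through the augmented growth condition: take \<open>y = 0\<close> for values and \<open>y = e\<^sub>k\<close> for derivatives.\<close>
  have \<nu>b: "jet_bounded X 1 (BB * sqweight X x ^ q) (\<lambda>x. h t x j) x"
    if hg: "hat_growth T X J h \<le> ennreal C" "C \<ge> 0" "C \<le> b" "finite J" and t: "t \<in> {0..T}" and j: "j \<in> J" and x: "x \<in> Rn X"
    for J t j x C and h :: "real \<Rightarrow> (nat \<Rightarrow> real) \<Rightarrow> 'z \<Rightarrow> real"
    unfolding jet_bounded_def
  proof (intro allI impI)
    fix js assume js: "set js \<subseteq> X \<and> length js \<le> 1"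
    have Cw: "sqrt (4 * C\<^sup>2 * sqweight X x) \<le> BB * sqweight X x ^ q"
    proof -
      have s1: "sqweight X x \<ge> 1" by (rule sqweight_ge_1)
      have "sqrt (4 * C\<^sup>2 * sqweight X x) \<le> sqrt ((2 * C * sqweight X x)\<^sup>2)"
        using s1 self_le_power[of "sqweight X x" 2] by (intro real_sqrt_le_mono) (auto simp: power_mult_distrib mult_left_mono)
      also have "\<dots> = 2 * C * sqweight X x" using hg(2) s1 by simp
      also have "\<dots> \<le> BB * sqweight X x ^ q"
      proof (intro mult_mono)
        have "2 * C \<le> 2 * b" using hg(3) by simp
        also have "\<dots> \<le> BB" unfolding BB_def
          using b d mult_mono[of 2 "2 * (real d + 1) * 4 ^ q" b b] mult_mono[of 2 "2 * (real d + 1)" 1 "4 ^ q"] by simp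
        finally show "2 * C \<le> BB" .
        show "sqweight X x \<le> sqweight X x ^ q" using s1 rq(3) by (intro self_le_power) auto
      qed (use b s1 in \<open>auto simp: BB_def\<close>)
      finally show ?thesis .
    qed
    have key: "a \<le> 4 * C\<^sup>2 * sqweight X x" if "a + e \<le> 2 * C\<^sup>2 * (1 + (\<Sum>i\<in>X. (x i)\<^sup>2) + s)" "s \<le> 1" "0 \<le> e" for a e s
    proof -
      have "2 * C\<^sup>2 * (1 + (\<Sum>i\<in>X. (x i)\<^sup>2) + s) \<le> 2 * C\<^sup>2 * (2 * sqweight X x)"
        using that(2) sqweight_ge_1[of X x] by (intro mult_left_mono) (auto simp: sqweight_def)
      then show ?thesis using that by (simp add: algebra_simps)
    qed
    show "\<bar>partial_derivs js (\<lambda>x. h t x j) x\<bar> \<le> BB * sqweight X x ^ q"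
    proof (cases js)
      case Nil
      have "(h t x j)\<^sup>2 \<le> (\<Sum>j\<in>J. (h t x j)\<^sup>2)" using hg(4) j by (intro member_le_sum) auto
      moreover have "(\<Sum>j\<in>J. (h t x j)\<^sup>2) \<le> 4 * C\<^sup>2 * sqweight X x"
        by (rule key[OF hat_growth_bound[OF X(1) hg(4,1,2) t x, of "\<lambda>_. 0"]]) (auto intro: sum_nonneg)
      ultimately have "(h t x j)\<^sup>2 \<le> 4 * C\<^sup>2 * sqweight X x" by linarith
      then have "\<bar>h t x j\<bar> \<le> sqrt (4 * C\<^sup>2 * sqweight X x)" by (simp add: real_le_rsqrt)
      then show ?thesis using Cw Nil by simp
    next
      case (Cons k ks)
      then have k: "js = [k]" "k \<in> X" using js by auto
      let ?e = "\<lambda>l. if l = k then 1 else 0 :: real"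
      have sq: "(?e l)\<^sup>2 = ?e l" for l by simp
      have e1: "(\<Sum>l\<in>X. (?e l)\<^sup>2) \<le> 1" unfolding sq using X(1) k(2) by simp
      have pe: "(\<Sum>i\<in>X. partial_deriv i (\<lambda>x. h t x j) x * ?e i) = partial_deriv k (\<lambda>x. h t x j) x" for j
        using X(1) k(2) by (simp add: if_distrib[of "\<lambda>a. _ * a"] cong: if_cong)
      have "(\<Sum>j\<in>J. (partial_deriv k (\<lambda>x. h t x j) x)\<^sup>2) + (\<Sum>j\<in>J. (h t x j)\<^sup>2) \<le> 2 * C\<^sup>2 * (1 + (\<Sum>i\<in>X. (x i)\<^sup>2) + (\<Sum>l\<in>X. (?e l)\<^sup>2))"
        using hat_growth_bound[OF X(1) hg(4,1,2) t x, of ?e] unfolding pe by simp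
      from key[OF this e1] have "(\<Sum>j\<in>J. (partial_deriv k (\<lambda>x. h t x j) x)\<^sup>2) \<le> 4 * C\<^sup>2 * sqweight X x"
        by (simp add: sum_nonneg)
      moreover have "(partial_deriv k (\<lambda>x. h t x j) x)\<^sup>2 \<le> (\<Sum>j\<in>J. (partial_deriv k (\<lambda>x. h t x j) x)\<^sup>2)" using hg(4) j by (intro member_le_sum) auto
      ultimately have "(partial_deriv k (\<lambda>x. h t x j) x)\<^sup>2 \<le> 4 * C\<^sup>2 * sqweight X x" by linarith
      then have "\<bar>partial_deriv k (\<lambda>x. h t x j) x\<bar> \<le> sqrt (4 * C\<^sup>2 * sqweight X x)" by (simp add: real_le_rsqrt)
      then show ?thesis using Cw k by simp
    qed
  qed
  have td1: "times_differentiable 1 X (\<lambda>x. \<mu> t x j)" "times_differentiable 1 X (\<lambda>x. \<nu> t x j)"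
    if "t \<in> {0..T}" "j \<in> X" for t j
  proof -
    show "times_differentiable 1 X (\<lambda>x. \<mu> t x j)" by (rule td[OF cd that(2)]) (use diff[OF that(1)] in auto)
    show "times_differentiable 1 X (\<lambda>x. \<nu> t x j)" by (rule td[OF _ that(2)]) (use pert[OF that(1)] in auto)
  qed
  have td2: "times_differentiable 1 X (\<lambda>x. \<sigma> t x j)" "times_differentiable 1 X (\<lambda>x. \<tau> t x j)"
    if "t \<in> {0..T}" "j \<in> M" for t j
  proof -
    show "times_differentiable 1 X (\<lambda>x. \<sigma> t x j)" by (rule td[OF cd that(2)]) (use diff[OF that(1)] in auto)
    show "times_differentiable 1 X (\<lambda>x. \<tau> t x j)" by (rule td[OF _ that(2)]) (use pert[OF that(1)] in auto)
  qed
  have td3: "times_differentiable 2 X (\<lambda>x. g t x i)" "times_differentiable 1 X (\<lambda>x. g t x i)" "times_differentiable 1 X (\<lambda>x. G t x i)"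
    if "t \<in> {0..T}" for t
  proof -
    show "times_differentiable 2 X (\<lambda>x. g t x i)" by (rule td[OF cd iY]) (use diff[OF that] in auto)
    show "times_differentiable 1 X (\<lambda>x. g t x i)" by (rule td[OF cd iY]) (use diff[OF that] in auto)
    show "times_differentiable 1 X (\<lambda>x. G t x i)" by (rule td[OF _ iY]) (use pert[OF that] in auto)
  qed
  have td4: "times_differentiable 1 X (\<lambda>x. f x i)" "times_differentiable 1 X (\<lambda>x. F x i)"
  proof -
    show "times_differentiable 1 X (\<lambda>x. f x i)" by (rule td[OF cd[OF f_diff] iY]) simp
    show "times_differentiable 1 X (\<lambda>x. F x i)" by (rule td[OF F_diff iY]) simp
  qed
  have sc: "sqrt c \<le> b"
  proof -
    have "c \<le> b * b" using hats_b b mult_mono[of 1 b c b] c by simp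
    then show ?thesis using b by (intro real_le_lsqrt) (auto simp: power2_eq_square c)
  qed
  have "euler_setting d q T BB \<delta> \<alpha> c \<mu> \<nu> \<sigma> \<tau> (\<lambda>t x. u t x i) (\<lambda>t x. g t x i) (\<lambda>t x. G t x i) (\<lambda>x. f x i) (\<lambda>x. F x i)"
    unfolding X_def[symmetric]
  proof (unfold_locales, fold X_def)
    show "1 \<le> BB" unfolding BB_def using b d mult_mono[of 1 "2 * (real d + 1) * 4 ^ q" 1 b] mult_mono[of 1 "2 * (real d + 1)" 1 "4 ^ q"] by simp
    fix t assume t: "t \<in> {0..T}"
    show "times_differentiable 5 X (\<lambda>x. u t x i)" by (rule td[OF u5[OF t] iY]) simp
    show "times_differentiable 2 X (\<lambda>x. g t x i)" "times_differentiable 1 X (\<lambda>x. G t x i)" using td3[OF t] by blast+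
    show "continuous_on (Rn X) (partial_derivs js (\<lambda>x. u t x i))" if "set js \<subseteq> X" "length js \<le> 3" for js
    proof -
      have "continuous_on ({0..T} \<times> Rn X) (\<lambda>(t, x). partial_derivs js (\<lambda>y. u t y i) x)"
        using u that iY unfolding C1k_def by auto
      then have "continuous_on (Rn X) (\<lambda>x. (\<lambda>(t, x). partial_derivs js (\<lambda>y. u t y i) x) (t, x))"
        by (rule continuous_on_compose2) (use t in \<open>auto intro!: continuous_intros\<close>)
      then show ?thesis by simp
    qed
    fix j assume j: "j < d"
    then have jX: "j \<in> X" by (simp add: X_def)
    show "times_differentiable 1 X (\<lambda>x. \<mu> t x j)" "times_differentiable 1 X (\<lambda>x. \<nu> t x j)" using td1[OF t jX] by blast+
    fix l assume l: "l < d"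
    then have jl: "(j, l) \<in> M" using j by (simp add: M_def)
    show "times_differentiable 1 X (\<lambda>x. \<sigma> t x (j, l))" "times_differentiable 1 X (\<lambda>x. \<tau> t x (j, l))" using td2[OF t jl] by blast+
  next
    show "times_differentiable 1 X (\<lambda>x. F x i)" by (rule td4(2))
  next
    fix t x assume t: "t \<in> {0..T}" and x: "x \<in> Rn X"
    show "jet_bounded X 5 (BB * sqweight X x ^ q) (\<lambda>x. u t x i) x"
      by (rule jb[OF growth_tD[OF gr(7) t] X(3) iY x]) (use rq in auto)
    show "jet_bounded X 2 (BB * sqweight X x ^ q) (\<lambda>x. g t x i) x"
      by (rule jb[OF growth_tD[OF gr(3) t] X(3) iY x]) (use rq r in auto)
    show "jet_bounded X 1 (BB * sqweight X x ^ q) (\<lambda>x. G t x i) x"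
      by (rule jb[OF growth_tD[OF gr(5) t] X(3) iY x]) (use rq in auto)
    show "jet_diff X (\<delta> * (BB * sqweight X x ^ q)) (\<lambda>x. g t x i) (\<lambda>x. G t x i) x"
      by (rule jd[of Y "g t" "G t" i x, OF growth_tD[OF close(4) t] X(3) iY x td3(2,3)[OF t]])
    have "((\<lambda>s. u s x i) has_vector_derivative time_deriv T u t x i) (at t within {0..T})"
      using u t x iY unfolding C1k_def time_deriv_def by (auto simp: vector_derivative_works)
    moreover have "time_deriv T u t x i = - (generator d (\<lambda>x. u t x i) (\<mu> t) (\<sigma> t) x + g t x i)"
    proof -
      have "time_deriv T u t x i + (\<Sum>j<d. partial_deriv j (\<lambda>y. u t y i) x * \<mu> t x j)
        + 1/2 * (\<Sum>j<d. \<Sum>k<d. (\<Sum>l<d. \<sigma> t x (j, l) * \<sigma> t x (k, l)) * partial_derivs [k, j] (\<lambda>y. u t y i) x) + g t x i = 0"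
        using pde t x i unfolding solves_pde_def X_def by blast
      then show ?thesis unfolding generator_def sum_distrib_right by (simp add: mult.commute)
    qed
    ultimately show "((\<lambda>s. u s x i) has_real_derivative - (generator d (\<lambda>x. u t x i) (\<mu> t) (\<sigma> t) x + g t x i)) (at t within {0..T})"
      by (simp add: has_real_derivative_iff_has_vector_derivative)
    fix y assume y: "y \<in> Rn X"
    show "(\<Sum>j\<in>X. (\<nu> t x j)\<^sup>2) + (\<Sum>j\<in>X. (\<Sum>i\<in>X. partial_deriv i (\<lambda>x. \<nu> t x j) x * y i)\<^sup>2) \<le> 2 * c\<^sup>2 * (1 + (\<Sum>i\<in>X. (x i)\<^sup>2) + (\<Sum>i\<in>X. (y i)\<^sup>2))"
      using hat_growth_bound[OF X(1) X(1) hats(1) c t x, of y] .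
    show "(\<Sum>j\<in>X. \<Sum>l\<in>X. (\<tau> t x (j, l))\<^sup>2) + (\<Sum>j\<in>X. \<Sum>l\<in>X. (\<Sum>i\<in>X. partial_deriv i (\<lambda>x. \<tau> t x (j, l)) x * y i)\<^sup>2) \<le> 2 * c * (1 + (\<Sum>i\<in>X. (x i)\<^sup>2) + (\<Sum>i\<in>X. (y i)\<^sup>2))"
      using hat_growth_bound[OF X(1) X(2) hb _ t x, of y] c unfolding M_def X_def[symmetric] by (simp add: sum.cartesian_product case_prod_beta')
  next
    fix x assume x: "x \<in> Rn X"
    show "u T x i = f x i" using pde x i unfolding solves_pde_def X_def by blast
    show "jet_bounded X 1 (BB * sqweight X x ^ q) (\<lambda>x. F x i) x"
      by (rule jb[OF gr(4) X(3) iY x]) (use rq in auto)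
    show "jet_diff X (\<delta> * (BB * sqweight X x ^ q)) (\<lambda>x. f x i) (\<lambda>x. F x i) x"
      by (rule jd[of Y f F i x, OF close(3) X(3) iY x td4])
  next
    fix t j x assume t: "t \<in> {0..T}" and j: "j < d" and x: "x \<in> Rn X"
    have jX: "j \<in> X" using j by (simp add: X_def)
    show "jet_bounded X 1 (BB * sqweight X x ^ q) (\<lambda>x. \<mu> t x j) x"
      by (rule jb[OF growth_tD[OF gr(1) t] X(1) jX x]) (use rq r in auto)
    show "jet_bounded X 1 (BB * sqweight X x ^ q) (\<lambda>x. \<nu> t x j) x"
      by (rule \<nu>b[OF hats(1) c hats_b X(1) t jX x])
    show "jet_diff X (\<delta> * (BB * sqweight X x ^ q)) (\<lambda>x. \<mu> t x j) (\<lambda>x. \<nu> t x j) x"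
      by (rule jd[of X "\<mu> t" "\<nu> t" j x, OF growth_tD[OF close(1) t] X(1) jX x td1[OF t jX]])
  next
    fix t j l x assume t: "t \<in> {0..T}" and j: "j < d" "l < d" and x: "x \<in> Rn X"
    have jl: "(j, l) \<in> M" using j by (simp add: M_def)
    show "jet_bounded X 1 (BB * sqweight X x ^ q) (\<lambda>x. \<sigma> t x (j, l)) x"
      by (rule jb[OF growth_tD[OF gr(2) t] X(2) jl x]) (use rq r in auto)
    show "jet_bounded X 1 (BB * sqweight X x ^ q) (\<lambda>x. \<tau> t x (j, l)) x"
      by (rule \<nu>b[OF hb _ sc X(2) t jl x]) (use c in auto)
    show "jet_diff X (\<delta> * (BB * sqweight X x ^ q)) (\<lambda>x. \<sigma> t x (j, l)) (\<lambda>x. \<tau> t x (j, l)) x"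
      by (rule jd[of M "\<sigma> t" "\<tau> t" "(j, l)" x, OF growth_tD[OF close(2) t] X(2) jl x td2[OF t jl]])
  next
    fix s t j x assume st: "s \<in> {0..T}" "t \<in> {0..T}" "\<bar>s - t\<bar> \<le> 1" and j: "j < d" and x: "x \<in> Rn X"
    have jX: "j \<in> X" using j by (simp add: X_def)
    show "jet_diff X (\<bar>s - t\<bar> powr \<alpha> * (BB * sqweight X x ^ q)) (\<lambda>x. \<mu> s x j) (\<lambda>x. \<mu> t x j) x"
      by (rule jet_diff_mono[OF holder_growth_jet_diff[OF X(1,1,4) gr(8) b0 rq(2) st x jX] mult_left_mono[OF Bb(1)[OF w0]]]) simp
  next
    fix s t j l x assume st: "s \<in> {0..T}" "t \<in> {0..T}" "\<bar>s - t\<bar> \<le> 1" and j: "j < d" "l < d" and x: "x \<in> Rn X"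
    have jl: "(j, l) \<in> M" using j by (simp add: M_def)
    show "jet_diff X (\<bar>s - t\<bar> powr \<alpha> * (BB * sqweight X x ^ q)) (\<lambda>x. \<sigma> s x (j, l)) (\<lambda>x. \<sigma> t x (j, l)) x"
      by (rule jet_diff_mono[OF holder_growth_jet_diff[OF X(1,2,4) gr(9) b0 rq(2) st x jl] mult_left_mono[OF Bb(1)[OF w0]]]) simp
  next
    fix s t x assume s: "s \<in> {0..T}" and t: "t \<in> {0..T}" and x: "x \<in> Rn X"
    have "norm (g s x i - g t x i) \<le> (BB * sqweight X x ^ q) * norm (s - t)"
    proof (rule field_differentiable_bound[of "{0..T}" "\<lambda>s. g s x i" "\<lambda>s. time_deriv T g s x i"])
      fix z assume z: "z \<in> {0..T}"
      have "((\<lambda>s. g s x i) has_vector_derivative time_deriv T g z x i) (at z within {0..T})"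
        using g_time z x iY unfolding cont_differentiable_in_time_def time_deriv_def by (auto simp: vector_derivative_works)
      then show "((\<lambda>s. g s x i) has_real_derivative time_deriv T g z x i) (at z within {0..T})"
        by (simp add: has_real_derivative_iff_has_vector_derivative)
      have "jet_bounded X 1 (BB * sqweight X x ^ q) (\<lambda>x. time_deriv T g z x i) x"
        by (rule jb[OF growth_tD[OF gr(6) z] X(3) iY x]) (use rq in auto)
      from jet_boundedD(1)[OF this] show "norm (time_deriv T g z x i) \<le> BB * sqweight X x ^ q" by simp
    qed (use s t in auto)
    then show "\<bar>g s x i - g t x i\<bar> \<le> BB * \<bar>s - t\<bar> * sqweight X x ^ q" by (simp add: mult_ac)
  qed (use d T \<delta> \<alpha> c rq in auto)
  then show ?thesis unfolding BB_def .
qed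

section \<open>Approximation by a network\<close>

text \<open>The constants of the error analysis in closed form. At a point \<open>x\<close> of the unit cube and a coordinate direction, the weight of the pair is at most \<open>2 + d\<close>.\<close>

definition defect_const :: "nat \<Rightarrow> real \<Rightarrow> real \<Rightarrow> real" where
  "defect_const p d B = 26 * 3 ^ p * d ^ 8 * B ^ 5 + 3 ^ (9 * p) * (13 * d ^ 3 * ((3 * 3 ^ (3 * p)) ^ 4 * (3 * d ^ 3 * B ^ 3)) ^ 3)"

definition growth_rate :: "nat \<Rightarrow> real" where
  "growth_rate p = 8 * real (9 * p + 1) + 56 * 3 ^ (9 * p + 1)"

definition bias_factor :: "real \<Rightarrow> nat \<Rightarrow> real \<Rightarrow> real \<Rightarrow> real \<Rightarrow> real" where
  "bias_factor T p d B c = exp (growth_rate p * c * T) * (d * (B + T * defect_const p d B)) * (2 + d) ^ (9 * p + 1)"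

definition moment_bound :: "real \<Rightarrow> nat \<Rightarrow> real \<Rightarrow> real \<Rightarrow> real \<Rightarrow> real" where
  "moment_bound T p d B c = exp (T + growth_rate p * c * T) * (1 + T) * (d * B)\<^sup>2 * (2 + d) ^ (9 * p + 1)"

lemma (in euler_setting) path_value_euler_path:
  assumes "\<And>t x. G t x = GG t x i" "\<And>x. F x = FF x i"
  shows "path_value h k w x = euler_path d \<nu> \<tau> GG FF h k w x i"
proof (induction w arbitrary: k x)
  case (Cons \<xi> w)
  have mv: "move (real k * h) h \<xi> x = euler_move d \<nu> \<tau> (real k * h) h \<xi> x"
    by (simp add: move_def euler_move_def disp_def)
  have "path_value h k (\<xi> # w) x = h * G (real k * h) x + path_value h (Suc k) w (move (real k * h) h \<xi> x)" by simp
  also have "\<dots> = h * GG (real k * h) x i + euler_path d \<nu> \<tau> GG FF h (Suc k) w (euler_move d \<nu> \<tau> (real k * h) h \<xi> x) i"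
    unfolding mv by (rule arg_cong2[where f = "(+)", OF arg_cong[OF assms(1)] Cons.IH])
  finally show ?case by (simp only: euler_path.simps)
qed (simp add: assms)

text \<open>On the unit cube, the average over all paths approximates the solution and its gradient, with bounded second moments.\<close>

lemma (in euler_setting) cube_bounds:
  fixes N :: nat
  defines "h \<equiv> T / real N"
  assumes GG: "\<And>t x. G t x = GG t x i" and FF: "\<And>x. F x = FF x i"
    and N: "N > 0" and h1: "h \<le> 1" and hd: "64 * h * real d * (c + 1)\<^sup>2 \<le> 1"
  defines "V \<equiv> (\<lambda>w x. euler_path d \<nu> \<tau> GG FF h 0 w x i)"
  shows "w \<in> paths (signs d) N \<Longrightarrow> x \<in> Rn {..<d} \<Longrightarrow> \<exists>a. has_grad {..<d} (V w) a x"
    and "x \<in> unit_cube d \<Longrightarrow> \<bar>u 0 x - avg (paths (signs d) N) (\<lambda>w. V w x)\<bar> \<le> bias_factor T p (real d) B c * (\<delta> + h powr min \<alpha> (1 / 8))"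
    and "x \<in> unit_cube d \<Longrightarrow> k < d \<Longrightarrow> \<bar>partial_deriv k (u 0) x - avg (paths (signs d) N) (\<lambda>w. partial_deriv k (V w) x)\<bar> \<le> bias_factor T p (real d) B c * (\<delta> + h powr min \<alpha> (1 / 8))"
    and "x \<in> unit_cube d \<Longrightarrow> avg (paths (signs d) N) (\<lambda>w. (V w x)\<^sup>2) \<le> moment_bound T p (real d) B c"
    and "x \<in> unit_cube d \<Longrightarrow> k < d \<Longrightarrow> avg (paths (signs d) N) (\<lambda>w. (partial_deriv k (V w) x)\<^sup>2) \<le> moment_bound T p (real d) B c"
proof -
  have V: "V w = path_value h 0 w" for w
    unfolding V_def by (rule ext) (rule path_value_euler_path[where GG = GG and FF = FF and i = i, OF GG FF, symmetric])
  have h0: "h \<ge> 0" using T by (simp add: h_def)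
  have lenT: "real (0 + length w) * h \<le> T" if "w \<in> paths (signs d) N" for w
    using that N by (simp add: paths_def h_def)
  show "\<exists>a. has_grad {..<d} (V w) a x" if "w \<in> paths (signs d) N" "x \<in> Rn {..<d}" for w x
    using has_grad_path_value[OF h0 that(2) lenT[OF that(1)]] unfolding V by blast
  define e where "e k = (\<lambda>l\<in>I. if l = k then 1 else 0 :: real)" for k
  have eR: "e k \<in> Rn I" for k by (simp add: e_def)
  have pd: "partial_deriv k (V w) x = path_deriv h 0 w (x, e k)" if wxk: "w \<in> paths (signs d) N" "x \<in> Rn I" "k < d" for w x k
  proof -
    obtain a where a: "has_grad I (path_value h 0 w) a x" "\<And>y. path_deriv h 0 w (x, y) = (\<Sum>i<d. a i * y i)"
      using has_grad_path_value[OF h0 wxk(2) lenT[OF wxk(1)]] by blast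
    have "(\<Sum>i<d. a i * e k i) = a k" using wxk(3) by (simp add: e_def if_distrib[of "\<lambda>z. _ * z"] cong: if_cong)
    then show ?thesis using has_grad_partial_deriv[OF _ _ wxk(2) a(1), of k] wxk(3) a(2) unfolding V by simp
  qed
  have du: "(\<Sum>i<d. partial_deriv i (u 0) x * e k i) = partial_deriv k (u 0) x" if "k < d" for k x
    using that by (simp add: e_def if_distrib[of "\<lambda>z. _ * z"] cong: if_cong)
  have K: "K = defect_const p (real d) B"
    unfolding K_def K1_def K2_def C4_def Ci_def C1_def defect_const_def by simp
  have rc: "rate_c (9 * p + 1) = growth_rate p * c" by (simp add: rate_c_def growth_rate_def)
  have pw: "pair_weight (x, e k) ^ (9 * p + 1) \<le> (2 + real d) ^ (9 * p + 1)" if x: "x \<in> unit_cube d" and k: "k < d" for x k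
  proof (rule power_mono)
    have "(\<Sum>i<d. (x i)\<^sup>2) \<le> (\<Sum>i<d. 1)"
    proof (rule sum_mono)
      fix i assume i: "i \<in> I"
      have "x i \<in> {0..1}" using x i unfolding unit_cube_def by (auto simp: PiE_iff)
      then show "(x i)\<^sup>2 \<le> 1" by (simp add: power_le_one)
    qed
    moreover have "(\<Sum>i<d. (e k i)\<^sup>2) = 1" using k by (simp add: e_def if_distrib[of "\<lambda>z. z\<^sup>2"] cong: if_cong)
    ultimately show "pair_weight (x, e k) \<le> 2 + real d" by (simp add: pair_weight_def)
    show "0 \<le> pair_weight (x, e k)" using pair_weight_ge(1)[of "(x, e k)"] by simp
  qed
  have xR: "x \<in> Rn I" if "x \<in> unit_cube d" for x using that unit_cube_Rn by blast
  note sb = scheme_bounds[OF N h1[unfolded h_def] hd[unfolded h_def], folded h_def, unfolded rc K]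
  have r: "rate h \<ge> 0" by (rule rate_nonneg)
  have dc: "defect_const p (real d) B \<ge> 0" unfolding K[symmetric] by (rule K_nonneg)
  have E: "exp (growth_rate p * c * T) * (real d * (B + T * defect_const p (real d) B) * rate h) * pair_weight (x, e k) ^ (9 * p + 1)
      \<le> bias_factor T p (real d) B c * (\<delta> + h powr min \<alpha> (1 / 8))" if "x \<in> unit_cube d" "k < d" for x k
  proof -
    have "exp (growth_rate p * c * T) * (real d * (B + T * defect_const p (real d) B) * rate h) * pair_weight (x, e k) ^ (9 * p + 1)
      \<le> exp (growth_rate p * c * T) * (real d * (B + T * defect_const p (real d) B) * rate h) * (2 + real d) ^ (9 * p + 1)"
      using pw[OF that] r dc B T by (intro mult_left_mono) auto
    then show ?thesis by (simp add: bias_factor_def rate_def mult_ac)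
  qed
  have M: "exp (T + growth_rate p * c * T) * (1 + T) * (real d * B)\<^sup>2 * pair_weight (x, e k) ^ (9 * p + 1)
      \<le> moment_bound T p (real d) B c" if "x \<in> unit_cube d" "k < d" for x k
    unfolding moment_bound_def using pw[OF that] T by (intro mult_left_mono) auto
  show "\<bar>u 0 x - avg (paths (signs d) N) (\<lambda>w. V w x)\<bar> \<le> bias_factor T p (real d) B c * (\<delta> + h powr min \<alpha> (1 / 8))" if x: "x \<in> unit_cube d" for x
    unfolding V by (rule order_trans[OF sb(1)[OF xR[OF x] eR] E[OF x d_pos]])
  show "avg (paths (signs d) N) (\<lambda>w. (V w x)\<^sup>2) \<le> moment_bound T p (real d) B c" if x: "x \<in> unit_cube d" for x
    unfolding V by (rule order_trans[OF sb(3)[OF xR[OF x] eR] M[OF x d_pos]])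
  show "\<bar>partial_deriv k (u 0) x - avg (paths (signs d) N) (\<lambda>w. partial_deriv k (V w) x)\<bar> \<le> bias_factor T p (real d) B c * (\<delta> + h powr min \<alpha> (1 / 8))" if x: "x \<in> unit_cube d" "k < d" for x k
  proof -
    have "avg (paths (signs d) N) (\<lambda>w. partial_deriv k (V w) x) = avg (paths (signs d) N) (\<lambda>w. path_deriv h 0 w (x, e k))"
      by (rule avg_cong) (rule pd[OF _ xR[OF x(1)] x(2)])
    then show ?thesis using order_trans[OF sb(2)[OF xR[OF x(1)] eR] E[OF x]] du[OF x(2)] by simp
  qed
  show "avg (paths (signs d) N) (\<lambda>w. (partial_deriv k (V w) x)\<^sup>2) \<le> moment_bound T p (real d) B c" if x: "x \<in> unit_cube d" "k < d" for x k
  proof -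
    have "avg (paths (signs d) N) (\<lambda>w. (partial_deriv k (V w) x)\<^sup>2) = avg (paths (signs d) N) (\<lambda>w. (path_deriv h 0 w (x, e k))\<^sup>2)"
      by (rule avg_cong) (simp only: pd[OF _ xR[OF x(1)] x(2)])
    then show ?thesis using order_trans[OF sb(4)[OF xR[OF x(1)] eR] M[OF x]] by simp
  qed
qed

lemma nabla_norm_1_square:
  assumes "finite I" "finite J"
  shows "(nabla_norm 1 I J h x)\<^sup>2 = (\<Sum>j\<in>J. \<Sum>k\<in>I. (partial_deriv k (\<lambda>y. h y j) x)\<^sup>2)"
proof -
  have "{js. set js \<subseteq> I \<and> length js = 1} = (\<lambda>k. [k]) ` I" by (auto simp: length_Suc_conv)
  then have e: "{js. set js \<subseteq> I \<and> length js = 1} \<times> J = (\<lambda>(j, k). ([k], j)) ` (J \<times> I)" by auto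
  have "(nabla_norm 1 I J h x)\<^sup>2 = (\<Sum>z\<in>{js. set js \<subseteq> I \<and> length js = 1} \<times> J. (case z of (js, j) \<Rightarrow> partial_derivs js (\<lambda>y. h y j) x)\<^sup>2)"
    unfolding nabla_norm_def L2_set_def by (intro real_sqrt_pow2 sum_nonneg) auto
  also have "\<dots> = (\<Sum>(j, k)\<in>J \<times> I. (partial_deriv k (\<lambda>y. h y j) x)\<^sup>2)"
    unfolding e by (subst sum.reindex) (auto simp: inj_on_def case_prod_beta')
  finally show ?thesis by (simp add: sum.cartesian_product)
qed

text \<open>All components of the solution and of its gradient are sampled simultaneously: one list of paths serves
  all of them, which gives the network.\<close>

lemma network_approximation:
  fixes T B \<delta> \<alpha> c s :: real and d m p P N S :: nat
  assumes E: "\<And>i. i < m \<Longrightarrow> euler_setting d p T B \<delta> \<alpha> c \<mu> \<nu> \<sigma> \<tau> (\<lambda>t x. u t x i) (\<lambda>t x. g t x i) (\<lambda>t x. G t x i) (\<lambda>x. f x i) (\<lambda>x. F x i)"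
    and net: "scheme_network \<rho> T d m P \<nu> \<tau> G F N\<nu> N\<tau> NG NF"
    and N: "N > 0" "T / real N \<le> 1" "64 * (T / real N) * real d * (c + 1)\<^sup>2 \<le> 1" and T: "T \<ge> 0"
    and S: "S > 0" and s: "s \<ge> 0"
    and err: "real m * (real d + 1) * (2 * (bias_factor T p (real d) B c * (\<delta> + (T / real N) powr min \<alpha> (1 / 8)))\<^sup>2
        + 2 * moment_bound T p (real d) B c / real S) \<le> s\<^sup>2"
  shows "\<exists>\<psi>. is_network d m \<psi> \<and> differentiable_times 1 {..<d} {..<m} (realization \<rho> \<psi>) \<and>
     L2_integrable d (\<lambda>x. L2_set (\<lambda>i. u 0 x i - realization \<rho> \<psi> x i) {..<m}) \<and>
     L2_integrable d (nabla_norm 1 {..<d} {..<m} (\<lambda>x i. u 0 x i - realization \<rho> \<psi> x i)) \<and>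
     L2_norm d (\<lambda>x. L2_set (\<lambda>i. u 0 x i - realization \<rho> \<psi> x i) {..<m}) \<le> s \<and>
     L2_norm d (nabla_norm 1 {..<d} {..<m} (\<lambda>x i. u 0 x i - realization \<rho> \<psi> x i)) \<le> s \<and>
     nonzero_params \<psi> \<le> 22 * (P + 1) * (3 * d + m) ^ 3 * (S * (3 * N + 1) + 1)"
proof -
  interpret scheme_network \<rho> T d m P \<nu> \<tau> G F N\<nu> N\<tau> NG NF by (rule net)
  define h where "h = T / real N"
  have h0: "h \<ge> 0" using T by (simp add: h_def)
  have Nh: "real N * h \<le> T" using N(1) by (simp add: h_def)
  let ?X = "{..<d}" and ?Y = "{..<m}" and ?A = "paths (signs d) N"
  define V where "V i w x = euler_path d \<nu> \<tau> G F h 0 w x i" for i w x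
  {
    fix i assume i: "i < m"
    note euler_setting.cube_bounds[OF E[OF i], where GG = G and FF = F and i = i, OF refl refl N, folded h_def]
  }
  note cb = this
  define b where "b = bias_factor T p (real d) B c * (\<delta> + h powr min \<alpha> (1 / 8))"
  define \<Phi> where "\<Phi> = ?Y \<times> insert None (Some ` ?X)"
  define UU where "UU f x = (case f of (i, None) \<Rightarrow> u 0 x i | (i, Some k) \<Rightarrow> partial_deriv k (\<lambda>x. u 0 x i) x)" for f x
  define VV where "VV f w x = (case f of (i, None) \<Rightarrow> V i w x | (i, Some k) \<Rightarrow> partial_deriv k (V i w) x)" for f w x
  have A: "finite ?A" "?A \<noteq> {}" by (simp_all add: finite_paths paths_nonempty)
  have grad: "\<exists>a. has_grad ?X (V i w) a x" if "i < m" "w \<in> ?A" "x \<in> Rn ?X" for i w x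
    using cb(1)[OF that(1,2,3)] by (simp add: V_def[abs_def])
  have meas: "VV f w \<in> borel_measurable (PiM ?X (\<lambda>_. lborel))" if fw: "f \<in> \<Phi>" "w \<in> ?A" for f w
  proof -
    obtain i q where f: "f = (i, q)" "i < m" "q = None \<or> (\<exists>k<d. q = Some k)" using fw(1) by (auto simp: \<Phi>_def)
    show ?thesis using f(3)
    proof (elim disjE exE conjE)
      assume "q = None"
      then have "VV f w = V i w" by (simp add: VV_def[abs_def] f fun_eq_iff)
      then show ?thesis using has_grad_measurable(1)[of ?X "V i w"] grad[OF f(2) fw(2)] by simp
    next
      fix k assume k: "k < d" "q = Some k"
      then have "VV f w = partial_deriv k (V i w)" by (simp add: VV_def[abs_def] f fun_eq_iff)
      then show ?thesis using has_grad_measurable(2)[of ?X "V i w" k] grad[OF f(2) fw(2)] k by simp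
    qed
  qed
  have cV: "V i w = (\<lambda>x. euler_path d \<nu> \<tau> G F h 0 w x i)" for i w by (simp add: V_def fun_eq_iff)
  have d0: "d > 0" and m0: "m > 0" by (rule d, rule m)
  have cx: "x \<in> unit_cube d" if "x \<in> space (cube_measure d)" for x using that by (simp add: space_cube_measure)
  have bias: "\<bar>UU f x - avg ?A (\<lambda>w. VV f w x)\<bar> \<le> b" if fw: "f \<in> \<Phi>" "x \<in> space (cube_measure d)" for f x
  proof -
    obtain i q where f: "f = (i, q)" "i < m" "q = None \<or> (\<exists>k<d. q = Some k)" using fw(1) by (auto simp: \<Phi>_def)
    show ?thesis using f(3) cb(2)[OF f(2) cx[OF fw(2)]] cb(3)[OF f(2) cx[OF fw(2)]]
      by (auto simp: UU_def VV_def f(1) b_def cV)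
  qed
  have moment: "avg ?A (\<lambda>w. (VV f w x)\<^sup>2) \<le> moment_bound T p (real d) B c" if fw: "f \<in> \<Phi>" "x \<in> space (cube_measure d)" for f x
  proof -
    obtain i q where f: "f = (i, q)" "i < m" "q = None \<or> (\<exists>k<d. q = Some k)" using fw(1) by (auto simp: \<Phi>_def)
    show ?thesis using f(3) cb(4)[OF f(2) cx[OF fw(2)]] cb(5)[OF f(2) cx[OF fw(2)]]
      by (auto simp: VV_def f(1) cV)
  qed
  have mb0: "moment_bound T p (real d) B c \<ge> 0" using T by (simp add: moment_bound_def)
  have M1: "emeasure (cube_measure d) (space (cube_measure d)) = 1" by (rule emeasure_cube_measure)
  have fin: "finite \<Phi>" by (simp add: \<Phi>_def)
  have "\<exists>ws. set ws \<subseteq> ?A \<and> length ws = S \<and>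
     (\<integral>\<^sup>+x. ennreal (\<Sum>f\<in>\<Phi>. (UU f x - (\<Sum>w\<leftarrow>ws. VV f w x) / real S)\<^sup>2) \<partial>cube_measure d)
       \<le> ennreal (real (card \<Phi>) * (2 * b\<^sup>2 + 2 * moment_bound T p (real d) B c / real S))"
    by (rule sample_average_exists[OF A fin S measurable_cube_measure[OF meas] M1 bias moment mb0])
  then obtain ws where ws: "set ws \<subseteq> ?A" "length ws = S" and
    I: "(\<integral>\<^sup>+x. ennreal (\<Sum>f\<in>\<Phi>. (UU f x - (\<Sum>w\<leftarrow>ws. VV f w x) / real S)\<^sup>2) \<partial>cube_measure d)
       \<le> ennreal (real (card \<Phi>) * (2 * b\<^sup>2 + 2 * moment_bound T p (real d) B c / real S))" by blast
  have "card \<Phi> = m * (d + 1)" by (simp add: \<Phi>_def card_cartesian_product card_insert_if card_image image_iff)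
  then have cd: "real (card \<Phi>) = real m * (real d + 1)" by (simp add: distrib_left)
  have "real (card \<Phi>) * (2 * b\<^sup>2 + 2 * moment_bound T p (real d) B c / real S) \<le> s\<^sup>2"
    using err unfolding cd b_def h_def .
  then have I2: "(\<integral>\<^sup>+x. ennreal (\<Sum>f\<in>\<Phi>. (UU f x - (\<Sum>w\<leftarrow>ws. VV f w x) / real S)\<^sup>2) \<partial>cube_measure d) \<le> ennreal (s\<^sup>2)"
    using I by (meson ennreal_leI order_trans)
  have "computes \<rho> d m (22 * (P + 1) * (3 * d + m) ^ 3 * (length ws * (3 * N + 1) + 1)) (\<lambda>x i. (\<Sum>w\<leftarrow>ws. euler_path d \<nu> \<tau> G F h 0 w x i) / real (length ws))"
    using ws S by (intro computes_sample_average h0 Nh) (auto simp: paths_def)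
  then obtain \<psi> where \<psi>: "is_network d m \<psi>" "nonzero_params \<psi> \<le> 22 * (P + 1) * (3 * d + m) ^ 3 * (S * (3 * N + 1) + 1)"
    "\<And>x. x \<in> Rn ?X \<Longrightarrow> realization \<rho> \<psi> x = restrict (\<lambda>i. (\<Sum>w\<leftarrow>ws. euler_path d \<nu> \<tau> G F h 0 w x i) / real S) ?Y"
    unfolding computes_def ws(2) by blast
  have R: "realization \<rho> \<psi> x i = (\<Sum>w\<leftarrow>ws. V i w x) / real S" if "x \<in> Rn ?X" "i < m" for x i
    using \<psi>(3)[OF that(1)] that(2) by (simp add: V_def)
  have gradS: "has_grad ?X (\<lambda>x. (\<Sum>w\<leftarrow>ws. V i w x) / real S) (\<lambda>k. (\<Sum>w\<leftarrow>ws. partial_deriv k (V i w) x) / real S) x"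
    if i: "i < m" and x: "x \<in> Rn ?X" for i x
  proof -
    have g1: "has_grad ?X (V i w) (\<lambda>k. partial_deriv k (V i w) x) x" if "w \<in> ?A" for w
    proof -
      from grad[OF i that x] obtain a where a: "has_grad ?X (V i w) a x" by blast
      show ?thesis by (rule has_grad_cong[OF a x]) (use has_grad_partial_deriv[OF _ _ x a] in auto)
    qed
    have "has_grad ?X (\<lambda>x. \<Sum>w\<leftarrow>ws. V i w x) (\<lambda>k. \<Sum>w\<leftarrow>ws. partial_deriv k (V i w) x) x"
      using ws(1) by (induction ws) (auto intro: has_grad_const has_grad_add g1)
    from has_grad_cmult[OF this, of "1 / real S"] show ?thesis by simp
  qed
  have gradR: "has_grad ?X (\<lambda>x. realization \<rho> \<psi> x i) (\<lambda>k. (\<Sum>w\<leftarrow>ws. partial_deriv k (V i w) x) / real S) x"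
    if i: "i < m" and x: "x \<in> Rn ?X" for i x
    by (rule has_grad_cong[OF gradS[OF i x] x]) (use R i in auto)
  have gradu: "has_grad ?X (\<lambda>x. u 0 x i) (\<lambda>k. partial_deriv k (\<lambda>x. u 0 x i) x) x" if i: "i < m" and x: "x \<in> Rn ?X" for i x
  proof -
    have "times_differentiable 5 ?X (\<lambda>x. u 0 x i)" by (rule euler_setting.u_diff[OF E[OF i]]) (use T in auto)
    from times_differentiable_has_grad[of ?X 0, OF _ times_differentiable_mono[OF this] x] show ?thesis by simp
  qed
  define e where "e x i = u 0 x i - realization \<rho> \<psi> x i" for x i
  have grade: "has_grad ?X (\<lambda>x. e x i) (\<lambda>k. partial_deriv k (\<lambda>x. u 0 x i) x - (\<Sum>w\<leftarrow>ws. partial_deriv k (V i w) x) / real S) x"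
    if "i < m" "x \<in> Rn ?X" for i x
    unfolding e_def by (intro has_grad_diff gradu gradR that)
  have eU: "e x i = UU (i, None) x - (\<Sum>w\<leftarrow>ws. VV (i, None) w x) / real S" if "i < m" "x \<in> Rn ?X" for x i
    using R[OF that(2,1)] by (simp add: e_def UU_def VV_def)
  have deU: "partial_deriv k (\<lambda>x. e x i) x = UU (i, Some k) x - (\<Sum>w\<leftarrow>ws. VV (i, Some k) w x) / real S" if "i < m" "x \<in> Rn ?X" "k < d" for x i k
    using has_grad_partial_deriv[OF _ _ that(2) grade[OF that(1,2)], of k] that(3) by (simp add: UU_def VV_def)
  let ?tot = "\<lambda>x. \<Sum>f\<in>\<Phi>. (UU f x - (\<Sum>w\<leftarrow>ws. VV f w x) / real S)\<^sup>2"
  have sub: "(\<Sum>f\<in>\<Psi>. (UU f x - (\<Sum>w\<leftarrow>ws. VV f w x) / real S)\<^sup>2) \<le> ?tot x" if "\<Psi> \<subseteq> \<Phi>" for \<Psi> x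
    using that fin by (intro sum_mono2) auto
  have v_le: "(L2_set (e x) ?Y)\<^sup>2 \<le> ?tot x" if x: "x \<in> Rn ?X" for x
  proof -
    have "(L2_set (e x) ?Y)\<^sup>2 = (\<Sum>i\<in>?Y. (e x i)\<^sup>2)" unfolding L2_set_def by (intro real_sqrt_pow2 sum_nonneg) auto
    also have "\<dots> = (\<Sum>f\<in>(\<lambda>i. (i, None)) ` ?Y. (UU f x - (\<Sum>w\<leftarrow>ws. VV f w x) / real S)\<^sup>2)"
      using eU[OF _ x] by (subst sum.reindex) (auto simp: inj_on_def intro!: sum.cong)
    also have "\<dots> \<le> ?tot x" by (rule sub) (auto simp: \<Phi>_def)
    finally show ?thesis .
  qed
  have n_le: "(nabla_norm 1 ?X ?Y e x)\<^sup>2 \<le> ?tot x" if x: "x \<in> Rn ?X" for x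
  proof -
    have "(nabla_norm 1 ?X ?Y e x)\<^sup>2 = (\<Sum>(i, k)\<in>?Y \<times> ?X. (partial_deriv k (\<lambda>y. e y i) x)\<^sup>2)"
      unfolding nabla_norm_1_square[OF finite_lessThan finite_lessThan] sum.cartesian_product ..
    also have "\<dots> = (\<Sum>f\<in>(\<lambda>(i, k). (i, Some k)) ` (?Y \<times> ?X). (UU f x - (\<Sum>w\<leftarrow>ws. VV f w x) / real S)\<^sup>2)"
      using deU[OF _ x] by (subst sum.reindex) (auto simp: inj_on_def intro!: sum.cong)
    also have "\<dots> \<le> ?tot x" by (rule sub) (auto simp: \<Phi>_def)
    finally show ?thesis .
  qed
  have em: "(\<lambda>x. e x i) \<in> borel_measurable (PiM ?X (\<lambda>_. lborel))" "k < d \<Longrightarrow> partial_deriv k (\<lambda>x. e x i) \<in> borel_measurable (PiM ?X (\<lambda>_. lborel))" if "i < m" for i k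
    using has_grad_measurable[of ?X "\<lambda>x. e x i"] grade[OF that] by blast+
  have vm: "(\<lambda>x. L2_set (e x) ?Y) \<in> borel_measurable (PiM ?X (\<lambda>_. lborel))"
    unfolding L2_set_def using em(1) by (intro measurable_compose[OF _ borel_measurable_sqrt] borel_measurable_sum borel_measurable_power) auto
  have nm: "nabla_norm 1 ?X ?Y e \<in> borel_measurable (PiM ?X (\<lambda>_. lborel))"
  proof -
    have "nabla_norm 1 ?X ?Y e = (\<lambda>x. sqrt (\<Sum>j\<in>?Y. \<Sum>k\<in>?X. (partial_deriv k (\<lambda>y. e y j) x)\<^sup>2))"
      by (rule ext) (simp add: nabla_norm_1_square[symmetric] nabla_norm_def L2_set_nonneg)
    then show ?thesis using em(2) by (auto intro!: measurable_compose[OF _ borel_measurable_sqrt] borel_measurable_sum borel_measurable_power)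
  qed
  have le: "(\<integral>\<^sup>+x. ennreal ((\<phi> x)\<^sup>2) \<partial>cube_measure d) \<le> ennreal (s\<^sup>2)" if "\<And>x. x \<in> Rn ?X \<Longrightarrow> (\<phi> x)\<^sup>2 \<le> ?tot x" for \<phi> :: "(nat \<Rightarrow> real) \<Rightarrow> real"
  proof -
    have "(\<integral>\<^sup>+x. ennreal ((\<phi> x)\<^sup>2) \<partial>cube_measure d) \<le> (\<integral>\<^sup>+x. ennreal (?tot x) \<partial>cube_measure d)"
      using that unit_cube_Rn cx by (intro nn_integral_mono ennreal_leI) blast
    then show ?thesis using I2 by (rule order_trans)
  qed
  note Lv = L2_norm_le[OF vm s le[OF v_le]] and Ln = L2_norm_le[OF nm s le[OF n_le]]
  have "differentiable_times 1 ?X ?Y (realization \<rho> \<psi>)"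
    unfolding differentiable_times_def using gradR by (auto simp: frechet_iff_has_grad One_nat_def)
  moreover have "e = (\<lambda>x i. u 0 x i - realization \<rho> \<psi> x i)" by (simp add: e_def fun_eq_iff)
  ultimately show ?thesis using \<psi>(1,2) Lv Ln by (intro exI[of _ \<psi>]) simp
qed

section \<open>Polynomial bounds\<close>

text \<open>All parameters of the construction are explicit functions of the two dimensions, of \<open>c\<close>, and of \<open>\<epsilon>\<close>. It
  suffices to bound them by a power of the single quantity \<open>d m e\<^sup>c / \<epsilon>\<close>, and such bounds are stable under all operations that occur.\<close>

definition poly_bounded :: "(real \<Rightarrow> real \<Rightarrow> real \<Rightarrow> real \<Rightarrow> real) \<Rightarrow> bool" where
  "poly_bounded f \<longleftrightarrow> (\<exists>C\<ge>1. \<forall>d m c e. 1 \<le> d \<longrightarrow> 1 \<le> m \<longrightarrow> 0 \<le> c \<longrightarrow> 0 < e \<longrightarrow> e < 1 \<longrightarrow>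
     \<bar>f d m c e\<bar> \<le> C * (d * m * exp c / e) powr C)"

lemma scale_bounds:
  fixes d m c e :: real
  assumes "1 \<le> d" "1 \<le> m" "0 \<le> c" "0 < e" "e < 1"
  defines "z \<equiv> d * m * exp c / e"
  shows "1 \<le> z" "d \<le> z" "m \<le> z" "exp c \<le> z" "1 / e \<le> z"
proof -
  have dm: "d \<le> d * m" "m \<le> d * m" "1 \<le> d * m"
    using assms mult_left_mono[of 1 m d] mult_right_mono[of 1 d m] mult_mono[of 1 d 1 m] by auto
  have dme: "d * m \<le> d * m * exp c" "exp c \<le> d * m * exp c"
    using assms dm mult_left_mono[of 1 "exp c" "d * m"] mult_right_mono[of 1 "d * m" "exp c"] by auto
  have i: "a \<le> a / e" if "a \<ge> 0" for a using assms that by (simp add: le_divide_eq mult_left_le)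
  have "d * m * exp c \<le> z" unfolding z_def using dm by (intro i) auto
  then show "1 \<le> z" "d \<le> z" "m \<le> z" "exp c \<le> z" using dm dme by linarith+
  show "1 / e \<le> z" unfolding z_def using dm dme assms by (intro divide_right_mono) linarith+
qed

lemma poly_boundedI:
  assumes "\<And>d m c e. 1 \<le> d \<Longrightarrow> 1 \<le> m \<Longrightarrow> 0 \<le> c \<Longrightarrow> 0 < e \<Longrightarrow> e < 1 \<Longrightarrow> \<bar>f d m c e\<bar> \<le> C * (d * m * exp c / e) powr D"
    and "C \<ge> 0" "D \<ge> 0"
  shows "poly_bounded f"
  unfolding poly_bounded_def
proof (intro exI[of _ "1 + C + D"] conjI allI impI)
  fix d m c e :: real assume a: "1 \<le> d" "1 \<le> m" "0 \<le> c" "0 < e" "e < 1"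
  have "\<bar>f d m c e\<bar> \<le> C * (d * m * exp c / e) powr D" by (rule assms(1)[OF a])
  also have "\<dots> \<le> (1 + C + D) * (d * m * exp c / e) powr (1 + C + D)"
    using scale_bounds(1)[OF a] assms(2,3) by (intro mult_mono powr_mono) auto
  finally show "\<bar>f d m c e\<bar> \<le> (1 + C + D) * (d * m * exp c / e) powr (1 + C + D)" .
qed (use assms in auto)

lemma poly_bounded_const: "poly_bounded (\<lambda>d m c e. a)"
  by (rule poly_boundedI[where C = "\<bar>a\<bar>" and D = 0]) (use scale_bounds(1) in \<open>force\<close>)+

lemma poly_bounded_vars:
  "poly_bounded (\<lambda>d m c e. d)" "poly_bounded (\<lambda>d m c e. m)" "poly_bounded (\<lambda>d m c e. c)" "poly_bounded (\<lambda>d m c e. 1 / e)"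
proof -
  have c: "c \<le> exp c" for c :: real using exp_ge_add_one_self[of c] by linarith
  have p: "(z::real) powr 1 = z" if "1 \<le> z" for z using that by simp
  show "poly_bounded (\<lambda>d m c e. d)"
    by (rule poly_boundedI[where C = 1 and D = 1]) (use scale_bounds(1,2) in \<open>auto simp: p\<close>)
  show "poly_bounded (\<lambda>d m c e. m)"
    by (rule poly_boundedI[where C = 1 and D = 1]) (use scale_bounds(1,3) in \<open>auto simp: p\<close>)
  show "poly_bounded (\<lambda>d m c e. c)"
    by (rule poly_boundedI[where C = 1 and D = 1]) (use scale_bounds(1,4) order_trans[OF c] in \<open>auto simp: p\<close>)
  show "poly_bounded (\<lambda>d m c e. 1 / e)"
    by (rule poly_boundedI[where C = 1 and D = 1]) (use scale_bounds(1,5) in \<open>auto simp: p\<close>)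
qed

lemma poly_bounded_exp:
  assumes "k \<ge> 0" shows "poly_bounded (\<lambda>d m c e. exp (k * c))"
proof (rule poly_boundedI[where C = 1 and D = k])
  fix d m c e :: real assume a: "1 \<le> d" "1 \<le> m" "0 \<le> c" "0 < e" "e < 1"
  have "exp (k * c) = exp c powr k" by (simp add: powr_def mult.commute)
  also have "\<dots> \<le> (d * m * exp c / e) powr k" using scale_bounds(4)[OF a] assms by (intro powr_mono2) auto
  finally show "\<bar>exp (k * c)\<bar> \<le> 1 * (d * m * exp c / e) powr k" by simp
qed (use assms in auto)

lemma poly_bounded_add:
  assumes "poly_bounded f" "poly_bounded g" shows "poly_bounded (\<lambda>d m c e. f d m c e + g d m c e)"
proof -
  obtain C where C: "C \<ge> 1" "\<And>d m c e. 1 \<le> d \<Longrightarrow> 1 \<le> m \<Longrightarrow> 0 \<le> c \<Longrightarrow> 0 < e \<Longrightarrow> e < 1 \<Longrightarrow> \<bar>f d m c e\<bar> \<le> C * (d * m * exp c / e) powr C"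
    using assms(1) unfolding poly_bounded_def by blast
  obtain D where D: "D \<ge> 1" "\<And>d m c e. 1 \<le> d \<Longrightarrow> 1 \<le> m \<Longrightarrow> 0 \<le> c \<Longrightarrow> 0 < e \<Longrightarrow> e < 1 \<Longrightarrow> \<bar>g d m c e\<bar> \<le> D * (d * m * exp c / e) powr D"
    using assms(2) unfolding poly_bounded_def by blast
  show ?thesis
  proof (rule poly_boundedI[where C = "C + D" and D = "C + D"])
    fix d m c e :: real assume a: "1 \<le> d" "1 \<le> m" "0 \<le> c" "0 < e" "e < 1"
    define z where "z = d * m * exp c / e"
    have z: "1 \<le> z" using scale_bounds(1)[OF a] by (simp add: z_def)
    have "\<bar>f d m c e + g d m c e\<bar> \<le> C * z powr C + D * z powr D"
      using C(2)[OF a] D(2)[OF a] abs_triangle_ineq[of "f d m c e" "g d m c e"] unfolding z_def by linarith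
    also have "\<dots> \<le> C * z powr (C + D) + D * z powr (C + D)"
      using z C(1) D(1) by (intro add_mono mult_left_mono powr_mono) auto
    finally show "\<bar>f d m c e + g d m c e\<bar> \<le> (C + D) * (d * m * exp c / e) powr (C + D)"
      unfolding z_def by (simp add: distrib_right)
  qed (use C D in auto)
qed

lemma poly_bounded_mult:
  assumes "poly_bounded f" "poly_bounded g" shows "poly_bounded (\<lambda>d m c e. f d m c e * g d m c e)"
proof -
  obtain C where C: "C \<ge> 1" "\<And>d m c e. 1 \<le> d \<Longrightarrow> 1 \<le> m \<Longrightarrow> 0 \<le> c \<Longrightarrow> 0 < e \<Longrightarrow> e < 1 \<Longrightarrow> \<bar>f d m c e\<bar> \<le> C * (d * m * exp c / e) powr C"
    using assms(1) unfolding poly_bounded_def by blast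
  obtain D where D: "D \<ge> 1" "\<And>d m c e. 1 \<le> d \<Longrightarrow> 1 \<le> m \<Longrightarrow> 0 \<le> c \<Longrightarrow> 0 < e \<Longrightarrow> e < 1 \<Longrightarrow> \<bar>g d m c e\<bar> \<le> D * (d * m * exp c / e) powr D"
    using assms(2) unfolding poly_bounded_def by blast
  show ?thesis
  proof (rule poly_boundedI[where C = "C * D" and D = "C + D"])
    fix d m c e :: real assume a: "1 \<le> d" "1 \<le> m" "0 \<le> c" "0 < e" "e < 1"
    have "\<bar>f d m c e * g d m c e\<bar> \<le> (C * (d * m * exp c / e) powr C) * (D * (d * m * exp c / e) powr D)"
      unfolding abs_mult using C D by (intro mult_mono C(2)[OF a] D(2)[OF a]) auto
    then show "\<bar>f d m c e * g d m c e\<bar> \<le> C * D * (d * m * exp c / e) powr (C + D)"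
      by (simp add: powr_add mult_ac)
  qed (use C D in auto)
qed

lemma poly_bounded_power: "poly_bounded f \<Longrightarrow> poly_bounded (\<lambda>d m c e. f d m c e ^ n)"
  by (induction n) (auto intro: poly_bounded_const poly_bounded_mult)

lemma poly_bounded_powr:
  assumes "poly_bounded f" "a \<ge> 0" and nn: "\<And>d m c e. 1 \<le> d \<Longrightarrow> 1 \<le> m \<Longrightarrow> 0 \<le> c \<Longrightarrow> 0 < e \<Longrightarrow> e < 1 \<Longrightarrow> 0 \<le> f d m c e"
  shows "poly_bounded (\<lambda>d m c e. f d m c e powr a)"
proof -
  obtain C where C: "C \<ge> 1" "\<And>d m c e. 1 \<le> d \<Longrightarrow> 1 \<le> m \<Longrightarrow> 0 \<le> c \<Longrightarrow> 0 < e \<Longrightarrow> e < 1 \<Longrightarrow> \<bar>f d m c e\<bar> \<le> C * (d * m * exp c / e) powr C"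
    using assms(1) unfolding poly_bounded_def by blast
  show ?thesis
  proof (rule poly_boundedI[where C = "C powr a" and D = "C * a"])
    fix d m c e :: real assume b: "1 \<le> d" "1 \<le> m" "0 \<le> c" "0 < e" "e < 1"
    have "f d m c e powr a \<le> (C * (d * m * exp c / e) powr C) powr a"
      using C(2)[OF b] nn[OF b] assms(2) by (intro powr_mono2) auto
    also have "\<dots> = C powr a * (d * m * exp c / e) powr (C * a)"
      using C(1) by (simp add: powr_mult powr_powr)
    finally show "\<bar>f d m c e powr a\<bar> \<le> C powr a * (d * m * exp c / e) powr (C * a)" by simp
  qed (use C assms in auto)
qed

lemma poly_bounded_divide_e: "poly_bounded f \<Longrightarrow> poly_bounded (\<lambda>d m c e. f d m c e / e)"
  using poly_bounded_mult[OF _ poly_bounded_vars(4), of f] by simp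

lemmas poly_bounded_intros = poly_bounded_const poly_bounded_vars poly_bounded_add poly_bounded_mult poly_bounded_power poly_bounded_divide_e

section \<open>Choice of the parameters\<close>

text \<open>The constants \<open>b\<close> and \<open>B\<close> are the polynomial bounds on the data, \<open>inv_tol\<close> is the reciprocal of the tolerance for each of the two error sources (step size and perturbation),
  and \<open>index\<close> selects a perturbation with this accuracy. As the perturbation error decays exponentially, a polynomial index suffices.\<close>

locale parameter_choice =
  fixes T lam r \<alpha> \<kappa> :: real
  assumes T: "T \<ge> 1" and lam: "lam > 0" and \<alpha>: "0 < \<alpha>" and \<kappa>: "\<kappa> \<ge> 1"
begin

definition p where "p = nat \<lceil>r\<rceil> + 6"
definition b where "b d = \<kappa> * d powr \<kappa>"
definition B where "B d = 2 * (d + 1) * 4 ^ p * b d"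
definition bias where "bias d c = bias_factor T p d (B d) c"
definition moment where "moment d c = moment_bound T p d (B d) c"
definition inv_tol where "inv_tol d m c e = 8 * m * (d + 1) * bias d c / e"
definition steps where "steps d m c e = T * inv_tol d m c e powr (1 / min \<alpha> (1 / 8)) + T + 64 * T * d * (c + 1)\<^sup>2"
definition samples where "samples d m c e = 16 * m * (d + 1) * moment d c / e / e + 1"
definition index where "index d m c e = (d powr lam * \<bar>ln lam\<bar> + inv_tol d m c e) powr lam"
definition size_bound where "size_bound d m c e = 22 * (lam * (d * m * (index d m c e + 2)) powr lam + 1) * (3 * d + m) ^ 3
    * ((samples d m c e + 1) * (3 * (steps d m c e + 1) + 1) + 1)"

context
  fixes d m c e :: real
  assumes d: "1 \<le> d" and m: "1 \<le> m" and c: "0 \<le> c" and e: "0 < e" "e < 1"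
begin

lemma b_ge: "b d \<ge> 1"
  unfolding b_def using \<kappa> d by (metis ge_one_powr_ge_zero mult_mono' mult_1 order_trans zero_le_one)

lemma B_ge: "B d \<ge> 1"
proof -
  have "1 * 1 * 1 * 1 \<le> 2 * (d + 1) * 4 ^ p * b d" using d b_ge by (intro mult_mono) auto
  then show ?thesis by (simp add: B_def)
qed

lemma bias_ge: "bias d c \<ge> 1"
proof -
  have g: "growth_rate p \<ge> 0" by (simp add: growth_rate_def)
  have dc: "defect_const p d (B d) \<ge> 0" unfolding defect_const_def using d B_ge by simp
  have "1 * (1 * (1 + 0)) * 1 \<le> bias d c"
    unfolding bias_def bias_factor_def using g T c d B_ge dc by (intro mult_mono add_mono one_le_power) (auto intro!: add_nonneg_nonneg mult_nonneg_nonneg)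
  then show ?thesis by simp
qed

lemma moment_ge: "moment d c \<ge> 0"
  unfolding moment_def moment_bound_def using T d by simp

lemma inv_tol_ge: "inv_tol d m c e \<ge> 1"
proof -
  have "1 * 1 * 1 * 1 \<le> 8 * m * (d + 1) * bias d c" using d m bias_ge by (intro mult_mono) auto
  then show ?thesis unfolding inv_tol_def using e by (simp add: le_divide_eq)
qed

lemma nonneg_parameters: "steps d m c e \<ge> 1" "samples d m c e \<ge> 1" "index d m c e \<ge> 0"
proof -
  have "T * inv_tol d m c e powr (1 / min \<alpha> (1 / 8)) \<ge> 0" "64 * T * d * (c + 1)\<^sup>2 \<ge> 0" using T d by auto
  then show "steps d m c e \<ge> 1" unfolding steps_def using T by linarith
  show "samples d m c e \<ge> 1" unfolding samples_def using m d e moment_ge by simp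
  show "index d m c e \<ge> 0" by (simp add: index_def)
qed

lemma step_size:
  assumes N: "real N \<ge> steps d m c e"
  shows "T / real N \<le> 1" "64 * (T / real N) * d * (c + 1)\<^sup>2 \<le> 1" "(T / real N) powr min \<alpha> (1 / 8) \<le> 1 / inv_tol d m c e"
proof -
  define \<gamma> where "\<gamma> = min \<alpha> (1 / 8)"
  have \<gamma>: "\<gamma> > 0" using \<alpha> by (simp add: \<gamma>_def)
  have N0: "real N > 0" using N nonneg_parameters(1) by linarith
  have i0: "inv_tol d m c e > 0" using inv_tol_ge by linarith
  have t: "T * inv_tol d m c e powr (1 / \<gamma>) \<ge> 0" "64 * T * d * (c + 1)\<^sup>2 \<ge> 0" using T d by auto
  have s: "T * inv_tol d m c e powr (1 / \<gamma>) \<le> real N" "T \<le> real N" "64 * T * d * (c + 1)\<^sup>2 \<le> real N"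
    using N t T unfolding steps_def \<gamma>_def[symmetric] by linarith+
  show "T / real N \<le> 1" using s(2) N0 by simp
  show "64 * (T / real N) * d * (c + 1)\<^sup>2 \<le> 1" using s(3) N0 by (simp add: field_simps)
  have "T / real N \<le> 1 / inv_tol d m c e powr (1 / \<gamma>)" using s(1) N0 i0 by (simp add: field_simps)
  then have "(T / real N) powr \<gamma> \<le> (1 / inv_tol d m c e powr (1 / \<gamma>)) powr \<gamma>"
    using \<gamma> T N0 by (intro powr_mono2) auto
  also have "\<dots> = 1 / inv_tol d m c e" using i0 \<gamma> by (simp add: powr_divide powr_powr)
  finally show "(T / real N) powr min \<alpha> (1 / 8) \<le> 1 / inv_tol d m c e" by (simp add: \<gamma>_def)
qed

lemma perturbation_small:
  assumes P: "real P \<ge> index d m c e"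
  shows "lam powr (d powr lam) * exp (- (real P powr (1 / lam))) \<le> 1 / inv_tol d m c e"
proof -
  define a where "a = d powr lam * \<bar>ln lam\<bar> + inv_tol d m c e"
  have i: "inv_tol d m c e \<ge> 1" by (rule inv_tol_ge)
  have a0: "a \<ge> 0" unfolding a_def using i by simp
  have "a = (a powr lam) powr (1 / lam)" using lam a0 i by (simp add: powr_powr a_def)
  also have "\<dots> \<le> real P powr (1 / lam)" using P lam unfolding index_def a_def by (intro powr_mono2) auto
  finally have "exp (- (real P powr (1 / lam))) \<le> exp (- a)" by simp
  moreover have "lam powr (d powr lam) \<le> exp (d powr lam * \<bar>ln lam\<bar>)"
    using lam by (auto simp: powr_def intro!: mult_left_mono)
  ultimately have "lam powr (d powr lam) * exp (- (real P powr (1 / lam))) \<le> exp (d powr lam * \<bar>ln lam\<bar>) * exp (- a)"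
    by (intro mult_mono) auto
  also have "\<dots> = 1 / exp (inv_tol d m c e)" by (simp add: a_def exp_minus exp_add[symmetric] exp_diff field_simps)
  also have "\<dots> \<le> 1 / inv_tol d m c e"
  proof (rule divide_left_mono)
    show "inv_tol d m c e \<le> exp (inv_tol d m c e)" using exp_ge_add_one_self[of "inv_tol d m c e"] by linarith
  qed (use i in auto)
  finally show ?thesis .
qed

lemma total_error:
  assumes h: "h \<le> 1 / inv_tol d m c e" "h \<ge> 0" and S: "real S \<ge> samples d m c e"
  shows "m * (d + 1) * (2 * (bias d c * (1 / inv_tol d m c e + h))\<^sup>2 + 2 * moment d c / real S) \<le> (e / 2)\<^sup>2"
proof -
  define A where "A = bias d c"
  define k where "k = m * (d + 1)"
  have A: "A \<ge> 1" unfolding A_def by (rule bias_ge)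
  have k: "k \<ge> 2" unfolding k_def using d m mult_mono[of 1 m 2 "d + 1"] by simp
  have i: "inv_tol d m c e = 8 * k * A / e" by (simp add: inv_tol_def k_def A_def mult_ac)
  have "A * (1 / inv_tol d m c e + h) \<le> A * (1 / inv_tol d m c e + 1 / inv_tol d m c e)" using h A by (intro mult_left_mono) auto
  also have "\<dots> = e / (4 * k)" unfolding i using A k e by (simp add: field_simps)
  finally have "(A * (1 / inv_tol d m c e + h))\<^sup>2 \<le> (e / (4 * k))\<^sup>2"
    using A h inv_tol_ge by (intro power_mono) auto
  also have "\<dots> = e\<^sup>2 / (16 * k\<^sup>2)" by (simp add: power_divide power_mult_distrib)
  finally have "k * (2 * (A * (1 / inv_tol d m c e + h))\<^sup>2) \<le> k * (2 * (e\<^sup>2 / (16 * k\<^sup>2)))" using k by (intro mult_left_mono) auto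
  also have "\<dots> = e\<^sup>2 / (8 * k)" using k by (simp add: field_simps power2_eq_square)
  also have "\<dots> \<le> e\<^sup>2 / 8" using k e by (intro divide_left_mono) auto
  finally have 1: "k * (2 * (A * (1 / inv_tol d m c e + h))\<^sup>2) \<le> e\<^sup>2 / 8" .
  have S0: "real S > 0" using S nonneg_parameters(2) by linarith
  have "16 * k * moment d c / e / e \<le> real S" using S unfolding samples_def k_def by (simp add: mult_ac)
  then have "k * (2 * moment d c / real S) \<le> e\<^sup>2 / 8" using S0 e by (simp add: field_simps power2_eq_square)
  with 1 have "k * (2 * (A * (1 / inv_tol d m c e + h))\<^sup>2) + k * (2 * moment d c / real S) \<le> e\<^sup>2 / 4" by simp
  then show ?thesis unfolding A_def[symmetric] k_def[symmetric] by (simp add: distrib_left power_divide)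
qed

end

lemma poly_bounded_b: "poly_bounded (\<lambda>d m c e. b d)"
  unfolding b_def using \<kappa> by (intro poly_bounded_intros poly_bounded_powr) auto

lemma poly_bounded_B: "poly_bounded (\<lambda>d m c e. B d)"
  unfolding B_def by (intro poly_bounded_intros poly_bounded_b)

lemma poly_bounded_defect: "poly_bounded (\<lambda>d m c e. defect_const p d (B d))"
  unfolding defect_const_def by (intro poly_bounded_intros poly_bounded_B)

lemma poly_bounded_growth: "k \<ge> 0 \<Longrightarrow> poly_bounded (\<lambda>d m c e. exp (k * c * T))"
  using poly_bounded_exp[of "k * T"] T by (simp add: mult_ac)

lemma growth_rate_nonneg: "growth_rate p \<ge> 0"
  by (simp add: growth_rate_def)

lemma poly_bounded_bias: "poly_bounded (\<lambda>d m c e. bias d c)"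
  unfolding bias_def bias_factor_def
  by (intro poly_bounded_intros poly_bounded_B poly_bounded_defect poly_bounded_growth growth_rate_nonneg)

lemma poly_bounded_moment: "poly_bounded (\<lambda>d m c e. moment d c)"
  unfolding moment_def moment_bound_def exp_add
  by (intro poly_bounded_intros poly_bounded_B poly_bounded_growth growth_rate_nonneg)

lemma poly_bounded_inv_tol: "poly_bounded inv_tol"
  unfolding inv_tol_def[abs_def] by (intro poly_bounded_intros poly_bounded_bias)

lemma poly_bounded_steps: "poly_bounded steps"
proof -
  have "0 \<le> 1 / min \<alpha> (1 / 8)" using \<alpha> by simp
  then show ?thesis
    unfolding steps_def[abs_def]
    by (intro poly_bounded_intros poly_bounded_powr poly_bounded_inv_tol order_trans[OF zero_le_one inv_tol_ge])
qed

lemma poly_bounded_samples: "poly_bounded samples"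
  unfolding samples_def[abs_def] by (intro poly_bounded_intros poly_bounded_moment)

lemma poly_bounded_index: "poly_bounded index"
  unfolding index_def[abs_def]
  using lam by (intro poly_bounded_intros poly_bounded_powr poly_bounded_inv_tol add_nonneg_nonneg order_trans[OF zero_le_one inv_tol_ge]) auto

lemma poly_bounded_size: "poly_bounded size_bound"
  unfolding size_bound_def[abs_def]
  using lam by (intro poly_bounded_intros poly_bounded_powr poly_bounded_index poly_bounded_steps poly_bounded_samples)
    (auto intro!: mult_nonneg_nonneg add_nonneg_nonneg nonneg_parameters(3))

end

section \<open>The approximation theorem\<close>

lemma nonzero_params_architecture: "nonzero_params N \<le> (\<Sum>(a, b)\<leftarrow>architecture N. b * a + b)"
  unfolding nonzero_params_def architecture_def
  by (induction N) (auto intro!: add_mono layer_params_le)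

lemma nonzero_params_t_ge:
  assumes "given_by_networks \<rho> T D d m N h" "t \<in> {0..T}"
  shows "nonzero_params (N t) \<le> nonzero_params_t T N"
proof -
  obtain a where a: "\<And>t. t \<in> {0..T} \<Longrightarrow> architecture (N t) = a"
    using assms(1) unfolding given_by_networks_def by blast
  have "bdd_above ((\<lambda>t. nonzero_params (N t)) ` {0..T})"
    using nonzero_params_architecture a by (intro bdd_aboveI[of _ "\<Sum>(a, b)\<leftarrow>a. b * a + b"]) (auto, metis)
  then show ?thesis unfolding nonzero_params_t_def using assms(2) by (rule cSUP_upper[rotated])
qed

lemma scheme_network_of_perturbation:
  assumes P: "network_perturbation \<rho> T d m D NF NG N\<nu> N\<tau> F G \<nu> \<tau>" and "d \<ge> 1" "m \<ge> 1"
  shows "scheme_network \<rho> T d m (max_params T NF NG N\<nu> N\<tau>) \<nu> \<tau> G F N\<nu> N\<tau> NG NF"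
proof -
  have F: "given_by_network \<rho> D d m NF F" and G: "given_by_networks \<rho> T D d m NG G"
    and \<nu>: "given_by_networks \<rho> T D d d N\<nu> \<nu>" and \<tau>: "given_by_networks \<rho> T D d (d * d) N\<tau> (\<lambda>t x. flatten d (\<tau> t x))"
    using P unfolding network_perturbation_def by blast+
  have mx: "nonzero_params NF \<le> max_params T NF NG N\<nu> N\<tau>" "nonzero_params_t T NG \<le> max_params T NF NG N\<nu> N\<tau>"
    "nonzero_params_t T N\<nu> \<le> max_params T NF NG N\<nu> N\<tau>" "nonzero_params_t T N\<tau> \<le> max_params T NF NG N\<nu> N\<tau>"
    unfolding max_params_def by (intro Max_ge; simp)+
  show ?thesis
  proof
    fix t assume t: "t \<in> {0..T}"
    show "is_network d d (N\<nu> t) \<and> nonzero_params (N\<nu> t) \<le> max_params T NF NG N\<nu> N\<tau> \<and> (\<forall>x\<in>Rn {..<d}. \<forall>j<d. \<nu> t x j = realization \<rho> (N\<nu> t) x j)"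
      using \<nu> t order_trans[OF nonzero_params_t_ge[OF \<nu> t] mx(3)] unfolding given_by_networks_def given_by_network_def by auto
    show "is_network d (d * d) (N\<tau> t) \<and> nonzero_params (N\<tau> t) \<le> max_params T NF NG N\<nu> N\<tau> \<and> (\<forall>x\<in>Rn {..<d}. \<forall>j<d * d. flatten d (\<tau> t x) j = realization \<rho> (N\<tau> t) x j)"
      using \<tau> t order_trans[OF nonzero_params_t_ge[OF \<tau> t] mx(4)] unfolding given_by_networks_def given_by_network_def by auto
    show "is_network d m (NG t) \<and> nonzero_params (NG t) \<le> max_params T NF NG N\<nu> N\<tau> \<and> (\<forall>x\<in>Rn {..<d}. \<forall>j<m. G t x j = realization \<rho> (NG t) x j)"
      using G t order_trans[OF nonzero_params_t_ge[OF G t] mx(2)] unfolding given_by_networks_def given_by_network_def by auto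
  next
    show "is_network d m NF \<and> nonzero_params NF \<le> max_params T NF NG N\<nu> N\<tau> \<and> (\<forall>x\<in>Rn {..<d}. \<forall>j<m. F x j = realization \<rho> NF x j)"
      using F mx(1) unfolding given_by_network_def by auto
  qed (use assms in auto)
qed

lemma bound_le_power:
  assumes "1 \<le> (d::real)"
  shows "ennreal (k * d powr k) \<le> ennreal (max 1 k * d powr max 1 k)"
proof (rule ennreal_leI)
  have 1: "d powr k \<le> d powr max 1 k" using assms by (intro powr_mono) auto
  have "k * d powr k \<le> max 1 k * d powr k" by (intro mult_right_mono) auto
  also have "\<dots> \<le> max 1 k * d powr max 1 k" using 1 by (intro mult_left_mono) auto
  finally show "k * d powr k \<le> max 1 k * d powr max 1 k" .
qed

theorem theorem4p8:
  fixes T lam r \<alpha> :: real and K :: "real \<Rightarrow> real \<Rightarrow> real"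
  assumes "T \<ge> 1" and "lam > 0" and "r \<ge> 0" and "0 < \<alpha>" and "\<alpha> \<le> 1"
  shows "\<exists>\<kappa>>0. \<forall>(\<rho> :: real \<Rightarrow> real) (d :: nat) (m :: nat) (\<epsilon> :: real)
      (\<mu> :: real \<Rightarrow> (nat \<Rightarrow> real) \<Rightarrow> nat \<Rightarrow> real)
      (\<sigma> :: real \<Rightarrow> (nat \<Rightarrow> real) \<Rightarrow> nat \<times> nat \<Rightarrow> real)
      (g :: real \<Rightarrow> (nat \<Rightarrow> real) \<Rightarrow> nat \<Rightarrow> real)
      (f :: (nat \<Rightarrow> real) \<Rightarrow> nat \<Rightarrow> real)
      (u :: real \<Rightarrow> (nat \<Rightarrow> real) \<Rightarrow> nat \<Rightarrow> real)
      (D :: nat \<Rightarrow> nat)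
      (NF :: nat \<Rightarrow> network) (NG :: nat \<Rightarrow> real \<Rightarrow> network)
      (N\<nu> :: nat \<Rightarrow> real \<Rightarrow> network) (N\<tau> :: nat \<Rightarrow> real \<Rightarrow> network)
      (F :: nat \<Rightarrow> (nat \<Rightarrow> real) \<Rightarrow> nat \<Rightarrow> real)
      (G :: nat \<Rightarrow> real \<Rightarrow> (nat \<Rightarrow> real) \<Rightarrow> nat \<Rightarrow> real)
      (\<nu> :: nat \<Rightarrow> real \<Rightarrow> (nat \<Rightarrow> real) \<Rightarrow> nat \<Rightarrow> real)
      (\<tau> :: nat \<Rightarrow> real \<Rightarrow> (nat \<Rightarrow> real) \<Rightarrow> nat \<times> nat \<Rightarrow> real)
      (c :: ennreal).
    let X = {..<d}; M = {..<d} \<times> {..<d}; Y = {..<m}; B = ennreal (K r \<alpha> * real d powr K r \<alpha>) in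
    d \<ge> 1 \<and> m \<ge> 1 \<and> 0 < \<epsilon> \<and> \<epsilon> < 1 \<and>
    admissible_coefficient T d X \<mu> \<and> admissible_coefficient T d M \<sigma> \<and>
    (\<forall>t\<in>{0..T}. cont_differentiable_times 3 X X (\<mu> t) \<and>
                 cont_differentiable_times 3 X M (\<sigma> t) \<and>
                 cont_differentiable_times 3 X Y (g t)) \<and>
    cont_differentiable_in_time T X Y g \<and>
    (\<forall>t\<in>{0..T}. differentiable_times 1 X Y (time_deriv T g t)) \<and>
    cont_differentiable_times 5 X Y f \<and>
    C1k T 5 X Y u \<and>
    solves_pde T d m \<mu> \<sigma> g f u \<and>
    (\<forall>n. network_perturbation \<rho> T d m (D n) (NF n) (NG n) (N\<nu> n) (N\<tau> n) (F n) (G n) (\<nu> n) (\<tau> n)) \<and>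
    sizes_sweep lam T d m NF NG N\<nu> N\<tau> \<and>
    c = Max {hat_growth T X X \<mu>, (hat_growth T X M \<sigma>)\<^sup>2,
             SUP n. hat_growth T X X (\<nu> n), SUP n. (hat_growth T X M (\<tau> n))\<^sup>2} \<and>
    c \<le> B \<and>
    growth_t T 2 0 X X \<mu> \<le> B \<and> growth_t T 2 0 X M \<sigma> \<le> B \<and>
    growth 2 0 X Y f \<le> B \<and> growth_t T 2 0 X Y g \<le> B \<and>
    (\<forall>n. growth 1 r X Y (F n) \<le> B) \<and> (\<forall>n. growth_t T 1 r X Y (G n) \<le> B) \<and>
    growth_t T 1 r X Y (time_deriv T g) \<le> B \<and>
    growth_t T 3 r X X \<mu> \<le> B \<and> growth_t T 3 r X M \<sigma> \<le> B \<and> growth_t T 3 r X Y g \<le> B \<and>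
    growth_t T 5 r X Y u \<le> B \<and>
    holder_growth T \<alpha> r (X <+> X) (X <+> X) (\<lambda>t. hat X (\<mu> t)) \<le> B \<and>
    holder_growth T \<alpha> r (X <+> X) (M <+> M) (\<lambda>t. hat X (\<sigma> t)) \<le> B \<and>
    (\<forall>n. Max {growth_t T 1 0 X X (\<lambda>t x i. \<mu> t x i - \<nu> n t x i),
              growth_t T 1 0 X M (\<lambda>t x i. \<sigma> t x i - \<tau> n t x i),
              growth 1 0 X Y (\<lambda>x i. f x i - F n x i),
              growth_t T 1 0 X Y (\<lambda>t x i. g t x i - G n t x i)}
         \<le> ennreal (lam powr (real d powr lam)
             * exp (- (real (min_params T (NF n) (NG n) (N\<nu> n) (N\<tau> n)) powr (1 / lam)))))
    \<longrightarrow>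
    (\<exists>\<psi>. is_network d m \<psi> \<and>
         differentiable_times 1 X Y (realization \<rho> \<psi>) \<and>
         L2_integrable d (\<lambda>x. L2_set (\<lambda>i. u 0 x i - realization \<rho> \<psi> x i) Y) \<and>
         L2_integrable d (nabla_norm 1 X Y (\<lambda>x i. u 0 x i - realization \<rho> \<psi> x i)) \<and>
         L2_norm d (\<lambda>x. L2_set (\<lambda>i. u 0 x i - realization \<rho> \<psi> x i) Y)
         + L2_norm d (nabla_norm 1 X Y (\<lambda>x i. u 0 x i - realization \<rho> \<psi> x i)) \<le> \<epsilon> \<and>
         real (nonzero_params \<psi>)
           \<le> \<kappa> * (real d * real m) powr \<kappa> * exp (\<kappa> * enn2real c) * \<epsilon> powr (- \<kappa>))"
proof -
  interpret pc: parameter_choice T lam r \<alpha> "max 1 (K r \<alpha>)"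
    using assms by unfold_locales auto
  obtain \<kappa> where \<kappa>: "\<kappa> \<ge> 1" "\<And>d m c e. 1 \<le> d \<Longrightarrow> 1 \<le> m \<Longrightarrow> 0 \<le> c \<Longrightarrow> 0 < e \<Longrightarrow> e < 1 \<Longrightarrow> \<bar>pc.size_bound d m c e\<bar> \<le> \<kappa> * (d * m * exp c / e) powr \<kappa>"
    using pc.poly_bounded_size unfolding poly_bounded_def by blast
  show ?thesis
    unfolding Let_def
  proof (intro exI[of _ \<kappa>] conjI allI impI, goal_cases)
    case 1
    show ?case using \<kappa>(1) by simp
  next
    case (2 \<rho> d m \<epsilon> \<mu> \<sigma> g f u D NF NG N\<nu> N\<tau> F G \<nu> \<tau> c)
    let ?X = "{..<d}" and ?M = "{..<d} \<times> {..<d}" and ?Y = "{..<m}"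
    have d: "d \<ge> 1" and m: "m \<ge> 1" and \<epsilon>: "0 < \<epsilon>" "\<epsilon> < 1"
      and diff: "\<And>t. t \<in> {0..T} \<Longrightarrow> cont_differentiable_times 3 ?X ?X (\<mu> t) \<and> cont_differentiable_times 3 ?X ?M (\<sigma> t) \<and> cont_differentiable_times 3 ?X ?Y (g t)"
      and g_time: "cont_differentiable_in_time T ?X ?Y g" and f_diff: "cont_differentiable_times 5 ?X ?Y f"
      and u: "C1k T 5 ?X ?Y u" and pde: "solves_pde T d m \<mu> \<sigma> g f u"
      and pert: "\<And>n. network_perturbation \<rho> T d m (D n) (NF n) (NG n) (N\<nu> n) (N\<tau> n) (F n) (G n) (\<nu> n) (\<tau> n)"
      and sweep: "sizes_sweep lam T d m NF NG N\<nu> N\<tau>"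
      and c: "c = Max {hat_growth T ?X ?X \<mu>, (hat_growth T ?X ?M \<sigma>)\<^sup>2, SUP n. hat_growth T ?X ?X (\<nu> n), SUP n. (hat_growth T ?X ?M (\<tau> n))\<^sup>2}"
      and cB: "c \<le> ennreal (K r \<alpha> * real d powr K r \<alpha>)"
      and gr: "growth_t T 2 0 ?X ?X \<mu> \<le> ennreal (K r \<alpha> * real d powr K r \<alpha>)" "growth_t T 2 0 ?X ?M \<sigma> \<le> ennreal (K r \<alpha> * real d powr K r \<alpha>)"
        "growth_t T 2 0 ?X ?Y g \<le> ennreal (K r \<alpha> * real d powr K r \<alpha>)"
        "\<And>n. growth 1 r ?X ?Y (F n) \<le> ennreal (K r \<alpha> * real d powr K r \<alpha>)" "\<And>n. growth_t T 1 r ?X ?Y (G n) \<le> ennreal (K r \<alpha> * real d powr K r \<alpha>)"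
        "growth_t T 1 r ?X ?Y (time_deriv T g) \<le> ennreal (K r \<alpha> * real d powr K r \<alpha>)"
        "growth_t T 5 r ?X ?Y u \<le> ennreal (K r \<alpha> * real d powr K r \<alpha>)"
        "holder_growth T \<alpha> r (?X <+> ?X) (?X <+> ?X) (\<lambda>t. hat ?X (\<mu> t)) \<le> ennreal (K r \<alpha> * real d powr K r \<alpha>)"
        "holder_growth T \<alpha> r (?X <+> ?X) (?M <+> ?M) (\<lambda>t. hat ?X (\<sigma> t)) \<le> ennreal (K r \<alpha> * real d powr K r \<alpha>)"
      and close: "\<And>n. Max {growth_t T 1 0 ?X ?X (\<lambda>t x i. \<mu> t x i - \<nu> n t x i), growth_t T 1 0 ?X ?M (\<lambda>t x i. \<sigma> t x i - \<tau> n t x i),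
          growth 1 0 ?X ?Y (\<lambda>x i. f x i - F n x i), growth_t T 1 0 ?X ?Y (\<lambda>t x i. g t x i - G n t x i)}
         \<le> ennreal (lam powr (real d powr lam) * exp (- (real (min_params T (NF n) (NG n) (N\<nu> n) (N\<tau> n)) powr (1 / lam))))"
      using 2 by blast+
    have dm: "1 \<le> real d" "1 \<le> real m" using d m by auto
    define b where "b = pc.b (real d)"
    note Bb = order_trans[OF _ bound_le_power[OF dm(1), of "K r \<alpha>"], folded pc.b_def, folded b_def]
    have b1: "b \<ge> 1" unfolding b_def by (rule pc.b_ge[OF dm order_refl \<epsilon>])
    define cr where "cr = enn2real c"
    have cfin: "c < top" using Bb[OF cB] by (simp add: le_less_trans)
    have cr: "c = ennreal cr" "cr \<ge> 0" using cfin by (auto simp: cr_def)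
    have crb: "cr \<le> b" using Bb[OF cB] b1 unfolding cr(1) by simp
    note in_range = dm cr(2) \<epsilon>
    define \<theta> where "\<theta> = 1 / pc.inv_tol (real d) (real m) cr \<epsilon>"
    have \<theta>0: "\<theta> \<ge> 0" unfolding \<theta>_def using pc.inv_tol_ge[OF in_range] by simp
    define n where "n = nat \<lceil>pc.index (real d) (real m) cr \<epsilon>\<rceil>"
    define N where "N = nat \<lceil>pc.steps (real d) (real m) cr \<epsilon>\<rceil>"
    define S where "S = nat \<lceil>pc.samples (real d) (real m) cr \<epsilon>\<rceil>"
    note nn = pc.nonneg_parameters[OF in_range]
    have round: "real (nat \<lceil>a\<rceil>) \<ge> a" "real (nat \<lceil>a\<rceil>) \<le> a + 1" if "a \<ge> 0" for a :: real
      using that by linarith+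
    have n: "real n \<ge> pc.index (real d) (real m) cr \<epsilon>" "real n \<le> pc.index (real d) (real m) cr \<epsilon> + 1"
      unfolding n_def using round nn by auto
    have N: "real N \<ge> pc.steps (real d) (real m) cr \<epsilon>" "real N \<le> pc.steps (real d) (real m) cr \<epsilon> + 1"
      unfolding N_def using round nn by auto
    have S: "real S \<ge> pc.samples (real d) (real m) cr \<epsilon>" "real S \<le> pc.samples (real d) (real m) cr \<epsilon> + 1"
      unfolding S_def using round nn by auto
    have pos: "N > 0" "S > 0" using N(1) S(1) nn by (auto intro!: Nat.gr0I)
    let ?min = "min_params T (NF n) (NG n) (N\<nu> n) (N\<tau> n)" and ?max = "max_params T (NF n) (NG n) (N\<nu> n) (N\<tau> n)"
    have sw: "n \<le> ?min" "real ?max \<le> lam * (real d * real m * (real n + 1)) powr lam"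
      using sweep unfolding sizes_sweep_def by blast+
    have "lam powr (real d powr lam) * exp (- (real ?min powr (1 / lam))) \<le> \<theta>"
      unfolding \<theta>_def by (rule pc.perturbation_small[OF in_range]) (use n(1) sw(1) in linarith)
    then have close': "Max {growth_t T 1 0 ?X ?X (\<lambda>t x i. \<mu> t x i - \<nu> n t x i), growth_t T 1 0 ?X ?M (\<lambda>t x i. \<sigma> t x i - \<tau> n t x i),
          growth 1 0 ?X ?Y (\<lambda>x i. f x i - F n x i), growth_t T 1 0 ?X ?Y (\<lambda>t x i. g t x i - G n t x i)} \<le> ennreal \<theta>"
      using close[of n] by (meson ennreal_leI order_trans)
    have cl: "growth_t T 1 0 ?X ?X (\<lambda>t x i. \<mu> t x i - \<nu> n t x i) \<le> ennreal \<theta>" "growth_t T 1 0 ?X ?M (\<lambda>t x i. \<sigma> t x i - \<tau> n t x i) \<le> ennreal \<theta>"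
      "growth 1 0 ?X ?Y (\<lambda>x i. f x i - F n x i) \<le> ennreal \<theta>" "growth_t T 1 0 ?X ?Y (\<lambda>t x i. g t x i - G n t x i) \<le> ennreal \<theta>"
      by (rule order_trans[OF Max_ge close']; simp)+
    have hs: "hat_growth T ?X ?X (\<nu> n) \<le> c" "(hat_growth T ?X ?M (\<tau> n))\<^sup>2 \<le> c"
    proof -
      have "hat_growth T ?X ?X (\<nu> n) \<le> (SUP n. hat_growth T ?X ?X (\<nu> n))" by (rule SUP_upper) simp
      also have "\<dots> \<le> c" unfolding c by (rule Max_ge) auto
      finally show "hat_growth T ?X ?X (\<nu> n) \<le> c" .
      have "(hat_growth T ?X ?M (\<tau> n))\<^sup>2 \<le> (SUP n. (hat_growth T ?X ?M (\<tau> n))\<^sup>2)" by (rule SUP_upper) simp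
      also have "\<dots> \<le> c" unfolding c by (rule Max_ge) auto
      finally show "(hat_growth T ?X ?M (\<tau> n))\<^sup>2 \<le> c" .
    qed
    have pd: "differentiable_times 2 ?X ?Y (F n)"
      "\<And>t. t \<in> {0..T} \<Longrightarrow> differentiable_times 2 ?X ?Y (G n t) \<and> differentiable_times 2 ?X ?X (\<nu> n t) \<and> differentiable_times 2 ?X ?M (\<tau> n t)"
      using pert[of n] unfolding network_perturbation_def by blast+
    have E: "euler_setting d pc.p T (pc.B (real d)) \<theta> \<alpha> cr \<mu> (\<nu> n) \<sigma> (\<tau> n) (\<lambda>t x. u t x i) (\<lambda>t x. g t x i) (\<lambda>t x. G n t x i) (\<lambda>x. f x i) (\<lambda>x. F n x i)" if i: "i < m" for i
      unfolding pc.B_def b_def[symmetric] pc.p_def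
      by (rule euler_setting_of_growth[OF d assms(1) b1 \<theta>0 cr(2) assms(3,4) i diff g_time f_diff u pde pd hs[unfolded cr(1)] crb
            Bb[OF gr(1)] Bb[OF gr(2)] Bb[OF gr(3)] Bb[OF gr(4)] Bb[OF gr(5)] Bb[OF gr(6)] Bb[OF gr(7)] Bb[OF gr(8)] Bb[OF gr(9)] cl])
    note st = pc.step_size[OF in_range N(1)]
    have err: "real m * (real d + 1) * (2 * (bias_factor T pc.p (real d) (pc.B (real d)) cr * (\<theta> + (T / real N) powr min \<alpha> (1 / 8)))\<^sup>2
        + 2 * moment_bound T pc.p (real d) (pc.B (real d)) cr / real S) \<le> (\<epsilon> / 2)\<^sup>2"
      using pc.total_error[OF in_range st(3) _ S(1)] unfolding pc.bias_def pc.moment_def \<theta>_def by simp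
    have T0: "T \<ge> 0" "\<epsilon> / 2 \<ge> 0" using assms(1) \<epsilon> by auto
    from network_approximation[OF E scheme_network_of_perturbation[OF pert d m] pos(1) st(1,2) T0(1) pos(2) T0(2) err]
    obtain \<psi> where \<psi>: "is_network d m \<psi>" "differentiable_times 1 ?X ?Y (realization \<rho> \<psi>)"
       "L2_integrable d (\<lambda>x. L2_set (\<lambda>i. u 0 x i - realization \<rho> \<psi> x i) ?Y)"
       "L2_integrable d (nabla_norm 1 ?X ?Y (\<lambda>x i. u 0 x i - realization \<rho> \<psi> x i))"
       "L2_norm d (\<lambda>x. L2_set (\<lambda>i. u 0 x i - realization \<rho> \<psi> x i) ?Y) \<le> \<epsilon> / 2"
       "L2_norm d (nabla_norm 1 ?X ?Y (\<lambda>x i. u 0 x i - realization \<rho> \<psi> x i)) \<le> \<epsilon> / 2"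
       "nonzero_params \<psi> \<le> 22 * (?max + 1) * (3 * d + m) ^ 3 * (S * (3 * N + 1) + 1)" by blast
    have "real (nonzero_params \<psi>) \<le> real (22 * (?max + 1) * (3 * d + m) ^ 3 * (S * (3 * N + 1) + 1))"
      using \<psi>(7) of_nat_le_iff by blast
    also have "\<dots> = 22 * (real ?max + 1) * (3 * real d + real m) ^ 3 * (real S * (3 * real N + 1) + 1)"
      by (simp only: of_nat_mult of_nat_add of_nat_power of_nat_1 of_nat_numeral)
    also have "\<dots> \<le> pc.size_bound (real d) (real m) cr \<epsilon>"
      unfolding pc.size_bound_def
    proof (intro mult_mono mult_left_mono add_mono order_refl)
      show "real S \<le> pc.samples (real d) (real m) cr \<epsilon> + 1" "real N \<le> pc.steps (real d) (real m) cr \<epsilon> + 1" by (fact S(2), fact N(2))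
      have "(real d * real m * (real n + 1)) powr lam \<le> (real d * real m * (pc.index (real d) (real m) cr \<epsilon> + 2)) powr lam"
        using n(2) assms(2) by (intro powr_mono2 mult_left_mono) auto
      then have "lam * (real d * real m * (real n + 1)) powr lam \<le> lam * (real d * real m * (pc.index (real d) (real m) cr \<epsilon> + 2)) powr lam"
        using assms(2) by (intro mult_left_mono) auto
      then show "real ?max \<le> lam * (real d * real m * (pc.index (real d) (real m) cr \<epsilon> + 2)) powr lam" using sw(2) by linarith
    qed (use nn assms(2) in auto)
    also have "\<dots> \<le> \<kappa> * (real d * real m * exp cr / \<epsilon>) powr \<kappa>"
      using \<kappa>(2)[OF in_range] by linarith
    also have "\<dots> = \<kappa> * (real d * real m) powr \<kappa> * exp (\<kappa> * enn2real c) * \<epsilon> powr (- \<kappa>)"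
    proof -
      have "(real d * real m * exp cr / \<epsilon>) powr \<kappa> = (real d * real m * exp cr) powr \<kappa> / \<epsilon> powr \<kappa>"
        by (rule powr_divide)
      also have "(real d * real m * exp cr) powr \<kappa> = (real d * real m) powr \<kappa> * exp cr powr \<kappa>"
        by (rule powr_mult)
      also have "exp cr powr \<kappa> = exp (\<kappa> * cr)" by (simp add: powr_def)
      finally show ?thesis unfolding cr_def[symmetric] by (simp add: powr_minus divide_inverse)
    qed
    finally have "real (nonzero_params \<psi>) \<le> \<kappa> * (real d * real m) powr \<kappa> * exp (\<kappa> * enn2real c) * \<epsilon> powr (- \<kappa>)" .
    then show ?case using \<psi> by (intro exI[of _ \<psi>] conjI) auto
  qed
qed

end
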